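(* Assume conditions (A), (B), (C) and (D) below hold; in particular (C) holds with some $E\subset\mathbb{S}^{d-1}$ and $\kappa\ge 0$, and (D) holds with some bounded nonempty $T\subset(0,\infty)$. Then: (a) For every $t\in T$, $\theta\in E$ and $y\in\mathbb{R}^d$, the density $p_t$ of $P_t$ exists and $$\lim_{r\to\infty}\frac{p_t(r\theta-y)}{t\,\nu(r\theta)}=\begin{cases}1 & \text{if } \kappa=0,\\ e^{-t\widetilde\psi(\kappa\theta)+\kappa(\theta\cdot y)} & \text{if }\kappa>0.\end{cases}$$ (b) If for every compact set $D\subset\mathbb{R}^d$ the convergence $\lim_{r\to\infty}\nu(r\theta-y)/\nu(r\theta)=e^{\kappa(\theta\cdot y)}$ in (C) is uniform in $(\theta,y)\in E\times D$, then the convergence in (a) is uniform in $(t,\theta,y)$ on each set $T\times E\times B(0,\varrho)$, $\varrho>0$.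
   Context: Let $d\ge1$, $b\in\mathbb{R}^d$, $A$ a symmetric nonnegative definite $d\times d$ matrix and $\nu$ a Lévy measure on $\mathbb{R}^d\setminus\{0\}$ (i.e. $\int(1\wedge|y|^2)\nu(dy)<\infty$). Let $\psi(\xi)=-i\,\xi\cdot b+\xi\cdot A\xi+\int\big(1-e^{i\xi\cdot y}+i\xi\cdot y\,\mathbf 1_{B(0,1)}(y)\big)\nu(dy)$, and let $\{P_t\}_{t\ge0}$ be the convolution semigroup of probability measures on $\mathbb{R}^d$ with $\int e^{i\xi\cdot y}P_t(dy)=e^{-t\psi(\xi)}$; $p_t$ denotes the Lebesgue density of $P_t$. Let $\Phi(\xi)=\int\big(1-e^{i\xi\cdot y}+i\xi\cdot y\,\mathbf 1_{B(0,1)}(y)\big)\nu(dy)$, $\Psi(r)=\sup_{|\xi|\le r}\mathrm{Re}\,\Phi(\xi)$ for $r>0$, $\Psi(\infty)=\lim_{r\to\infty}\Psi(r)$, and $\Psi_-(s)=\sup\{r>0:\Psi(r)=s\}$ for $s\in(0,\Psi(\infty))$. $\mathbb{S}^{d-1}$ is the unit sphere, and for $E\subset\mathbb{S}^{d-1}$, $\Gamma_E=\{y\neq0: y/|y|\in E\}$. For $\xi$ with $\int_{|y|>1}e^{\xi\cdot y}\nu(dy)<\infty$ put $\widetilde\psi(\xi)=-\xi\cdot b-\xi\cdot A\xi+\int\big(1-e^{\xi\cdot y}+\xi\cdot y\,\mathbf 1_{B(0,1)}(y)\big)\nu(dy)$. Assumptions: (A) $A\equiv0$ or $\inf_{|\xi|=1}\xi\cdot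 A\xi>0$. (B) $\nu(dx)=\nu(x)dx$ and there are a nonincreasing $f:(0,\infty)\to(0,\infty)$ and $C_0>0$ with $\nu(x)\le C_0f(|x|)$ for $x\ne0$, $\liminf_{r\to0^+}\frac{\nu(\{|x|>r\})}{f(r)r^d}>0$, and $K(r):=\sup_{|x|>1}\frac{1}{f(|x|)}\int_{|x-y|>r,\,|y|>r}f(|x-y|)f(|y|)\,dy$ decreases to $0$ as $r\to\infty$. (C) $E\subset\mathbb{S}^{d-1}$ and $\kappa\ge0$ are such that $\lim_{r\to\infty}\nu(r\theta-y)/\nu(r\theta)=e^{\kappa(\theta\cdot y)}$ for all $y\in\mathbb{R}^d$, $\theta\in E$, and $C_1:=\inf_{x\in\Gamma_E}\nu(x)/f(|x|)>0$. (D) $T\subset(0,\infty)$ is nonempty and bounded and there is $C_2>0$ with $\int_{\mathbb{R}^d}e^{-t\,\mathrm{Re}\Phi(\xi)}|\xi|\,d\xi\le C_2\big(\Psi_-(1/t)\big)^{d+1}$ for $t\in T$. *)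

theory Defs
  imports "HOL-Analysis.Analysis" "HOL-Probability.Probability"
begin

definition char_fun :: "'a::euclidean_space measure \<Rightarrow> 'a \<Rightarrow> complex" where
  "char_fun M \<xi> = (CLINT x|M. cis (\<xi> \<bullet> x))"

definition levy_Phi :: "('a::euclidean_space \<Rightarrow> real) \<Rightarrow> 'a \<Rightarrow> complex" where
  "levy_Phi nu \<xi> = (CLINT y|lborel. complex_of_real (nu y) *
      (1 - cis (\<xi> \<bullet> y) + \<i> * complex_of_real ((\<xi> \<bullet> y) * indicator (ball 0 1) y)))"

definition levy_psi :: "'a::euclidean_space \<Rightarrow> ('a \<Rightarrow> 'a) \<Rightarrow> ('a \<Rightarrow> real) \<Rightarrow> 'a \<Rightarrow> complex" where
  "levy_psi b A nu \<xi> = - \<i> * complex_of_real (\<xi> \<bullet> b) + complex_of_real (\<xi> \<bullet> A \<xi>) + levy_Phi nu \<xi>"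

definition Psi :: "('a::euclidean_space \<Rightarrow> real) \<Rightarrow> real \<Rightarrow> real" where
  "Psi nu r = (SUP \<xi>\<in>cball 0 r. Re (levy_Phi nu \<xi>))"

definition Psi_infty :: "('a::euclidean_space \<Rightarrow> real) \<Rightarrow> ereal" where
  "Psi_infty nu = Lim at_top (\<lambda>r. ereal (Psi nu r))"

definition Psi_minus :: "('a::euclidean_space \<Rightarrow> real) \<Rightarrow> real \<Rightarrow> real" where
  "Psi_minus nu s = Sup {r. 0 < r \<and> Psi nu r = s}"

definition Gamma_cone :: "'a::euclidean_space set \<Rightarrow> 'a set" where
  "Gamma_cone E = {y. y \<noteq> 0 \<and> (1 / norm y) *\<^sub>R y \<in> E}"

definition levy_K :: "'a::euclidean_space itself \<Rightarrow> (real \<Rightarrow> real) \<Rightarrow> real \<Rightarrow> ennreal" where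
  "levy_K _ f r = (SUP x\<in>{x::'a. 1 < norm x}.
      (\<integral>\<^sup>+ y. indicator {y. r < norm (x - y) \<and> r < norm y} y
               * ennreal (f (norm (x - y)) * f (norm y)) \<partial>lborel) / ennreal (f (norm x)))"

text \<open>psi-tilde (the exponent continued to real arguments).\<close>
definition psi_tilde :: "'a::euclidean_space \<Rightarrow> ('a \<Rightarrow> 'a) \<Rightarrow> ('a \<Rightarrow> real) \<Rightarrow> 'a \<Rightarrow> real" where
  "psi_tilde b A nu \<xi> = - (\<xi> \<bullet> b) - \<xi> \<bullet> A \<xi> +
      (LINT y|lborel. nu y * (1 - exp (\<xi> \<bullet> y) + (\<xi> \<bullet> y) * indicator (ball 0 1) y))"

definition limit_value :: "'a::euclidean_space \<Rightarrow> ('a \<Rightarrow> 'a) \<Rightarrow> ('a \<Rightarrow> real) \<Rightarrow> real \<Rightarrow> real \<Rightarrow> 'a \<Rightarrow> 'a \<Rightarrow> real" where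
  "limit_value b A nu \<kappa> t \<theta> y =
     (if \<kappa> = 0 then 1 else exp (- t * psi_tilde b A nu (\<kappa> *\<^sub>R \<theta>) + \<kappa> * (\<theta> \<bullet> y)))"

end

theory Submission
  imports Defs
begin

text \<open>
  Cut the jump density at a radius \<open>R\<close>. The jumps larger than \<open>R\<close> form a compound Poisson part, so the
  heat kernel is \<open>exp (- t * mass)\<close> times the exponential series of convolutions of the truncated kernel
  with the large-jump density. The truncated kernel decays faster than any exponential and has all exponential moments,
  hence contributes nothing at the scale of \<open>nu\<close>. The term with one large jump converges, after division by
  \<open>t * nu (r *\<^sub>R \<theta>)\<close>, to an exponential moment of the truncated kernel by dominated convergence, because the
  majorant \<open>f\<close> changes by at most an exponential factor under translations. The terms with two or more
  large jumps are bounded by \<open>t\<^sup>2\<close> times the heat kernel convolved with the square of the large-jump density,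
  which is small relative to \<open>f\<close> by the condition on \<open>levy_K\<close>; so one finally lets \<open>R\<close> tend to infinity.

  Uniformity for small times needs the bound \<open>C * t * exp (- m * norm x)\<close> for the truncated kernel. It comes from
  cutting once more at the spatial scale \<open>h\<close> of the process at time \<open>t\<close>, where the frequency bound (D) gives a
  Lipschitz constant which, combined with Chernoff's bound, controls the kernel pointwise; the jumps between
  \<open>h\<close> and \<open>R\<close> are restored using that \<open>n\<close> jumps adding up to \<open>z\<close> include one of size at least
  \<open>norm z / n\<close>.
\<close>

text \<open>All kernels are inverse Fourier transforms of explicit functions, so splitting the
  exponent is algebra; the price is that positivity and exponential moments must be proved. The
  predicate \<open>mgf_kernel\<close> carries both through convolutions, exponential series and
  dominated limits, starting from a Gaussian. The condition on \<open>levy_K\<close> does more than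
  control double jumps. It forces \<open>f u \<le> C * f (u + 1)\<close>, the source of all
  translation bounds, and via Fatou along a ray it makes the exponential moment of the large jumps
  finite and small, which removes the truncation from the limit. As \<open>f\<close> may be singular
  at 0, comparisons use \<open>F\<close>, which freezes \<open>f\<close> at radius 1. The lower
  limit in (B) together with Levy integrability makes that singularity at most polynomial; the
  factorials of the jump series absorb it. Time enters the estimates only through
  \<open>good_scale t h\<close> with one constant \<open>c\<close>; the two alternatives of (A)
  merely supply different \<open>h\<close>.\<close>

lemma cis_borel_measurable [measurable]: "cis \<in> borel_measurable borel"
  by (intro borel_measurable_continuous_onI continuous_intros)

lemma ball_cball_measurable [measurable]: "ball x r \<in> sets borel" "cball x r \<in> sets borel"
  by auto

lemma nn_integral_lborel_shift:
  fixes y :: "'a::euclidean_space"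
  assumes [measurable]: "g \<in> borel_measurable borel"
  shows "(\<integral>\<^sup>+x. g (x - y) \<partial>lborel) = (\<integral>\<^sup>+x. g x \<partial>lborel)"
proof -
  have "(\<integral>\<^sup>+x. g x \<partial>lborel) = (\<integral>\<^sup>+x. g x \<partial>(distr lborel borel ((+) (-y))))"
    by (simp add: lborel_distr_plus)
  also have "\<dots> = (\<integral>\<^sup>+x. g (x - y) \<partial>lborel)"
    by (subst nn_integral_distr) auto
  finally show ?thesis by simp
qed

lemma nn_integral_lborel_reflect:
  fixes x :: "'a::euclidean_space"
  assumes [measurable]: "g \<in> borel_measurable borel"
  shows "(\<integral>\<^sup>+y. g (x - y) \<partial>lborel) = (\<integral>\<^sup>+y. g y \<partial>lborel)"
proof -
  have "(\<integral>\<^sup>+y. g y \<partial>lborel) = (\<integral>\<^sup>+y. g (x + (-1) *\<^sub>R y) \<partial>lborel)"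
    by (subst lborel_affine[of "-1" x]) (simp_all add: nn_integral_density nn_integral_distr)
  then show ?thesis by simp
qed

text \<open>The largest coordinate satisfies
  \<open>norm x \<le> DIM('a) * \<bar>x \<bullet> b0\<bar>\<close>, so one linear form in direction
  \<open>b0\<close> or \<open>- b0\<close> dominates; summing over all directions avoids naming
  \<open>b0\<close>. Radial exponential moments thus reduce to finitely many values of a moment
  generating function.\<close>

lemma exp_norm_le_sum_exp_inner:
  fixes x :: "'a::euclidean_space"
  assumes "0 \<le> c"
  shows "exp (c * norm x) \<le>
    (\<Sum>b\<in>Basis. exp (((c * DIM('a)) *\<^sub>R b) \<bullet> x) + exp ((- (c * DIM('a)) *\<^sub>R b) \<bullet> x))"
proof -
  obtain b0 :: 'a where b0: "b0 \<in> Basis" "\<And>b. b \<in> Basis \<Longrightarrow> \<bar>x \<bullet> b\<bar> \<le> \<bar>x \<bullet> b0\<bar>"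
  proof -
    have "finite ((\<lambda>b. \<bar>x \<bullet> b\<bar>) ` Basis)" "((\<lambda>b. \<bar>x \<bullet> b\<bar>) ` (Basis::'a set)) \<noteq> {}" by auto
    then have "Max ((\<lambda>b. \<bar>x \<bullet> b\<bar>) ` Basis) \<in> (\<lambda>b. \<bar>x \<bullet> b\<bar>) ` Basis" by (rule Max_in)
    then obtain b where "b \<in> Basis" "Max ((\<lambda>b. \<bar>x \<bullet> b\<bar>) ` Basis) = \<bar>x \<bullet> b\<bar>" by (rule imageE) auto
    then show thesis using that by (metis Max_ge finite_Basis finite_imageI imageI)
  qed
  have "norm x \<le> (\<Sum>b\<in>Basis. \<bar>x \<bullet> b\<bar>)" by (rule norm_le_l1)
  also have "\<dots> \<le> DIM('a) * \<bar>x \<bullet> b0\<bar>" using b0(2) by (rule sum_bounded_above)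
  finally have "c * norm x \<le> c * (DIM('a) * \<bar>x \<bullet> b0\<bar>)" by (rule mult_left_mono) fact
  then have "exp (c * norm x) \<le> exp (c * (DIM('a) * \<bar>x \<bullet> b0\<bar>))" by simp
  also have "\<dots> \<le> exp (((c * DIM('a)) *\<^sub>R b0) \<bullet> x) + exp ((- (c * DIM('a)) *\<^sub>R b0) \<bullet> x)"
    by (cases "0 \<le> x \<bullet> b0") (auto simp: inner_commute algebra_simps)
  also have "\<dots> \<le> (\<Sum>b\<in>Basis. exp (((c * DIM('a)) *\<^sub>R b) \<bullet> x) + exp ((- (c * DIM('a)) *\<^sub>R b) \<bullet> x))"
    using b0(1) by (intro member_le_sum) (auto intro: add_nonneg_nonneg)
  finally show ?thesis .
qed

lemma norm_cis_diff_le: "norm (cis a - cis b) \<le> \<bar>a - b\<bar>"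
proof -
  have "cis a - cis b = cis b * (cis (a - b) - 1)"
    by (simp add: algebra_simps cis_mult)
  then have "norm (cis a - cis b) = norm (iexp (a - b) - 1)"
    by (simp add: norm_mult cis_conv_exp)
  also have "\<dots> \<le> \<bar>a - b\<bar>" using iexp_approx1[of "a - b" 0] by simp
  finally show ?thesis .
qed

lemma integrable_cis_mult:
  assumes "integrable M \<phi>" and [measurable]: "g \<in> borel_measurable M"
  shows "integrable M (\<lambda>\<xi>. cis (g \<xi>) * \<phi> \<xi>)"
  by (rule Bochner_Integration.integrable_bound[OF assms(1)])
     (use assms(1) in \<open>auto simp: norm_mult\<close>)

section \<open>Inverse Fourier transforms\<close>

text \<open>The real part is built in, so the result is a real function without any symmetry
  condition on \<open>\<phi>\<close>.\<close>

definition ift :: "('a::euclidean_space \<Rightarrow> complex) \<Rightarrow> 'a \<Rightarrow> real" where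
  "ift \<phi> x = Re (CLINT \<xi>|lborel. cis (- (x \<bullet> \<xi>)) * \<phi> \<xi>) / (2 * pi) ^ DIM('a)"

lemma two_pi_power_ge_1: "1 \<le> (2 * pi) ^ n"
  using pi_ge_two by (intro one_le_power) auto

lemma abs_ift_le:
  fixes \<phi> :: "'a::euclidean_space \<Rightarrow> complex"
  shows "\<bar>ift \<phi> x\<bar> \<le> (LINT \<xi>|lborel. norm (\<phi> \<xi>))"
proof -
  have "\<bar>ift \<phi> x\<bar> = \<bar>Re (CLINT \<xi>|lborel. cis (- (x \<bullet> \<xi>)) * \<phi> \<xi>)\<bar> / (2 * pi) ^ DIM('a)"
    by (simp add: ift_def)
  also have "\<dots> \<le> \<bar>Re (CLINT \<xi>|lborel. cis (- (x \<bullet> \<xi>)) * \<phi> \<xi>)\<bar> / 1"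
    by (intro divide_left_mono two_pi_power_ge_1) auto
  also have "\<dots> \<le> norm (CLINT \<xi>|lborel. cis (- (x \<bullet> \<xi>)) * \<phi> \<xi>)" by (simp add: abs_Re_le_cmod)
  also have "\<dots> \<le> (LINT \<xi>|lborel. norm (cis (- (x \<bullet> \<xi>)) * \<phi> \<xi>))" by (rule integral_norm_bound)
  finally show ?thesis by (simp add: norm_mult)
qed

lemma ift_diff:
  assumes "integrable lborel \<phi>" "integrable lborel \<phi>'"
  shows "ift \<phi> (x::'a::euclidean_space) - ift \<phi>' y = Re (CLINT \<xi>|lborel. cis (- (x \<bullet> \<xi>)) * \<phi> \<xi> - cis (- (y \<bullet> \<xi>)) * \<phi>' \<xi>)
     / (2 * pi) ^ DIM('a)"
  unfolding ift_def
  by (subst Bochner_Integration.integral_diff)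
     (auto intro!: integrable_cis_mult assms simp: diff_divide_distrib)

text \<open>The first frequency moment bounds the gradient; here this comes from the Lipschitz bound
  for \<open>cis\<close>. It is the form in which (D) acts on densities.\<close>

lemma ift_lipschitz:
  fixes \<phi> :: "'a::euclidean_space \<Rightarrow> complex"
  assumes \<phi>: "integrable lborel \<phi>" and \<phi>1: "integrable lborel (\<lambda>\<xi>. norm \<xi> * norm (\<phi> \<xi>))"
  shows "\<bar>ift \<phi> x - ift \<phi> y\<bar> \<le> norm (x - y) * (LINT \<xi>|lborel. norm \<xi> * norm (\<phi> \<xi>))"
proof -
  let ?h = "\<lambda>\<xi>. cis (- (x \<bullet> \<xi>)) * \<phi> \<xi> - cis (- (y \<bullet> \<xi>)) * \<phi> \<xi>"
  have "\<bar>ift \<phi> x - ift \<phi> y\<bar> \<le> \<bar>Re (CLINT \<xi>|lborel. ?h \<xi>)\<bar> / 1"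
    unfolding ift_diff[OF \<phi> \<phi>] abs_divide
    by (intro frac_le) (auto intro: order_trans[OF two_pi_power_ge_1])
  also have "\<dots> \<le> norm (CLINT \<xi>|lborel. ?h \<xi>)" by (simp add: abs_Re_le_cmod)
  also have "\<dots> \<le> (LINT \<xi>|lborel. norm (?h \<xi>))" by (rule integral_norm_bound)
  also have "\<dots> \<le> (LINT \<xi>|lborel. norm (x - y) * (norm \<xi> * norm (\<phi> \<xi>)))"
  proof (rule integral_mono)
    show "integrable lborel (\<lambda>\<xi>. norm (?h \<xi>))"
      by (intro integrable_norm Bochner_Integration.integrable_diff integrable_cis_mult \<phi>) auto
    show "integrable lborel (\<lambda>\<xi>. norm (x - y) * (norm \<xi> * norm (\<phi> \<xi>)))"
      using \<phi>1 by simp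
    fix \<xi>
    have "norm (?h \<xi>) = norm (cis (- (x \<bullet> \<xi>)) - cis (- (y \<bullet> \<xi>))) * norm (\<phi> \<xi>)"
      by (simp flip: norm_mult add: algebra_simps)
    also have "\<dots> \<le> (norm (x - y) * norm \<xi>) * norm (\<phi> \<xi>)"
    proof (rule mult_right_mono)
      have "norm (cis (- (x \<bullet> \<xi>)) - cis (- (y \<bullet> \<xi>))) \<le> \<bar>(y - x) \<bullet> \<xi>\<bar>"
        by (rule order_trans[OF norm_cis_diff_le]) (simp add: inner_diff_left)
      also have "\<dots> \<le> norm (x - y) * norm \<xi>" using Cauchy_Schwarz_ineq2[of "y - x" \<xi>]
        by (simp add: norm_minus_commute)
      finally show "norm (cis (- (x \<bullet> \<xi>)) - cis (- (y \<bullet> \<xi>))) \<le> norm (x - y) * norm \<xi>" .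
    qed simp
    finally show "norm (?h \<xi>) \<le> norm (x - y) * (norm \<xi> * norm (\<phi> \<xi>))" by (simp add: mult.assoc)
  qed
  finally show ?thesis by simp
qed

text \<open>Letting the point \<open>xn\<close> move together with the integrand makes continuity of
  \<open>ift \<phi>\<close> the case of a constant sequence of functions.\<close>

lemma ift_tendsto:
  fixes \<phi> :: "'a::euclidean_space \<Rightarrow> complex"
  assumes m: "\<And>n. \<phi>n n \<in> borel_measurable lborel" and m': "\<phi> \<in> borel_measurable lborel"
    and b: "\<And>n \<xi>. norm (\<phi>n n \<xi>) \<le> w \<xi>"
    and w: "integrable lborel w" and l: "\<And>\<xi>. (\<lambda>n. \<phi>n n \<xi>) \<longlonglongrightarrow> \<phi> \<xi>"
    and x: "xn \<longlonglongrightarrow> x"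
  shows "(\<lambda>n. ift (\<phi>n n) (xn n)) \<longlonglongrightarrow> ift \<phi> x"
  unfolding ift_def
proof (intro tendsto_intros tendsto_Re integral_dominated_convergence[where w=w])
  have [measurable]: "\<And>n. \<phi>n n \<in> borel_measurable borel" "\<phi> \<in> borel_measurable borel"
    using m m' by auto
  show "(\<lambda>\<xi>. cis (- (x \<bullet> \<xi>)) * \<phi> \<xi>) \<in> borel_measurable lborel" by measurable
  show "(\<lambda>\<xi>. cis (- (xn n \<bullet> \<xi>)) * \<phi>n n \<xi>) \<in> borel_measurable lborel" for n by measurable
  show "AE \<xi> in lborel. (\<lambda>n. cis (- (xn n \<bullet> \<xi>)) * \<phi>n n \<xi>) \<longlonglongrightarrow> cis (- (x \<bullet> \<xi>)) * \<phi> \<xi>"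
  proof (intro AE_I2 tendsto_mult l)
    fix \<xi>
    have "(\<lambda>n. - (xn n \<bullet> \<xi>)) \<longlonglongrightarrow> - (x \<bullet> \<xi>)" by (intro tendsto_intros x)
    then show "(\<lambda>n. cis (- (xn n \<bullet> \<xi>))) \<longlonglongrightarrow> cis (- (x \<bullet> \<xi>))"
      by (rule continuous_on_tendsto_compose[of UNIV cis, rotated 1]) (auto intro!: continuous_intros)
  qed
  show "AE \<xi> in lborel. norm (cis (- (xn n \<bullet> \<xi>)) * \<phi>n n \<xi>) \<le> w \<xi>" for n
    using b by (auto simp: norm_mult)
qed (use w in auto)

lemma continuous_on_ift:
  fixes \<phi> :: "'a::euclidean_space \<Rightarrow> complex"
  assumes "integrable lborel \<phi>"
  shows "continuous_on UNIV (ift \<phi>)"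
proof -
  have "isCont (ift \<phi>) x" for x
    unfolding continuous_at_sequentially comp_def
    using assms by (intro allI impI ift_tendsto[where w="\<lambda>\<xi>. norm (\<phi> \<xi>)"]) auto
  then show ?thesis by (simp add: continuous_at_imp_continuous_on)
qed

lemma ift_borel_measurable [measurable (raw)]:
  "integrable lborel \<phi> \<Longrightarrow> ift \<phi> \<in> borel_measurable borel"
  by (intro borel_measurable_continuous_onI continuous_on_ift)

lemma ift_add: "integrable lborel \<phi> \<Longrightarrow> integrable lborel \<phi>' \<Longrightarrow>
  ift (\<lambda>\<xi>. \<phi> \<xi> + \<phi>' \<xi>) x = ift \<phi> x + ift \<phi>' x"
  unfolding ift_def
  by (simp add: distrib_left Bochner_Integration.integral_add integrable_cis_mult add_divide_distrib)

lemma ift_cmult: "ift (\<lambda>\<xi>. complex_of_real c * \<phi> \<xi>) x = c * ift \<phi> x"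
proof -
  have "(\<lambda>\<xi>. cis (- (x \<bullet> \<xi>)) * (complex_of_real c * \<phi> \<xi>)) =
        (\<lambda>\<xi>. complex_of_real c * (cis (- (x \<bullet> \<xi>)) * \<phi> \<xi>))" by (simp add: algebra_simps)
  then show ?thesis unfolding ift_def by simp
qed

lemma char_fun_measurable [measurable]:
  assumes "finite_measure M" and [simp]: "sets M = sets borel"
  shows "char_fun M \<in> borel_measurable borel"
proof -
  interpret finite_measure M by fact
  have [measurable_cong]: "sets M = sets borel" by simp
  show ?thesis unfolding char_fun_def[abs_def]
    by (rule borel_measurable_lebesgue_integral) simp
qed

lemma integrable_cis_finite_measure:
  assumes "finite_measure M" and [simp]: "sets M = sets borel" and "g \<in> borel_measurable borel"
  shows "integrable M (\<lambda>y. cis (g y))"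
proof -
  interpret finite_measure M by fact
  have [measurable_cong]: "sets M = sets borel" by simp
  note assms(3)[measurable]
  show ?thesis by (rule integrable_const_bound[where B=1]) auto
qed

lemma norm_char_fun_le:
  assumes "finite_measure M"
  shows "norm (char_fun M \<xi>) \<le> measure M (space M)"
proof -
  interpret finite_measure M by fact
  have "norm (char_fun M \<xi>) \<le> (LINT y|M. norm (cis (\<xi> \<bullet> y)))"
    unfolding char_fun_def by (rule integral_norm_bound)
  then show ?thesis by simp
qed

lemma integrable_mult_char_fun:
  assumes "finite_measure M" "sets M = sets borel" "integrable lborel \<phi>"
  shows "integrable lborel (\<lambda>\<xi>. \<phi> \<xi> * char_fun M \<xi> ^ n)"
proof (rule Bochner_Integration.integrable_bound[where f="\<lambda>\<xi>. norm (\<phi> \<xi>) * measure M (space M) ^ n"])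
  show "AE \<xi> in lborel. norm (\<phi> \<xi> * char_fun M \<xi> ^ n) \<le> norm (norm (\<phi> \<xi>) * measure M (space M) ^ n)"
    using norm_char_fun_le[OF assms(1)]
    by (auto simp: norm_mult norm_power intro!: mult_left_mono power_mono)
  have [measurable]: "char_fun M \<in> borel_measurable borel"
    using assms by (intro char_fun_measurable) auto
  have [measurable]: "\<phi> \<in> borel_measurable borel" using assms(3) by auto
  show "(\<lambda>\<xi>. \<phi> \<xi> * char_fun M \<xi> ^ n) \<in> borel_measurable lborel" by measurable
qed (use assms in auto)

text \<open>Multiplication in frequency is convolution in space. Fubini applies because
  \<open>\<phi>\<close> is integrable and \<open>M\<close> finite; \<open>M\<close> may be singular,
  as needed for Dirac masses and for Gaussians on a line.\<close>

lemma ift_mult_char_fun: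
  fixes \<phi> :: "'a::euclidean_space \<Rightarrow> complex"
  assumes M: "finite_measure M" and sM: "sets M = sets borel" and \<phi>: "integrable lborel \<phi>"
  shows "ift (\<lambda>\<xi>. \<phi> \<xi> * char_fun M \<xi>) x = (LINT y|M. ift \<phi> (x - y))"
proof -
  interpret finite_measure M by fact
  interpret pair_sigma_finite "lborel::'a measure" M ..
  note [measurable_cong] = sM
  have [measurable]: "\<phi> \<in> borel_measurable borel" using \<phi> by auto
  have int: "integrable (lborel \<Otimes>\<^sub>M M) (\<lambda>(\<xi>, y). cis (- ((x - y) \<bullet> \<xi>)) * \<phi> \<xi>)"
  proof (rule Fubini_integrable)
    show "(\<lambda>(\<xi>, y). cis (- ((x - y) \<bullet> \<xi>)) * \<phi> \<xi>) \<in> borel_measurable (lborel \<Otimes>\<^sub>M M)" by measurable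
    have "(\<lambda>\<xi>. LINT y|M. norm (case (\<xi>, y) of (\<xi>, y) \<Rightarrow> cis (- ((x - y) \<bullet> \<xi>)) * \<phi> \<xi>)) =
          (\<lambda>\<xi>. measure M (space M) * norm (\<phi> \<xi>))" by (simp add: norm_mult fun_eq_iff)
    then show "integrable lborel (\<lambda>\<xi>. LINT y|M. norm (case (\<xi>, y) of (\<xi>, y) \<Rightarrow> cis (- ((x - y) \<bullet> \<xi>)) * \<phi> \<xi>))"
      using \<phi> by simp
    show "AE \<xi> in lborel. integrable M (\<lambda>y. case (\<xi>, y) of (\<xi>, y) \<Rightarrow> cis (- ((x - y) \<bullet> \<xi>)) * \<phi> \<xi>)"
      using integrable_cis_finite_measure[OF M sM] by (auto intro!: AE_I2)
  qed
  have inner: "(CLINT y|M. cis (- ((x - y) \<bullet> \<xi>)) * \<phi> \<xi>) = cis (- (x \<bullet> \<xi>)) * (\<phi> \<xi> * char_fun M \<xi>)" for \<xi>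
  proof -
    have "(\<lambda>y. cis (- ((x - y) \<bullet> \<xi>)) * \<phi> \<xi>) = (\<lambda>y. (cis (- (x \<bullet> \<xi>)) * \<phi> \<xi>) * cis (\<xi> \<bullet> y))"
      by (auto simp: inner_diff_left cis_mult[symmetric] cis_divide[symmetric] inner_commute fun_eq_iff algebra_simps
          diff_conv_add_uminus simp del: add_uminus_conv_diff)
    then show ?thesis by (simp add: char_fun_def)
  qed
  have "(CLINT \<xi>|lborel. cis (- (x \<bullet> \<xi>)) * (\<phi> \<xi> * char_fun M \<xi>))
      = (CLINT y|M. CLINT \<xi>|lborel. cis (- ((x - y) \<bullet> \<xi>)) * \<phi> \<xi>)"
    unfolding inner[symmetric] by (rule Fubini_integral[symmetric]) (use int in simp)
  then have "Re (CLINT \<xi>|lborel. cis (- (x \<bullet> \<xi>)) * (\<phi> \<xi> * char_fun M \<xi>))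
      = (LINT y|M. Re (CLINT \<xi>|lborel. cis (- ((x - y) \<bullet> \<xi>)) * \<phi> \<xi>))"
    using integrable_snd[OF int] by simp
  then show ?thesis unfolding ift_def by simp
qed

lemma integrable_ift_finite_measure:
  assumes "finite_measure M" and sM: "sets M = sets borel" and "integrable lborel \<phi>"
  shows "integrable M (\<lambda>y. ift \<phi> (x - y))"
proof -
  interpret finite_measure M by fact
  note [measurable_cong] = sM
  note ift_borel_measurable[OF assms(3), measurable]
  show ?thesis by (rule integrable_const_bound[where B="LINT \<xi>|lborel. norm (\<phi> \<xi>)"])
    (auto intro: abs_ift_le)
qed

text \<open>The bound is the same for every finite set of indices, so it dominates the partial sums
  over \<open>{..<n}\<close> as well as those over \<open>{..n}\<close>.\<close>

lemma exp_char_fun_series: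
  fixes z :: complex and \<xi> :: "'a::euclidean_space"
  assumes M: "finite_measure M" and s: "0 \<le> s"
  defines "u \<equiv> \<lambda>k. complex_of_real (s ^ k / fact k) * (z * char_fun M \<xi> ^ k)"
  shows "finite I \<Longrightarrow> norm (\<Sum>k\<in>I. u k) \<le> norm z * exp (s * measure M (space M))"
    and "u sums (z * exp (complex_of_real s * char_fun M \<xi>))"
proof -
  let ?m = "measure M (space M)"
  assume I: "finite I"
  have "norm (\<Sum>k\<in>I. u k) \<le> (\<Sum>k\<in>I. norm z * ((s * ?m) ^ k / fact k))"
  proof (rule order_trans[OF norm_sum], rule sum_mono)
    fix k
    have "norm (u k) = norm z * (s ^ k * norm (char_fun M \<xi>) ^ k / fact k)"
      using s by (simp add: u_def norm_mult norm_power norm_divide)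
    also have "\<dots> \<le> norm z * (s ^ k * ?m ^ k / fact k)"
      using s by (intro mult_left_mono divide_right_mono power_mono norm_char_fun_le M) auto
    finally show "norm (u k) \<le> norm z * ((s * ?m) ^ k / fact k)" by (simp add: power_mult_distrib)
  qed
  also have "\<dots> = norm z * (\<Sum>k\<in>I. (s * ?m) ^ k / fact k)" by (simp add: sum_distrib_left)
  also have "\<dots> \<le> norm z * exp (s * ?m)"
  proof (rule mult_left_mono)
    have "summable (\<lambda>k. (s * ?m) ^ k / fact k)" "suminf (\<lambda>k. (s * ?m) ^ k / fact k) = exp (s * ?m)"
      using exp_converges[of "s * ?m"] by (auto simp: sums_iff divide_inverse mult.commute)
    then show "(\<Sum>k\<in>I. (s * ?m) ^ k / fact k) \<le> exp (s * ?m)"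
      using s I sum_le_suminf[of "\<lambda>k. (s * ?m) ^ k / fact k" I] by auto
  qed simp
  finally show "norm (\<Sum>k\<in>I. u k) \<le> norm z * exp (s * ?m)" .
next
  have "(\<lambda>k. z * ((complex_of_real s * char_fun M \<xi>) ^ k /\<^sub>R fact k)) sums
      (z * exp (complex_of_real s * char_fun M \<xi>))"
    by (intro sums_mult exp_converges)
  moreover have "z * ((complex_of_real s * char_fun M \<xi>) ^ k /\<^sub>R fact k) = u k" for k
    by (simp add: u_def power_mult_distrib scaleR_conv_of_real divide_inverse)
  ultimately show "u sums (z * exp (complex_of_real s * char_fun M \<xi>))" by simp
qed

text \<open>Dominated convergence for the exponential series. Term \<open>n\<close> is the
  contribution of exactly \<open>n\<close> jumps of a compound Poisson process with intensity
  \<open>M\<close>, before normalisation.\<close>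

lemma ift_exp_char_fun_sums:
  fixes \<phi> :: "'a::euclidean_space \<Rightarrow> complex"
  assumes M: "finite_measure M" and sM: "sets M = sets borel" and \<phi>: "integrable lborel \<phi>" and s: "0 \<le> s"
  shows "(\<lambda>n. s ^ n / fact n * ift (\<lambda>\<xi>. \<phi> \<xi> * char_fun M \<xi> ^ n) x) sums
     ift (\<lambda>\<xi>. \<phi> \<xi> * exp (complex_of_real s * char_fun M \<xi>)) x"
proof -
  have [measurable]: "char_fun M \<in> borel_measurable borel"
    using M sM by (intro char_fun_measurable) auto
  have [measurable]: "\<phi> \<in> borel_measurable borel" using \<phi> by auto
  let ?c = "\<lambda>n. complex_of_real (s ^ n / fact n)"
  let ?m = "measure M (space M)"
  have part: "integrable lborel (\<lambda>\<xi>. \<Sum>k<n. ?c k * (\<phi> \<xi> * char_fun M \<xi> ^ k)) \<and>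
     ift (\<lambda>\<xi>. \<Sum>k<n. ?c k * (\<phi> \<xi> * char_fun M \<xi> ^ k)) x =
       (\<Sum>k<n. s ^ k / fact k * ift (\<lambda>\<xi>. \<phi> \<xi> * char_fun M \<xi> ^ k) x)" for n
  proof (induction n)
    case 0 then show ?case by (simp add: ift_def)
  next
    case (Suc n)
    have i: "integrable lborel (\<lambda>\<xi>. ?c n * (\<phi> \<xi> * char_fun M \<xi> ^ n))"
      using integrable_mult_char_fun[OF M sM \<phi>] by (intro integrable_mult_right) auto
    show ?case using Suc i by (simp add: ift_add[OF _ i] ift_cmult del: of_real_divide of_real_power)
  qed
  have "(\<lambda>n. ift (\<lambda>\<xi>. \<Sum>k<n. ?c k * (\<phi> \<xi> * char_fun M \<xi> ^ k)) x)
     \<longlonglongrightarrow> ift (\<lambda>\<xi>. \<phi> \<xi> * exp (complex_of_real s * char_fun M \<xi>)) x"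
  proof (rule ift_tendsto[where w="\<lambda>\<xi>. norm (\<phi> \<xi>) * exp (s * ?m)"])
    fix n \<xi>
    show "norm (\<Sum>k<n. ?c k * (\<phi> \<xi> * char_fun M \<xi> ^ k)) \<le> norm (\<phi> \<xi>) * exp (s * ?m)"
      by (rule exp_char_fun_series(1)[OF M s]) simp
  next
    fix \<xi>
    show "(\<lambda>n. \<Sum>k<n. ?c k * (\<phi> \<xi> * char_fun M \<xi> ^ k))
        \<longlonglongrightarrow> \<phi> \<xi> * exp (complex_of_real s * char_fun M \<xi>)"
      using exp_char_fun_series(2)[OF M s] unfolding sums_def .
  qed (use \<phi> in auto)
  then show ?thesis using part by (simp add: sums_def)
qed

section \<open>Nonnegative kernels with finite exponential moments\<close>

text \<open>\<open>L\<close> is the moment generating function of the density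
  \<open>ift \<phi>\<close>, finite at every real vector. The predicate is designed to survive
  convolution, exponential series and dominated limits, so positivity of truncated kernels follows
  without constructing a process.\<close>

definition mgf_kernel :: "('a::euclidean_space \<Rightarrow> complex) \<Rightarrow> ('a \<Rightarrow> real) \<Rightarrow> bool" where
  "mgf_kernel \<phi> L \<longleftrightarrow> integrable lborel \<phi> \<and> (\<forall>x. 0 \<le> ift \<phi> x) \<and>
     (\<forall>\<eta>. 0 \<le> L \<eta> \<and> (\<integral>\<^sup>+x. ennreal (exp (\<eta> \<bullet> x) * ift \<phi> x) \<partial>lborel) = ennreal (L \<eta>))"

lemma mgf_kernelD:
  assumes "mgf_kernel \<phi> L"
  shows "integrable lborel \<phi>" "0 \<le> ift \<phi> x" "0 \<le> L \<eta>"
    "(\<integral>\<^sup>+x. ennreal (exp (\<eta> \<bullet> x) * ift \<phi> x) \<partial>lborel) = ennreal (L \<eta>)"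
    "ift \<phi> \<in> borel_measurable borel"
  using assms ift_borel_measurable[of \<phi>] unfolding mgf_kernel_def by auto

text \<open>The tilt \<open>\<eta>\<close> is kept beside the radial weight so that the bound also
  yields tightness of exponentially tilted kernels.\<close>

lemma nn_integral_exp_norm_le:
  fixes \<phi> :: "'a::euclidean_space \<Rightarrow> complex"
  assumes g: "mgf_kernel \<phi> L" and c: "0 \<le> c"
  shows "(\<integral>\<^sup>+x. ennreal (exp (\<eta> \<bullet> x + c * norm x) * ift \<phi> x) \<partial>lborel) \<le>
    ennreal (\<Sum>b\<in>Basis. L (\<eta> + (c * DIM('a)) *\<^sub>R b) + L (\<eta> - (c * DIM('a)) *\<^sub>R b))"
proof -
  note [measurable] = mgf_kernelD(5)[OF g]
  let ?u = "ift \<phi>"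
  have "(\<integral>\<^sup>+x. ennreal (exp (\<eta> \<bullet> x + c * norm x) * ?u x) \<partial>lborel) \<le>
    (\<integral>\<^sup>+x. (\<Sum>b\<in>Basis. ennreal (exp ((\<eta> + (c * DIM('a)) *\<^sub>R b) \<bullet> x) * ?u x) +
       ennreal (exp ((\<eta> - (c * DIM('a)) *\<^sub>R b) \<bullet> x) * ?u x)) \<partial>lborel)"
  proof (rule nn_integral_mono)
    fix x
    have "exp (\<eta> \<bullet> x + c * norm x) * ?u x = exp (\<eta> \<bullet> x) * exp (c * norm x) * ?u x" by (simp add: exp_add)
    also have "\<dots> \<le> exp (\<eta> \<bullet> x) * (\<Sum>b\<in>Basis. exp (((c * DIM('a)) *\<^sub>R b) \<bullet> x) + exp ((- (c * DIM('a)) *\<^sub>R b) \<bullet> x)) * ?u x"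
      by (intro mult_right_mono mult_left_mono exp_norm_le_sum_exp_inner c mgf_kernelD(2)[OF g]) auto
    also have "\<dots> = (\<Sum>b\<in>Basis. exp ((\<eta> + (c * DIM('a)) *\<^sub>R b) \<bullet> x) * ?u x +
        exp ((\<eta> - (c * DIM('a)) *\<^sub>R b) \<bullet> x) * ?u x)"
      by (simp add: inner_add_left inner_diff_left sum_distrib_left sum_distrib_right exp_add exp_diff
        exp_minus algebra_simps divide_inverse)
    also have "ennreal \<dots> = (\<Sum>b\<in>Basis. ennreal (exp ((\<eta> + (c * DIM('a)) *\<^sub>R b) \<bullet> x) * ?u x) +
       ennreal (exp ((\<eta> - (c * DIM('a)) *\<^sub>R b) \<bullet> x) * ?u x))"
      using mgf_kernelD(2)[OF g] by (subst sum_ennreal[symmetric]) (auto simp: ennreal_plus)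
    finally show "ennreal (exp (\<eta> \<bullet> x + c * norm x) * ?u x) \<le> \<dots>"
      by (simp add: ennreal_leI)
  qed
  also have "\<dots> = (\<Sum>b\<in>Basis. ennreal (L (\<eta> + (c * DIM('a)) *\<^sub>R b)) + ennreal (L (\<eta> - (c * DIM('a)) *\<^sub>R b)))"
    by (subst nn_integral_sum) (auto simp: nn_integral_add mgf_kernelD(4)[OF g])
  also have "\<dots> = ennreal (\<Sum>b\<in>Basis. L (\<eta> + (c * DIM('a)) *\<^sub>R b) + L (\<eta> - (c * DIM('a)) *\<^sub>R b))"
    using mgf_kernelD(3)[OF g] by (subst sum_ennreal[symmetric]) (auto simp: ennreal_plus)
  finally show ?thesis .
qed

lemma mgf_kernel_add:
  assumes "mgf_kernel \<phi> L" "mgf_kernel \<phi>' L'"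
  shows "mgf_kernel (\<lambda>\<xi>. \<phi> \<xi> + \<phi>' \<xi>) (\<lambda>\<eta>. L \<eta> + L' \<eta>)"
proof -
  note a = mgf_kernelD[OF assms(1)] and b = mgf_kernelD[OF assms(2)]
  note [measurable] = a(5) b(5)
  have "(\<integral>\<^sup>+x. ennreal (exp (\<eta> \<bullet> x) * (ift \<phi> x + ift \<phi>' x)) \<partial>lborel) = ennreal (L \<eta> + L' \<eta>)" for \<eta>
  proof -
    have "(\<integral>\<^sup>+x. ennreal (exp (\<eta> \<bullet> x) * (ift \<phi> x + ift \<phi>' x)) \<partial>lborel) =
       (\<integral>\<^sup>+x. ennreal (exp (\<eta> \<bullet> x) * ift \<phi> x) + ennreal (exp (\<eta> \<bullet> x) * ift \<phi>' x) \<partial>lborel)"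
      using a(2) b(2) by (simp add: distrib_left ennreal_plus)
    also have "\<dots> = ennreal (L \<eta>) + ennreal (L' \<eta>)"
      by (subst nn_integral_add) (auto simp: a(4) b(4))
    finally show ?thesis using a(3) b(3) by (simp add: ennreal_plus)
  qed
  then show ?thesis unfolding mgf_kernel_def
    using a b by (auto simp: ift_add)
qed

lemma mgf_kernel_scale:
  assumes "mgf_kernel \<phi> L" "0 \<le> c"
  shows "mgf_kernel (\<lambda>\<xi>. complex_of_real c * \<phi> \<xi>) (\<lambda>\<eta>. c * L \<eta>)"
proof -
  note a = mgf_kernelD[OF assms(1)]
  note [measurable] = a(5)
  have "(\<integral>\<^sup>+x. ennreal (exp (\<eta> \<bullet> x) * (c * ift \<phi> x)) \<partial>lborel) = ennreal (c * L \<eta>)" for \<eta>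
  proof -
    have "(\<integral>\<^sup>+x. ennreal (exp (\<eta> \<bullet> x) * (c * ift \<phi> x)) \<partial>lborel) =
       (\<integral>\<^sup>+x. ennreal c * ennreal (exp (\<eta> \<bullet> x) * ift \<phi> x) \<partial>lborel)"
      using a(2) assms(2) by (simp add: ennreal_mult[symmetric] mult_ac)
    also have "\<dots> = ennreal c * ennreal (L \<eta>)"
      by (subst nn_integral_cmult) (auto simp: a(4))
    finally show ?thesis using a(3) assms(2) by (simp add: ennreal_mult)
  qed
  then show ?thesis unfolding mgf_kernel_def
    using a assms(2) by (auto simp: ift_cmult)
qed

text \<open>Tonelli: \<open>exp (\<eta> \<bullet> x)\<close> factors along
  \<open>x = y + (x - y)\<close>, so the moment generating functions multiply.\<close>

lemma mgf_kernel_convolution: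
  fixes \<phi> :: "'a::euclidean_space \<Rightarrow> complex"
  assumes g: "mgf_kernel \<phi> L" and M: "finite_measure M" and sM: "sets M = sets borel"
    and m: "\<And>\<eta>. 0 \<le> m \<eta>" "\<And>\<eta>. (\<integral>\<^sup>+y. ennreal (exp (\<eta> \<bullet> y)) \<partial>M) = ennreal (m \<eta>)"
  shows "mgf_kernel (\<lambda>\<xi>. \<phi> \<xi> * char_fun M \<xi>) (\<lambda>\<eta>. L \<eta> * m \<eta>)"
proof -
  note a = mgf_kernelD[OF g]
  note [measurable] = a(5)
  note [measurable_cong] = sM
  interpret finite_measure M by fact
  interpret pair_sigma_finite "lborel::'a measure" M ..
  let ?u = "ift \<phi>"
  have conv: "ift (\<lambda>\<xi>. \<phi> \<xi> * char_fun M \<xi>) x = (LINT y|M. ?u (x - y))" for x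
    by (rule ift_mult_char_fun[OF M sM a(1)])
  have nonneg: "0 \<le> ift (\<lambda>\<xi>. \<phi> \<xi> * char_fun M \<xi>) x" for x
    unfolding conv using a(2) by (intro integral_nonneg_AE) auto
  have nn: "ennreal (ift (\<lambda>\<xi>. \<phi> \<xi> * char_fun M \<xi>) x) = (\<integral>\<^sup>+y. ennreal (?u (x - y)) \<partial>M)" for x
    unfolding conv using a(2)
    by (subst nn_integral_eq_integral) (auto intro!: integrable_ift_finite_measure[OF M sM a(1)])
  have "(\<integral>\<^sup>+x. ennreal (exp (\<eta> \<bullet> x) * ift (\<lambda>\<xi>. \<phi> \<xi> * char_fun M \<xi>) x) \<partial>lborel) = ennreal (L \<eta> * m \<eta>)" for \<eta>
  proof -
    have "(\<integral>\<^sup>+x. ennreal (exp (\<eta> \<bullet> x) * ift (\<lambda>\<xi>. \<phi> \<xi> * char_fun M \<xi>) x) \<partial>lborel) =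
      (\<integral>\<^sup>+x. \<integral>\<^sup>+y. ennreal (exp (\<eta> \<bullet> y)) * ennreal (exp (\<eta> \<bullet> (x - y)) * ?u (x - y)) \<partial>M \<partial>lborel)"
    proof (rule nn_integral_cong)
      fix x
      have "ennreal (exp (\<eta> \<bullet> x) * ift (\<lambda>\<xi>. \<phi> \<xi> * char_fun M \<xi>) x) =
         ennreal (exp (\<eta> \<bullet> x)) * (\<integral>\<^sup>+y. ennreal (?u (x - y)) \<partial>M)"
        using nonneg by (simp add: ennreal_mult nn)
      also have "\<dots> = (\<integral>\<^sup>+y. ennreal (exp (\<eta> \<bullet> x)) * ennreal (?u (x - y)) \<partial>M)"
        by (subst nn_integral_cmult) auto
      also have "\<dots> = (\<integral>\<^sup>+y. ennreal (exp (\<eta> \<bullet> y)) * ennreal (exp (\<eta> \<bullet> (x - y)) * ?u (x - y)) \<partial>M)"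
      proof (rule nn_integral_cong)
        fix y
        have "exp (\<eta> \<bullet> x) * ?u (x - y) = exp (\<eta> \<bullet> y) * (exp (\<eta> \<bullet> (x - y)) * ?u (x - y))"
          by (simp add: inner_diff_right exp_diff)
        then show "ennreal (exp (\<eta> \<bullet> x)) * ennreal (?u (x - y)) =
           ennreal (exp (\<eta> \<bullet> y)) * ennreal (exp (\<eta> \<bullet> (x - y)) * ?u (x - y))"
          using a(2) by (simp add: ennreal_mult[symmetric])
      qed
      finally show "ennreal (exp (\<eta> \<bullet> x) * ift (\<lambda>\<xi>. \<phi> \<xi> * char_fun M \<xi>) x) =
        (\<integral>\<^sup>+y. ennreal (exp (\<eta> \<bullet> y)) * ennreal (exp (\<eta> \<bullet> (x - y)) * ?u (x - y)) \<partial>M)" .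
    qed
    also have "\<dots> = (\<integral>\<^sup>+y. \<integral>\<^sup>+x. ennreal (exp (\<eta> \<bullet> y)) * ennreal (exp (\<eta> \<bullet> (x - y)) * ?u (x - y)) \<partial>lborel \<partial>M)"
      by (rule Fubini'[symmetric]) measurable
    also have "\<dots> = (\<integral>\<^sup>+y. ennreal (exp (\<eta> \<bullet> y)) * ennreal (L \<eta>) \<partial>M)"
      by (intro nn_integral_cong, subst nn_integral_cmult)
         (auto simp: nn_integral_lborel_shift[of "\<lambda>x. ennreal (exp (\<eta> \<bullet> x) * ?u x)"] a(4))
    also have "\<dots> = ennreal (m \<eta>) * ennreal (L \<eta>)"
      by (subst nn_integral_multc) (auto simp: m(2))
    finally show ?thesis using a(3) m(1) by (simp add: ennreal_mult mult.commute)
  qed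
  then show ?thesis unfolding mgf_kernel_def
    using a(3) m(1) nonneg integrable_mult_char_fun[OF M sM a(1), of 1] by auto
qed

text \<open>Exponential moments of a slightly larger order, bounded along the sequence,
  rule out that mass escapes to infinity.\<close>

lemma mgf_kernel_tendsto:
  fixes \<phi> :: "'a::euclidean_space \<Rightarrow> complex"
  assumes g: "\<And>n. mgf_kernel (\<phi>n n) (Lq n)" and m': "\<phi> \<in> borel_measurable lborel"
    and b: "\<And>n \<xi>. norm (\<phi>n n \<xi>) \<le> w \<xi>"
    and w: "integrable lborel w" and l: "\<And>\<xi>. (\<lambda>n. \<phi>n n \<xi>) \<longlonglongrightarrow> \<phi> \<xi>"
    and L: "\<And>\<eta>. (\<lambda>n. Lq n \<eta>) \<longlonglongrightarrow> L \<eta>"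
  shows "mgf_kernel \<phi> L"
proof -
  note a = mgf_kernelD[OF g]
  note [measurable] = a(5)
  have b': "norm (\<phi> \<xi>) \<le> w \<xi>" for \<xi>
    by (rule tendsto_upperbound[OF tendsto_norm[OF l]]) (use b in auto)
  have int: "integrable lborel \<phi>"
    by (rule Bochner_Integration.integrable_bound[OF w m']) (use b' in \<open>auto intro!: AE_I2 order_trans[OF b']\<close>)
  note [measurable] = ift_borel_measurable[OF int]
  let ?u = "ift \<phi>"
  have lim: "(\<lambda>n. ift (\<phi>n n) x) \<longlonglongrightarrow> ?u x" for x
    by (rule ift_tendsto[OF _ m' b w l]) (use a(1) in auto)
  have nonneg: "0 \<le> ?u x" for x
    by (rule tendsto_lowerbound[OF lim]) (auto simp: a(2))
  have Lnn: "0 \<le> L \<eta>" for \<eta> by (rule tendsto_lowerbound[OF L]) (auto simp: a(3))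
  define B where "B = (LINT \<xi>|lborel. w \<xi>)"
  have B: "ift (\<phi>n n) x \<le> B" for n x
  proof -
    have "ift (\<phi>n n) x \<le> (LINT \<xi>|lborel. norm (\<phi>n n \<xi>))" using abs_ift_le[of "\<phi>n n" x] by simp
    also have "\<dots> \<le> B" unfolding B_def by (intro integral_mono) (use a(1) w b in auto)
    finally show ?thesis .
  qed
  have "(\<integral>\<^sup>+x. ennreal (exp (\<eta> \<bullet> x) * ?u x) \<partial>lborel) = ennreal (L \<eta>)" for \<eta>
  proof (rule antisym)
    have "(\<integral>\<^sup>+x. ennreal (exp (\<eta> \<bullet> x) * ?u x) \<partial>lborel) =
      (\<integral>\<^sup>+x. liminf (\<lambda>n. ennreal (exp (\<eta> \<bullet> x) * ift (\<phi>n n) x)) \<partial>lborel)"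
      by (intro nn_integral_cong lim_imp_Liminf[symmetric] tendsto_ennrealI tendsto_intros lim) simp
    also have "\<dots> \<le> liminf (\<lambda>n. \<integral>\<^sup>+x. ennreal (exp (\<eta> \<bullet> x) * ift (\<phi>n n) x) \<partial>lborel)"
      by (rule nn_integral_liminf) measurable
    also have "\<dots> = ennreal (L \<eta>)"
      unfolding a(4) by (intro lim_imp_Liminf tendsto_ennrealI L) simp
    finally show "(\<integral>\<^sup>+x. ennreal (exp (\<eta> \<bullet> x) * ?u x) \<partial>lborel) \<le> ennreal (L \<eta>)" .
  next
    \<comment> \<open>\<open>S n\<close> bounds the tilted moment with the additional weight
      \<open>exp (norm x)\<close>. It converges because every \<open>Lq n\<close> does, so it has a
      bound \<open>C\<close>, and the mass outside radius \<open>r\<close> is at most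
      \<open>exp (- r) * C\<close> for all \<open>n\<close>.\<close>
    define S where "S n = (\<Sum>b\<in>Basis. Lq n (\<eta> + (1 * DIM('a)) *\<^sub>R b) + Lq n (\<eta> - (1 * DIM('a)) *\<^sub>R b))" for n
    have "convergent S" unfolding S_def
      by (intro convergent_sum convergent_add convergentI[OF L])
    then obtain C where C: "\<And>n. S n \<le> C"
      using convergent_imp_Bseq[of S] by (auto simp: Bseq_def abs_le_iff)
    have C0: "0 \<le> C" using C[of 0] a(3) by (intro order_trans[OF _ C[of 0]]) (auto simp: S_def intro!: sum_nonneg add_nonneg_nonneg)
    have tail: "(\<integral>\<^sup>+x. ennreal (exp (\<eta> \<bullet> x) * ift (\<phi>n n) x) * indicator (- cball 0 r) x \<partial>lborel) \<le> ennreal (exp (- r) * C)" for n r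
    proof -
      have "(\<integral>\<^sup>+x. ennreal (exp (\<eta> \<bullet> x) * ift (\<phi>n n) x) * indicator (- cball 0 r) x \<partial>lborel) \<le>
        (\<integral>\<^sup>+x. ennreal (exp (- r)) * ennreal (exp (\<eta> \<bullet> x + 1 * norm x) * ift (\<phi>n n) x) \<partial>lborel)"
      proof (rule nn_integral_mono)
        fix x :: 'a
        show "ennreal (exp (\<eta> \<bullet> x) * ift (\<phi>n n) x) * indicator (- cball 0 r) x \<le>
          ennreal (exp (- r)) * ennreal (exp (\<eta> \<bullet> x + 1 * norm x) * ift (\<phi>n n) x)"
        proof (cases "r < norm x")
          case True
          have "exp (\<eta> \<bullet> x) * ift (\<phi>n n) x \<le> exp (- r + (\<eta> \<bullet> x + norm x)) * ift (\<phi>n n) x"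
            using True a(2) by (intro mult_right_mono) auto
          also have "\<dots> = exp (- r) * (exp (\<eta> \<bullet> x + 1 * norm x) * ift (\<phi>n n) x)"
            by (simp only: exp_add mult.assoc mult_1)
          finally have "ennreal (exp (\<eta> \<bullet> x) * ift (\<phi>n n) x) \<le> ennreal (exp (- r) * (exp (\<eta> \<bullet> x + 1 * norm x) * ift (\<phi>n n) x))"
            by (rule ennreal_leI)
          also have "\<dots> = ennreal (exp (- r)) * ennreal (exp (\<eta> \<bullet> x + 1 * norm x) * ift (\<phi>n n) x)"
            using a(2) by (intro ennreal_mult) auto
          finally show ?thesis using True by simp
        qed (auto simp: indicator_def)
      qed
      also have "\<dots> = ennreal (exp (- r)) * (\<integral>\<^sup>+x. ennreal (exp (\<eta> \<bullet> x + 1 * norm x) * ift (\<phi>n n) x) \<partial>lborel)"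
        by (rule nn_integral_cmult) measurable
      also have "\<dots> \<le> ennreal (exp (- r)) * ennreal (S n)"
        using nn_integral_exp_norm_le[OF g[of n], where c=1 and \<eta>=\<eta>]
        by (intro mult_left_mono) (auto simp: S_def)
      also have "\<dots> \<le> ennreal (exp (- r)) * ennreal C" by (intro mult_left_mono ennreal_leI C) auto
      finally show ?thesis using C0 by (simp add: ennreal_mult)
    qed
    \<comment> \<open>Inside the ball the kernels are bounded by \<open>B\<close> on a set of finite
      measure, so dominated convergence applies there.\<close>
    have main: "ennreal (L \<eta>) \<le> (\<integral>\<^sup>+x. ennreal (exp (\<eta> \<bullet> x) * ?u x) \<partial>lborel) + ennreal (exp (- r) * C)" for r
    proof -
      have [measurable]: "cball (0::'a) r \<in> sets borel" by simp
      have "(\<lambda>n. \<integral>\<^sup>+x. ennreal (exp (\<eta> \<bullet> x) * ift (\<phi>n n) x) * indicator (cball 0 r) x \<partial>lborel)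
         \<longlonglongrightarrow> (\<integral>\<^sup>+x. ennreal (exp (\<eta> \<bullet> x) * ?u x) * indicator (cball 0 r) x \<partial>lborel)"
      proof (rule nn_integral_dominated_convergence[where w="\<lambda>x. ennreal (exp (norm \<eta> * r) * B) * indicator (cball 0 r) x"])
        show "AE x in lborel. ennreal (exp (\<eta> \<bullet> x) * ift (\<phi>n n) x) * indicator (cball 0 r) x \<le>
           ennreal (exp (norm \<eta> * r) * B) * indicator (cball 0 r) x" for n
        proof (rule AE_I2)
          fix x :: 'a
          show "ennreal (exp (\<eta> \<bullet> x) * ift (\<phi>n n) x) * indicator (cball 0 r) x \<le>
             ennreal (exp (norm \<eta> * r) * B) * indicator (cball 0 r) x"
          proof (cases "norm x \<le> r")
            case True
            have "\<eta> \<bullet> x \<le> norm \<eta> * norm x" by (rule norm_cauchy_schwarz)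
            also have "\<dots> \<le> norm \<eta> * r" using True by (intro mult_left_mono) auto
            finally show ?thesis using True a(2) B
              by (auto simp: indicator_def intro!: ennreal_leI mult_mono)
          qed (auto simp: indicator_def)
        qed
        have "(\<integral>\<^sup>+x. ennreal (exp (norm \<eta> * r) * B) * indicator (cball 0 r) (x::'a) \<partial>lborel) =
           ennreal (exp (norm \<eta> * r) * B) * emeasure lborel (cball (0::'a) r)"
          by (rule nn_integral_cmult_indicator) simp
        also have "\<dots> < \<infinity>" using emeasure_bounded_finite[of "cball (0::'a) r"]
          by (auto simp: ennreal_mult_less_top)
        finally show "(\<integral>\<^sup>+x. ennreal (exp (norm \<eta> * r) * B) * indicator (cball 0 r) (x::'a) \<partial>lborel) < \<infinity>" .
        show "AE x in lborel. (\<lambda>n. ennreal (exp (\<eta> \<bullet> x) * ift (\<phi>n n) x) * indicator (cball 0 r) x)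
           \<longlonglongrightarrow> ennreal (exp (\<eta> \<bullet> x) * ?u x) * indicator (cball 0 r) x"
        proof (rule AE_I2)
          fix x :: 'a
          have "(\<lambda>n. ennreal (exp (\<eta> \<bullet> x) * ift (\<phi>n n) x)) \<longlonglongrightarrow> ennreal (exp (\<eta> \<bullet> x) * ?u x)"
            by (intro tendsto_ennrealI tendsto_intros lim)
          then show "(\<lambda>n. ennreal (exp (\<eta> \<bullet> x) * ift (\<phi>n n) x) * indicator (cball 0 r) x)
            \<longlonglongrightarrow> ennreal (exp (\<eta> \<bullet> x) * ?u x) * indicator (cball 0 r) x"
            by (auto simp: indicator_def)
        qed
      qed measurable
      then have 1: "(\<lambda>n. (\<integral>\<^sup>+x. ennreal (exp (\<eta> \<bullet> x) * ift (\<phi>n n) x) * indicator (cball 0 r) x \<partial>lborel) + ennreal (exp (- r) * C))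
         \<longlonglongrightarrow> (\<integral>\<^sup>+x. ennreal (exp (\<eta> \<bullet> x) * ?u x) * indicator (cball 0 r) x \<partial>lborel) + ennreal (exp (- r) * C)"
        by (intro tendsto_intros)
      have "ennreal (Lq n \<eta>) \<le> (\<integral>\<^sup>+x. ennreal (exp (\<eta> \<bullet> x) * ift (\<phi>n n) x) * indicator (cball 0 r) x \<partial>lborel) + ennreal (exp (- r) * C)" for n
      proof -
        have "ennreal (Lq n \<eta>) = (\<integral>\<^sup>+x. ennreal (exp (\<eta> \<bullet> x) * ift (\<phi>n n) x) * indicator (cball 0 r) x +
           ennreal (exp (\<eta> \<bullet> x) * ift (\<phi>n n) x) * indicator (- cball 0 r) x \<partial>lborel)"
          unfolding a(4)[symmetric] by (intro nn_integral_cong) (auto simp: indicator_def)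
        also have "\<dots> = (\<integral>\<^sup>+x. ennreal (exp (\<eta> \<bullet> x) * ift (\<phi>n n) x) * indicator (cball 0 r) x \<partial>lborel) +
           (\<integral>\<^sup>+x. ennreal (exp (\<eta> \<bullet> x) * ift (\<phi>n n) x) * indicator (- cball 0 r) x \<partial>lborel)"
          by (rule nn_integral_add) measurable
        also have "\<dots> \<le> (\<integral>\<^sup>+x. ennreal (exp (\<eta> \<bullet> x) * ift (\<phi>n n) x) * indicator (cball 0 r) x \<partial>lborel) + ennreal (exp (- r) * C)"
          by (intro add_left_mono tail)
        finally show ?thesis .
      qed
      then have "ennreal (L \<eta>) \<le> (\<integral>\<^sup>+x. ennreal (exp (\<eta> \<bullet> x) * ?u x) * indicator (cball 0 r) x \<partial>lborel) + ennreal (exp (- r) * C)"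
        by (intro tendsto_le[OF _ 1 tendsto_ennrealI[OF L]]) (auto intro!: always_eventually)
      also have "\<dots> \<le> (\<integral>\<^sup>+x. ennreal (exp (\<eta> \<bullet> x) * ?u x) \<partial>lborel) + ennreal (exp (- r) * C)"
        by (intro add_right_mono nn_integral_mono) (auto simp: indicator_def)
      finally show ?thesis .
    qed
    have "(\<lambda>n. exp (- real n) * C) \<longlonglongrightarrow> 0 * C"
      by (intro tendsto_intros) real_asymp
    then have "(\<lambda>n. (\<integral>\<^sup>+x. ennreal (exp (\<eta> \<bullet> x) * ?u x) \<partial>lborel) + ennreal (exp (- real n) * C))
      \<longlonglongrightarrow> (\<integral>\<^sup>+x. ennreal (exp (\<eta> \<bullet> x) * ?u x) \<partial>lborel) + ennreal (0 * C)"
      by (intro tendsto_add[OF tendsto_const] tendsto_ennrealI)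
    then have "(\<lambda>n. (\<integral>\<^sup>+x. ennreal (exp (\<eta> \<bullet> x) * ?u x) \<partial>lborel) + ennreal (exp (- real n) * C))
      \<longlonglongrightarrow> (\<integral>\<^sup>+x. ennreal (exp (\<eta> \<bullet> x) * ?u x) \<partial>lborel)" by simp
    then show "ennreal (L \<eta>) \<le> (\<integral>\<^sup>+x. ennreal (exp (\<eta> \<bullet> x) * ?u x) \<partial>lborel)"
      by (rule LIMSEQ_le_const) (intro exI allI impI main)
  qed
  with int nonneg Lnn show ?thesis unfolding mgf_kernel_def by blast
qed

text \<open>The partial sums of the exponential series are built by convolution, scaling and
  addition; passing to the limit takes domination in frequency and pointwise convergence of the
  moment generating functions.\<close>

lemma mgf_kernel_compound_poisson:
  fixes \<phi> :: "'a::euclidean_space \<Rightarrow> complex"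
  assumes g: "mgf_kernel \<phi> L" and M: "finite_measure M" and sM: "sets M = sets borel"
    and m: "\<And>\<eta>. 0 \<le> m \<eta>" "\<And>\<eta>. (\<integral>\<^sup>+y. ennreal (exp (\<eta> \<bullet> y)) \<partial>M) = ennreal (m \<eta>)" and s: "0 \<le> s"
  shows "mgf_kernel (\<lambda>\<xi>. \<phi> \<xi> * exp (complex_of_real s * char_fun M \<xi>)) (\<lambda>\<eta>. L \<eta> * exp (s * m \<eta>))"
proof -
  have [measurable]: "char_fun M \<in> borel_measurable borel"
    using M sM by (intro char_fun_measurable) auto
  have \<phi>: "integrable lborel \<phi>" using mgf_kernelD(1)[OF g] .
  have [measurable]: "\<phi> \<in> borel_measurable borel" using \<phi> by auto
  let ?c = "\<lambda>n. complex_of_real (s ^ n / fact n)"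
  let ?m = "measure M (space M)"
  have pw: "mgf_kernel (\<lambda>\<xi>. \<phi> \<xi> * char_fun M \<xi> ^ k) (\<lambda>\<eta>. L \<eta> * m \<eta> ^ k)" for k
  proof (induction k)
    case (Suc k)
    have "mgf_kernel (\<lambda>\<xi>. \<phi> \<xi> * char_fun M \<xi> ^ k * char_fun M \<xi>) (\<lambda>\<eta>. L \<eta> * m \<eta> ^ k * m \<eta>)"
      by (rule mgf_kernel_convolution[OF Suc M sM m])
    then show ?case by (simp add: mult_ac)
  qed (use g in simp)
  have part: "mgf_kernel (\<lambda>\<xi>. \<Sum>k\<le>n. ?c k * (\<phi> \<xi> * char_fun M \<xi> ^ k))
      (\<lambda>\<eta>. \<Sum>k\<le>n. s ^ k / fact k * (L \<eta> * m \<eta> ^ k))" for n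
  proof (induction n)
    case 0
    then show ?case using g by simp
  next
    case (Suc n)
    have "0 \<le> s ^ Suc n / fact (Suc n)" using s by simp
    from mgf_kernel_add[OF Suc mgf_kernel_scale[OF pw[of "Suc n"] this]] show ?case by simp
  qed
  show ?thesis
  proof (rule mgf_kernel_tendsto[where w="\<lambda>\<xi>. norm (\<phi> \<xi>) * exp (s * ?m)", OF part])
    fix n \<xi>
    show "norm (\<Sum>k\<le>n. ?c k * (\<phi> \<xi> * char_fun M \<xi> ^ k)) \<le> norm (\<phi> \<xi>) * exp (s * ?m)"
      by (rule exp_char_fun_series(1)[OF M s]) simp
  next
    fix \<xi>
    show "(\<lambda>n. \<Sum>k\<le>n. ?c k * (\<phi> \<xi> * char_fun M \<xi> ^ k))
        \<longlonglongrightarrow> \<phi> \<xi> * exp (complex_of_real s * char_fun M \<xi>)"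
      using exp_char_fun_series(2)[OF M s] unfolding sums_def_le .
  next
    fix \<eta>
    have "(\<lambda>k. L \<eta> * ((s * m \<eta>) ^ k /\<^sub>R fact k)) sums (L \<eta> * exp (s * m \<eta>))"
      by (intro sums_mult exp_converges)
    moreover have "L \<eta> * ((s * m \<eta>) ^ k /\<^sub>R fact k) = s ^ k / fact k * (L \<eta> * m \<eta> ^ k)" for k
      by (simp add: power_mult_distrib divide_inverse)
    ultimately show "(\<lambda>n. \<Sum>k\<le>n. s ^ k / fact k * (L \<eta> * m \<eta> ^ k)) \<longlonglongrightarrow> L \<eta> * exp (s * m \<eta>)"
      by (simp add: sums_def_le)
  qed (use \<phi> in auto)
qed

section \<open>Gaussian kernels and Fourier inversion\<close>

lemma integral_lborel_prod_complex:
  fixes f :: "'a::euclidean_space \<Rightarrow> real \<Rightarrow> complex"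
  assumes f: "\<And>b. b \<in> Basis \<Longrightarrow> integrable lborel (f b)"
  shows "(CLINT x|lborel. (\<Prod>b\<in>Basis. f b (x \<bullet> b))) = (\<Prod>b\<in>Basis. CLINT s|lborel. f b s)"
proof -
  interpret product_sigma_finite "\<lambda>_::'a. lborel::real measure" ..
  have [measurable]: "b \<in> Basis \<Longrightarrow> f b \<in> borel_measurable borel" for b using f[of b] by auto
  have "(CLINT x|lborel. (\<Prod>b\<in>Basis. f b (x \<bullet> b))) =
    (CLINT g|(\<Pi>\<^sub>M b\<in>(Basis::'a set). lborel). (\<Prod>b\<in>Basis. f b ((\<Sum>c\<in>Basis. g c *\<^sub>R c) \<bullet> b)))"
    by (subst lborel_eq, subst integral_distr) auto
  also have "\<dots> = (CLINT g|(\<Pi>\<^sub>M b\<in>(Basis::'a set). lborel). (\<Prod>b\<in>Basis. f b (g b)))"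
    by (intro Bochner_Integration.integral_cong prod.cong refl) simp
  also have "\<dots> = (\<Prod>b\<in>Basis. CLINT s|lborel. f b s)"
    by (rule product_integral_prod) (auto intro: f)
  finally show ?thesis .
qed

text \<open>The characteristic function of the standard normal law after the substitution
  \<open>v = s * u\<close>.\<close>

lemma fourier_gaussian_real:
  assumes "0 < s"
  shows "(CLINT u|lborel. cis (- (x * u)) * complex_of_real (exp (- (s * u)\<^sup>2 / 2))) =
     complex_of_real (2 * pi * normal_density 0 s x)"
    and "integrable lborel (\<lambda>u. complex_of_real (exp (- (s * u)\<^sup>2 / 2)))"
proof -
  have "complex_of_real (exp (- (- x / s)\<^sup>2 / 2)) = (CLINT v|std_normal_distribution. iexp ((- x / s) * v))"
    using fun_cong[OF char_std_normal_distribution, of "- x / s"] by (simp only: char_def)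
  also have "\<dots> = (CLINT v|lborel. std_normal_density v *\<^sub>R iexp ((- x / s) * v))"
    by (rule integral_density) auto
  also have "\<dots> = s *\<^sub>R (CLINT u|lborel. std_normal_density (0 + s * u) *\<^sub>R iexp ((- x / s) * (0 + s * u)))"
    using assms by (subst lborel_integral_real_affine[where c=s and t=0]) auto
  also have "\<dots> = s *\<^sub>R (CLINT u|lborel. complex_of_real (1 / sqrt (2 * pi)) * (cis (- (x * u)) * complex_of_real (exp (- (s * u)\<^sup>2 / 2))))"
    using assms by (intro arg_cong2[where f=scaleR] Bochner_Integration.integral_cong refl)
      (auto simp: std_normal_density_def cis_conv_exp scaleR_conv_of_real field_simps exp_of_real)
  also have "\<dots> = complex_of_real (s / sqrt (2 * pi)) * (CLINT u|lborel. cis (- (x * u)) * complex_of_real (exp (- (s * u)\<^sup>2 / 2)))"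
    by (simp add: scaleR_conv_of_real)
  finally have "(CLINT u|lborel. cis (- (x * u)) * complex_of_real (exp (- (s * u)\<^sup>2 / 2))) =
     complex_of_real (sqrt (2 * pi) / s * exp (- (- x / s)\<^sup>2 / 2))"
    using assms by (simp add: field_simps flip: of_real_mult)
  also have "sqrt (2 * pi) / s * exp (- (- x / s)\<^sup>2 / 2) = 2 * pi * normal_density 0 s x"
    using assms by (simp add: normal_density_def field_simps real_sqrt_mult power2_eq_square)
  finally show "(CLINT u|lborel. cis (- (x * u)) * complex_of_real (exp (- (s * u)\<^sup>2 / 2))) =
     complex_of_real (2 * pi * normal_density 0 s x)" .
  have "integrable lborel (\<lambda>u. normal_density 0 (1/s) u * (sqrt (2 * pi) / s))"
    using assms by (intro integrable_mult_left integrable_normal_density) auto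
  moreover have "(\<lambda>u. normal_density 0 (1/s) u * (sqrt (2 * pi) / s)) = (\<lambda>u. exp (- (s * u)\<^sup>2 / 2))"
    using assms by (auto simp: fun_eq_iff normal_density_def field_simps real_sqrt_mult power2_eq_square real_sqrt_divide)
  ultimately show "integrable lborel (\<lambda>u. complex_of_real (exp (- (s * u)\<^sup>2 / 2)))"
    by (simp add: complex_of_real_integrable_eq)
qed

lemma nn_integral_exp_normal_density:
  assumes "0 < s"
  shows "(\<integral>\<^sup>+v. ennreal (exp (a * v) * normal_density 0 s v) \<partial>lborel) = ennreal (exp ((s * a)\<^sup>2 / 2))"
proof -
  have "exp (a * v) * normal_density 0 s v = exp ((s * a)\<^sup>2 / 2) * normal_density (a * s\<^sup>2) s v" for v
  proof -
    \<comment> \<open>Completing the square: the tilt moves the mean to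
      \<open>a * s\<^sup>2\<close>.\<close>
    have "a * v + - (v\<^sup>2) / (2 * s\<^sup>2) = (s * a)\<^sup>2 / 2 + - ((v - a * s\<^sup>2)\<^sup>2) / (2 * s\<^sup>2)"
      using assms by (simp add: field_simps power2_eq_square)
    then have "exp (a * v) * exp (- (v\<^sup>2) / (2 * s\<^sup>2)) = exp ((s * a)\<^sup>2 / 2) * exp (- ((v - a * s\<^sup>2)\<^sup>2) / (2 * s\<^sup>2))"
      unfolding exp_add[symmetric] by simp
    then show ?thesis by (simp add: normal_density_def)
  qed
  then have "(\<integral>\<^sup>+v. ennreal (exp (a * v) * normal_density 0 s v) \<partial>lborel) =
     (\<integral>\<^sup>+v. ennreal (exp ((s * a)\<^sup>2 / 2)) * ennreal (normal_density (a * s\<^sup>2) s v) \<partial>lborel)"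
    by (simp add: ennreal_mult)
  also have "\<dots> = ennreal (exp ((s * a)\<^sup>2 / 2)) * (\<integral>\<^sup>+v. ennreal (normal_density (a * s\<^sup>2) s v) \<partial>lborel)"
    by (rule nn_integral_cmult) measurable
  also have "(\<integral>\<^sup>+v. ennreal (normal_density (a * s\<^sup>2) s v) \<partial>lborel) = 1"
    using assms by (subst nn_integral_eq_integral) auto
  finally show ?thesis by simp
qed

text \<open>Everything factors over the coordinates. This kernel is the regulariser both for Fourier
  inversion and for exponents whose exponential need not be integrable.\<close>

lemma mgf_kernel_gaussian:
  assumes s: "0 < s"
  shows "mgf_kernel (\<lambda>\<xi>::'a::euclidean_space. complex_of_real (exp (- (s * norm \<xi>)\<^sup>2 / 2)))
     (\<lambda>\<eta>. exp ((s * norm \<eta>)\<^sup>2 / 2))"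
proof -
  have nsq: "(norm (x::'a))\<^sup>2 = (\<Sum>b\<in>Basis. (x \<bullet> b)\<^sup>2)" for x
    by (subst euclidean_inner[of x x, folded power2_norm_eq_inner]) (simp add: power2_eq_square)
  let ?\<phi> = "\<lambda>\<xi>::'a. complex_of_real (exp (- (s * norm \<xi>)\<^sup>2 / 2))"
  have prod: "?\<phi> \<xi> = (\<Prod>b\<in>Basis. complex_of_real (exp (- (s * (\<xi> \<bullet> b))\<^sup>2 / 2)))" for \<xi>
    by (simp add: exp_sum[symmetric] sum_negf sum_divide_distrib[symmetric] power_mult_distrib nsq sum_distrib_left flip: of_real_prod)
  have cprod: "cis (- (x \<bullet> \<xi>)) = (\<Prod>b\<in>Basis. cis (- ((x \<bullet> b) * (\<xi> \<bullet> b))))" for x \<xi> :: 'a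
    by (subst euclidean_inner) (simp add: cis_conv_exp sum_negf sum_distrib_left exp_sum[symmetric])
  have cint: "(CLINT \<xi>|lborel. cis (- (x \<bullet> \<xi>)) * ?\<phi> \<xi>) =
      complex_of_real ((2 * pi) ^ DIM('a) * (\<Prod>b\<in>Basis. normal_density 0 s (x \<bullet> b)))" for x
  proof -
    have "(CLINT \<xi>|lborel. cis (- (x \<bullet> \<xi>)) * ?\<phi> \<xi>) =
      (CLINT \<xi>|lborel. (\<Prod>b\<in>Basis. cis (- ((x \<bullet> b) * (\<xi> \<bullet> b))) * complex_of_real (exp (- (s * (\<xi> \<bullet> b))\<^sup>2 / 2))))"
      by (intro Bochner_Integration.integral_cong refl) (simp only: prod cprod prod.distrib)
    also have "\<dots> = (\<Prod>b\<in>Basis. CLINT u|lborel. cis (- ((x \<bullet> b) * u)) * complex_of_real (exp (- (s * u)\<^sup>2 / 2)))"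
      by (rule integral_lborel_prod_complex[where f="\<lambda>b u. cis (- ((x \<bullet> b) * u)) * complex_of_real (exp (- (s * u)\<^sup>2 / 2))"])
         (intro integrable_cis_mult fourier_gaussian_real(2) s, measurable)
    also have "\<dots> = (\<Prod>b\<in>Basis. complex_of_real (2 * pi * normal_density 0 s (x \<bullet> b)))"
      by (simp only: fourier_gaussian_real(1)[OF s])
    finally show ?thesis by (simp add: prod.distrib)
  qed
  have ift: "ift ?\<phi> x = (\<Prod>b\<in>Basis. normal_density 0 s (x \<bullet> b))" for x
    unfolding ift_def cint Re_complex_of_real by simp
  have mgf: "(\<integral>\<^sup>+x. ennreal (exp (\<eta> \<bullet> x) * (\<Prod>b\<in>Basis. normal_density 0 s (x \<bullet> b))) \<partial>lborel) =
     ennreal (exp ((s * norm \<eta>)\<^sup>2 / 2))" for \<eta> :: 'a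
  proof -
    have e: "exp (\<eta> \<bullet> x) = (\<Prod>b\<in>Basis. exp ((\<eta> \<bullet> b) * (x \<bullet> b)))" for x
      by (subst euclidean_inner) (simp add: exp_sum)
    have "(\<integral>\<^sup>+x. ennreal (exp (\<eta> \<bullet> x) * (\<Prod>b\<in>Basis. normal_density 0 s (x \<bullet> b))) \<partial>lborel) =
      (\<integral>\<^sup>+x. (\<Prod>b\<in>Basis. ennreal (exp ((\<eta> \<bullet> b) * (x \<bullet> b)) * normal_density 0 s (x \<bullet> b))) \<partial>lborel)"
      by (intro nn_integral_cong)
         (simp add: prod_ennreal prod.distrib e)
    also have "\<dots> = (\<Prod>b\<in>Basis. \<integral>\<^sup>+v. ennreal (exp ((\<eta> \<bullet> b) * v) * normal_density 0 s v) \<partial>lborel)"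
      by (rule nn_integral_lborel_prod[where f="\<lambda>b v. ennreal (exp ((\<eta> \<bullet> b) * v) * normal_density 0 s v)"]) auto
    also have "\<dots> = (\<Prod>b\<in>Basis. ennreal (exp ((s * (\<eta> \<bullet> b))\<^sup>2 / 2)))"
      by (simp only: nn_integral_exp_normal_density[OF s])
    also have "\<dots> = ennreal (exp ((s * norm \<eta>)\<^sup>2 / 2))"
      by (simp add: prod_ennreal exp_sum[symmetric] power_mult_distrib nsq sum_distrib_left sum_divide_distrib[symmetric])
    finally show ?thesis .
  qed
  have "integrable lborel ?\<phi>"
  proof -
    have "(\<integral>\<^sup>+\<xi>. ennreal (norm (?\<phi> \<xi>)) \<partial>lborel) = (\<integral>\<^sup>+x. (\<Prod>b\<in>Basis. ennreal (exp (- (s * ((x::'a) \<bullet> b))\<^sup>2 / 2))) \<partial>lborel)"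
      by (intro nn_integral_cong) (simp add: prod_ennreal exp_sum[symmetric] sum_negf sum_divide_distrib[symmetric] power_mult_distrib nsq sum_distrib_left)
    also have "\<dots> = (\<Prod>b\<in>(Basis::'a set). \<integral>\<^sup>+u. ennreal (exp (- (s * u)\<^sup>2 / 2)) \<partial>lborel)"
      by (rule nn_integral_lborel_prod[where f="\<lambda>b u. ennreal (exp (- (s * u)\<^sup>2 / 2))"]) auto
    also have "\<dots> < \<infinity>"
    proof -
      have "(\<integral>\<^sup>+u. ennreal (exp (- (s * u)\<^sup>2 / 2)) \<partial>lborel) < \<infinity>"
        using fourier_gaussian_real(2)[OF s] unfolding integrable_iff_bounded by simp
      then show ?thesis by (simp add: power_less_top_ennreal)
    qed
    finally show ?thesis by (intro integrableI_bounded) auto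
  qed
  then show ?thesis unfolding mgf_kernel_def ift using mgf by (auto intro!: prod_nonneg)
qed

text \<open>Chernoff's bound with radial weight \<open>Suc k\<close>. This rate is reciprocal to the
  standard deviation, so the weighted moment does not depend on \<open>k\<close> and only
  \<open>exp (- (Suc k * \<delta>))\<close> varies.\<close>

lemma gaussian_tail_tendsto_0:
  fixes \<delta> :: real
  defines "\<gamma> \<equiv> \<lambda>k (\<xi>::'a::euclidean_space). complex_of_real (exp (- ((1 / Suc k) * norm \<xi>)\<^sup>2 / 2))"
  assumes \<delta>: "0 < \<delta>"
  shows "(\<lambda>k. \<integral>\<^sup>+z. ennreal (ift (\<gamma> k) z) * indicator {z. \<delta> \<le> norm z} z \<partial>lborel) \<longlonglongrightarrow> 0"
proof -
  let ?d = "real DIM('a)"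
  have bd: "(\<integral>\<^sup>+z. ennreal (ift (\<gamma> k) z) * indicator {z. \<delta> \<le> norm z} z \<partial>lborel) \<le>
     ennreal (exp (- (Suc k * \<delta>)) * (2 * ?d * exp (?d\<^sup>2 / 2)))" for k
  proof -
    have g: "mgf_kernel (\<gamma> k) (\<lambda>\<eta>. exp (((1 / Suc k) * norm \<eta>)\<^sup>2 / 2))"
      unfolding \<gamma>_def by (rule mgf_kernel_gaussian) simp
    note [measurable] = mgf_kernelD(5)[OF g]
    have "(\<integral>\<^sup>+z. ennreal (ift (\<gamma> k) z) * indicator {z. \<delta> \<le> norm z} z \<partial>lborel) \<le>
      (\<integral>\<^sup>+z. ennreal (exp (- (Suc k * \<delta>))) * ennreal (exp (0 \<bullet> z + Suc k * norm z) * ift (\<gamma> k) z) \<partial>lborel)"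
    proof (rule nn_integral_mono)
      fix z :: 'a
      show "ennreal (ift (\<gamma> k) z) * indicator {z. \<delta> \<le> norm z} z \<le>
         ennreal (exp (- (Suc k * \<delta>))) * ennreal (exp (0 \<bullet> z + Suc k * norm z) * ift (\<gamma> k) z)"
      proof (cases "\<delta> \<le> norm z")
        case True
        then have "Suc k * \<delta> \<le> Suc k * norm z" by (intro mult_left_mono) auto
        then have "1 * ift (\<gamma> k) z \<le> exp (- (Suc k * \<delta>) + Suc k * norm z) * ift (\<gamma> k) z"
          using mgf_kernelD(2)[OF g] by (intro mult_right_mono) auto
        then show ?thesis using True mgf_kernelD(2)[OF g] unfolding exp_add
          by (simp add: ennreal_mult[symmetric] mult.assoc ennreal_leI del: of_nat_Suc)
      qed simp
    qed
    also have "\<dots> = ennreal (exp (- (Suc k * \<delta>))) * (\<integral>\<^sup>+z. ennreal (exp (0 \<bullet> z + Suc k * norm z) * ift (\<gamma> k) z) \<partial>lborel)"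
      by (rule nn_integral_cmult) measurable
    also have "\<dots> \<le> ennreal (exp (- (Suc k * \<delta>))) * ennreal (\<Sum>b\<in>(Basis::'a set).
        exp (((1 / Suc k) * norm (0 + (Suc k * ?d) *\<^sub>R b))\<^sup>2 / 2) + exp (((1 / Suc k) * norm (0 - (Suc k * ?d) *\<^sub>R b))\<^sup>2 / 2))"
      by (intro mult_left_mono nn_integral_exp_norm_le[OF g]) auto
    also have "(\<Sum>b\<in>(Basis::'a set). exp (((1 / Suc k) * norm (0 + (Suc k * ?d) *\<^sub>R b))\<^sup>2 / 2) + exp (((1 / Suc k) * norm (0 - (Suc k * ?d) *\<^sub>R b))\<^sup>2 / 2))
       = (\<Sum>b\<in>(Basis::'a set). 2 * exp (?d\<^sup>2 / 2))"
      by (intro sum.cong refl) (simp add: power_mult_distrib power_divide del: of_nat_Suc)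
    finally show ?thesis by (simp add: ennreal_mult mult_ac)
  qed
  have "(\<lambda>k. exp (- (Suc k * \<delta>)) * (2 * ?d * exp (?d\<^sup>2 / 2))) \<longlonglongrightarrow> 0 * (2 * ?d * exp (?d\<^sup>2 / 2))"
    using \<delta> by (intro tendsto_intros) real_asymp
  then have "(\<lambda>k. ennreal (exp (- (Suc k * \<delta>)) * (2 * ?d * exp (?d\<^sup>2 / 2)))) \<longlonglongrightarrow> ennreal 0"
    by (intro tendsto_ennrealI) simp
  then have lim: "(\<lambda>k. ennreal (exp (- (Suc k * \<delta>)) * (2 * ?d * exp (?d\<^sup>2 / 2)))) \<longlonglongrightarrow> 0" by simp
  show ?thesis
    by (rule tendsto_sandwich[OF _ _ tendsto_const lim]) (auto simp del: of_nat_Suc intro!: always_eventually bd)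
qed

text \<open>Fourier inversion. Convolving \<open>P\<close> with shrinking Gaussians gives densities
  \<open>q k\<close> converging to the candidate density of \<open>Q\<close>. A portmanteau argument
  yields \<open>P \<le> Q\<close> on open sets and Fatou bounds the total mass of \<open>Q\<close>
  by 1. With equal masses, complements give \<open>Q \<le> P\<close> on compact sets, inner
  regularity extends this to Borel sets, and complements once more give equality.\<close>

lemma density_ift_char_fun:
  fixes P :: "'a::euclidean_space measure"
  assumes P: "prob_space P" and sP: "sets P = sets borel" and int: "integrable lborel (char_fun P)"
  shows "0 \<le> ift (char_fun P) x" and "P = density lborel (\<lambda>x. ennreal (ift (char_fun P) x))"
proof -
  interpret prob_space P by fact
  interpret pair_sigma_finite "lborel::'a measure" P ..
  note [measurable_cong] = sP
  have fP: "finite_measure P" by (rule finite_measure_axioms)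
  let ?\<phi> = "char_fun P" let ?p = "ift ?\<phi>"
  define \<gamma> where "\<gamma> k \<xi> = complex_of_real (exp (- ((1 / Suc k) * norm \<xi>)\<^sup>2 / 2))" for k and \<xi> :: 'a
  have g: "mgf_kernel (\<gamma> k) (\<lambda>\<eta>. exp (((1 / Suc k) * norm \<eta>)\<^sup>2 / 2))" for k
    unfolding \<gamma>_def by (rule mgf_kernel_gaussian) simp
  note a = mgf_kernelD[OF g]
  note [measurable] = a(5) ift_borel_measurable[OF int]
  have [measurable]: "?\<phi> \<in> borel_measurable borel" using int by auto
  have [measurable]: "\<gamma> k \<in> borel_measurable borel" for k using a(1) by auto
  define q where "q k x = ift (\<lambda>\<xi>. \<gamma> k \<xi> * ?\<phi> \<xi>) x" for k x
  have qint: "integrable lborel (\<lambda>\<xi>. \<gamma> k \<xi> * ?\<phi> \<xi>)" for k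
    using integrable_mult_char_fun[OF fP sP mgf_kernelD(1)[OF g[of k]], where n=1] by simp
  have [measurable]: "q k \<in> borel_measurable borel" for k
    using ift_borel_measurable[OF qint] by (simp add: q_def[abs_def])
  have q: "q k x = (LINT y|P. ift (\<gamma> k) (x - y))" for k x
    unfolding q_def by (rule ift_mult_char_fun[OF fP sP a(1)])
  have q0: "0 \<le> q k x" for k x unfolding q using a(2) by (intro integral_nonneg_AE) auto
  have qe: "ennreal (q k x) = (\<integral>\<^sup>+y. ennreal (ift (\<gamma> k) (x - y)) \<partial>P)" for k x
    unfolding q using a(2)
    by (subst nn_integral_eq_integral) (auto intro!: integrable_ift_finite_measure[OF fP sP a(1)])
  have \<gamma>1: "norm (\<gamma> k \<xi>) \<le> 1" for k \<xi> by (simp add: \<gamma>_def)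
  have \<gamma>b: "norm (\<gamma> k \<xi> * ?\<phi> \<xi>) \<le> norm (?\<phi> \<xi>)" for k \<xi>
    using mult_right_mono[OF \<gamma>1[of k \<xi>], of "norm (?\<phi> \<xi>)"] by (simp add: norm_mult)
  have lim: "(\<lambda>k. q k x) \<longlonglongrightarrow> ?p x" for x
    unfolding q_def
  proof (rule ift_tendsto[where w="\<lambda>\<xi>. norm (?\<phi> \<xi>)"])
    fix \<xi> :: 'a
    have "(\<lambda>k. exp (- ((1 / Suc k) * norm \<xi>)\<^sup>2 / 2)) \<longlonglongrightarrow> exp (- (0 * norm \<xi>)\<^sup>2 / 2)"
      by (intro tendsto_intros) (simp_all, real_asymp)
    then have "(\<lambda>k. \<gamma> k \<xi>) \<longlonglongrightarrow> complex_of_real 1" unfolding \<gamma>_def by (intro tendsto_of_real) simp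
    then have "(\<lambda>k. \<gamma> k \<xi> * ?\<phi> \<xi>) \<longlonglongrightarrow> complex_of_real 1 * ?\<phi> \<xi>" by (intro tendsto_intros)
    then show "(\<lambda>k. \<gamma> k \<xi> * ?\<phi> \<xi>) \<longlonglongrightarrow> ?\<phi> \<xi>" by simp
  qed (use int \<gamma>b in auto)
  show p0: "0 \<le> ?p x" for x by (rule tendsto_lowerbound[OF lim]) (auto simp: q0)
  define B where "B = (LINT \<xi>|lborel. norm (?\<phi> \<xi>))"
  have qB: "q k x \<le> B" for k x
  proof -
    have "q k x \<le> (LINT \<xi>|lborel. norm (\<gamma> k \<xi> * ?\<phi> \<xi>))" using abs_ift_le[of "\<lambda>\<xi>. \<gamma> k \<xi> * ?\<phi> \<xi>" x] by (simp add: q_def)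
    also have "\<dots> \<le> B" unfolding B_def by (intro integral_mono) (use qint int \<gamma>b in auto)
    finally show ?thesis .
  qed
  define Q where "Q = density lborel (\<lambda>x. ennreal (?p x))"
  have Q: "A \<in> sets borel \<Longrightarrow> emeasure Q A = (\<integral>\<^sup>+x. ennreal (?p x) * indicator A x \<partial>lborel)" for A
    unfolding Q_def by (rule emeasure_density) auto
  have sQ: "sets Q = sets borel" "space Q = UNIV" by (auto simp: Q_def)
  have sP': "space P = UNIV" using sets_eq_imp_space_eq[OF sP] by simp
  have swap: "(\<integral>\<^sup>+x. ennreal (q k x) * indicator U x \<partial>lborel) =
     (\<integral>\<^sup>+y. \<integral>\<^sup>+z. ennreal (ift (\<gamma> k) z) * indicator U (y + z) \<partial>lborel \<partial>P)" if [measurable]: "U \<in> sets borel" for U k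
  proof -
    have "(\<integral>\<^sup>+x. ennreal (q k x) * indicator U x \<partial>lborel) =
      (\<integral>\<^sup>+x. \<integral>\<^sup>+y. ennreal (ift (\<gamma> k) (x - y)) * indicator U x \<partial>P \<partial>lborel)"
      by (intro nn_integral_cong) (subst nn_integral_multc, auto simp: qe)
    also have "\<dots> = (\<integral>\<^sup>+y. \<integral>\<^sup>+x. ennreal (ift (\<gamma> k) (x - y)) * indicator U x \<partial>lborel \<partial>P)"
      by (rule Fubini'[symmetric]) measurable
    also have "\<dots> = (\<integral>\<^sup>+y. \<integral>\<^sup>+z. ennreal (ift (\<gamma> k) z) * indicator U (y + z) \<partial>lborel \<partial>P)"
    proof (rule nn_integral_cong)
      fix y
      show "(\<integral>\<^sup>+x. ennreal (ift (\<gamma> k) (x - y)) * indicator U x \<partial>lborel) = (\<integral>\<^sup>+z. ennreal (ift (\<gamma> k) z) * indicator U (y + z) \<partial>lborel)"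
        using nn_integral_lborel_shift[of "\<lambda>z. ennreal (ift (\<gamma> k) z) * indicator U (y + z)" y] by simp
    qed
    finally show ?thesis .
  qed
  have mass1: "(\<integral>\<^sup>+z. ennreal (ift (\<gamma> k) z) \<partial>lborel) = 1" for k
    using mgf_kernelD(4)[OF g[of k], of 0] by simp
  have tot: "emeasure Q UNIV \<le> 1"
  proof -
    have "emeasure Q UNIV = (\<integral>\<^sup>+x. liminf (\<lambda>k. ennreal (q k x)) \<partial>lborel)"
      by (subst Q) (auto intro!: nn_integral_cong lim_imp_Liminf[symmetric] tendsto_ennrealI lim)
    also have "\<dots> \<le> liminf (\<lambda>k. \<integral>\<^sup>+x. ennreal (q k x) \<partial>lborel)" by (rule nn_integral_liminf) measurable
    also have "(\<lambda>k. \<integral>\<^sup>+x. ennreal (q k x) \<partial>lborel) = (\<lambda>k. 1)"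
      using swap[of UNIV] by (simp add: mass1 emeasure_space_1)
    finally show ?thesis by (simp add: Liminf_const)
  qed
  \<comment> \<open>Boundedness of \<open>U\<close> makes the constant \<open>B\<close> an
    integrable majorant of \<open>q k\<close> on \<open>U\<close>.\<close>
  have open_bd: "emeasure P U \<le> emeasure Q U" if U: "open U" "bounded U" for U
  proof -
    have [measurable]: "U \<in> sets borel" using U by auto
    \<comment> \<open>A ball of radius \<open>\<delta>\<close> around \<open>y\<close> lies in
      \<open>U\<close>, and the Gaussian leaves it with vanishing probability.\<close>
    have ptw: "indicator U y \<le> liminf (\<lambda>k. \<integral>\<^sup>+z. ennreal (ift (\<gamma> k) z) * indicator U (y + z) \<partial>lborel)" for y
    proof (cases "y \<in> U")
      case True
      then obtain \<delta> where \<delta>: "0 < \<delta>" "ball y \<delta> \<subseteq> U" using U(1) open_contains_ball by blast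
      let ?e = "\<lambda>k. \<integral>\<^sup>+z. ennreal (ift (\<gamma> k) z) * indicator {z. \<delta> \<le> norm z} z \<partial>lborel"
      have e0: "?e \<longlonglongrightarrow> 0" using gaussian_tail_tendsto_0[OF \<delta>(1)] by (simp add: \<gamma>_def[abs_def])
      have "1 - ?e k \<le> (\<integral>\<^sup>+z. ennreal (ift (\<gamma> k) z) * indicator U (y + z) \<partial>lborel)" for k
      proof -
        have "1 \<le> (\<integral>\<^sup>+z. ennreal (ift (\<gamma> k) z) * indicator U (y + z) + ennreal (ift (\<gamma> k) z) * indicator {z. \<delta> \<le> norm z} z \<partial>lborel)"
          unfolding mass1[of k, symmetric]
        proof (rule nn_integral_mono)
          fix z
          have "z \<in> {z. \<delta> \<le> norm z} \<or> y + z \<in> U" using \<delta>(2) by (auto simp: dist_norm subset_eq)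
          then show "ennreal (ift (\<gamma> k) z) \<le> ennreal (ift (\<gamma> k) z) * indicator U (y + z) + ennreal (ift (\<gamma> k) z) * indicator {z. \<delta> \<le> norm z} z"
            by (auto simp: indicator_def)
        qed
        also have "\<dots> = (\<integral>\<^sup>+z. ennreal (ift (\<gamma> k) z) * indicator U (y + z) \<partial>lborel) + ?e k"
          by (rule nn_integral_add) measurable
        finally show ?thesis by (simp add: ennreal_minus_le_iff add.commute)
      qed
      then have "liminf (\<lambda>k. 1 - ?e k) \<le> liminf (\<lambda>k. \<integral>\<^sup>+z. ennreal (ift (\<gamma> k) z) * indicator U (y + z) \<partial>lborel)"
        by (intro Liminf_mono always_eventually) auto
      moreover have "(\<lambda>k. 1 - ?e k) \<longlonglongrightarrow> 1 - 0"
        by (intro tendsto_diff_ennreal e0 tendsto_const) auto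
      then have "liminf (\<lambda>k. 1 - ?e k) = 1" by (simp add: lim_imp_Liminf)
      ultimately show ?thesis using True by simp
    qed simp
    have "emeasure P U = (\<integral>\<^sup>+y. indicator U y \<partial>P)" by simp
    also have "\<dots> \<le> (\<integral>\<^sup>+y. liminf (\<lambda>k. \<integral>\<^sup>+z. ennreal (ift (\<gamma> k) z) * indicator U (y + z) \<partial>lborel) \<partial>P)"
      by (intro nn_integral_mono ptw)
    also have "\<dots> \<le> liminf (\<lambda>k. \<integral>\<^sup>+y. \<integral>\<^sup>+z. ennreal (ift (\<gamma> k) z) * indicator U (y + z) \<partial>lborel \<partial>P)"
      by (rule nn_integral_liminf) measurable
    also have "\<dots> = liminf (\<lambda>k. \<integral>\<^sup>+x. ennreal (q k x) * indicator U x \<partial>lborel)" by (simp add: swap)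
    also have "\<dots> = (\<integral>\<^sup>+x. ennreal (?p x) * indicator U x \<partial>lborel)"
    proof (intro lim_imp_Liminf nn_integral_dominated_convergence[where w="\<lambda>x. ennreal B * indicator U x"])
      have "(\<integral>\<^sup>+x. ennreal B * indicator U x \<partial>lborel) = ennreal B * emeasure lborel U"
        by (rule nn_integral_cmult_indicator) simp
      also have "\<dots> < \<infinity>" using emeasure_bounded_finite[OF U(2)] by (auto simp: ennreal_mult_less_top)
      finally show "(\<integral>\<^sup>+x. ennreal B * indicator U x \<partial>lborel) < \<infinity>" .
      show "AE x in lborel. ennreal (q k x) * indicator U x \<le> ennreal B * indicator U x" for k
        by (intro AE_I2 mult_right_mono ennreal_leI qB) auto
      show "AE x in lborel. (\<lambda>k. ennreal (q k x) * indicator U x) \<longlonglongrightarrow> ennreal (?p x) * indicator U x"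
      proof (rule AE_I2)
        fix x show "(\<lambda>k. ennreal (q k x) * indicator U x) \<longlonglongrightarrow> ennreal (?p x) * indicator U x"
          using tendsto_ennrealI[OF lim[of x]] by (auto simp: indicator_def)
      qed
    qed auto
    also have "\<dots> = emeasure Q U" by (simp add: Q)
    finally show ?thesis .
  qed
  have open_le: "emeasure P U \<le> emeasure Q U" if "open U" for U
  proof -
    have "(SUP n. emeasure P (U \<inter> ball 0 (real n))) = emeasure P (\<Union>n. U \<inter> ball 0 (real n))"
    proof (rule SUP_emeasure_incseq)
      show "range (\<lambda>n. U \<inter> ball 0 (real n)) \<subseteq> sets P"
        unfolding sP using that by (intro image_subsetI borel_open open_Int) auto
      show "incseq (\<lambda>n. U \<inter> ball 0 (real n))"
        by (intro monoI Int_mono order_refl subset_ball) simp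
    qed
    moreover have "(\<Union>n. U \<inter> ball 0 (real n)) = U" using reals_Archimedean2 by auto
    moreover have "emeasure P (U \<inter> ball 0 (real n)) \<le> emeasure Q U" for n
      by (rule order_trans[OF open_bd emeasure_mono]) (use that sQ in \<open>auto intro!: bounded_Int open_Int\<close>)
    ultimately show ?thesis by (metis SUP_least)
  qed
  have tot1: "emeasure Q UNIV = 1"
    using tot open_le[of UNIV] emeasure_space_1 sP' by (auto intro: antisym)
  have fQ: "finite_measure Q" by (intro finite_measureI) (use tot1 sQ in auto)
  have le: "emeasure Q A \<le> emeasure P A" if A: "A \<in> sets borel" for A
  proof -
    have "emeasure Q A = (SUP K\<in>{K. K \<subseteq> A \<and> compact K}. emeasure Q K)"
      by (rule inner_regular) (use tot1 sQ A in auto)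
    also have "\<dots> \<le> emeasure P A"
    proof (rule SUP_least)
      fix K assume K: "K \<in> {K. K \<subseteq> A \<and> compact K}"
      then have Km: "K \<in> sets borel" and op: "open (- K)"
        by (auto simp: borel_compact compact_imp_closed open_Compl)
      have "emeasure Q K = emeasure Q UNIV - emeasure Q (- K)"
        using emeasure_compl[of "- K" Q] Km sQ fQ by (auto simp: finite_measure.emeasure_finite Compl_eq_Diff_UNIV[symmetric])
      also have "\<dots> \<le> 1 - emeasure P (- K)"
        unfolding tot1 by (intro ennreal_mono_minus open_le op)
      also have "\<dots> = emeasure P K"
        using emeasure_compl[of "- K" P] Km sP sP' emeasure_space_1 by (auto simp: Compl_eq_Diff_UNIV[symmetric])
      also have "\<dots> \<le> emeasure P A" using K A sP by (intro emeasure_mono) auto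
      finally show "emeasure Q K \<le> emeasure P A" .
    qed
    finally show ?thesis .
  qed
  have "P = Q"
  proof (rule measure_eqI)
    fix A assume "A \<in> sets P"
    then have A: "A \<in> sets borel" using sP by simp
    have "emeasure P A = 1 - emeasure P (- A)"
      using emeasure_compl[of "- A" P] A sP sP' emeasure_space_1 by (auto simp: Compl_eq_Diff_UNIV[symmetric])
    also have "\<dots> \<le> emeasure Q UNIV - emeasure Q (- A)"
      unfolding tot1 by (intro ennreal_mono_minus le) (use A in auto)
    also have "\<dots> = emeasure Q A"
      using emeasure_compl[of "- A" Q] A sQ fQ by (auto simp: finite_measure.emeasure_finite Compl_eq_Diff_UNIV[symmetric])
    finally show "emeasure P A = emeasure Q A" using le[OF A] by (rule antisym)
  qed (use sP sQ in auto)
  then show "P = density lborel (\<lambda>x. ennreal (?p x))" by (simp add: Q_def)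
qed

section \<open>Levy exponents\<close>

text \<open>Nonnegativity includes the origin, where the theorem leaves \<open>nu\<close> free; its
  proof first passes to a version vanishing there.\<close>

definition levy_density :: "('a::euclidean_space \<Rightarrow> real) \<Rightarrow> bool" where
  "levy_density n \<longleftrightarrow> n \<in> borel_measurable borel \<and> (\<forall>y. 0 \<le> n y) \<and>
     integrable lborel (\<lambda>y. min 1 ((norm y)\<^sup>2) * n y)"

lemma levy_densityD:
  assumes "levy_density n"
  shows "n \<in> borel_measurable borel" "0 \<le> n y" "integrable lborel (\<lambda>y. min 1 ((norm y)\<^sup>2) * n y)"
  using assms by (auto simp: levy_density_def)

lemma levy_density_bounded_integrable:
  fixes g :: "'a::euclidean_space \<Rightarrow> 'b::{banach, second_countable_topology}"
  assumes n: "levy_density n" and [measurable]: "g \<in> borel_measurable borel"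
    and le: "\<And>y. norm (g y) \<le> C * min 1 ((norm y)\<^sup>2)"
  shows "integrable lborel (\<lambda>y. n y *\<^sub>R g y)"
proof (rule Bochner_Integration.integrable_bound)
  note [measurable] = levy_densityD(1)[OF n]
  show "integrable lborel (\<lambda>y. C * (min 1 ((norm y)\<^sup>2) * n y))"
    using levy_densityD(3)[OF n] by simp
  show "(\<lambda>y. n y *\<^sub>R g y) \<in> borel_measurable lborel" by measurable
  show "AE y in lborel. norm (n y *\<^sub>R g y) \<le> norm (C * (min 1 ((norm y)\<^sup>2) * n y))"
  proof (rule AE_I2)
    fix y
    have "norm (n y *\<^sub>R g y) = n y * norm (g y)" using levy_densityD(2)[OF n] by simp
    also have "\<dots> \<le> n y * (C * min 1 ((norm y)\<^sup>2))" by (intro mult_left_mono le levy_densityD(2)[OF n])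
    finally show "norm (n y *\<^sub>R g y) \<le> norm (C * (min 1 ((norm y)\<^sup>2) * n y))" by (simp add: mult_ac)
  qed
qed

lemma levy_density_cut:
  assumes n: "levy_density n" and [measurable]: "S \<in> sets borel"
  shows "levy_density (\<lambda>y. indicator S y * n y)"
proof -
  note [measurable] = levy_densityD(1)[OF n]
  have "integrable lborel (\<lambda>y. min 1 ((norm y)\<^sup>2) * (indicator S y * n y))"
    by (rule Bochner_Integration.integrable_bound[OF levy_densityD(3)[OF n]])
       (use levy_densityD(2)[OF n] in \<open>auto simp: indicator_def\<close>)
  then show ?thesis unfolding levy_density_def
    using levy_densityD(2)[OF n] by (auto simp: indicator_def)
qed

lemma abs_inner_sq_le: "(\<xi> \<bullet> y)\<^sup>2 \<le> (norm \<xi>)\<^sup>2 * (norm y)\<^sup>2" for \<xi> y :: "'a::real_inner"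
  using Cauchy_Schwarz_ineq[of \<xi> y] by (simp add: power2_norm_eq_inner)

text \<open>Inside the unit ball the compensator cancels the linear term and leaves the second-order
  Taylor remainder; outside, two terms of modulus 1 remain.\<close>

lemma levy_Phi_integrand_bound:
  fixes \<xi> y :: "'a::euclidean_space"
  shows "norm (1 - cis (\<xi> \<bullet> y) + \<i> * complex_of_real ((\<xi> \<bullet> y) * indicator (ball 0 1) y))
     \<le> (2 + (norm \<xi>)\<^sup>2) * min 1 ((norm y)\<^sup>2)"
proof (cases "norm y < 1")
  case True
  have "norm (1 - cis (\<xi> \<bullet> y) + \<i> * complex_of_real (\<xi> \<bullet> y)) \<le> (\<xi> \<bullet> y)\<^sup>2 / 2"
    using iexp_approx1[of "\<xi> \<bullet> y" 1]
    by (simp add: cis_conv_exp norm_minus_commute[of _ "1 + _"] algebra_simps numeral_2_eq_2 power2_eq_square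
        flip: norm_minus_cancel[of "1 - _ + _"])
  also have "\<dots> \<le> (norm \<xi>)\<^sup>2 * (norm y)\<^sup>2" using abs_inner_sq_le[of \<xi> y] zero_le_power2[of "\<xi> \<bullet> y"] by linarith
  also have "\<dots> \<le> (2 + (norm \<xi>)\<^sup>2) * (norm y)\<^sup>2" by (intro mult_right_mono) auto
  also have "(norm y)\<^sup>2 = min 1 ((norm y)\<^sup>2)" using True power_le_one[of "norm y" 2] by (simp add: min_def)
  finally show ?thesis using True by (simp add: dist_norm)
next
  case False
  have "norm (1 - cis (\<xi> \<bullet> y)) \<le> norm (1::complex) + norm (cis (\<xi> \<bullet> y))" by (rule norm_triangle_ineq4)
  also have "\<dots> \<le> (2 + (norm \<xi>)\<^sup>2) * 1" by simp
  also have "1 = min 1 ((norm y)\<^sup>2)" using False by (simp add: min_def one_le_power)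
  finally show ?thesis using False by (simp add: dist_norm)
qed

lemma levy_Phi_integrable:
  assumes n: "levy_density n"
  shows "integrable lborel (\<lambda>y. complex_of_real (n y) *
      (1 - cis (\<xi> \<bullet> y) + \<i> * complex_of_real ((\<xi> \<bullet> y) * indicator (ball 0 1) y)))"
proof -
  have "integrable lborel (\<lambda>y. n y *\<^sub>R
      (1 - cis (\<xi> \<bullet> y) + \<i> * complex_of_real ((\<xi> \<bullet> y) * indicator (ball 0 1) y)))"
    by (rule levy_density_bounded_integrable[OF n _ levy_Phi_integrand_bound]) measurable
  then show ?thesis by (simp only: scaleR_conv_of_real)
qed

lemma levy_Phi_measurable [measurable (raw)]:
  assumes "n \<in> borel_measurable borel"
  shows "levy_Phi n \<in> borel_measurable borel"
proof -
  note assms[measurable]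
  show ?thesis unfolding levy_Phi_def[abs_def]
    by (rule lborel.borel_measurable_lebesgue_integral) measurable
qed

lemma one_minus_cos_bound: "norm (1 - cos (\<xi> \<bullet> y)) \<le> (2 + (norm \<xi>)\<^sup>2) * min 1 ((norm y)\<^sup>2)"
  for \<xi> y :: "'a::euclidean_space"
  using order_trans[OF abs_Re_le_cmod levy_Phi_integrand_bound[of \<xi> y]] by simp

lemma integrable_one_minus_cos:
  assumes n: "levy_density n"
  shows "integrable lborel (\<lambda>y. n y * (1 - cos (\<xi> \<bullet> y)))"
proof -
  have "integrable lborel (\<lambda>y. n y *\<^sub>R (1 - cos (\<xi> \<bullet> y)))"
    by (rule levy_density_bounded_integrable[OF n _ one_minus_cos_bound]) measurable
  then show ?thesis by simp
qed

lemma Re_levy_Phi: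
  assumes n: "levy_density n"
  shows "Re (levy_Phi n \<xi>) = (LINT y|lborel. n y * (1 - cos (\<xi> \<bullet> y)))"
  unfolding levy_Phi_def by (subst integral_Re[OF levy_Phi_integrable[OF n], symmetric]) simp

lemma Re_levy_Phi_nonneg:
  assumes n: "levy_density n"
  shows "0 \<le> Re (levy_Phi n \<xi>)"
  unfolding Re_levy_Phi[OF n] using levy_densityD(2)[OF n] by (intro integral_nonneg_AE) auto

lemma norm_exp_levy_psi:
  "norm (exp (- complex_of_real t * levy_psi b A n \<xi>)) = exp (- t * (\<xi> \<bullet> A \<xi> + Re (levy_Phi n \<xi>)))"
  by (simp add: levy_psi_def)

lemma abs_exp_minus_1_minus_le: "\<bar>exp a - 1 - a\<bar> \<le> a\<^sup>2 * exp \<bar>a\<bar>" for a :: real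
proof -
  obtain s where s: "\<bar>s\<bar> \<le> \<bar>a\<bar>" "exp a = (\<Sum>m<2. a ^ m / fact m) + exp s / fact 2 * a ^ 2"
    using Maclaurin_exp_le[of a 2] by blast
  have "\<bar>exp a - 1 - a\<bar> = exp s / 2 * a\<^sup>2" using s(2) by (simp add: numeral_2_eq_2)
  also have "\<dots> \<le> exp \<bar>a\<bar> * a\<^sup>2" 
  proof (rule mult_right_mono)
    have "exp s / 2 \<le> exp s" by simp
    also have "\<dots> \<le> exp \<bar>a\<bar>" using s(1) by simp
    finally show "exp s / 2 \<le> exp \<bar>a\<bar>" .
  qed simp
  finally show ?thesis by (simp add: mult.commute)
qed

lemma abs_inner_le_mult:
  fixes \<eta> y :: "'a::real_inner"
  assumes "norm y \<le> \<rho>"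
  shows "\<bar>\<eta> \<bullet> y\<bar> \<le> norm \<eta> * \<rho>"
  by (rule order_trans[OF Cauchy_Schwarz_ineq2]) (use assms in \<open>auto intro: mult_left_mono\<close>)

text \<open>Unlike \<open>cis\<close>, the real exponential is unbounded, so only jumps of size at
  most \<open>\<rho>\<close> are covered, at the cost of
  \<open>exp (norm \<eta> * \<rho>)\<close>.\<close>

lemma psi_tilde_integrand_bound:
  fixes \<eta> y :: "'a::euclidean_space"
  assumes "norm y \<le> \<rho>"
  shows "\<bar>1 - exp (\<eta> \<bullet> y) + (\<eta> \<bullet> y) * indicator (ball 0 1) y\<bar>
     \<le> ((1 + (norm \<eta>)\<^sup>2) * exp (norm \<eta> * \<rho>)) * min 1 ((norm y)\<^sup>2)"
proof (cases "norm y < 1")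
  case True
  have "\<bar>1 - exp (\<eta> \<bullet> y) + (\<eta> \<bullet> y)\<bar> \<le> (\<eta> \<bullet> y)\<^sup>2 * exp \<bar>\<eta> \<bullet> y\<bar>"
    using abs_exp_minus_1_minus_le[of "\<eta> \<bullet> y"] by linarith
  also have "\<dots> \<le> ((norm \<eta>)\<^sup>2 * (norm y)\<^sup>2) * exp (norm \<eta> * \<rho>)"
    using abs_inner_le_mult[OF assms, of \<eta>] by (intro mult_mono abs_inner_sq_le) auto
  also have "\<dots> \<le> ((1 + (norm \<eta>)\<^sup>2) * exp (norm \<eta> * \<rho>)) * (norm y)\<^sup>2"
    by (simp add: algebra_simps)
  also have "(norm y)\<^sup>2 = min 1 ((norm y)\<^sup>2)" using True power_le_one[of "norm y" 2] by (simp add: min_def)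
  finally show ?thesis using True by (simp add: dist_norm)
next
  case False
  have "exp (\<eta> \<bullet> y) \<le> exp (norm \<eta> * \<rho>)" "1 \<le> exp (norm \<eta> * \<rho>)"
    using abs_inner_le_mult[OF assms, of \<eta>] by auto
  then have "\<bar>1 - exp (\<eta> \<bullet> y)\<bar> \<le> exp (norm \<eta> * \<rho>)" using exp_gt_zero[of "\<eta> \<bullet> y"] by linarith
  also have "\<dots> \<le> ((1 + (norm \<eta>)\<^sup>2) * exp (norm \<eta> * \<rho>)) * 1" by (simp add: algebra_simps)
  also have "1 = min 1 ((norm y)\<^sup>2)" using False by (simp add: min_def one_le_power)
  finally show ?thesis using False by (simp add: dist_norm)
qed

lemma psi_tilde_integrable:
  assumes n: "levy_density n" and supp: "\<And>y. \<rho> < norm y \<Longrightarrow> n y = 0"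
  shows "integrable lborel (\<lambda>y. n y * (1 - exp (\<eta> \<bullet> y) + (\<eta> \<bullet> y) * indicator (ball 0 1) y))"
proof -
  let ?g = "\<lambda>y. indicator (cball 0 \<rho>) y * (1 - exp (\<eta> \<bullet> y) + (\<eta> \<bullet> y) * indicator (ball 0 1) y)"
  have [measurable]: "cball (0::'a) \<rho> \<in> sets borel" by simp
  have "integrable lborel (\<lambda>y. n y *\<^sub>R ?g y)"
  proof (rule levy_density_bounded_integrable[OF n])
    fix y show "norm (?g y) \<le> ((1 + (norm \<eta>)\<^sup>2) * exp (norm \<eta> * \<rho>)) * min 1 ((norm y)\<^sup>2)"
      using psi_tilde_integrand_bound[of y \<rho> \<eta>] by (cases "norm y \<le> \<rho>") auto
  qed measurable
  moreover have "(\<lambda>y. n y *\<^sub>R ?g y) = (\<lambda>y. n y * (1 - exp (\<eta> \<bullet> y) + (\<eta> \<bullet> y) * indicator (ball 0 1) y))"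
    using supp by (auto simp: fun_eq_iff indicator_def not_le)
  ultimately show ?thesis by simp
qed

lemma psi_tilde_integral_bound:
  assumes n: "levy_density n" and supp: "\<And>y. \<rho> < norm y \<Longrightarrow> n y = 0"
  shows "\<bar>LINT y|lborel. n y * (1 - exp (\<eta> \<bullet> y) + (\<eta> \<bullet> y) * indicator (ball 0 1) y)\<bar>
    \<le> ((1 + (norm \<eta>)\<^sup>2) * exp (norm \<eta> * \<rho>)) * (LINT y|lborel. min 1 ((norm y)\<^sup>2) * n y)"
proof -
  have "\<bar>LINT y|lborel. n y * (1 - exp (\<eta> \<bullet> y) + (\<eta> \<bullet> y) * indicator (ball 0 1) y)\<bar> \<le>
    (LINT y|lborel. \<bar>n y * (1 - exp (\<eta> \<bullet> y) + (\<eta> \<bullet> y) * indicator (ball 0 1) y)\<bar>)"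
    by (rule integral_abs_bound)
  also have "\<dots> \<le> (LINT y|lborel. ((1 + (norm \<eta>)\<^sup>2) * exp (norm \<eta> * \<rho>)) * (min 1 ((norm y)\<^sup>2) * n y))"
  proof (rule integral_mono)
    show "integrable lborel (\<lambda>y. \<bar>n y * (1 - exp (\<eta> \<bullet> y) + (\<eta> \<bullet> y) * indicator (ball 0 1) y)\<bar>)"
      by (intro integrable_abs psi_tilde_integrable[OF n supp])
    show "integrable lborel (\<lambda>y. ((1 + (norm \<eta>)\<^sup>2) * exp (norm \<eta> * \<rho>)) * (min 1 ((norm y)\<^sup>2) * n y))"
      by (intro integrable_mult_right levy_densityD(3) n)
    fix y
    show "\<bar>n y * (1 - exp (\<eta> \<bullet> y) + (\<eta> \<bullet> y) * indicator (ball 0 1) y)\<bar> \<le>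
      ((1 + (norm \<eta>)\<^sup>2) * exp (norm \<eta> * \<rho>)) * (min 1 ((norm y)\<^sup>2) * n y)"
    proof (cases "norm y \<le> \<rho>")
      case True
      have "\<bar>n y * (1 - exp (\<eta> \<bullet> y) + (\<eta> \<bullet> y) * indicator (ball 0 1) y)\<bar> =
        n y * \<bar>1 - exp (\<eta> \<bullet> y) + (\<eta> \<bullet> y) * indicator (ball 0 1) y\<bar>"
        using levy_densityD(2)[OF n] by (simp add: abs_mult)
      also have "\<dots> \<le> n y * (((1 + (norm \<eta>)\<^sup>2) * exp (norm \<eta> * \<rho>)) * min 1 ((norm y)\<^sup>2))"
        by (intro mult_left_mono psi_tilde_integrand_bound True levy_densityD(2)[OF n])
      finally show ?thesis by (simp only: mult_ac)
    qed (use supp[of y] in auto)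
  qed
  finally show ?thesis by simp
qed

text \<open>Jumps with integrable density form a finite measure, so they can be split off the exponent
  as a compound Poisson part at the price of a change of the drift.\<close>

definition jump_measure :: "('a::euclidean_space \<Rightarrow> real) \<Rightarrow> 'a measure" where
  "jump_measure v = density lborel (\<lambda>y. ennreal (v y))"

lemma sets_jump_measure [simp]: "sets (jump_measure v) = sets borel"
  by (simp add: jump_measure_def)

context
  fixes v :: "'a::euclidean_space \<Rightarrow> real"
  assumes v: "integrable lborel v" and v0: "\<And>y. 0 \<le> v y"
begin

lemma integral_jump_measure:
  fixes g :: "'a \<Rightarrow> 'b::{banach, second_countable_topology}"
  assumes [measurable]: "g \<in> borel_measurable borel"
  shows "integral\<^sup>L (jump_measure v) g = (LINT y|lborel. v y *\<^sub>R g y)"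
  unfolding jump_measure_def using v v0 by (subst integral_density) auto

lemma nn_integral_jump_measure:
  assumes [measurable]: "g \<in> borel_measurable borel"
  shows "integral\<^sup>N (jump_measure v) g = (\<integral>\<^sup>+y. ennreal (v y) * g y \<partial>lborel)"
  unfolding jump_measure_def using v by (subst nn_integral_density) auto

lemma finite_measure_jump_measure: "finite_measure (jump_measure v)"
proof
  have "emeasure (jump_measure v) (space (jump_measure v)) = (\<integral>\<^sup>+y. ennreal (v y) \<partial>lborel)"
    unfolding jump_measure_def using v by (subst emeasure_density) auto
  also have "\<dots> = ennreal (LINT y|lborel. v y)" using v v0 by (intro nn_integral_eq_integral) auto
  finally show "emeasure (jump_measure v) (space (jump_measure v)) \<noteq> \<infinity>" by simp
qed

lemma measure_jump_measure: "measure (jump_measure v) (space (jump_measure v)) = (LINT y|lborel. v y)"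
  using integral_jump_measure[of "\<lambda>_. 1::real"] by simp

lemma char_fun_jump_measure:
  "char_fun (jump_measure v) \<xi> = (CLINT y|lborel. complex_of_real (v y) * cis (\<xi> \<bullet> y))"
  unfolding char_fun_def by (subst integral_jump_measure) (auto simp: scaleR_conv_of_real)

end

text \<open>Jumps outside \<open>S\<close> have finite mass, so their integrand separates into mass,
  characteristic function and compensator; the last is linear in \<open>\<xi>\<close> and moves into
  \<open>b'\<close>.\<close>

lemma levy_psi_split:
  fixes n :: "'a::euclidean_space \<Rightarrow> real" and b :: 'a
  assumes n: "levy_density n" and S [measurable]: "S \<in> sets borel"
    and big: "integrable lborel (\<lambda>y. indicator (- S) y * n y)"
  defines "b' \<equiv> b - (LINT y|lborel. (indicator (- S) y * n y * indicator (ball 0 1) y) *\<^sub>R y)"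
  shows "levy_psi b A n \<xi> = levy_psi b' A (\<lambda>y. indicator S y * n y) \<xi> +
     (complex_of_real (LINT y|lborel. indicator (- S) y * n y) -
      char_fun (jump_measure (\<lambda>y. indicator (- S) y * n y)) \<xi>)"
proof -
  let ?v = "\<lambda>y. indicator (- S) y * n y"
  note [measurable] = levy_densityD(1)[OF n]
  have v0: "0 \<le> ?v y" for y using levy_densityD(2)[OF n] by (auto simp: indicator_def)
  have i1: "integrable lborel (\<lambda>y. (?v y * indicator (ball 0 1) y) *\<^sub>R y)"
    by (rule Bochner_Integration.integrable_bound[OF big])
       (auto simp: indicator_def dist_norm intro!: mult_left_le)
  have ic: "integrable lborel (\<lambda>y. complex_of_real (?v y))" using big by (simp only: complex_of_real_integrable_eq)
  have i2: "integrable lborel (\<lambda>y. complex_of_real (?v y) * cis (\<xi> \<bullet> y))"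
    using integrable_cis_mult[OF ic, of "\<lambda>y. \<xi> \<bullet> y"] by (simp add: mult.commute)
  have i3: "integrable lborel (\<lambda>y. complex_of_real (?v y * ((\<xi> \<bullet> y) * indicator (ball 0 1) y)))"
  proof -
    have "integrable lborel (\<lambda>y. \<xi> \<bullet> ((?v y * indicator (ball 0 1) y) *\<^sub>R y))"
      by (rule integrable_inner_right) (use i1 in simp)
    then show ?thesis by (simp only: complex_of_real_integrable_eq inner_scaleR_right mult_ac)
  qed
  have "levy_Phi n \<xi> = (CLINT y|lborel. complex_of_real (indicator S y * n y) *
      (1 - cis (\<xi> \<bullet> y) + \<i> * complex_of_real ((\<xi> \<bullet> y) * indicator (ball 0 1) y)) +
      (complex_of_real (?v y) - complex_of_real (?v y) * cis (\<xi> \<bullet> y) +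
       \<i> * complex_of_real (?v y * ((\<xi> \<bullet> y) * indicator (ball 0 1) y))))"
    unfolding levy_Phi_def
    by (intro Bochner_Integration.integral_cong refl) (auto simp: indicator_def algebra_simps)
  also have "\<dots> = levy_Phi (\<lambda>y. indicator S y * n y) \<xi> +
      (complex_of_real (LINT y|lborel. ?v y) - char_fun (jump_measure ?v) \<xi> +
       \<i> * complex_of_real (LINT y|lborel. ?v y * ((\<xi> \<bullet> y) * indicator (ball 0 1) y)))"
    unfolding levy_Phi_def char_fun_jump_measure[OF big v0]
    using levy_Phi_integrable[OF levy_density_cut[OF n S], of \<xi>] ic i2 i3
    by (subst Bochner_Integration.integral_add)
       (auto simp: Bochner_Integration.integral_add Bochner_Integration.integral_diff simp del: of_real_mult)
  also have "(LINT y|lborel. ?v y * ((\<xi> \<bullet> y) * indicator (ball 0 1) y)) = \<xi> \<bullet> (b - b')"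
  proof -
    have "\<xi> \<bullet> (b - b') = (LINT y|lborel. \<xi> \<bullet> ((?v y * indicator (ball 0 1) y) *\<^sub>R y))"
      unfolding b'_def using i1 by (simp del: inner_scaleR_right)
    then show ?thesis by (simp add: mult_ac)
  qed
  finally show ?thesis unfolding levy_psi_def by (simp add: inner_diff_right algebra_simps)
qed

lemma psi_tilde_split:
  fixes n :: "'a::euclidean_space \<Rightarrow> real" and b :: 'a
  assumes n: "levy_density n" and S [measurable]: "S \<in> sets borel"
    and big: "integrable lborel (\<lambda>y. indicator (- S) y * n y)"
    and bige: "integrable lborel (\<lambda>y. indicator (- S) y * n y * exp (\<eta> \<bullet> y))"
    and small: "integrable lborel (\<lambda>y. indicator S y * n y * (1 - exp (\<eta> \<bullet> y) + (\<eta> \<bullet> y) * indicator (ball 0 1) y))"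
  defines "b' \<equiv> b - (LINT y|lborel. (indicator (- S) y * n y * indicator (ball 0 1) y) *\<^sub>R y)"
  shows "psi_tilde b A n \<eta> = psi_tilde b' A (\<lambda>y. indicator S y * n y) \<eta> +
     ((LINT y|lborel. indicator (- S) y * n y) - (LINT y|lborel. indicator (- S) y * n y * exp (\<eta> \<bullet> y)))"
proof -
  let ?v = "\<lambda>y. indicator (- S) y * n y"
  note [measurable] = levy_densityD(1)[OF n]
  have i1: "integrable lborel (\<lambda>y. (?v y * indicator (ball 0 1) y) *\<^sub>R y)"
    by (rule Bochner_Integration.integrable_bound[OF big])
       (auto simp: indicator_def dist_norm intro!: mult_left_le)
  have i3: "integrable lborel (\<lambda>y. ?v y * ((\<eta> \<bullet> y) * indicator (ball 0 1) y))"
  proof -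
    have "integrable lborel (\<lambda>y. \<eta> \<bullet> ((?v y * indicator (ball 0 1) y) *\<^sub>R y))"
      by (rule integrable_inner_right) (use i1 in simp)
    then show ?thesis by (simp only: inner_scaleR_right mult_ac)
  qed
  have "(LINT y|lborel. n y * (1 - exp (\<eta> \<bullet> y) + (\<eta> \<bullet> y) * indicator (ball 0 1) y)) =
     (LINT y|lborel. indicator S y * n y * (1 - exp (\<eta> \<bullet> y) + (\<eta> \<bullet> y) * indicator (ball 0 1) y) +
      (?v y - ?v y * exp (\<eta> \<bullet> y) + ?v y * ((\<eta> \<bullet> y) * indicator (ball 0 1) y)))"
    by (intro Bochner_Integration.integral_cong refl) (auto simp: indicator_def algebra_simps)
  also have "\<dots> = (LINT y|lborel. indicator S y * n y * (1 - exp (\<eta> \<bullet> y) + (\<eta> \<bullet> y) * indicator (ball 0 1) y)) +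
      ((LINT y|lborel. ?v y) - (LINT y|lborel. ?v y * exp (\<eta> \<bullet> y)) +
       (LINT y|lborel. ?v y * ((\<eta> \<bullet> y) * indicator (ball 0 1) y)))"
    using small big bige i3
    by (subst Bochner_Integration.integral_add)
       (auto simp: Bochner_Integration.integral_add Bochner_Integration.integral_diff)
  also have "(LINT y|lborel. ?v y * ((\<eta> \<bullet> y) * indicator (ball 0 1) y)) = \<eta> \<bullet> (b - b')"
  proof -
    have "\<eta> \<bullet> (b - b') = (LINT y|lborel. \<eta> \<bullet> ((?v y * indicator (ball 0 1) y) *\<^sub>R y))"
      unfolding b'_def using i1 by (simp del: inner_scaleR_right)
    then show ?thesis by (simp add: mult_ac)
  qed
  finally show ?thesis unfolding psi_tilde_def by (simp add: inner_diff_right algebra_simps)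
qed

text \<open>Induction on the rank, as in Lagrange's diagonalisation: subtracting the square of
  \<open>x \<bullet> A u\<close> divided by \<open>u \<bullet> A u\<close> puts \<open>u\<close>
  into the kernel. A Gaussian with form \<open>A\<close> can then be composed of one-dimensional
  ones.\<close>

lemma nonneg_form_sum_of_squares:
  fixes A :: "'a::euclidean_space \<Rightarrow> 'a"
  assumes "linear A" "\<And>x y. A x \<bullet> y = x \<bullet> A y" "\<And>x. 0 \<le> x \<bullet> A x"
  shows "\<exists>as. \<forall>x. x \<bullet> A x = (\<Sum>a\<leftarrow>as. (x \<bullet> a)\<^sup>2)"
  using assms
proof (induction "DIM('a) - dim {x. A x = 0}" arbitrary: A rule: less_induct)
  case less
  note lin = less.prems(1) and sym = less.prems(2) and nn = less.prems(3)
  interpret A: linear A by fact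
  show ?case
  proof (cases "\<forall>x. x \<bullet> A x = 0")
    case True
    then show ?thesis by (intro exI[of _ "[]"]) simp
  next
    case False
    then obtain u where "u \<bullet> A u \<noteq> 0" by auto
    with nn[of u] have u: "0 < u \<bullet> A u" by linarith
    define B where "B x = A x - ((x \<bullet> A u) / (u \<bullet> A u)) *\<^sub>R A u" for x
    have linB: "linear B" unfolding B_def
      by (intro linearI) (simp_all add: A.add A.scale inner_add_left add_divide_distrib algebra_simps)
    have symB: "B x \<bullet> y = x \<bullet> B y" for x y
      using sym[of x y] by (simp add: B_def inner_diff_left inner_diff_right inner_commute mult.commute)
    have Bq: "x \<bullet> B x = x \<bullet> A x - (x \<bullet> A u)\<^sup>2 / (u \<bullet> A u)" for x
      by (simp add: B_def inner_diff_right power2_eq_square)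
    have nnB: "0 \<le> x \<bullet> B x" for x
    proof -
      \<comment> \<open>This \<open>s\<close> minimises the form of \<open>A\<close> at
        \<open>x - s *\<^sub>R u\<close>, and the minimum is the form of \<open>B\<close> at
        \<open>x\<close>.\<close>
      define s where "s = (x \<bullet> A u) / (u \<bullet> A u)"
      have "0 \<le> (x - s *\<^sub>R u) \<bullet> A (x - s *\<^sub>R u)" by (rule nn)
      also have "\<dots> = x \<bullet> A x - 2 * s * (x \<bullet> A u) + s\<^sup>2 * (u \<bullet> A u)"
        using sym[of u x] by (simp add: A.diff A.scale inner_diff_left inner_diff_right algebra_simps power2_eq_square inner_commute)
      also have "\<dots> = x \<bullet> B x" using u by (simp add: Bq s_def field_simps power2_eq_square)
      finally show ?thesis .
    qed
    have "span {x. A x = 0} \<subset> span {x. B x = 0}"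
    proof -
      have s: "span {x. A x = 0} = {x. A x = 0}" "span {x. B x = 0} = {x. B x = 0}"
        using linear_subspace_kernel[OF lin] linear_subspace_kernel[OF linB] by (auto simp: span_eq_iff)
      have "{x. A x = 0} \<subseteq> {x. B x = 0}"
      proof
        fix x assume "x \<in> {x. A x = 0}"
        then have "A x = 0" by simp
        moreover have "x \<bullet> A u = 0" using sym[of x u] \<open>A x = 0\<close> by simp
        ultimately show "x \<in> {x. B x = 0}" by (simp add: B_def)
      qed
      moreover have "u \<in> {x. B x = 0}" "u \<notin> {x. A x = 0}" using u by (auto simp: B_def)
      ultimately show ?thesis unfolding s by blast
    qed
    then have "dim {x. A x = 0} < dim {x. B x = 0}" by (rule dim_psubset)
    moreover have "dim {x. B x = 0} \<le> DIM('a)" by (rule dim_subset_UNIV)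
    ultimately have "DIM('a) - dim {x. B x = 0} < DIM('a) - dim {x. A x = 0}" by linarith
    from less.hyps[OF this linB symB nnB] obtain as where as: "\<And>x. x \<bullet> B x = (\<Sum>a\<leftarrow>as. (x \<bullet> a)\<^sup>2)" by blast
    have "x \<bullet> A x = (\<Sum>a\<leftarrow>((1 / sqrt (u \<bullet> A u)) *\<^sub>R A u) # as. (x \<bullet> a)\<^sup>2)" for x
      using u as[of x] Bq[of x] by (simp add: power_divide)
    then show ?thesis by blast
  qed
qed

text \<open>Convolution with the Dirac mass at \<open>c\<close>.\<close>

lemma mgf_kernel_shift:
  fixes \<phi> :: "'a::euclidean_space \<Rightarrow> complex"
  assumes g: "mgf_kernel \<phi> L"
  shows "mgf_kernel (\<lambda>\<xi>. \<phi> \<xi> * cis (\<xi> \<bullet> c)) (\<lambda>\<eta>. L \<eta> * exp (\<eta> \<bullet> c))"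
proof -
  interpret R: prob_space "return borel c" by (rule prob_space_return) simp
  have c: "char_fun (return borel c) \<xi> = cis (\<xi> \<bullet> c)" for \<xi>
    unfolding char_fun_def by (subst integral_return) auto
  have "mgf_kernel (\<lambda>\<xi>. \<phi> \<xi> * char_fun (return borel c) \<xi>) (\<lambda>\<eta>. L \<eta> * exp (\<eta> \<bullet> c))"
    by (rule mgf_kernel_convolution[OF g R.finite_measure_axioms]) (auto simp: nn_integral_return)
  then show ?thesis by (simp add: c)
qed

text \<open>Convolution with a standard normal law carried by the line through \<open>c\<close>; the
  smoothness of the result is inherited from \<open>\<phi>\<close>.\<close>

lemma mgf_kernel_rank_one_gaussian:
  fixes \<phi> :: "'a::euclidean_space \<Rightarrow> complex"
  assumes g: "mgf_kernel \<phi> L"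
  shows "mgf_kernel (\<lambda>\<xi>. \<phi> \<xi> * complex_of_real (exp (- (\<xi> \<bullet> c)\<^sup>2 / 2))) (\<lambda>\<eta>. L \<eta> * exp ((\<eta> \<bullet> c)\<^sup>2 / 2))"
proof -
  interpret N: prob_space std_normal_distribution by (rule prob_space_normal_density) simp
  let ?M = "distr std_normal_distribution borel (\<lambda>s. s *\<^sub>R c)"
  interpret M: prob_space ?M by (rule N.prob_space_distr) simp
  have c: "char_fun ?M \<xi> = complex_of_real (exp (- (\<xi> \<bullet> c)\<^sup>2 / 2))" for \<xi>
  proof -
    have "char_fun ?M \<xi> = (CLINT s|std_normal_distribution. iexp ((\<xi> \<bullet> c) * s))"
      unfolding char_fun_def by (subst integral_distr) (auto simp: cis_conv_exp mult_ac)
    also have "\<dots> = complex_of_real (exp (- (\<xi> \<bullet> c)\<^sup>2 / 2))"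
      using fun_cong[OF char_std_normal_distribution, of "\<xi> \<bullet> c"] by (simp only: char_def)
    finally show ?thesis .
  qed
  have m: "(\<integral>\<^sup>+y. ennreal (exp (\<eta> \<bullet> y)) \<partial>?M) = ennreal (exp ((\<eta> \<bullet> c)\<^sup>2 / 2))" for \<eta>
  proof -
    have "(\<integral>\<^sup>+y. ennreal (exp (\<eta> \<bullet> y)) \<partial>?M) = (\<integral>\<^sup>+s. ennreal (exp ((\<eta> \<bullet> c) * s)) \<partial>std_normal_distribution)"
      by (subst nn_integral_distr) (auto simp: mult_ac)
    also have "\<dots> = (\<integral>\<^sup>+s. ennreal (exp ((\<eta> \<bullet> c) * s) * normal_density 0 1 s) \<partial>lborel)"
      by (subst nn_integral_density) (auto simp: ennreal_mult[symmetric] mult.commute)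
    also have "\<dots> = ennreal (exp ((\<eta> \<bullet> c)\<^sup>2 / 2))" using nn_integral_exp_normal_density[of 1 "\<eta> \<bullet> c"] by simp
    finally show ?thesis .
  qed
  have "mgf_kernel (\<lambda>\<xi>. \<phi> \<xi> * char_fun ?M \<xi>) (\<lambda>\<eta>. L \<eta> * exp ((\<eta> \<bullet> c)\<^sup>2 / 2))"
    by (rule mgf_kernel_convolution[OF g M.finite_measure_axioms]) (auto simp: m)
  then show ?thesis by (simp add: c)
qed

lemma mgf_kernel_gaussian_form:
  fixes \<phi> :: "'a::euclidean_space \<Rightarrow> complex"
  assumes g: "mgf_kernel \<phi> L" and t: "0 \<le> t"
    and A: "linear A" "\<And>x y. A x \<bullet> y = x \<bullet> A y" "\<And>x. 0 \<le> x \<bullet> A x"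
  shows "mgf_kernel (\<lambda>\<xi>. \<phi> \<xi> * complex_of_real (exp (- t * (\<xi> \<bullet> A \<xi>)))) (\<lambda>\<eta>. L \<eta> * exp (t * (\<eta> \<bullet> A \<eta>)))"
proof -
  obtain as where as: "\<And>x. x \<bullet> A x = (\<Sum>a\<leftarrow>as. (x \<bullet> a)\<^sup>2)"
    using nonneg_form_sum_of_squares[OF A] by blast
  have "mgf_kernel (\<lambda>\<xi>. \<phi> \<xi> * complex_of_real (exp (- t * (\<Sum>a\<leftarrow>as. (\<xi> \<bullet> a)\<^sup>2))))
      (\<lambda>\<eta>. L \<eta> * exp (t * (\<Sum>a\<leftarrow>as. (\<eta> \<bullet> a)\<^sup>2)))"
  proof (induction as)
    case (Cons a as)
    \<comment> \<open>The exponent is \<open>t * (\<xi> \<bullet> A \<xi>)\<close> without the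
      factor 1/2, hence the scaling by \<open>sqrt (2 * t)\<close>.\<close>
    have sq: "(\<xi> \<bullet> (sqrt (2 * t) *\<^sub>R a))\<^sup>2 / 2 = t * (\<xi> \<bullet> a)\<^sup>2" for \<xi>
      using t by (simp add: power_mult_distrib)
    have "mgf_kernel (\<lambda>\<xi>. \<phi> \<xi> * complex_of_real (exp (- t * (\<Sum>a\<leftarrow>as. (\<xi> \<bullet> a)\<^sup>2))) * complex_of_real (exp (- (t * (\<xi> \<bullet> a)\<^sup>2))))
      (\<lambda>\<eta>. L \<eta> * exp (t * (\<Sum>a\<leftarrow>as. (\<eta> \<bullet> a)\<^sup>2)) * exp (t * (\<eta> \<bullet> a)\<^sup>2))"
      using mgf_kernel_rank_one_gaussian[OF Cons, of "sqrt (2 * t) *\<^sub>R a"] by (simp only: sq minus_divide_left[symmetric])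
    moreover have "(\<lambda>\<xi>. \<phi> \<xi> * complex_of_real (exp (- t * (\<Sum>a\<leftarrow>as. (\<xi> \<bullet> a)\<^sup>2))) * complex_of_real (exp (- (t * (\<xi> \<bullet> a)\<^sup>2)))) =
      (\<lambda>\<xi>. \<phi> \<xi> * complex_of_real (exp (- t * (\<Sum>a\<leftarrow>(a#as). (\<xi> \<bullet> a)\<^sup>2))))"
      by (simp add: fun_eq_iff distrib_left exp_add[symmetric] mult.assoc flip: of_real_mult)
    moreover have "(\<lambda>\<eta>. L \<eta> * exp (t * (\<Sum>a\<leftarrow>as. (\<eta> \<bullet> a)\<^sup>2)) * exp (t * (\<eta> \<bullet> a)\<^sup>2)) =
      (\<lambda>\<eta>. L \<eta> * exp (t * (\<Sum>a\<leftarrow>(a#as). (\<eta> \<bullet> a)\<^sup>2)))"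
      by (simp add: fun_eq_iff distrib_left exp_add mult_ac)
    ultimately show ?case by simp
  qed (use g in simp)
  then show ?thesis by (simp only: as)
qed

lemma levy_psi_zero: "levy_psi b A (\<lambda>y. 0) \<xi> = - \<i> * complex_of_real (\<xi> \<bullet> b) + complex_of_real (\<xi> \<bullet> A \<xi>)"
  by (simp add: levy_psi_def levy_Phi_def)

lemma psi_tilde_zero: "psi_tilde b A (\<lambda>y. 0) \<eta> = - (\<eta> \<bullet> b) - \<eta> \<bullet> A \<eta>"
  by (simp add: psi_tilde_def)

lemma levy_psi_measurable:
  assumes "linear A" "n \<in> borel_measurable borel"
  shows "levy_psi b A n \<in> borel_measurable borel"
proof -
  have "continuous_on UNIV A" using assms(1) by (rule linear_continuous_on_compose[OF continuous_on_id, unfolded id_def comp_def])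
  then have [measurable]: "A \<in> borel_measurable borel" by (rule borel_measurable_continuous_onI)
  note [measurable] = levy_Phi_measurable[OF assms(2)]
  show ?thesis unfolding levy_psi_def[abs_def] by measurable
qed

section \<open>Moment generating functions for Levy exponents with bounded jumps\<close>

context
  fixes b :: "'a::euclidean_space" and A :: "'a \<Rightarrow> 'a" and t :: real
  assumes t: "0 \<le> t" and A: "linear A" "\<And>x y. A x \<bullet> y = x \<bullet> A y" "\<And>x. 0 \<le> x \<bullet> A x"
begin

text \<open>With finite jump mass the exponent consists of a drift, a Gaussian form and a compound
  Poisson part. None of them has to decay in frequency, so a kernel \<open>\<gamma>\<close> is
  carried along to supply integrability.\<close>

lemma mgf_kernel_levy_finite:
  fixes v :: "'a \<Rightarrow> real"
  assumes v: "levy_density v" and fin: "integrable lborel v" and supp: "\<And>y. \<rho> < norm y \<Longrightarrow> v y = 0"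
    and g: "mgf_kernel \<gamma> L"
  shows "mgf_kernel (\<lambda>\<xi>. \<gamma> \<xi> * exp (- complex_of_real t * levy_psi b A v \<xi>)) (\<lambda>\<eta>. L \<eta> * exp (- t * psi_tilde b A v \<eta>))"
proof -
  note [measurable] = levy_densityD(1)[OF v]
  note v0 = levy_densityD(2)[OF v]
  \<comment> \<open>The split is taken at \<open>S = {}\<close>, which puts every jump into the
    compound Poisson part.\<close>
  define b' where "b' = b - (LINT y|lborel. (indicator (- {}) y * v y * indicator (ball 0 1) y) *\<^sub>R y)"
  define lam where "lam = (LINT y|lborel. v y)"
  define m where "m \<eta> = (LINT y|lborel. v y * exp (\<eta> \<bullet> y))" for \<eta>
  have ie: "integrable lborel (\<lambda>y. v y * exp (\<eta> \<bullet> y))" for \<eta>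
  proof (rule Bochner_Integration.integrable_bound)
    show "integrable lborel (\<lambda>y. v y * exp (norm \<eta> * \<rho>))" using fin by simp
    show "AE y in lborel. norm (v y * exp (\<eta> \<bullet> y)) \<le> norm (v y * exp (norm \<eta> * \<rho>))"
    proof (rule AE_I2)
      fix y show "norm (v y * exp (\<eta> \<bullet> y)) \<le> norm (v y * exp (norm \<eta> * \<rho>))"
        using supp[of y] abs_inner_le_mult[of y \<rho> \<eta>] v0[of y]
        by (cases "norm y \<le> \<rho>") (auto simp: abs_mult intro!: mult_left_mono)
    qed
  qed measurable
  have psi: "levy_psi b A v \<xi> = - \<i> * complex_of_real (\<xi> \<bullet> b') + complex_of_real (\<xi> \<bullet> A \<xi>) +
     (complex_of_real lam - char_fun (jump_measure v) \<xi>)" for \<xi>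
    using levy_psi_split[OF v, of "{}" b A \<xi>] fin by (simp add: levy_psi_zero lam_def b'_def)
  have psit: "psi_tilde b A v \<eta> = - (\<eta> \<bullet> b') - \<eta> \<bullet> A \<eta> + (lam - m \<eta>)" for \<eta>
    using psi_tilde_split[OF v, of "{}" \<eta> b A] fin ie by (simp add: psi_tilde_zero lam_def m_def b'_def)
  note fm = finite_measure_jump_measure[OF fin v0]
  have m0: "0 \<le> m \<eta>" for \<eta> unfolding m_def using v0 by (intro integral_nonneg_AE) auto
  have me: "(\<integral>\<^sup>+y. ennreal (exp (\<eta> \<bullet> y)) \<partial>jump_measure v) = ennreal (m \<eta>)" for \<eta>
  proof -
    have "(\<integral>\<^sup>+y. ennreal (exp (\<eta> \<bullet> y)) \<partial>jump_measure v) = (\<integral>\<^sup>+y. ennreal (v y * exp (\<eta> \<bullet> y)) \<partial>lborel)"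
      using v0 by (subst nn_integral_jump_measure[OF fin v0]) (auto simp: ennreal_mult)
    also have "\<dots> = ennreal (m \<eta>)" unfolding m_def using v0 by (intro nn_integral_eq_integral ie) auto
    finally show ?thesis .
  qed
  have "mgf_kernel (\<lambda>\<xi>. complex_of_real (exp (- t * lam)) * (\<gamma> \<xi> * cis (\<xi> \<bullet> (t *\<^sub>R b')) * complex_of_real (exp (- t * (\<xi> \<bullet> A \<xi>))) *
     exp (complex_of_real t * char_fun (jump_measure v) \<xi>)))
     (\<lambda>\<eta>. exp (- t * lam) * (L \<eta> * exp (\<eta> \<bullet> (t *\<^sub>R b')) * exp (t * (\<eta> \<bullet> A \<eta>)) * exp (t * m \<eta>)))"
    by (intro mgf_kernel_scale mgf_kernel_compound_poisson[OF _ fm sets_jump_measure m0 me t] mgf_kernel_gaussian_form[OF _ t A] mgf_kernel_shift g) auto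
  moreover have "complex_of_real (exp (- t * lam)) * (\<gamma> \<xi> * cis (\<xi> \<bullet> (t *\<^sub>R b')) * complex_of_real (exp (- t * (\<xi> \<bullet> A \<xi>))) *
     exp (complex_of_real t * char_fun (jump_measure v) \<xi>)) = \<gamma> \<xi> * exp (- complex_of_real t * levy_psi b A v \<xi>)" for \<xi>
  proof -
    have "- complex_of_real t * levy_psi b A v \<xi> = complex_of_real (- t * lam) + \<i> * complex_of_real (\<xi> \<bullet> (t *\<^sub>R b')) +
      complex_of_real (- t * (\<xi> \<bullet> A \<xi>)) + complex_of_real t * char_fun (jump_measure v) \<xi>"
      by (simp add: psi algebra_simps)
    then show ?thesis by (simp only: exp_add exp_of_real cis_conv_exp mult_ac)
  qed
  moreover have "exp (- t * lam) * (L \<eta> * exp (\<eta> \<bullet> (t *\<^sub>R b')) * exp (t * (\<eta> \<bullet> A \<eta>)) * exp (t * m \<eta>)) =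
    L \<eta> * exp (- t * psi_tilde b A v \<eta>)" for \<eta>
  proof -
    have "- t * psi_tilde b A v \<eta> = - t * lam + \<eta> \<bullet> (t *\<^sub>R b') + t * (\<eta> \<bullet> A \<eta>) + t * m \<eta>"
      by (simp add: psit algebra_simps)
    then show ?thesis by (simp only: exp_add mult_ac)
  qed
  ultimately show ?thesis by (simp only:)
qed

text \<open>Two limits in turn. With a Gaussian factor fixed, the jumps smaller than
  \<open>1 / Suc j\<close> are restored; then the Gaussian is removed, with the modulus of the
  exponential itself as majorant. Bounded jump size makes the real exponents converge at every
  \<open>\<eta>\<close>.\<close>

lemma mgf_kernel_levy:
  fixes n :: "'a \<Rightarrow> real"
  assumes n: "levy_density n" and supp: "\<And>y. \<rho> < norm y \<Longrightarrow> n y = 0"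
    and int: "integrable lborel (\<lambda>\<xi>. exp (- complex_of_real t * levy_psi b A n \<xi>))"
  shows "mgf_kernel (\<lambda>\<xi>. exp (- complex_of_real t * levy_psi b A n \<xi>)) (\<lambda>\<eta>. exp (- t * psi_tilde b A n \<eta>))"
proof -
  note [measurable] = levy_densityD(1)[OF n]
  note n0 = levy_densityD(2)[OF n]
  have [measurable]: "levy_psi b A n \<in> borel_measurable borel" by (rule levy_psi_measurable[OF A(1)]) measurable
  define \<gamma> where "\<gamma> k \<xi> = complex_of_real (exp (- ((1 / Suc k) * norm \<xi>)\<^sup>2 / 2))" for k and \<xi> :: 'a
  have g: "mgf_kernel (\<gamma> k) (\<lambda>\<eta>. exp (((1 / Suc k) * norm \<eta>)\<^sup>2 / 2))" for k
    unfolding \<gamma>_def by (rule mgf_kernel_gaussian) simp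
  have \<gamma>1: "norm (\<gamma> k \<xi>) \<le> 1" for k \<xi> by (simp add: \<gamma>_def)
  have [measurable]: "\<gamma> k \<in> borel_measurable borel" for k using mgf_kernelD(1)[OF g[of k]] by auto
  have ple1: "norm (exp (- complex_of_real t * levy_psi b A n' \<xi>)) \<le> 1" if "levy_density n'" for n' \<xi>
    unfolding norm_exp_levy_psi using t A(3)[of \<xi>] Re_levy_Phi_nonneg[OF that, of \<xi>] by simp
  let ?S = "\<lambda>j::nat. - cball (0::'a) (1 / Suc j)"
  define v where "v j y = indicator (?S j) y * n y" for j y
  have vl: "levy_density (v j)" for j unfolding v_def by (rule levy_density_cut[OF n]) auto
  have vfin: "integrable lborel (v j)" for j
  proof (rule Bochner_Integration.integrable_bound)
    show "integrable lborel (\<lambda>y. (Suc j)\<^sup>2 * (min 1 ((norm y)\<^sup>2) * n y))" using levy_densityD(3)[OF n] by simp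
    show "v j \<in> borel_measurable lborel" using levy_densityD(1)[OF vl[of j]] by simp
    show "AE y in lborel. norm (v j y) \<le> norm ((Suc j)\<^sup>2 * (min 1 ((norm y)\<^sup>2) * n y))"
    proof (rule AE_I2)
      fix y
      show "norm (v j y) \<le> norm ((Suc j)\<^sup>2 * (min 1 ((norm y)\<^sup>2) * n y))"
      proof (cases "1 / Suc j < norm y")
        case True
        have "(1 / Suc j)\<^sup>2 \<le> min 1 ((norm y)\<^sup>2)"
          using True by (auto intro!: power_le_one power_mono simp del: of_nat_Suc)
        then have "(Suc j)\<^sup>2 * (1 / Suc j)\<^sup>2 \<le> (Suc j)\<^sup>2 * min 1 ((norm y)\<^sup>2)"
          by (intro mult_left_mono) auto
        then have "1 \<le> (Suc j)\<^sup>2 * min 1 ((norm y)\<^sup>2)"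
          by (simp add: power_divide del: of_nat_Suc)
        then have "1 * n y \<le> (Suc j)\<^sup>2 * min 1 ((norm y)\<^sup>2) * n y" by (intro mult_right_mono n0)
        then show ?thesis using n0[of y] True by (simp add: v_def mult.assoc abs_mult)
      qed (simp add: v_def)
    qed
  qed
  have vsupp: "\<rho> < norm y \<Longrightarrow> v j y = 0" for j y by (simp add: v_def supp)
  have vlim: "(\<lambda>j. v j y) \<longlonglongrightarrow> n y" if "y \<noteq> 0" for y
  proof (rule tendsto_eventually)
    have "\<forall>\<^sub>F j in sequentially. inverse (real (Suc j)) < norm y"
      using order_tendstoD(2)[OF LIMSEQ_inverse_real_of_nat, of "norm y"] that by simp
    then show "\<forall>\<^sub>F j in sequentially. v j y = n y"
      by (rule eventually_mono) (simp add: v_def inverse_eq_divide)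
  qed
  have vn: "v j y \<le> n y" "0 \<le> v j y" for j y using n0[of y] by (auto simp: v_def indicator_def)
  have step1: "mgf_kernel (\<lambda>\<xi>. \<gamma> k \<xi> * exp (- complex_of_real t * levy_psi b A n \<xi>))
      (\<lambda>\<eta>. exp (((1 / Suc k) * norm \<eta>)\<^sup>2 / 2) * exp (- t * psi_tilde b A n \<eta>))" for k
  proof (rule mgf_kernel_tendsto[where w="\<lambda>\<xi>. norm (\<gamma> k \<xi>)", OF mgf_kernel_levy_finite[OF vl vfin vsupp g]])
    show "(\<lambda>\<xi>. \<gamma> k \<xi> * exp (- complex_of_real t * levy_psi b A n \<xi>)) \<in> borel_measurable lborel" by measurable
    show "norm (\<gamma> k \<xi> * exp (- complex_of_real t * levy_psi b A (v j) \<xi>)) \<le> norm (\<gamma> k \<xi>)" for j \<xi>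
      using mult_left_mono[OF ple1[OF vl[of j], of \<xi>], of "norm (\<gamma> k \<xi>)"] by (simp add: norm_mult)
    show "integrable lborel (\<lambda>\<xi>. norm (\<gamma> k \<xi>))" using mgf_kernelD(1)[OF g[of k]] by simp
    fix \<xi> :: 'a
    have "(\<lambda>j. levy_Phi (v j) \<xi>) \<longlonglongrightarrow> levy_Phi n \<xi>"
      unfolding levy_Phi_def
    proof (rule integral_dominated_convergence[where w="\<lambda>y. (2 + (norm \<xi>)\<^sup>2) * (min 1 ((norm y)\<^sup>2) * n y)"])
      show "(\<lambda>y. complex_of_real (n y) * (1 - cis (\<xi> \<bullet> y) + \<i> * complex_of_real (\<xi> \<bullet> y * indicat_real (ball 0 1) y))) \<in> borel_measurable lborel"
        using levy_Phi_integrable[OF n, of \<xi>] by auto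
      show "(\<lambda>y. complex_of_real (v j y) * (1 - cis (\<xi> \<bullet> y) + \<i> * complex_of_real (\<xi> \<bullet> y * indicat_real (ball 0 1) y))) \<in> borel_measurable lborel" for j
        using levy_Phi_integrable[OF vl[of j], of \<xi>] by auto
      show "integrable lborel (\<lambda>y. (2 + (norm \<xi>)\<^sup>2) * (min 1 ((norm y)\<^sup>2) * n y))" using levy_densityD(3)[OF n] by simp
      show "AE y in lborel. (\<lambda>j. complex_of_real (v j y) * (1 - cis (\<xi> \<bullet> y) + \<i> * complex_of_real (\<xi> \<bullet> y * indicat_real (ball 0 1) y)))
          \<longlonglongrightarrow> complex_of_real (n y) * (1 - cis (\<xi> \<bullet> y) + \<i> * complex_of_real (\<xi> \<bullet> y * indicat_real (ball 0 1) y))"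
      proof (rule AE_I2)
        fix y show "(\<lambda>j. complex_of_real (v j y) * (1 - cis (\<xi> \<bullet> y) + \<i> * complex_of_real (\<xi> \<bullet> y * indicat_real (ball 0 1) y)))
          \<longlonglongrightarrow> complex_of_real (n y) * (1 - cis (\<xi> \<bullet> y) + \<i> * complex_of_real (\<xi> \<bullet> y * indicat_real (ball 0 1) y))"
          using vlim[of y] by (cases "y = 0") (auto intro!: tendsto_mult tendsto_of_real)
      qed
      show "AE y in lborel. norm (complex_of_real (v j y) * (1 - cis (\<xi> \<bullet> y) + \<i> * complex_of_real (\<xi> \<bullet> y * indicat_real (ball 0 1) y)))
        \<le> (2 + (norm \<xi>)\<^sup>2) * (min 1 ((norm y)\<^sup>2) * n y)" for j
      proof (rule AE_I2)
        fix y
        have "norm (complex_of_real (v j y) * (1 - cis (\<xi> \<bullet> y) + \<i> * complex_of_real (\<xi> \<bullet> y * indicat_real (ball 0 1) y)))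
          \<le> n y * ((2 + (norm \<xi>)\<^sup>2) * min 1 ((norm y)\<^sup>2))"
          unfolding norm_mult norm_of_real using vn[of j y] by (intro mult_mono levy_Phi_integrand_bound) auto
        then show "norm (complex_of_real (v j y) * (1 - cis (\<xi> \<bullet> y) + \<i> * complex_of_real (\<xi> \<bullet> y * indicat_real (ball 0 1) y)))
          \<le> (2 + (norm \<xi>)\<^sup>2) * (min 1 ((norm y)\<^sup>2) * n y)" by (simp only: mult_ac)
      qed
    qed
    then show "(\<lambda>j. \<gamma> k \<xi> * exp (- complex_of_real t * levy_psi b A (v j) \<xi>)) \<longlonglongrightarrow> \<gamma> k \<xi> * exp (- complex_of_real t * levy_psi b A n \<xi>)"
      unfolding levy_psi_def by (intro tendsto_intros)
  next
    fix \<eta> :: 'a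
    let ?C = "(1 + (norm \<eta>)\<^sup>2) * exp (norm \<eta> * \<rho>)"
    have "(\<lambda>j. LINT y|lborel. v j y * (1 - exp (\<eta> \<bullet> y) + (\<eta> \<bullet> y) * indicator (ball 0 1) y))
        \<longlonglongrightarrow> (LINT y|lborel. n y * (1 - exp (\<eta> \<bullet> y) + (\<eta> \<bullet> y) * indicator (ball 0 1) y))"
    proof (rule integral_dominated_convergence[where w="\<lambda>y. ?C * (min 1 ((norm y)\<^sup>2) * n y)"])
      show "(\<lambda>y. n y * (1 - exp (\<eta> \<bullet> y) + (\<eta> \<bullet> y) * indicator (ball 0 1) y)) \<in> borel_measurable lborel"
        by measurable
      show "(\<lambda>y. v j y * (1 - exp (\<eta> \<bullet> y) + (\<eta> \<bullet> y) * indicator (ball 0 1) y)) \<in> borel_measurable lborel" for j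
        using psi_tilde_integrable[OF vl[of j] vsupp] by auto
      show "integrable lborel (\<lambda>y. ?C * (min 1 ((norm y)\<^sup>2) * n y))" by (intro integrable_mult_right levy_densityD(3) n)
      show "AE y in lborel. (\<lambda>j. v j y * (1 - exp (\<eta> \<bullet> y) + (\<eta> \<bullet> y) * indicator (ball 0 1) y))
         \<longlonglongrightarrow> n y * (1 - exp (\<eta> \<bullet> y) + (\<eta> \<bullet> y) * indicator (ball 0 1) y)"
      proof (rule AE_I2)
        fix y show "(\<lambda>j. v j y * (1 - exp (\<eta> \<bullet> y) + (\<eta> \<bullet> y) * indicator (ball 0 1) y))
         \<longlonglongrightarrow> n y * (1 - exp (\<eta> \<bullet> y) + (\<eta> \<bullet> y) * indicator (ball 0 1) y)"
          using vlim[of y] by (cases "y = 0") (auto intro!: tendsto_mult)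
      qed
      show "AE y in lborel. norm (v j y * (1 - exp (\<eta> \<bullet> y) + (\<eta> \<bullet> y) * indicator (ball 0 1) y))
         \<le> ?C * (min 1 ((norm y)\<^sup>2) * n y)" for j
      proof (rule AE_I2)
        fix y
        show "norm (v j y * (1 - exp (\<eta> \<bullet> y) + (\<eta> \<bullet> y) * indicator (ball 0 1) y)) \<le> ?C * (min 1 ((norm y)\<^sup>2) * n y)"
        proof (cases "norm y \<le> \<rho>")
          case True
          have "norm (v j y * (1 - exp (\<eta> \<bullet> y) + (\<eta> \<bullet> y) * indicator (ball 0 1) y)) \<le> n y * (?C * min 1 ((norm y)\<^sup>2))"
            unfolding norm_mult real_norm_def[of "_ + _"] using vn[of j y]
            by (intro mult_mono psi_tilde_integrand_bound True) auto
          then show ?thesis by (simp only: mult_ac)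
        qed (use vsupp[of y j] supp[of y] in auto)
      qed
    qed
    then show "(\<lambda>j. exp (((1 / Suc k) * norm \<eta>)\<^sup>2 / 2) * exp (- t * psi_tilde b A (v j) \<eta>))
        \<longlonglongrightarrow> exp (((1 / Suc k) * norm \<eta>)\<^sup>2 / 2) * exp (- t * psi_tilde b A n \<eta>)"
      unfolding psi_tilde_def by (intro tendsto_intros)
  qed
  have r: "(\<lambda>k. ((1 / Suc k) * norm \<xi>)\<^sup>2 / 2) \<longlonglongrightarrow> 0" for \<xi> :: 'a
  proof -
    have "(\<lambda>k. ((1 / Suc k) * norm \<xi>)\<^sup>2 / 2) \<longlonglongrightarrow> (0 * norm \<xi>)\<^sup>2 / 2"
      by (intro tendsto_intros) (simp_all, real_asymp)
    then show ?thesis by simp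
  qed
  show ?thesis
  proof (rule mgf_kernel_tendsto[where w="\<lambda>\<xi>. norm (exp (- complex_of_real t * levy_psi b A n \<xi>))", OF step1])
    show "(\<lambda>\<xi>. exp (- complex_of_real t * levy_psi b A n \<xi>)) \<in> borel_measurable lborel" by measurable
    show "norm (\<gamma> k \<xi> * exp (- complex_of_real t * levy_psi b A n \<xi>)) \<le> norm (exp (- complex_of_real t * levy_psi b A n \<xi>))" for k \<xi>
      using mult_right_mono[OF \<gamma>1[of k \<xi>], of "norm (exp (- complex_of_real t * levy_psi b A n \<xi>))"] by (simp only: norm_mult mult_1 norm_ge_zero)
    show "integrable lborel (\<lambda>\<xi>. norm (exp (- complex_of_real t * levy_psi b A n \<xi>)))" using int by (rule integrable_norm)
    fix \<xi> :: 'a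
    have "(\<lambda>k. exp (- (((1 / Suc k) * norm \<xi>)\<^sup>2 / 2))) \<longlonglongrightarrow> exp (- 0)" by (intro tendsto_intros r)
    then have "(\<lambda>k. \<gamma> k \<xi>) \<longlonglongrightarrow> complex_of_real 1" unfolding \<gamma>_def by (intro tendsto_of_real) simp
    then have "(\<lambda>k. \<gamma> k \<xi> * exp (- complex_of_real t * levy_psi b A n \<xi>)) \<longlonglongrightarrow> complex_of_real 1 * exp (- complex_of_real t * levy_psi b A n \<xi>)"
      by (rule tendsto_mult) (rule tendsto_const)
    then show "(\<lambda>k. \<gamma> k \<xi> * exp (- complex_of_real t * levy_psi b A n \<xi>)) \<longlonglongrightarrow> exp (- complex_of_real t * levy_psi b A n \<xi>)"
      by (simp only: of_real_1 mult_1)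
  next
    fix \<eta> :: 'a
    have "(\<lambda>k. exp (((1 / Suc k) * norm \<eta>)\<^sup>2 / 2) * exp (- t * psi_tilde b A n \<eta>)) \<longlonglongrightarrow> exp 0 * exp (- t * psi_tilde b A n \<eta>)"
      by (intro tendsto_intros r)
    then show "(\<lambda>k. exp (((1 / Suc k) * norm \<eta>)\<^sup>2 / 2) * exp (- t * psi_tilde b A n \<eta>)) \<longlonglongrightarrow> exp (- t * psi_tilde b A n \<eta>)"
      by simp
  qed
qed

end

section \<open>The majorant of the jump density\<close>

lemma ennreal_le_of_divide_le:
  assumes "a / ennreal c \<le> ennreal k" "0 < c" "0 \<le> k"
  shows "a \<le> ennreal (k * c)"
proof -
  have "a = a / ennreal c * ennreal c"
    using assms(2) by (simp add: ennreal_divide_times ennreal_times_divide[symmetric] ennreal_divide_self)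
  also have "\<dots> \<le> ennreal k * ennreal c" using assms(1) by (rule mult_right_mono) simp
  finally show ?thesis using assms by (simp add: ennreal_mult)
qed

locale jump_kernel =
  fixes nu :: "'a::euclidean_space \<Rightarrow> real" and f :: "real \<Rightarrow> real" and C0 :: real
  assumes nu: "levy_density nu"
    and f_pos: "\<And>r. 0 < r \<Longrightarrow> 0 < f r"
    and f_noninc: "\<And>r s. 0 < r \<Longrightarrow> r \<le> s \<Longrightarrow> f s \<le> f r"
    and C0_pos: "C0 > 0"
    and nu_le_f: "\<And>x. x \<noteq> 0 \<Longrightarrow> nu x \<le> C0 * f (norm x)"
    and nu_small: "Liminf (at_right 0)
          (\<lambda>r. ereal (measure (density lborel (\<lambda>x. ennreal (nu x))) {x. r < norm x}
                       / (f r * r ^ DIM('a)))) > 0"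
    and K_lim: "(levy_K TYPE('a) f \<longlongrightarrow> 0) at_top"
begin

lemmas nu_meas [measurable] = levy_densityD(1)[OF nu]
lemmas nu_nonneg = levy_densityD(2)[OF nu]

text \<open>\<open>levy_K\<close> compares only at points of norm above 1, and \<open>f\<close> may
  blow up at 0. Freezing \<open>f\<close> at radius 1 gives a majorant bounded by \<open>f 1\<close>
  on the whole space.\<close>

definition F :: "'a \<Rightarrow> real" where
  "F x = f (max 1 (norm x))"

definition nubar :: "real \<Rightarrow> 'a \<Rightarrow> real" where
  "nubar R y = indicator (- cball 0 R) y * nu y"

text \<open>\<open>enn2real\<close> sends infinity to 0, so this is meaningful only where
  \<open>levy_K\<close> is finite; hence that hypothesis in the bounds below.\<close>

definition kk :: "real \<Rightarrow> real" where
  "kk R = enn2real (levy_K TYPE('a) f R)"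

lemma F_pos: "0 < F x"
  unfolding F_def by (rule f_pos) simp

lemma F_nonneg: "0 \<le> F x"
  using F_pos[of x] by simp

lemma F_measurable [measurable]: "F \<in> borel_measurable borel"
proof -
  have "mono (\<lambda>u. - f (max 1 u))" by (intro monoI) (auto intro!: f_noninc)
  then have "(\<lambda>u. - (- f (max 1 u))) \<in> borel_measurable borel"
    by (intro borel_measurable_uminus borel_measurable_mono)
  then have [measurable]: "(\<lambda>u. f (max 1 u)) \<in> borel_measurable borel" by simp
  have "(\<lambda>x::'a. (\<lambda>u. f (max 1 u)) (norm x)) \<in> borel_measurable borel" by measurable
  then show ?thesis by (simp add: F_def[abs_def])
qed

lemma nubar_measurable [measurable]: "nubar R \<in> borel_measurable borel"
  unfolding nubar_def[abs_def] by measurable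

lemma nubar_nonneg: "0 \<le> nubar R y"
  using nu_nonneg by (simp add: nubar_def indicator_def)

lemma nubar_le_F: "1 \<le> R \<Longrightarrow> nubar R y \<le> C0 * F y"
  using nu_le_f[of y] F_nonneg[of y] C0_pos
  by (cases "y = 0") (auto simp: nubar_def indicator_def F_def max_def not_le)

lemma integrable_nubar:
  assumes "0 < R" shows "integrable lborel (nubar R)"
proof -
  let ?g = "indicator (- cball (0::'a) R) :: 'a \<Rightarrow> real"
  have "integrable lborel (\<lambda>y. nu y *\<^sub>R ?g y)"
  proof (rule levy_density_bounded_integrable[OF nu, where C="1 + 1 / R\<^sup>2"])
    fix y :: 'a
    have "R\<^sup>2 \<le> (norm y)\<^sup>2" if "R < norm y" using that assms by (intro power_mono) auto
    then show "norm (?g y) \<le> (1 + 1 / R\<^sup>2) * min 1 ((norm y)\<^sup>2)"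
      using assms by (auto simp: indicator_def min_def field_simps add_increasing2 not_le)
  qed measurable
  then show ?thesis by (simp add: nubar_def[abs_def] mult.commute)
qed

lemma nubar_mass_tendsto_0: "((\<lambda>R. LINT y|lborel. nubar R y) \<longlongrightarrow> 0) at_top"
proof -
  have "((\<lambda>R. LINT y|lborel. nubar R y) \<longlongrightarrow> (LINT y|(lborel::'a measure). 0::real)) at_top"
  proof (rule integral_dominated_convergence_at_top[where w="nubar 1"])
    show "AE y in lborel. ((\<lambda>R. nubar R y) \<longlongrightarrow> 0) at_top"
    proof (rule AE_I2, rule tendsto_eventually)
      fix y :: 'a
      show "\<forall>\<^sub>F R in at_top. nubar R y = 0"
        using eventually_ge_at_top[of "norm y"] by eventually_elim (simp add: nubar_def)
    qed
    show "\<forall>\<^sub>F R in at_top. AE y in lborel. norm (nubar R y) \<le> nubar 1 y"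
      using eventually_ge_at_top[of 1]
      by eventually_elim (use nu_nonneg in \<open>auto simp: nubar_def indicator_def\<close>)
  qed (auto intro: integrable_nubar)
  then show ?thesis by simp
qed

lemma levy_K_finite: "\<exists>R0\<ge>1. \<forall>R\<ge>R0. levy_K TYPE('a) f R < \<infinity>"
proof -
  have "\<forall>\<^sub>F R in at_top. levy_K TYPE('a) f R < 1" using order_tendstoD(2)[OF K_lim, of 1] by simp
  then obtain R0 where "\<And>R. R \<ge> R0 \<Longrightarrow> levy_K TYPE('a) f R < 1" by (auto simp: eventually_at_top_linorder)
  then show ?thesis by (intro exI[of _ "max 1 R0"]) (auto intro: less_trans[OF _ ennreal_one_less_top])
qed

lemma kk_nonneg: "0 \<le> kk R" by (simp add: kk_def)

lemma kk_tendsto_0: "(kk \<longlongrightarrow> 0) at_top"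
  using tendsto_enn2real[of "levy_K TYPE('a) f" 0 at_top] K_lim by (simp add: kk_def[abs_def])

lemma kk_bound:
  fixes x :: 'a
  assumes K: "levy_K TYPE('a) f R < \<infinity>" and x: "1 < norm x"
  shows "(\<integral>\<^sup>+ y. indicator {y. R < norm (x - y) \<and> R < norm y} y
               * ennreal (f (norm (x - y)) * f (norm y)) \<partial>lborel) \<le> ennreal (kk R * f (norm x))" (is "?I x \<le> _")
proof -
  have "?I x / ennreal (f (norm x)) \<le> levy_K TYPE('a) f R"
    unfolding levy_K_def using x by (intro SUP_upper2[of x]) auto
  also have "\<dots> = ennreal (kk R)" using K by (simp add: kk_def)
  finally show ?thesis using x by (intro ennreal_le_of_divide_le f_pos kk_nonneg) auto
qed

text \<open>Take \<open>x\<close> at distance \<open>u + 1\<close> from the origin and a unit ball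
  whose centre has distance \<open>r0 + 2\<close> from \<open>x\<close>. On it the integrand in
  \<open>levy_K\<close> is at least \<open>f u * f (r0 + 3)\<close>, while the whole integral is at
  most \<open>kk r0 * f (u + 1)\<close>. For small \<open>u\<close> monotonicity of \<open>f\<close>
  suffices.\<close>

lemma f_doubling: "\<exists>C\<ge>1. \<forall>u\<ge>1. f u \<le> C * f (u + 1)"
proof -
  obtain r0 where r0: "1 \<le> r0" "levy_K TYPE('a) f r0 < \<infinity>" using levy_K_finite by auto
  obtain e :: 'a where e: "norm e = 1" using vector_choose_size[of 1] by auto
  define w where "w = unit_ball_vol (real DIM('a))"
  have w: "0 < w" by (simp add: w_def)
  define C1 where "C1 = kk r0 / (w * f (r0 + 3))"
  define C2 where "C2 = f 1 / f (2 * r0 + 4)"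
  have C12: "0 \<le> C1" "0 \<le> C2" using w f_pos[of "r0 + 3"] f_pos[of 1] f_pos[of "2 * r0 + 4"] r0 kk_nonneg
    by (auto simp: C1_def C2_def)
  have "f u \<le> (1 + C1 + C2) * f (u + 1)" if u: "1 \<le> u" for u
  proof (cases "u \<le> 2 * r0 + 3")
    case True
    have fp: "0 < f (2 * r0 + 4)" "0 < f (u + 1)" using r0 u by (auto intro: f_pos)
    have "f u \<le> f 1" using u by (intro f_noninc) auto
    also have "\<dots> = C2 * f (2 * r0 + 4)" using fp by (simp add: C2_def)
    also have "\<dots> \<le> C2 * f (u + 1)" using True u C12 by (intro mult_left_mono f_noninc) auto
    also have "\<dots> \<le> (1 + C1 + C2) * f (u + 1)" using C12 fp by (intro mult_right_mono) auto
    finally show ?thesis .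
  next
    case False
    define x where "x = (u + 1) *\<^sub>R e"
    \<comment> \<open>Points within 1 of \<open>z\<close> have norm between \<open>r0\<close> and
      \<open>u\<close>, and distance between \<open>r0\<close> and \<open>r0 + 3\<close> from
      \<open>x\<close>; the lower bound on the norm uses \<open>u > 2 * r0 + 3\<close>.\<close>
    define z where "z = (u + 1 - (r0 + 2)) *\<^sub>R e"
    have nx: "norm x = u + 1" using u e by (simp add: x_def)
    have nz: "norm z = u + 1 - (r0 + 2)" using False r0 e by (simp add: z_def)
    have "x - z = (r0 + 2) *\<^sub>R e" by (simp add: x_def z_def flip: scaleR_diff_left)
    then have nxz: "norm (x - z) = r0 + 2" using r0 e by simp
    have "ennreal (f u * f (r0 + 3) * w) = ennreal (f u * f (r0 + 3)) * emeasure lborel (ball z 1)"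
      using w f_pos[of u] f_pos[of "r0 + 3"] u r0 by (simp add: emeasure_ball w_def ennreal_mult)
    also have "\<dots> = (\<integral>\<^sup>+ y. ennreal (f u * f (r0 + 3)) * indicator (ball z 1) y \<partial>lborel)"
      by (rule nn_integral_cmult_indicator[symmetric]) simp
    also have "\<dots> \<le> (\<integral>\<^sup>+ y. indicator {y. r0 < norm (x - y) \<and> r0 < norm y} y
               * ennreal (f (norm (x - y)) * f (norm y)) \<partial>lborel)"
    proof (rule nn_integral_mono)
      fix y
      show "ennreal (f u * f (r0 + 3)) * indicator (ball z 1) y \<le>
        indicator {y. r0 < norm (x - y) \<and> r0 < norm y} y * ennreal (f (norm (x - y)) * f (norm y))"
      proof (cases "y \<in> ball z 1")
        case True
        then have d: "norm (z - y) < 1" by (simp add: dist_norm)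
        have "\<bar>norm y - norm z\<bar> \<le> norm (z - y)" using norm_triangle_ineq3[of y z] by (simp add: norm_minus_commute)
        moreover have "\<bar>norm (x - y) - norm (x - z)\<bar> \<le> norm (z - y)"
          using norm_triangle_ineq3[of "x - y" "x - z"] by simp
        ultimately have b: "norm y \<le> u" "r0 < norm y" "r0 < norm (x - y)" "norm (x - y) \<le> r0 + 3"
          using d nz nxz False r0(1) by auto
        have p: "0 < norm (x - y)" "0 < norm y" using b r0(1) by linarith+
        have "f u * f (r0 + 3) \<le> f (norm y) * f (norm (x - y))"
          using b p f_pos[OF p(2)] f_pos[of "r0 + 3"] r0(1) by (intro mult_mono f_noninc) auto
        then have "f u * f (r0 + 3) \<le> f (norm (x - y)) * f (norm y)" by (simp only: mult.commute)
        then show ?thesis using True b by (simp add: ennreal_leI)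
      qed simp
    qed
    also have "\<dots> \<le> ennreal (kk r0 * f (norm x))" using u by (intro kk_bound r0) (simp add: nx)
    finally have "f u * (f (r0 + 3) * w) \<le> kk r0 * f (u + 1)"
      using kk_nonneg f_pos[of "u + 1"] u by (subst (asm) ennreal_le_iff) (auto simp: nx mult_ac)
    then have "f u \<le> C1 * f (u + 1)"
      using w f_pos[of "r0 + 3"] r0 by (simp add: C1_def field_simps)
    also have "\<dots> \<le> (1 + C1 + C2) * f (u + 1)" using C12 f_pos[of "u + 1"] u by (intro mult_right_mono) auto
    finally show ?thesis .
  qed
  then show ?thesis using C12 by (intro exI[of _ "1 + C1 + C2"]) auto
qed

text \<open>Iterating \<open>f u \<le> C * f (u + 1)\<close> about \<open>norm z\<close> times gives
  the rate \<open>m = ln C\<close>.\<close>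

lemma F_shift: "\<exists>C m. 1 \<le> C \<and> 0 \<le> m \<and> (\<forall>x z. F (x - z) \<le> C * exp (m * norm z) * F x)"
proof -
  obtain C where C: "1 \<le> C" "\<And>u. 1 \<le> u \<Longrightarrow> f u \<le> C * f (u + 1)" using f_doubling by blast
  have it: "f u \<le> C ^ k * f (u + real k)" if "1 \<le> u" for u k
  proof (induction k)
    case (Suc k)
    have "f u \<le> C ^ k * f (u + real k)" by fact
    also have "\<dots> \<le> C ^ k * (C * f (u + real k + 1))" using C that by (intro mult_left_mono C) auto
    finally show ?case by (simp add: algebra_simps)
  qed simp
  have "F (x - z) \<le> C * exp (ln C * norm z) * F x" for x z
  proof -
    define k where "k = nat \<lceil>norm z\<rceil>"
    have k: "norm z \<le> real k" "real k \<le> norm z + 1" 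
    proof -
      have "real k = real_of_int \<lceil>norm z\<rceil>" by (simp add: k_def)
      then show "norm z \<le> real k" "real k \<le> norm z + 1" by linarith+
    qed
    have "F (x - z) \<le> C ^ k * f (max 1 (norm (x - z)) + real k)" unfolding F_def by (rule it) simp
    also have "\<dots> \<le> C ^ k * F x"
    proof (intro mult_left_mono)
      have "norm x \<le> norm (x - z) + norm z" using norm_triangle_ineq[of "x - z" z] by simp
      then show "f (max 1 (norm (x - z)) + real k) \<le> F x" unfolding F_def using k by (intro f_noninc) auto
    qed (use C in auto)
    also have "C ^ k = exp (real k * ln C)" using C by (simp add: exp_of_nat_mult)
    also have "\<dots> * F x \<le> exp ((norm z + 1) * ln C) * F x"
      using k C F_nonneg by (intro mult_right_mono exp_mono) auto
    also have "exp ((norm z + 1) * ln C) = C * exp (ln C * norm z)" 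
    proof -
      have "(norm z + 1) * ln C = ln C + ln C * norm z" by (simp add: algebra_simps)
      then show ?thesis using C by (simp add: exp_add)
    qed
    finally show ?thesis .
  qed
  then show ?thesis using C by (intro exI[of _ C] exI[of _ "ln C"]) auto
qed

text \<open>The translation bound with \<open>z = x\<close>. Whatever decays faster than every
  exponential is therefore negligible against \<open>F\<close>.\<close>

lemma F_lower: "\<exists>c m. 0 < c \<and> 0 \<le> m \<and> (\<forall>x. c * exp (- m * norm x) \<le> F x)"
proof -
  obtain C m where C: "1 \<le> C" "0 \<le> m" "\<And>x z. F (x - z) \<le> C * exp (m * norm z) * F x" using F_shift by blast
  have "F 0 / C * exp (- m * norm x) \<le> F x" for x
    using C(3)[of x x] C(1) by (simp add: exp_minus field_simps)
  then show ?thesis using C F_pos[of 0] by (intro exI[of _ "F 0 / C"] exI[of _ m]) auto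
qed

text \<open>Near the origin and near \<open>x\<close> one factor is at most \<open>f 1\<close> and
  the other is compared with \<open>F x\<close> by translation; on the rest \<open>levy_K\<close>
  applies. That requires \<open>norm x > 1\<close>, so the remaining \<open>x\<close> are compared
  with a reference point \<open>x0\<close> of norm 2.\<close>

lemma F_conv_F: "\<exists>C\<ge>0. \<forall>x. (\<integral>\<^sup>+ y. ennreal (F (x - y) * F y) \<partial>lborel) \<le> ennreal (C * F x)"
proof -
  obtain r0 where r0: "1 \<le> r0" "levy_K TYPE('a) f r0 < \<infinity>" using levy_K_finite by auto
  obtain C m where C: "1 \<le> C" "0 \<le> m" "\<And>x z. F (x - z) \<le> C * exp (m * norm z) * F x" using F_shift by blast
  define vol where "vol = unit_ball_vol (real DIM('a)) * r0 ^ DIM('a)"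
  have vol: "0 \<le> vol" "emeasure lborel (cball c r0) = ennreal vol" for c :: 'a
    using r0 by (auto simp: vol_def emeasure_cball)
  define D where "D = C * exp (m * r0) * f 1"
  have D: "0 \<le> D" using C f_pos[of 1] by (auto simp: D_def)
  have f1: "F y \<le> f 1" for y unfolding F_def by (intro f_noninc) auto
  have near: "F (x - y) * F y \<le> D * F x" if "norm y \<le> r0" for x y
  proof -
    have "F (x - y) * F y \<le> (C * exp (m * norm y) * F x) * f 1"
      using C F_nonneg by (intro mult_mono C(3) f1) auto
    also have "\<dots> \<le> (C * exp (m * r0) * F x) * f 1"
      using that C F_nonneg f_pos[of 1] by (intro mult_right_mono mult_left_mono) (auto intro!: mult_left_mono)
    finally show ?thesis by (simp add: D_def mult_ac)
  qed
  have big: "(\<integral>\<^sup>+ y. ennreal (F (x - y) * F y) \<partial>lborel) \<le> ennreal ((2 * vol * D + kk r0) * F x)" if x: "1 < norm x" for x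
  proof -
    have "(\<integral>\<^sup>+ y. ennreal (F (x - y) * F y) \<partial>lborel) \<le>
      (\<integral>\<^sup>+ y. ennreal (D * F x) * indicator (cball 0 r0) y + (ennreal (D * F x) * indicator (cball x r0) y +
        indicator {y. r0 < norm (x - y) \<and> r0 < norm y} y * ennreal (F (x - y) * F y)) \<partial>lborel)"
    proof (rule nn_integral_mono)
      fix y
      consider "norm y \<le> r0" | "norm (x - y) \<le> r0" | "r0 < norm (x - y)" "r0 < norm y" by linarith
      then show "ennreal (F (x - y) * F y) \<le> ennreal (D * F x) * indicator (cball 0 r0) y + (ennreal (D * F x) * indicator (cball x r0) y +
        indicator {y. r0 < norm (x - y) \<and> r0 < norm y} y * ennreal (F (x - y) * F y))"
      proof cases
        case 1
        then show ?thesis using near[OF 1, of x] by (intro add_increasing2) (auto intro!: ennreal_leI)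
      next
        case 2
        have "F (x - y) * F y \<le> D * F x" using near[OF 2, of x] by (simp add: mult.commute)
        then have "ennreal (F (x - y) * F y) \<le> ennreal (D * F x) * indicator (cball x r0) y"
          using 2 by (auto simp: dist_norm intro!: ennreal_leI)
        also have "\<dots> = 0 + (\<dots> + 0)" by simp
        also have "\<dots> \<le> ennreal (D * F x) * indicator (cball 0 r0) y + (ennreal (D * F x) * indicator (cball x r0) y +
            indicator {y. r0 < norm (x - y) \<and> r0 < norm y} y * ennreal (F (x - y) * F y))"
          by (intro add_mono) auto
        finally show ?thesis .
      next
        case 3
        then show ?thesis by (intro add_increasing) auto
      qed
    qed
    also have "\<dots> = ennreal (D * F x) * ennreal vol + (ennreal (D * F x) * ennreal vol +
        (\<integral>\<^sup>+ y. indicator {y. r0 < norm (x - y) \<and> r0 < norm y} y * ennreal (F (x - y) * F y) \<partial>lborel))"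
      by (simp add: nn_integral_add nn_integral_cmult_indicator vol)
    also have "(\<integral>\<^sup>+ y. indicator {y. r0 < norm (x - y) \<and> r0 < norm y} y * ennreal (F (x - y) * F y) \<partial>lborel)
      = (\<integral>\<^sup>+ y. indicator {y. r0 < norm (x - y) \<and> r0 < norm y} y * ennreal (f (norm (x - y)) * f (norm y)) \<partial>lborel)"
      using r0 by (intro nn_integral_cong) (auto simp: indicator_def F_def max_def)
    also have "\<dots> \<le> ennreal (kk r0 * f (norm x))" by (rule kk_bound[OF r0(2) x])
    also have "kk r0 * f (norm x) = kk r0 * F x" using x by (simp add: F_def max_def)
    also have "ennreal (D * F x) * ennreal vol + (ennreal (D * F x) * ennreal vol + ennreal (kk r0 * F x)) =
       ennreal ((2 * vol * D + kk r0) * F x)"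
      using D F_nonneg[of x] vol(1) kk_nonneg[of r0]
      by (simp add: ennreal_mult[symmetric] ennreal_plus[symmetric] algebra_simps del: ennreal_plus)
    finally show ?thesis by (simp add: add_left_mono)
  qed
  define B where "B = 2 * vol * D + kk r0"
  have B: "0 \<le> B" using D vol(1) kk_nonneg by (auto simp: B_def)
  obtain x0 :: 'a where x0: "norm x0 = 2" using vector_choose_size[of 2] by auto
  have small: "(\<integral>\<^sup>+ y. ennreal (F (x - y) * F y) \<partial>lborel) \<le> ennreal (C * exp (m * 3) * B * F x)" if x: "norm x \<le> 1" for x
  proof -
    have "(\<integral>\<^sup>+ y. ennreal (F (x - y) * F y) \<partial>lborel) \<le> (\<integral>\<^sup>+ y. ennreal (C * exp (m * 3)) * ennreal (F (x0 - y) * F y) \<partial>lborel)"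
    proof (rule nn_integral_mono)
      fix y
      have "F (x - y) = F ((x0 - y) - (x0 - x))" by simp
      also have "\<dots> \<le> C * exp (m * norm (x0 - x)) * F (x0 - y)" by (rule C(3))
      also have "\<dots> \<le> C * exp (m * 3) * F (x0 - y)"
        using norm_triangle_ineq4[of x0 x] x x0 C F_nonneg
        by (intro mult_right_mono mult_left_mono) (auto intro!: mult_left_mono)
      finally have "F (x - y) * F y \<le> C * exp (m * 3) * F (x0 - y) * F y"
        by (intro mult_right_mono F_nonneg)
      then have "F (x - y) * F y \<le> C * exp (m * 3) * (F (x0 - y) * F y)" by (simp only: mult.assoc)
      then show "ennreal (F (x - y) * F y) \<le> ennreal (C * exp (m * 3)) * ennreal (F (x0 - y) * F y)"
        using C F_nonneg by (subst ennreal_mult[symmetric]) (auto intro!: ennreal_leI)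
    qed
    also have "\<dots> = ennreal (C * exp (m * 3)) * (\<integral>\<^sup>+ y. ennreal (F (x0 - y) * F y) \<partial>lborel)"
      by (rule nn_integral_cmult) measurable
    also have "\<dots> \<le> ennreal (C * exp (m * 3)) * ennreal (B * F x0)"
      unfolding B_def using x0 by (intro mult_left_mono big) auto
    also have "\<dots> \<le> ennreal (C * exp (m * 3)) * ennreal (B * F x)"
      using x x0 B by (intro mult_left_mono ennreal_leI) (auto simp: F_def max_def intro!: f_noninc)
    also have "\<dots> = ennreal (C * exp (m * 3) * B * F x)"
      using C B F_nonneg by (subst ennreal_mult[symmetric]) (auto simp: mult_ac)
    finally show ?thesis .
  qed
  have "(\<integral>\<^sup>+ y. ennreal (F (x - y) * F y) \<partial>lborel) \<le> ennreal ((B + C * exp (m * 3) * B) * F x)" for x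
  proof (cases "1 < norm x")
    case True
    have "B * F x \<le> (B + C * exp (m * 3) * B) * F x" using B C F_nonneg by (intro mult_right_mono) auto
    then show ?thesis using big[OF True] by (auto simp: B_def[symmetric] intro: order_trans ennreal_leI)
  next
    case False
    have "C * exp (m * 3) * B * F x \<le> (B + C * exp (m * 3) * B) * F x" using B C F_nonneg by (intro mult_right_mono) auto
    then show ?thesis using small[of x] False by (auto intro: order_trans ennreal_leI)
  qed
  then show ?thesis using B C by (intro exI[of _ "B + C * exp (m * 3) * B"]) auto
qed

text \<open>Bounds the convolution square of \<open>nubar R\<close> relative to \<open>F x\<close>:
  the first summand serves \<open>norm x > 1\<close>, through \<open>levy_K\<close>, the second
  \<open>norm x \<le> 1\<close>, where \<open>F x = f 1\<close>.\<close>

definition double_jump :: "real \<Rightarrow> real" where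
  "double_jump R = C0\<^sup>2 * kk R + C0 * (LINT y|lborel. nubar R y)"

lemma double_jump_nonneg: "0 \<le> double_jump R"
  unfolding double_jump_def using C0_pos kk_nonneg nubar_nonneg
  by (intro add_nonneg_nonneg mult_nonneg_nonneg integral_nonneg_AE) auto

lemma double_jump_tendsto_0: "(double_jump \<longlongrightarrow> 0) at_top"
proof -
  have "((\<lambda>R. C0\<^sup>2 * kk R + C0 * (LINT y|lborel. nubar R y)) \<longlongrightarrow> C0\<^sup>2 * 0 + C0 * 0) at_top"
    by (intro tendsto_intros kk_tendsto_0 nubar_mass_tendsto_0)
  then show ?thesis by (simp add: double_jump_def[abs_def])
qed

lemma nubar_conv_nubar:
  assumes R: "1 \<le> R" and K: "levy_K TYPE('a) f R < \<infinity>"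
  shows "(\<integral>\<^sup>+ y. ennreal (nubar R (x - y) * nubar R y) \<partial>lborel) \<le> ennreal (double_jump R * F x)"
proof (cases "1 < norm x")
  case True
  have "(\<integral>\<^sup>+ y. ennreal (nubar R (x - y) * nubar R y) \<partial>lborel) \<le>
    (\<integral>\<^sup>+ y. ennreal (C0\<^sup>2) * (indicator {y. R < norm (x - y) \<and> R < norm y} y * ennreal (f (norm (x - y)) * f (norm y))) \<partial>lborel)"
  proof (rule nn_integral_mono)
    fix y
    show "ennreal (nubar R (x - y) * nubar R y) \<le>
      ennreal (C0\<^sup>2) * (indicator {y. R < norm (x - y) \<and> R < norm y} y * ennreal (f (norm (x - y)) * f (norm y)))"
    proof (cases "R < norm (x - y) \<and> R < norm y")
      case True
      then have ne: "x - y \<noteq> 0" "y \<noteq> 0" using R by auto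
      have "nubar R (x - y) * nubar R y \<le> (C0 * f (norm (x - y))) * (C0 * f (norm y))"
        using ne True C0_pos f_pos[of "norm (x - y)"] nu_nonneg R
        by (intro mult_mono) (auto simp: nubar_def intro!: nu_le_f)
      also have "\<dots> = C0\<^sup>2 * (f (norm (x - y)) * f (norm y))" by (simp add: power2_eq_square mult_ac)
      finally show ?thesis using True by (simp add: ennreal_mult'[symmetric] ennreal_leI)
    qed (auto simp: nubar_def indicator_def)
  qed
  also have "\<dots> = ennreal (C0\<^sup>2) * (\<integral>\<^sup>+ y. indicator {y. R < norm (x - y) \<and> R < norm y} y * ennreal (f (norm (x - y)) * f (norm y)) \<partial>lborel)"
  proof (rule nn_integral_cmult)
    \<comment> \<open>Measurability is read off from \<open>F\<close>, which agrees with
      \<open>f\<close> on the region of integration because \<open>R \<ge> 1\<close>.\<close>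
    have "(\<lambda>y. indicator {y. R < norm (x - y) \<and> R < norm y} y * ennreal (F (x - y) * F y)) \<in> borel_measurable lborel"
      by measurable
    moreover have "(\<lambda>y. indicator {y. R < norm (x - y) \<and> R < norm y} y * ennreal (F (x - y) * F y)) =
      (\<lambda>y. indicator {y. R < norm (x - y) \<and> R < norm y} y * ennreal (f (norm (x - y)) * f (norm y)))"
      using R by (auto simp: fun_eq_iff indicator_def F_def max_def)
    ultimately show "(\<lambda>y. indicator {y. R < norm (x - y) \<and> R < norm y} y * ennreal (f (norm (x - y)) * f (norm y))) \<in> borel_measurable lborel"
      by (simp only:)
  qed
  also have "\<dots> \<le> ennreal (C0\<^sup>2) * ennreal (kk R * f (norm x))" by (intro mult_left_mono kk_bound[OF K True]) auto
  also have "\<dots> = ennreal (C0\<^sup>2 * kk R * F x)"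
    using True kk_nonneg F_nonneg[of x] by (simp add: ennreal_mult'[symmetric] F_def max_def mult_ac)
  also have "\<dots> \<le> ennreal (double_jump R * F x)"
    unfolding double_jump_def using C0_pos nubar_nonneg F_nonneg
    by (intro ennreal_leI mult_right_mono) (auto intro!: mult_nonneg_nonneg integral_nonneg_AE)
  finally show ?thesis .
next
  case False
  have "(\<integral>\<^sup>+ y. ennreal (nubar R (x - y) * nubar R y) \<partial>lborel) \<le> (\<integral>\<^sup>+ y. ennreal (C0 * f 1) * ennreal (nubar R y) \<partial>lborel)"
  proof (rule nn_integral_mono)
    fix y
    have "nubar R (x - y) \<le> C0 * F (x - y)" by (rule nubar_le_F[OF R])
    also have "\<dots> \<le> C0 * f 1" using C0_pos unfolding F_def by (intro mult_left_mono f_noninc) auto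
    finally have "nubar R (x - y) * nubar R y \<le> (C0 * f 1) * nubar R y" by (intro mult_right_mono nubar_nonneg)
    then show "ennreal (nubar R (x - y) * nubar R y) \<le> ennreal (C0 * f 1) * ennreal (nubar R y)"
      using C0_pos f_pos[of 1] nubar_nonneg by (subst ennreal_mult[symmetric]) (auto intro!: ennreal_leI)
  qed
  also have "\<dots> = ennreal (C0 * f 1) * ennreal (LINT y|lborel. nubar R y)"
  proof -
    have "(\<integral>\<^sup>+ y. ennreal (nubar R y) \<partial>lborel) = ennreal (LINT y|lborel. nubar R y)"
      using R nubar_nonneg by (intro nn_integral_eq_integral integrable_nubar) auto
    then show ?thesis by (subst nn_integral_cmult) auto
  qed
  also have "\<dots> = ennreal (C0 * (LINT y|lborel. nubar R y) * F x)"
    using False C0_pos f_pos[of 1] nubar_nonneg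
    by (subst ennreal_mult[symmetric]) (auto simp: F_def max_def mult_ac intro!: integral_nonneg_AE)
  also have "\<dots> \<le> ennreal (double_jump R * F x)"
    unfolding double_jump_def using C0_pos kk_nonneg F_nonneg
    by (intro ennreal_leI mult_right_mono) auto
  finally show ?thesis .
qed

text \<open>Fatou along the ray: \<open>nu y * nu (n *\<^sub>R \<theta> - y) / nu (n *\<^sub>R
  \<theta>)\<close> tends to the integrand by (C), and the condition on \<open>levy_K\<close> at the
  point \<open>n *\<^sub>R \<theta>\<close> bounds its integral uniformly in \<open>n\<close>. This
  provides the exponential moment on which \<open>psi_tilde\<close> rests.\<close>

lemma nubar_exp_tail:
  assumes R: "1 \<le> R" and K: "levy_K TYPE('a) f R < \<infinity>" and \<theta>: "norm \<theta> = 1" and C1: "0 < C1"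
    and low: "\<And>r. 0 < r \<Longrightarrow> C1 * f r \<le> nu (r *\<^sub>R \<theta>)"
    and ratio: "\<And>y. ((\<lambda>r. nu (r *\<^sub>R \<theta> - y) / nu (r *\<^sub>R \<theta>)) \<longlongrightarrow> exp (\<kappa> * (\<theta> \<bullet> y))) at_top"
  shows "(\<integral>\<^sup>+ y. ennreal (nubar R y * exp (\<kappa> * (\<theta> \<bullet> y))) \<partial>lborel) \<le> ennreal (C0\<^sup>2 / C1 * kk R)"
proof -
  let ?g = "\<lambda>n y. indicator {y. R < norm (real n *\<^sub>R \<theta> - y) \<and> R < norm y} y *
      ennreal (nu y * (nu (real n *\<^sub>R \<theta> - y) / nu (real n *\<^sub>R \<theta>)))"
  have lim: "(\<lambda>n. ?g n y) \<longlonglongrightarrow> ennreal (nubar R y * exp (\<kappa> * (\<theta> \<bullet> y)))" for y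
  proof (cases "R < norm y")
    case True
    have "(\<lambda>n. ennreal (nu y * (nu (real n *\<^sub>R \<theta> - y) / nu (real n *\<^sub>R \<theta>)))) \<longlonglongrightarrow> ennreal (nu y * exp (\<kappa> * (\<theta> \<bullet> y)))"
      by (intro tendsto_ennrealI tendsto_mult tendsto_const filterlim_compose[OF ratio filterlim_real_sequentially])
    moreover have "\<forall>\<^sub>F n in sequentially. ennreal (nu y * (nu (real n *\<^sub>R \<theta> - y) / nu (real n *\<^sub>R \<theta>))) = ?g n y"
    proof -
      have "\<forall>\<^sub>F n in sequentially. R + norm y < real n"
        using filterlim_real_sequentially by (simp add: filterlim_at_top_dense)
      then show ?thesis
      proof eventually_elim
        case (elim n)
        have "norm (real n *\<^sub>R \<theta>) - norm y \<le> norm (real n *\<^sub>R \<theta> - y)" by (rule norm_triangle_ineq2)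
        then have "R < norm (real n *\<^sub>R \<theta> - y)" using elim \<theta> by simp
        then show ?case using True by simp
      qed
    qed
    ultimately have "(\<lambda>n. ?g n y) \<longlonglongrightarrow> ennreal (nu y * exp (\<kappa> * (\<theta> \<bullet> y)))"
      by (rule Lim_transform_eventually)
    then show ?thesis using True by (simp add: nubar_def)
  next
    case False
    then show ?thesis by (simp add: nubar_def)
  qed
  have bd: "integral\<^sup>N lborel (?g n) \<le> ennreal (C0\<^sup>2 / C1 * kk R)" if n: "2 \<le> n" for n
  proof -
    let ?x = "real n *\<^sub>R \<theta>"
    have nx: "norm ?x = real n" using \<theta> by simp
    have fn: "0 < f (real n)" using n by (intro f_pos) auto
    have low': "C1 * f (real n) \<le> nu ?x" using low[of "real n"] n by simp
    have pos: "0 < nu ?x" using low' C1 fn by (intro less_le_trans[OF _ low']) auto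
    have "integral\<^sup>N lborel (?g n) \<le> (\<integral>\<^sup>+ y. ennreal (C0\<^sup>2 / (C1 * f (real n))) *
       (indicator {y. R < norm (?x - y) \<and> R < norm y} y * ennreal (F (?x - y) * F y)) \<partial>lborel)"
    proof (rule nn_integral_mono)
      fix y
      show "?g n y \<le> ennreal (C0\<^sup>2 / (C1 * f (real n))) *
         (indicator {y. R < norm (?x - y) \<and> R < norm y} y * ennreal (F (?x - y) * F y))"
      proof (cases "R < norm (?x - y) \<and> R < norm y")
        case True
        then have ne: "?x - y \<noteq> 0" "y \<noteq> 0" using R by auto
        have F: "F (?x - y) = f (norm (?x - y))" "F y = f (norm y)" using True R by (auto simp: F_def max_def)
        have nb: "nu y \<le> C0 * F y" "nu (?x - y) \<le> C0 * F (?x - y)" unfolding F using ne by (intro nu_le_f; simp)+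
        have "nu y * (nu (?x - y) / nu ?x) \<le> (C0 * F y) * ((C0 * F (?x - y)) / (C1 * f (real n)))"
          using C1 fn C0_pos F_nonneg nu_nonneg pos
          by (intro mult_mono frac_le low' nb) auto
        also have "\<dots> = C0\<^sup>2 / (C1 * f (real n)) * (F (?x - y) * F y)" by (simp add: power2_eq_square field_simps)
        finally have "nu y * (nu (?x - y) / nu ?x) \<le> C0\<^sup>2 / (C1 * f (real n)) * (F (?x - y) * F y)" .
        from ennreal_leI[OF this] show ?thesis using True C1 fn F_nonneg
          by (subst (asm) ennreal_mult) auto
      qed simp
    qed
    also have "\<dots> = ennreal (C0\<^sup>2 / (C1 * f (real n))) *
       (\<integral>\<^sup>+ y. indicator {y. R < norm (?x - y) \<and> R < norm y} y * ennreal (F (?x - y) * F y) \<partial>lborel)"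
      by (rule nn_integral_cmult) measurable
    also have "(\<integral>\<^sup>+ y. indicator {y. R < norm (?x - y) \<and> R < norm y} y * ennreal (F (?x - y) * F y) \<partial>lborel) =
       (\<integral>\<^sup>+ y. indicator {y. R < norm (?x - y) \<and> R < norm y} y * ennreal (f (norm (?x - y)) * f (norm y)) \<partial>lborel)"
      using R by (intro nn_integral_cong) (auto simp: indicator_def F_def max_def)
    also have "\<dots> \<le> ennreal (kk R * f (norm ?x))" by (rule kk_bound[OF K]) (use nx n in simp)
    also have "ennreal (C0\<^sup>2 / (C1 * f (real n))) * ennreal (kk R * f (norm ?x)) = ennreal (C0\<^sup>2 / C1 * kk R)"
      using C1 fn kk_nonneg by (subst ennreal_mult[symmetric]) (auto simp: nx \<theta> simp del: norm_scaleR)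
    finally show ?thesis by (simp add: mult_left_mono)
  qed
  have "(\<integral>\<^sup>+ y. ennreal (nubar R y * exp (\<kappa> * (\<theta> \<bullet> y))) \<partial>lborel) = (\<integral>\<^sup>+ y. liminf (\<lambda>n. ?g n y) \<partial>lborel)"
    by (intro nn_integral_cong lim_imp_Liminf[symmetric] lim) simp
  also have "\<dots> \<le> liminf (\<lambda>n. integral\<^sup>N lborel (?g n))" by (rule nn_integral_liminf) measurable
  also have "\<dots> \<le> liminf (\<lambda>n. ennreal (C0\<^sup>2 / C1 * kk R))"
    by (intro Liminf_mono eventually_sequentiallyI[of 2] bd)
  also have "\<dots> = ennreal (C0\<^sup>2 / C1 * kk R)" by (simp add: Liminf_const)
  finally show ?thesis .
qed

text \<open>Near 0 the positive lower limit puts a multiple of \<open>f r * r ^ DIM('a)\<close>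
  below the mass of the jumps larger than \<open>r\<close>, and Levy integrability bounds this mass
  by a multiple of \<open>1 / r\<^sup>2\<close>. Away from 0 monotonicity suffices.\<close>

lemma f_power_bound:
  assumes R: "0 < R"
  shows "\<exists>C>0. \<forall>s. 0 < s \<longrightarrow> s \<le> R \<longrightarrow> f s * s ^ (DIM('a) + 2) \<le> C"
proof -
  let ?m = "\<lambda>r. measure (density lborel (\<lambda>x. ennreal (nu x))) {x::'a. r < norm x}"
  define I where "I = (LINT y|lborel. min 1 ((norm y)\<^sup>2) * nu y)"
  obtain c where c: "0 < ereal c" "ereal c < Liminf (at_right 0) (\<lambda>r. ereal (?m r / (f r * r ^ DIM('a))))"
    using ereal_dense2[OF nu_small] by blast
  have "\<forall>\<^sub>F r in at_right 0. ereal c < ereal (?m r / (f r * r ^ DIM('a)))" by (rule less_LiminfD[OF c(2)])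
  then obtain \<delta> where \<delta>: "0 < \<delta>" "\<And>r. 0 < r \<Longrightarrow> r < \<delta> \<Longrightarrow> c < ?m r / (f r * r ^ DIM('a))"
    by (auto simp: eventually_at_right_field)
  have mb: "?m r \<le> I / r\<^sup>2" if r: "0 < r" "r \<le> 1" for r
  proof -
    have "emeasure (density lborel (\<lambda>x. ennreal (nu x))) {x::'a. r < norm x} = (\<integral>\<^sup>+ x. ennreal (nu x) * indicator {x. r < norm x} x \<partial>lborel)"
      by (rule emeasure_density) auto
    also have "\<dots> \<le> (\<integral>\<^sup>+ x. ennreal (min 1 ((norm x)\<^sup>2) * nu x / r\<^sup>2) \<partial>lborel)"
    proof (rule nn_integral_mono)
      fix x :: 'a
      show "ennreal (nu x) * indicator {x. r < norm x} x \<le> ennreal (min 1 ((norm x)\<^sup>2) * nu x / r\<^sup>2)"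
      proof (cases "r < norm x")
        case True
        have "r\<^sup>2 \<le> min 1 ((norm x)\<^sup>2)" using r True by (auto intro!: power_le_one power_mono)
        then have "r\<^sup>2 * nu x \<le> min 1 ((norm x)\<^sup>2) * nu x" by (intro mult_right_mono nu_nonneg)
        then have "nu x \<le> min 1 ((norm x)\<^sup>2) * nu x / r\<^sup>2" using r by (simp add: field_simps)
        then show ?thesis using True by (simp add: ennreal_leI)
      qed simp
    qed
    also have "\<dots> = ennreal (LINT x|lborel. min 1 ((norm x)\<^sup>2) * nu x / r\<^sup>2)"
      using levy_densityD(3)[OF nu] nu_nonneg by (intro nn_integral_eq_integral) auto
    also have "\<dots> = ennreal (I / r\<^sup>2)" by (simp add: I_def)
    finally show ?thesis unfolding measure_def
      using nu_nonneg by (intro enn2real_leI) (auto simp: I_def intro!: divide_nonneg_nonneg integral_nonneg_AE)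
  qed
  define \<delta>' where "\<delta>' = min 1 (\<delta> / 2)"
  have \<delta>': "0 < \<delta>'" "\<delta>' \<le> 1" "\<delta>' < \<delta>" using \<delta>(1) by (auto simp: \<delta>'_def)
  have I0: "0 \<le> I" unfolding I_def using nu_nonneg by (intro integral_nonneg_AE) auto
  have c0: "0 < c" using c by simp
  have "f s * s ^ (DIM('a) + 2) \<le> I / c + f \<delta>' * R ^ (DIM('a) + 2)" if s: "0 < s" "s \<le> R" for s
  proof (cases "s \<le> \<delta>'")
    case True
    have fs: "0 < f s" using s by (intro f_pos)
    have "c * (f s * s ^ DIM('a)) < ?m s" using \<delta>(2)[of s] True \<delta>' s fs by (simp add: field_simps)
    also have "\<dots> \<le> I / s\<^sup>2" using True \<delta>' s by (intro mb) auto
    finally have "c * (f s * s ^ DIM('a)) \<le> I / s\<^sup>2" by simp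
    then have "f s * s ^ (DIM('a) + 2) \<le> I / c" using s c0 by (simp add: field_simps power_add power2_eq_square)
    also have "\<dots> \<le> I / c + f \<delta>' * R ^ (DIM('a) + 2)" using f_pos[OF \<delta>'(1)] R by simp
    finally show ?thesis .
  next
    case False
    have "f s * s ^ (DIM('a) + 2) \<le> f \<delta>' * R ^ (DIM('a) + 2)"
      using False s \<delta>' f_pos[OF \<delta>'(1)] by (intro mult_mono f_noninc power_mono) auto
    then show ?thesis using I0 c0 by (simp add: add_increasing)
  qed
  moreover have "0 < I / c + f \<delta>' * R ^ (DIM('a) + 2)"
    using I0 c0 f_pos[OF \<delta>'(1)] R by (intro add_nonneg_pos) auto
  ultimately show ?thesis by blast
qed

end

section \<open>Convolution powers of a jump density\<close>

text \<open>Index \<open>n\<close> stands for \<open>Suc n\<close> factors, since a zeroth power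
  would be a Dirac mass. Values in \<open>ennreal\<close> allow convolution without integrability
  conditions.\<close>

primrec conv_pow :: "('a::euclidean_space \<Rightarrow> real) \<Rightarrow> nat \<Rightarrow> 'a \<Rightarrow> ennreal" where
  "conv_pow w 0 z = ennreal (w z)"
| "conv_pow w (Suc n) z = (\<integral>\<^sup>+ y. conv_pow w n (z - y) * ennreal (w y) \<partial>lborel)"

context
  fixes w :: "'a::euclidean_space \<Rightarrow> real" and lam :: real
  assumes w_meas [measurable]: "w \<in> borel_measurable borel" and w_nonneg: "\<And>y. 0 \<le> w y"
    and w_int: "integrable lborel w" and lam: "lam = (LINT y|lborel. w y)"
begin

lemma conv_pow_measurable [measurable]: "conv_pow w n \<in> borel_measurable borel"
proof (induction n)
  case (Suc n)
  note [measurable] = Suc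
  have "(\<lambda>z. \<integral>\<^sup>+ y. conv_pow w n (z - y) * ennreal (w y) \<partial>lborel) \<in> borel_measurable borel" by measurable
  then show ?case by (simp add: fun_eq_iff[symmetric] cong: measurable_cong)
qed simp

lemma lam_nonneg: "0 \<le> lam"
  unfolding lam using w_nonneg by (intro integral_nonneg_AE) auto

lemma nn_integral_w: "(\<integral>\<^sup>+ y. ennreal (w y) \<partial>lborel) = ennreal lam"
  unfolding lam using w_nonneg w_int by (intro nn_integral_eq_integral) auto

lemma nn_integral_conv_pow: "(\<integral>\<^sup>+ z. conv_pow w n z \<partial>lborel) = ennreal (lam ^ Suc n)"
proof (induction n)
  case 0
  then show ?case by (simp add: nn_integral_w)
next
  case (Suc n)
  have "(\<integral>\<^sup>+ z. conv_pow w (Suc n) z \<partial>lborel) = (\<integral>\<^sup>+ y. \<integral>\<^sup>+ z. conv_pow w n (z - y) * ennreal (w y) \<partial>lborel \<partial>lborel)"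
    unfolding conv_pow.simps by (rule lborel_pair.Fubini') measurable
  also have "\<dots> = (\<integral>\<^sup>+ y. ennreal (lam ^ Suc n) * ennreal (w y) \<partial>lborel)"
    by (intro nn_integral_cong)
       (subst nn_integral_multc, auto simp: nn_integral_lborel_shift[of "conv_pow w n"] Suc)
  also have "\<dots> = ennreal (lam ^ Suc n) * ennreal lam"
    by (subst nn_integral_cmult) (auto simp: nn_integral_w)
  finally show ?case using lam_nonneg by (simp add: ennreal_mult[symmetric] mult_ac)
qed

lemma conv_pow_support:
  assumes supp: "\<And>y. R < norm y \<Longrightarrow> w y = 0"
  shows "real (Suc n) * R < norm z \<Longrightarrow> conv_pow w n z = 0"
proof (induction n arbitrary: z)
  case 0
  then show ?case using supp[of z] by simp
next
  case (Suc n)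
  have "conv_pow w n (z - y) * ennreal (w y) = 0" for y
  proof (cases "R < norm y")
    case False
    have "norm z \<le> norm (z - y) + norm y" using norm_triangle_ineq[of "z - y" y] by simp
    then have "real (Suc n) * R < norm (z - y)" using Suc.prems False by (simp add: algebra_simps)
    then show ?thesis using Suc.IH by simp
  qed (use supp in simp)
  then have "conv_pow w (Suc n) z = (\<integral>\<^sup>+ y. 0 \<partial>(lborel::'a measure))"
    unfolding conv_pow.simps by (intro nn_integral_cong)
  then show ?case by simp
qed

text \<open>If \<open>n\<close> jumps add up to \<open>z\<close>, then they include a jump of size at least \<open>norm z / n\<close>.\<close>

lemma conv_pow_bound:
  assumes f: "\<And>r s. 0 < r \<Longrightarrow> r \<le> s \<Longrightarrow> f s \<le> f r" "\<And>r. 0 < r \<Longrightarrow> 0 < f r" and C0: "0 < C0"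
    and w_le: "\<And>y. y \<noteq> 0 \<Longrightarrow> w y \<le> C0 * f (norm y)"
  shows "z \<noteq> 0 \<Longrightarrow> conv_pow w n z \<le> ennreal (real (Suc n) * C0 * f (norm z / real (Suc n)) * lam ^ n)"
proof (induction n arbitrary: z)
  case 0
  then show ?case using w_le[of z] by (simp add: ennreal_leI)
next
  case (Suc n)
  define q where "q = f (norm z / real (Suc (Suc n)))"
  have pz: "0 < norm z / real (Suc (Suc n))" using Suc.prems by (simp add: field_simps)
  have q: "0 < q" unfolding q_def by (rule f(2)[OF pz])
  have "conv_pow w (Suc n) z \<le>
    (\<integral>\<^sup>+ y. conv_pow w n (z - y) * ennreal (C0 * q) + ennreal (real (Suc n) * C0 * q * lam ^ n) * ennreal (w y) \<partial>lborel)"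
    unfolding conv_pow.simps
  proof (rule nn_integral_mono)
    fix y
    show "conv_pow w n (z - y) * ennreal (w y) \<le>
      conv_pow w n (z - y) * ennreal (C0 * q) + ennreal (real (Suc n) * C0 * q * lam ^ n) * ennreal (w y)"
    \<comment> \<open>Either the last jump reaches the average size \<open>norm z / (n + 2)\<close>,
      or the other \<open>n + 1\<close> jumps add up to at least \<open>n + 1\<close> times that
      size, and the induction hypothesis applies with the same threshold.\<close>
    proof (cases "norm z / real (Suc (Suc n)) \<le> norm y")
      case True
      then have "y \<noteq> 0" using pz by auto
      then have "w y \<le> C0 * f (norm y)" by (rule w_le)
      also have "\<dots> \<le> C0 * q" unfolding q_def using C0 True pz by (intro mult_left_mono f(1)) auto
      finally have "conv_pow w n (z - y) * ennreal (w y) \<le> conv_pow w n (z - y) * ennreal (C0 * q)"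
        by (intro mult_left_mono ennreal_leI) auto
      then show ?thesis by (rule add_increasing2[rotated]) simp
    next
      case False
      have "norm z - norm y \<le> norm (z - y)" by (rule norm_triangle_ineq2)
      moreover have "norm z - norm z / real (Suc (Suc n)) = real (Suc n) * (norm z / real (Suc (Suc n)))"
        by (simp add: field_simps)
      ultimately have ge: "real (Suc n) * (norm z / real (Suc (Suc n))) \<le> norm (z - y)" using False by linarith
      then have ge': "norm z / real (Suc (Suc n)) \<le> norm (z - y) / real (Suc n)"
        by (simp only: pos_le_divide_eq[of "real (Suc n)"] of_nat_0_less_iff zero_less_Suc mult.commute)
      have "0 < real (Suc n) * (norm z / real (Suc (Suc n)))" using pz by (intro mult_pos_pos) auto
      then have ne: "z - y \<noteq> 0" using ge by auto
      have "conv_pow w n (z - y) \<le> ennreal (real (Suc n) * C0 * f (norm (z - y) / real (Suc n)) * lam ^ n)"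
        by (rule Suc.IH[OF ne])
      also have "\<dots> \<le> ennreal (real (Suc n) * C0 * q * lam ^ n)"
        unfolding q_def using C0 lam_nonneg pz ge'
        by (intro ennreal_leI mult_right_mono mult_left_mono f(1)) auto
      finally have "conv_pow w n (z - y) * ennreal (w y) \<le> ennreal (real (Suc n) * C0 * q * lam ^ n) * ennreal (w y)"
        by (intro mult_right_mono) auto
      then show ?thesis by (rule add_increasing[rotated]) simp
    qed
  qed
  also have "\<dots> = (\<integral>\<^sup>+ y. conv_pow w n (z - y) \<partial>lborel) * ennreal (C0 * q) + ennreal (real (Suc n) * C0 * q * lam ^ n) * ennreal lam"
    by (subst nn_integral_add) (auto simp: nn_integral_multc nn_integral_cmult nn_integral_w)
  also have "(\<integral>\<^sup>+ y. conv_pow w n (z - y) \<partial>lborel) = ennreal (lam ^ Suc n)"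
    by (simp only: nn_integral_lborel_reflect[OF conv_pow_measurable] nn_integral_conv_pow)
  also have "ennreal (lam ^ Suc n) * ennreal (C0 * q) + ennreal (real (Suc n) * C0 * q * lam ^ n) * ennreal lam =
     ennreal (real (Suc (Suc n)) * C0 * q * lam ^ Suc n)"
    using C0 q lam_nonneg
    by (simp add: ennreal_mult[symmetric] ennreal_plus[symmetric] algebra_simps del: ennreal_plus)
  finally show ?case by (simp add: q_def)
qed

text \<open>Two groupings of one iterated convolution: peeling off a single jump, or first
  collecting all \<open>Suc n\<close> jumps in \<open>conv_pow\<close>. The second follows from the
  first by induction, translation and Tonelli.\<close>

lemma ift_char_fun_pow_conv:
  assumes \<phi>: "integrable lborel \<phi>" and pos: "\<And>x. 0 \<le> ift \<phi> x"
  shows "0 \<le> ift (\<lambda>\<xi>. \<phi> \<xi> * char_fun (jump_measure w) \<xi> ^ n) x"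
    and "ennreal (ift (\<lambda>\<xi>. \<phi> \<xi> * char_fun (jump_measure w) \<xi> ^ Suc n) x) =
       (\<integral>\<^sup>+ y. ennreal (ift (\<lambda>\<xi>. \<phi> \<xi> * char_fun (jump_measure w) \<xi> ^ n) (x - y)) * ennreal (w y) \<partial>lborel)"
    and "ennreal (ift (\<lambda>\<xi>. \<phi> \<xi> * char_fun (jump_measure w) \<xi> ^ Suc n) x) =
       (\<integral>\<^sup>+ z. ennreal (ift \<phi> (x - z)) * conv_pow w n z \<partial>lborel)"
proof -
  let ?M = "jump_measure w"
  let ?a = "\<lambda>n x. ift (\<lambda>\<xi>. \<phi> \<xi> * char_fun ?M \<xi> ^ n) x"
  note fin = finite_measure_jump_measure[OF w_int w_nonneg]
  have int: "integrable lborel (\<lambda>\<xi>. \<phi> \<xi> * char_fun ?M \<xi> ^ n)" for n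
    by (rule integrable_mult_char_fun[OF fin _ \<phi>]) simp
  have [measurable]: "?a n \<in> borel_measurable borel" for n by (rule ift_borel_measurable[OF int])
  have step: "?a (Suc n) x = (LINT y|?M. ?a n (x - y))" for n x
    using ift_mult_char_fun[OF fin _ int[of n], of x] by (simp add: mult_ac)
  have nn: "0 \<le> ?a n x" for n x
  proof (induction n arbitrary: x)
    case (Suc n)
    show ?case unfolding step using Suc by (intro integral_nonneg_AE) auto
  qed (use pos in simp)
  then show "0 \<le> ?a n x" .
  have step': "ennreal (?a (Suc n) x) = (\<integral>\<^sup>+ y. ennreal (?a n (x - y)) * ennreal (w y) \<partial>lborel)" for n x
  proof -
    have "ennreal (?a (Suc n) x) = (\<integral>\<^sup>+ y. ennreal (?a n (x - y)) \<partial>?M)"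
      unfolding step using nn
      by (intro nn_integral_eq_integral[symmetric] integrable_ift_finite_measure[OF fin _ int]) auto
    also have "\<dots> = (\<integral>\<^sup>+ y. ennreal (w y) * ennreal (?a n (x - y)) \<partial>lborel)"
      by (rule nn_integral_jump_measure[OF w_int w_nonneg]) measurable
    finally show ?thesis by (simp add: mult.commute)
  qed
  then show "ennreal (?a (Suc n) x) = (\<integral>\<^sup>+ y. ennreal (?a n (x - y)) * ennreal (w y) \<partial>lborel)" .
  have [measurable]: "ift \<phi> \<in> borel_measurable borel" by (rule ift_borel_measurable[OF \<phi>])
  show "ennreal (?a (Suc n) x) = (\<integral>\<^sup>+ z. ennreal (ift \<phi> (x - z)) * conv_pow w n z \<partial>lborel)"
  proof (induction n arbitrary: x)
    case 0
    then show ?case by (subst step') simp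
  next
    case (Suc n)
    have "ennreal (?a (Suc (Suc n)) x) =
      (\<integral>\<^sup>+ y. (\<integral>\<^sup>+ z. ennreal (ift \<phi> (x - y - z)) * conv_pow w n z \<partial>lborel) * ennreal (w y) \<partial>lborel)"
      by (subst step') (simp only: Suc)
    also have "\<dots> = (\<integral>\<^sup>+ y. \<integral>\<^sup>+ z. ennreal (ift \<phi> (x - z)) * (conv_pow w n (z - y) * ennreal (w y)) \<partial>lborel \<partial>lborel)"
    proof (rule nn_integral_cong)
      fix y
      have e: "(\<integral>\<^sup>+ z. ennreal (ift \<phi> (x - y - z)) * conv_pow w n z \<partial>lborel) =
        (\<integral>\<^sup>+ z. ennreal (ift \<phi> (x - z)) * conv_pow w n (z - y) \<partial>lborel)"
        using nn_integral_lborel_shift[of "\<lambda>z. ennreal (ift \<phi> (x - y - z)) * conv_pow w n z" y] by (simp add: algebra_simps)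
      show "(\<integral>\<^sup>+ z. ennreal (ift \<phi> (x - y - z)) * conv_pow w n z \<partial>lborel) * ennreal (w y) =
         (\<integral>\<^sup>+ z. ennreal (ift \<phi> (x - z)) * (conv_pow w n (z - y) * ennreal (w y)) \<partial>lborel)"
        unfolding e by (subst nn_integral_multc[symmetric]) (auto simp: mult.assoc)
    qed
    also have "\<dots> = (\<integral>\<^sup>+ z. \<integral>\<^sup>+ y. ennreal (ift \<phi> (x - z)) * (conv_pow w n (z - y) * ennreal (w y)) \<partial>lborel \<partial>lborel)"
      by (rule lborel_pair.Fubini') measurable
    also have "\<dots> = (\<integral>\<^sup>+ z. ennreal (ift \<phi> (x - z)) * conv_pow w (Suc n) z \<partial>lborel)"
      unfolding conv_pow.simps by (intro nn_integral_cong nn_integral_cmult) measurable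
    finally show ?case .
  qed
qed

end

text \<open>Chernoff's bound for the mass near \<open>x\<close>, combined with the Lipschitz bound, controls the value at \<open>x\<close>.\<close>

lemma mgf_kernel_pointwise_bound:
  fixes \<phi> :: "'a::euclidean_space \<Rightarrow> complex"
  assumes g: "mgf_kernel \<phi> L" and G: "0 < G"
    and lip: "\<And>x y. \<bar>ift \<phi> x - ift \<phi> y\<bar> \<le> G * norm (x - y)"
    and h: "0 < h"
  defines "\<omega> \<equiv> unit_ball_vol (real DIM('a))"
  shows "ift \<phi> x / 2 * (\<omega> * (min (ift \<phi> x / (2 * G)) h) ^ DIM('a)) \<le> L \<eta> * exp (- (\<eta> \<bullet> x) + norm \<eta> * h)"
proof (cases "ift \<phi> x = 0")
  case True
  then show ?thesis using mgf_kernelD(3)[OF g] by simp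
next
  case False
  define a where "a = ift \<phi> x"
  have a: "0 < a" using False mgf_kernelD(2)[OF g, of x] by (simp add: a_def)
  \<comment> \<open>The radius \<open>a / (2 * G)\<close> keeps the density above
    \<open>a / 2\<close> by the Lipschitz bound; the cap \<open>h\<close> keeps the tilt constant up
    to the factor \<open>exp (norm \<eta> * h)\<close>.\<close>
  define \<delta> where "\<delta> = min (a / (2 * G)) h"
  have \<delta>: "0 < \<delta>" "\<delta> \<le> h" "\<delta> \<le> a / (2 * G)" using a G h by (auto simp: \<delta>_def)
  have \<omega>: "0 < \<omega>" by (simp add: \<omega>_def)
  let ?k = "a / 2 * exp (\<eta> \<bullet> x - norm \<eta> * h)"
  have "ennreal (?k * (\<omega> * \<delta> ^ DIM('a))) = ennreal ?k * emeasure lborel (ball x \<delta>)"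
  proof -
    have "emeasure lborel (ball x \<delta>) = ennreal (\<omega> * \<delta> ^ DIM('a))" using \<delta> by (simp add: emeasure_ball \<omega>_def)
    then show ?thesis using a \<omega> \<delta> by (simp only:) (intro ennreal_mult; simp)
  qed
  also have "\<dots> = (\<integral>\<^sup>+ z. ennreal ?k * indicator (ball x \<delta>) z \<partial>lborel)"
    by (rule nn_integral_cmult_indicator[symmetric]) simp
  also have "\<dots> \<le> (\<integral>\<^sup>+ z. ennreal (exp (\<eta> \<bullet> z) * ift \<phi> z) \<partial>lborel)"
  proof (rule nn_integral_mono)
    fix z
    show "ennreal ?k * indicator (ball x \<delta>) z \<le> ennreal (exp (\<eta> \<bullet> z) * ift \<phi> z)"
    proof (cases "z \<in> ball x \<delta>")
      case True
      then have d: "norm (x - z) < \<delta>" by (simp add: dist_norm)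
      have "a - ift \<phi> z \<le> G * norm (x - z)" using lip[of x z] by (simp add: a_def)
      also have "\<dots> \<le> G * (a / (2 * G))" using d \<delta> G by (intro mult_left_mono) auto
      also have "\<dots> = a / 2" using G by simp
      finally have u: "a / 2 \<le> ift \<phi> z" by simp
      have "\<eta> \<bullet> (x - z) \<le> norm \<eta> * norm (x - z)" by (rule norm_cauchy_schwarz)
      also have "\<dots> \<le> norm \<eta> * h" using d \<delta> by (intro mult_left_mono) auto
      finally have "\<eta> \<bullet> x - norm \<eta> * h \<le> \<eta> \<bullet> z" by (simp add: inner_diff_right)
      then have "?k \<le> ift \<phi> z * exp (\<eta> \<bullet> z)" using u a by (intro mult_mono) auto
      then show ?thesis using True by (simp add: mult.commute ennreal_leI)
    qed simp
  qed
  also have "\<dots> = ennreal (L \<eta>)" by (rule mgf_kernelD(4)[OF g])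
  finally have "?k * (\<omega> * \<delta> ^ DIM('a)) \<le> L \<eta>"
    using mgf_kernelD(3)[OF g] by (simp add: ennreal_le_iff)
  then have "?k * (\<omega> * \<delta> ^ DIM('a)) * exp (- (\<eta> \<bullet> x) + norm \<eta> * h) \<le> L \<eta> * exp (- (\<eta> \<bullet> x) + norm \<eta> * h)"
    by (intro mult_right_mono) auto
  moreover have e1: "exp (\<eta> \<bullet> x - norm \<eta> * h) * exp (- (\<eta> \<bullet> x) + norm \<eta> * h) = 1" by (simp add: exp_add[symmetric])
  have "?k * (\<omega> * \<delta> ^ DIM('a)) * exp (- (\<eta> \<bullet> x) + norm \<eta> * h) = a / 2 * (\<omega> * \<delta> ^ DIM('a))"
  proof -
    have "?k * (\<omega> * \<delta> ^ DIM('a)) * exp (- (\<eta> \<bullet> x) + norm \<eta> * h) =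
      a / 2 * (\<omega> * \<delta> ^ DIM('a)) * (exp (\<eta> \<bullet> x - norm \<eta> * h) * exp (- (\<eta> \<bullet> x) + norm \<eta> * h))"
      by (simp only: mult_ac)
    then show ?thesis by (simp only: e1 mult_1_right)
  qed
  ultimately show ?thesis by (simp only: a_def \<delta>_def)
qed

section \<open>Truncated heat kernels\<close>

text \<open>One constant \<open>c\<close> serves all times: later estimates see \<open>t\<close>
  only through \<open>good_scale t h\<close>, which is what makes them uniform on
  \<open>T\<close>.\<close>

locale levy_heat = jump_kernel nu f C0
  for nu :: "'a::euclidean_space \<Rightarrow> real" and f :: "real \<Rightarrow> real" and C0 :: real +
  fixes b :: 'a and A :: "'a \<Rightarrow> 'a" and c :: real
  assumes A: "linear A" "\<And>x y. A x \<bullet> y = x \<bullet> A y" "\<And>x. 0 \<le> x \<bullet> A x" and c: "1 \<le> c"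
begin

definition nucut :: "real \<Rightarrow> 'a \<Rightarrow> real" where
  "nucut \<rho> y = indicator (cball 0 \<rho>) y * nu y"

definition bcut :: "real \<Rightarrow> 'a" where
  "bcut \<rho> = b - (LINT y|lborel. (indicator (- cball 0 \<rho>) y * nu y * indicator (ball 0 1) y) *\<^sub>R y)"

definition full_phi :: "real \<Rightarrow> 'a \<Rightarrow> complex" where
  "full_phi t \<xi> = exp (- complex_of_real t * levy_psi b A nu \<xi>)"

definition cut_phi :: "real \<Rightarrow> real \<Rightarrow> 'a \<Rightarrow> complex" where
  "cut_phi \<rho> t \<xi> = exp (- complex_of_real t * levy_psi (bcut \<rho>) A (nucut \<rho>) \<xi>)"

definition kern :: "real \<Rightarrow> real \<Rightarrow> 'a \<Rightarrow> real" where
  "kern \<rho> t = ift (cut_phi \<rho> t)"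

definition mass :: "real \<Rightarrow> real" where
  "mass \<rho> = (LINT y|lborel. nubar \<rho> y)"

definition cut_mgf :: "real \<Rightarrow> real \<Rightarrow> 'a \<Rightarrow> real" where
  "cut_mgf \<rho> t \<eta> = exp (- t * psi_tilde (bcut \<rho>) A (nucut \<rho>) \<eta>)"

text \<open>\<open>h\<close> is the spatial scale of the process at time \<open>t\<close>.\<close>

definition good_scale :: "real \<Rightarrow> real \<Rightarrow> bool" where
  "good_scale t h \<longleftrightarrow> 0 < h \<and> h \<le> 1 \<and> 0 < t \<and> t \<le> c \<and>
     (\<integral>\<^sup>+ \<xi>. ennreal (norm \<xi> * norm (full_phi t \<xi>)) \<partial>lborel) \<le> ennreal (c / h ^ (DIM('a) + 1)) \<and>
     t * (LINT y|lborel. min 1 ((norm y / h)\<^sup>2) * nu y) \<le> c \<and> h\<^sup>2 \<le> c * t \<and>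
     (\<forall>\<eta>. t * (\<eta> \<bullet> A \<eta>) \<le> c * h\<^sup>2 * (norm \<eta>)\<^sup>2)"

lemma good_scaleD:
  assumes "good_scale t h"
  shows "0 < h" "h \<le> 1" "0 < t" "t \<le> c"
     "(\<integral>\<^sup>+ \<xi>. ennreal (norm \<xi> * norm (full_phi t \<xi>)) \<partial>lborel) \<le> ennreal (c / h ^ (DIM('a) + 1))"
     "t * (LINT y|lborel. min 1 ((norm y / h)\<^sup>2) * nu y) \<le> c" "h\<^sup>2 \<le> c * t"
     "t * (\<eta> \<bullet> A \<eta>) \<le> c * h\<^sup>2 * (norm \<eta>)\<^sup>2"
  using assms by (auto simp: good_scale_def)

lemma nucut_levy: "levy_density (nucut \<rho>)"
  unfolding nucut_def[abs_def] by (rule levy_density_cut[OF nu]) simp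

lemma nucut_supp: "\<rho> < norm y \<Longrightarrow> nucut \<rho> y = 0"
  by (simp add: nucut_def)

lemma full_phi_measurable [measurable]: "full_phi t \<in> borel_measurable borel"
proof -
  note [measurable] = levy_psi_measurable[OF A(1) nu_meas]
  show ?thesis unfolding full_phi_def[abs_def] by measurable
qed

lemma cut_phi_measurable [measurable]: "cut_phi \<rho> t \<in> borel_measurable borel"
proof -
  note [measurable] = levy_psi_measurable[OF A(1) levy_densityD(1)[OF nucut_levy]]
  show ?thesis unfolding cut_phi_def[abs_def] by measurable
qed

lemma mass_nonneg: "0 \<le> mass \<rho>"
  unfolding mass_def using nubar_nonneg by (intro integral_nonneg_AE) auto

lemma full_phi_split:
  assumes "0 < \<rho>"
  shows "full_phi t \<xi> = complex_of_real (exp (- t * mass \<rho>)) *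
    (cut_phi \<rho> t \<xi> * exp (complex_of_real t * char_fun (jump_measure (nubar \<rho>)) \<xi>))"
proof -
  have "integrable lborel (\<lambda>y. indicator (- cball 0 \<rho>) y * nu y)"
    using integrable_nubar[OF assms] by (simp add: nubar_def[abs_def])
  from levy_psi_split[OF nu _ this, of b A \<xi>]
  have "levy_psi b A nu \<xi> = levy_psi (bcut \<rho>) A (nucut \<rho>) \<xi> +
    (complex_of_real (mass \<rho>) - char_fun (jump_measure (nubar \<rho>)) \<xi>)"
    by (simp add: bcut_def nucut_def[abs_def] mass_def nubar_def[abs_def])
  then have "- complex_of_real t * levy_psi b A nu \<xi> = complex_of_real (- t * mass \<rho>) +
    (- complex_of_real t * levy_psi (bcut \<rho>) A (nucut \<rho>) \<xi> + complex_of_real t * char_fun (jump_measure (nubar \<rho>)) \<xi>)"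
    by (simp only:) (simp add: algebra_simps)
  then show ?thesis unfolding full_phi_def cut_phi_def by (simp only: exp_add exp_of_real)
qed

lemma norm_full_phi_le_1: "0 \<le> t \<Longrightarrow> norm (full_phi t \<xi>) \<le> 1"
  unfolding full_phi_def norm_exp_levy_psi using A(3)[of \<xi>] Re_levy_Phi_nonneg[OF nu, of \<xi>] by simp

text \<open>The compound Poisson factor has modulus at least \<open>exp (- t * mass \<rho>)\<close>,
  so removing it costs a constant factor, and integrability in frequency passes to the truncated
  exponent.\<close>

lemma norm_cut_phi_le:
  assumes "0 < \<rho>" "0 \<le> t"
  shows "norm (cut_phi \<rho> t \<xi>) \<le> exp (2 * t * mass \<rho>) * norm (full_phi t \<xi>)"
proof -
  let ?j = "char_fun (jump_measure (nubar \<rho>)) \<xi>"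
  note fin = finite_measure_jump_measure[OF integrable_nubar[OF assms(1)] nubar_nonneg]
  have "norm ?j \<le> mass \<rho>"
    using norm_char_fun_le[OF fin] measure_jump_measure[OF integrable_nubar[OF assms(1)] nubar_nonneg] by (simp add: mass_def)
  then have "- mass \<rho> \<le> Re ?j" using abs_Re_le_cmod[of ?j] by linarith
  then have ge: "exp (- t * mass \<rho>) \<le> norm (exp (complex_of_real t * ?j))"
    using assms mult_left_mono[of "- mass \<rho>" "Re ?j" t] by simp
  have "norm (full_phi t \<xi>) = exp (- t * mass \<rho>) * (norm (cut_phi \<rho> t \<xi>) * norm (exp (complex_of_real t * ?j)))"
    unfolding full_phi_split[OF assms(1)] by (simp only: norm_mult norm_of_real abs_exp_cancel)
  also have "\<dots> \<ge> exp (- t * mass \<rho>) * (norm (cut_phi \<rho> t \<xi>) * exp (- t * mass \<rho>))"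
    by (intro mult_left_mono ge) auto
  finally have "exp (2 * t * mass \<rho>) * (exp (- t * mass \<rho>) * (norm (cut_phi \<rho> t \<xi>) * exp (- t * mass \<rho>))) \<le>
    exp (2 * t * mass \<rho>) * norm (full_phi t \<xi>)" by (intro mult_left_mono) auto
  moreover have "exp (2 * t * mass \<rho>) * (exp (- t * mass \<rho>) * (norm (cut_phi \<rho> t \<xi>) * exp (- t * mass \<rho>))) = norm (cut_phi \<rho> t \<xi>)"
  proof -
    have "exp (2 * t * mass \<rho>) * exp (- t * mass \<rho>) * exp (- t * mass \<rho>) = 1"
      unfolding exp_add[symmetric] by simp
    then have "norm (cut_phi \<rho> t \<xi>) = norm (cut_phi \<rho> t \<xi>) * (exp (2 * t * mass \<rho>) * exp (- t * mass \<rho>) * exp (- t * mass \<rho>))"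
      by (simp only: mult_1_right)
    then show ?thesis by (simp only: mult_ac)
  qed
  ultimately show ?thesis by (simp only:)
qed

lemma integrable_scaled_min:
  assumes "0 < h" "h \<le> 1"
  shows "integrable lborel (\<lambda>y. min 1 ((norm y / h)\<^sup>2) * nu y)"
proof -
  have "integrable lborel (\<lambda>y. nu y *\<^sub>R min 1 ((norm y / h)\<^sup>2))"
  proof (rule levy_density_bounded_integrable[OF nu, where C="1 / h\<^sup>2"])
    fix y :: 'a
    have "min 1 ((norm y / h)\<^sup>2) \<le> min (1 / h\<^sup>2) ((norm y)\<^sup>2 / h\<^sup>2)"
      using assms power_le_one[of h 2] by (intro min.mono) (auto simp: power_divide)
    also have "\<dots> = (1 / h\<^sup>2) * min 1 ((norm y)\<^sup>2)" using assms by (simp add: min_mult_distrib_left)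
    finally show "norm (min 1 ((norm y / h)\<^sup>2)) \<le> (1 / h\<^sup>2) * min 1 ((norm y)\<^sup>2)" by simp
  qed measurable
  then show ?thesis by (simp add: mult.commute)
qed

text \<open>The scaled moment in \<open>good_scale\<close> weighs jumps beyond \<open>h\<close> by
  1, which gives the mass, and those up to \<open>h\<close> by \<open>(norm y / h)\<^sup>2\<close>,
  which gives the second moment in the next lemma.\<close>

lemma mass_bound:
  assumes "good_scale t h"
  shows "t * mass h \<le> c"
proof -
  note g = good_scaleD[OF assms]
  note int = integrable_scaled_min[OF g(1,2)]
  have "mass h \<le> (LINT y|lborel. min 1 ((norm y / h)\<^sup>2) * nu y)"
    unfolding mass_def
  proof (rule integral_mono[OF integrable_nubar[OF g(1)] int])
    fix y :: 'a
    have "1 \<le> (norm y / h)\<^sup>2" if "h < norm y" using that g(1) by (intro one_le_power) simp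
    then show "nubar h y \<le> min 1 ((norm y / h)\<^sup>2) * nu y"
      using nu_nonneg[of y] by (auto simp: nubar_def indicator_def min_def not_le)
  qed
  then show ?thesis using g(3,6) by (meson less_imp_le mult_left_mono order_trans)
qed

lemma second_moment_bound:
  assumes "good_scale t h"
  shows "t * (LINT y|lborel. min 1 ((norm y)\<^sup>2) * nucut h y) \<le> c * h\<^sup>2"
proof -
  note g = good_scaleD[OF assms]
  note int = integrable_scaled_min[OF g(1,2)]
  have "(LINT y|lborel. min 1 ((norm y)\<^sup>2) * nucut h y) \<le> (LINT y|lborel. h\<^sup>2 * (min 1 ((norm y / h)\<^sup>2) * nu y))"
  proof (rule integral_mono)
    show "integrable lborel (\<lambda>y. min 1 ((norm y)\<^sup>2) * nucut h y)" by (rule levy_densityD(3)[OF nucut_levy])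
    show "integrable lborel (\<lambda>y. h\<^sup>2 * (min 1 ((norm y / h)\<^sup>2) * nu y))" using int by simp
    fix y :: 'a
    show "min 1 ((norm y)\<^sup>2) * nucut h y \<le> h\<^sup>2 * (min 1 ((norm y / h)\<^sup>2) * nu y)"
    proof (cases "norm y \<le> h")
      case True
      have "(norm y / h)\<^sup>2 \<le> 1" using True g(1) by (intro power_le_one) auto
      then have "h\<^sup>2 * min 1 ((norm y / h)\<^sup>2) = (norm y)\<^sup>2" using g(1) by (simp add: min_def power_divide)
      then have e: "h\<^sup>2 * (min 1 ((norm y / h)\<^sup>2) * nu y) = (norm y)\<^sup>2 * nu y" by (simp only: mult.assoc[symmetric])
      show ?thesis unfolding e using True nu_nonneg[of y] by (auto simp: nucut_def intro!: mult_right_mono)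
    qed (use nu_nonneg in \<open>auto simp: nucut_def\<close>)
  qed
  then have "(LINT y|lborel. min 1 ((norm y)\<^sup>2) * nucut h y) \<le> h\<^sup>2 * (LINT y|lborel. min 1 ((norm y / h)\<^sup>2) * nu y)"
    by simp
  then have "t * (LINT y|lborel. min 1 ((norm y)\<^sup>2) * nucut h y) \<le> t * (h\<^sup>2 * (LINT y|lborel. min 1 ((norm y / h)\<^sup>2) * nu y))"
    using g(3) by (intro mult_left_mono) auto
  also have "\<dots> = h\<^sup>2 * (t * (LINT y|lborel. min 1 ((norm y / h)\<^sup>2) * nu y))" by (rule mult.left_commute)
  also have "\<dots> \<le> h\<^sup>2 * c" by (intro mult_left_mono g(6)) simp
  finally show ?thesis by (simp add: mult.commute)
qed

text \<open>A bound for the displacement \<open>t * norm (bcut h)\<close>. It is bounded but not of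
  order \<open>h\<close>, so the tail estimates start only at distances beyond it.\<close>

definition drift :: real where
  "drift = c * norm b + c"

lemma drift_nonneg: "0 \<le> drift" using c by (simp add: drift_def)

lemma bcut_bound:
  assumes "good_scale t h"
  shows "t * norm (bcut h) \<le> drift"
proof -
  note g = good_scaleD[OF assms]
  have "norm (LINT y|lborel. (indicator (- cball 0 h) y * nu y * indicator (ball 0 1) y) *\<^sub>R y) \<le>
    (LINT y|lborel. norm ((indicator (- cball 0 h) y * nu y * indicator (ball 0 1) y) *\<^sub>R y))"
    by (rule integral_norm_bound)
  also have "\<dots> \<le> mass h" unfolding mass_def
  proof (rule integral_mono'[OF integrable_nubar[OF g(1)] _ nubar_nonneg])
    fix y :: 'a
    show "norm ((indicator (- cball 0 h) y * nu y * indicator (ball 0 1) y) *\<^sub>R y) \<le> nubar h y"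
      using nu_nonneg[of y] by (auto simp: nubar_def indicator_def dist_norm intro!: mult_left_le)
  qed
  finally have "norm (bcut h) \<le> norm b + mass h"
    unfolding bcut_def using norm_triangle_ineq4 by (smt (verit))
  then have "t * norm (bcut h) \<le> t * norm b + t * mass h"
    using g(3) mult_left_mono[of "norm (bcut h)" "norm b + mass h" t] by (simp add: distrib_left)
  also have "\<dots> \<le> c * norm b + c" using g(4) by (intro add_mono mult_right_mono mass_bound[OF assms]) auto
  finally show ?thesis by (simp add: drift_def)
qed

text \<open>When \<open>norm \<eta>\<close> is of order \<open>1 / h\<close>, every term of the
  exponent except the drift stays bounded; \<open>h\<close> is therefore the right scale for
  Chernoff's bound.\<close>

lemma cut_mgf_bound:
  assumes gs: "good_scale t h"
  shows "cut_mgf h t \<eta> \<le> exp (drift * norm \<eta> + c * h\<^sup>2 * (norm \<eta>)\<^sup>2 + (1 + (norm \<eta>)\<^sup>2) * exp (norm \<eta> * h) * (c * h\<^sup>2))"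
proof -
  note g = good_scaleD[OF gs]
  let ?I = "LINT y|lborel. nucut h y * (1 - exp (\<eta> \<bullet> y) + (\<eta> \<bullet> y) * indicator (ball 0 1) y)"
  let ?J = "LINT y|lborel. min 1 ((norm y)\<^sup>2) * nucut h y"
  let ?K = "(1 + (norm \<eta>)\<^sup>2) * exp (norm \<eta> * h)"
  have "- t * psi_tilde (bcut h) A (nucut h) \<eta> = t * (\<eta> \<bullet> bcut h) + t * (\<eta> \<bullet> A \<eta>) - t * ?I"
    by (simp add: psi_tilde_def algebra_simps)
  also have "\<dots> \<le> drift * norm \<eta> + c * h\<^sup>2 * (norm \<eta>)\<^sup>2 + ?K * (c * h\<^sup>2)"
  proof -
    have "t * (\<eta> \<bullet> bcut h) \<le> t * (norm \<eta> * norm (bcut h))" using g(3) by (intro mult_left_mono norm_cauchy_schwarz) auto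
    also have "\<dots> = (t * norm (bcut h)) * norm \<eta>" by simp
    also have "\<dots> \<le> drift * norm \<eta>" by (intro mult_right_mono bcut_bound[OF gs]) auto
    finally have 1: "t * (\<eta> \<bullet> bcut h) \<le> drift * norm \<eta>" .
    have "\<bar>?I\<bar> \<le> ?K * ?J" by (rule psi_tilde_integral_bound[OF nucut_levy nucut_supp])
    then have "- (t * ?I) \<le> t * (?K * ?J)" using g(3) by (smt (verit) mult_left_mono mult_minus_right)
    also have "\<dots> = ?K * (t * ?J)" by (simp only: mult_ac)
    also have "\<dots> \<le> ?K * (c * h\<^sup>2)" by (intro mult_left_mono second_moment_bound[OF gs]) auto
    finally have 2: "- (t * ?I) \<le> ?K * (c * h\<^sup>2)" .
    show ?thesis using 1 2 g(8)[of \<eta>] by linarith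
  qed
  finally show ?thesis unfolding cut_mgf_def by simp
qed

text \<open>The weight \<open>norm \<xi>\<close> controls frequencies beyond 1; below, the modulus
  is at most 1 on a ball of finite volume.\<close>

lemma full_phi_integrable:
  assumes "good_scale t h"
  shows "integrable lborel (\<lambda>\<xi>. norm \<xi> * norm (full_phi t \<xi>))" "integrable lborel (full_phi t)"
    "(LINT \<xi>|lborel. norm \<xi> * norm (full_phi t \<xi>)) \<le> c / h ^ (DIM('a) + 1)"
proof -
  note g = good_scaleD[OF assms]
  show i1: "integrable lborel (\<lambda>\<xi>. norm \<xi> * norm (full_phi t \<xi>))"
    by (rule integrableI_bounded) (use g(5) in \<open>auto simp: abs_mult intro: le_less_trans\<close>)
  have "ennreal (LINT \<xi>|lborel. norm \<xi> * norm (full_phi t \<xi>)) \<le> ennreal (c / h ^ (DIM('a) + 1))"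
    using g(5) by (subst nn_integral_eq_integral[OF i1, symmetric]) auto
  then show "(LINT \<xi>|lborel. norm \<xi> * norm (full_phi t \<xi>)) \<le> c / h ^ (DIM('a) + 1)"
    using c g(1) by (subst (asm) ennreal_le_iff) auto
  have i2: "integrable lborel (\<lambda>\<xi>::'a. indicator (cball 0 1) \<xi> :: real)"
    using emeasure_bounded_finite[of "cball (0::'a) 1"] by (intro integrable_real_indicator) auto
  show "integrable lborel (full_phi t)"
  proof (rule Bochner_Integration.integrable_bound[OF Bochner_Integration.integrable_add[OF i1 i2]])
    show "AE \<xi> in lborel. norm (full_phi t \<xi>) \<le> norm (norm \<xi> * norm (full_phi t \<xi>) + indicator (cball 0 1) \<xi>)"
    proof (rule AE_I2)
      fix \<xi> :: 'a
      show "norm (full_phi t \<xi>) \<le> norm (norm \<xi> * norm (full_phi t \<xi>) + indicator (cball 0 1) \<xi>)"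
      proof (cases "norm \<xi> \<le> 1")
        case True
        then show ?thesis using norm_full_phi_le_1[of t \<xi>] g(3) by (simp add: abs_of_nonneg add_increasing)
      next
        case False
        then show ?thesis using mult_right_mono[of 1 "norm \<xi>" "norm (full_phi t \<xi>)"] by simp
      qed
    qed
  qed measurable
qed

lemma cut_phi_integrable:
  assumes "good_scale t h" "0 < \<rho>"
  shows "integrable lborel (cut_phi \<rho> t)" "integrable lborel (\<lambda>\<xi>. norm \<xi> * norm (cut_phi \<rho> t \<xi>))"
    "(LINT \<xi>|lborel. norm \<xi> * norm (cut_phi \<rho> t \<xi>)) \<le> exp (2 * t * mass \<rho>) * (c / h ^ (DIM('a) + 1))"
proof -
  note g = good_scaleD[OF assms(1)] and i = full_phi_integrable[OF assms(1)]
  have le: "norm (cut_phi \<rho> t \<xi>) \<le> exp (2 * t * mass \<rho>) * norm (full_phi t \<xi>)" for \<xi>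
    using assms(2) g(3) by (intro norm_cut_phi_le) auto
  show "integrable lborel (cut_phi \<rho> t)"
    by (rule Bochner_Integration.integrable_bound[where f="\<lambda>\<xi>. exp (2 * t * mass \<rho>) * norm (full_phi t \<xi>)"])
       (use i(2) le in auto)
  have le': "norm \<xi> * norm (cut_phi \<rho> t \<xi>) \<le> exp (2 * t * mass \<rho>) * (norm \<xi> * norm (full_phi t \<xi>))" for \<xi>
    using mult_left_mono[OF le[of \<xi>], of "norm \<xi>"] by (simp add: mult_ac)
  show i2: "integrable lborel (\<lambda>\<xi>. norm \<xi> * norm (cut_phi \<rho> t \<xi>))"
    by (rule Bochner_Integration.integrable_bound[where f="\<lambda>\<xi>. exp (2 * t * mass \<rho>) * (norm \<xi> * norm (full_phi t \<xi>))"])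
       (use i(1) le' in auto)
  have "(LINT \<xi>|lborel. norm \<xi> * norm (cut_phi \<rho> t \<xi>)) \<le> (LINT \<xi>|lborel. exp (2 * t * mass \<rho>) * (norm \<xi> * norm (full_phi t \<xi>)))"
    using i(1) i2 le' by (intro integral_mono) auto
  also have "\<dots> \<le> exp (2 * t * mass \<rho>) * (c / h ^ (DIM('a) + 1))"
    using mult_left_mono[OF i(3), of "exp (2 * t * mass \<rho>)"] by simp
  finally show "(LINT \<xi>|lborel. norm \<xi> * norm (cut_phi \<rho> t \<xi>)) \<le> exp (2 * t * mass \<rho>) * (c / h ^ (DIM('a) + 1))" .
qed

lemma cut_mgf_kernel:
  assumes "good_scale t h" "0 < \<rho>"
  shows "mgf_kernel (cut_phi \<rho> t) (cut_mgf \<rho> t)"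
  unfolding cut_phi_def[abs_def] cut_mgf_def[abs_def]
  using good_scaleD(3)[OF assms(1)] cut_phi_integrable(1)[OF assms]
  by (intro mgf_kernel_levy[OF _ A nucut_levy nucut_supp]) (auto simp: cut_phi_def[abs_def])

lemma kern_nonneg: "good_scale t h \<Longrightarrow> 0 < \<rho> \<Longrightarrow> 0 \<le> kern \<rho> t x"
  unfolding kern_def by (rule mgf_kernelD(2)[OF cut_mgf_kernel])

text \<open>The tilt points towards \<open>x\<close> and has length \<open>k / h\<close>. The
  pointwise bound then controls \<open>a * h ^ ?d\<close> or its power of order
  \<open>?d + 1\<close>, depending on which term of the minimum is smaller.\<close>

lemma kern_h_bound:
  assumes m: "0 \<le> m"
  shows "\<exists>C>0. \<forall>t h x. good_scale t h \<longrightarrow> x \<noteq> 0 \<longrightarrow> drift \<le> norm x \<longrightarrow>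
    kern h t x * h ^ DIM('a) \<le> C * exp (- (m / h) * (norm x - drift))"
proof -
  let ?d = "DIM('a)"
  define \<omega> where "\<omega> = unit_ball_vol (real ?d)"
  have \<omega>: "0 < \<omega>" by (simp add: \<omega>_def)
  define g where "g = exp (2 * c) * c"
  have g: "0 < g" using c by (simp add: g_def)
  \<comment> \<open>The factor \<open>?d + 1\<close> pays for the root of order
    \<open>?d + 1\<close> taken when the Lipschitz radius is the smaller one.\<close>
  define k where "k = real (?d + 1) * m"
  have k: "0 \<le> k" using m by (simp add: k_def)
  define Ck where "Ck = exp (c * k\<^sup>2 + (1 + k\<^sup>2) * exp k * c + k)"
  have Ck: "0 < Ck" by (simp add: Ck_def)
  define C where "C = 1 + 2 * Ck / \<omega> + 2 * (2 * g) ^ ?d * Ck / \<omega>"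
  have C1: "1 \<le> C" "2 * Ck / \<omega> \<le> C" "2 * (2 * g) ^ ?d * Ck / \<omega> \<le> C" using \<omega> Ck g by (auto simp: C_def)
  have "kern h t x * h ^ ?d \<le> C * exp (- (m / h) * (norm x - drift))"
    if gs: "good_scale t h" and x: "x \<noteq> 0" "drift \<le> norm x" for t h x
  proof -
    note s = good_scaleD[OF gs]
    define a where "a = kern h t x"
    define Y where "Y = exp (- (m / h) * (norm x - drift))"
    have Y: "0 < Y" "Y \<le> 1" using m s(1) x(2) by (auto simp: Y_def)
    have a: "0 \<le> a" unfolding a_def by (rule kern_nonneg[OF gs s(1)])
    define G where "G = g / h ^ (?d + 1)"
    have G: "0 < G" using g s(1) by (simp add: G_def)
    note mk = cut_mgf_kernel[OF gs s(1)]
    have lip: "\<bar>ift (cut_phi h t) x - ift (cut_phi h t) y\<bar> \<le> G * norm (x - y)" for x y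
    proof -
      have "exp (2 * t * mass h) * (c / h ^ (?d + 1)) \<le> exp (2 * c) * (c / h ^ (?d + 1))"
        using mass_bound[OF gs] c s(1) by (intro mult_right_mono) auto
      then have "(LINT \<xi>|lborel. norm \<xi> * norm (cut_phi h t \<xi>)) \<le> G"
        using cut_phi_integrable(3)[OF gs s(1)] by (simp add: G_def g_def)
      then have "norm (x - y) * (LINT \<xi>|lborel. norm \<xi> * norm (cut_phi h t \<xi>)) \<le> norm (x - y) * G"
        by (rule mult_left_mono) simp
      then show ?thesis using ift_lipschitz[OF cut_phi_integrable(1,2)[OF gs s(1)], of x y] by (simp add: mult.commute)
    qed
    define \<eta> where "\<eta> = (k / (h * norm x)) *\<^sub>R x"
    have n\<eta>: "norm \<eta> = k / h" using k s(1) x(1) by (simp add: \<eta>_def)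
    have i\<eta>: "\<eta> \<bullet> x = k / h * norm x" using x(1) by (simp add: \<eta>_def dot_square_norm power2_eq_square)
    have "a / 2 * (\<omega> * (min (a / (2 * G)) h) ^ ?d) \<le> cut_mgf h t \<eta> * exp (- (\<eta> \<bullet> x) + norm \<eta> * h)"
      using mgf_kernel_pointwise_bound[OF mk G lip s(1), of x \<eta>] by (simp add: a_def kern_def \<omega>_def)
    also have "\<dots> \<le> exp (drift * norm \<eta> + c * h\<^sup>2 * (norm \<eta>)\<^sup>2 + (1 + (norm \<eta>)\<^sup>2) * exp (norm \<eta> * h) * (c * h\<^sup>2))
        * exp (- (\<eta> \<bullet> x) + norm \<eta> * h)"
      by (intro mult_right_mono cut_mgf_bound gs) auto
    also have "\<dots> \<le> Ck * Y ^ (?d + 1)"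
    proof -
      have e1: "c * h\<^sup>2 * (norm \<eta>)\<^sup>2 = c * k\<^sup>2" using s(1) by (simp add: n\<eta> power_divide)
      have "(1 + (norm \<eta>)\<^sup>2) * (c * h\<^sup>2) = c * (h\<^sup>2 + k\<^sup>2)" using s(1) by (simp add: n\<eta> power_divide field_simps)
      also have "\<dots> \<le> c * (1 + k\<^sup>2)" using c s(1,2) by (intro mult_left_mono add_right_mono power_le_one) auto
      finally have "(1 + (norm \<eta>)\<^sup>2) * (c * h\<^sup>2) * exp k \<le> c * (1 + k\<^sup>2) * exp k" by (intro mult_right_mono) auto
      then have e2: "(1 + (norm \<eta>)\<^sup>2) * exp (norm \<eta> * h) * (c * h\<^sup>2) \<le> (1 + k\<^sup>2) * exp k * c"
        using s(1) by (simp add: n\<eta> mult_ac)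
      have e3: "drift * norm \<eta> - \<eta> \<bullet> x = real (?d + 1) * (- (m / h) * (norm x - drift))"
        using s(1) by (simp add: n\<eta> i\<eta> k_def field_simps)
      have e4: "norm \<eta> * h = k" using s(1) by (simp add: n\<eta>)
      have "drift * norm \<eta> + c * h\<^sup>2 * (norm \<eta>)\<^sup>2 + (1 + (norm \<eta>)\<^sup>2) * exp (norm \<eta> * h) * (c * h\<^sup>2) + (- (\<eta> \<bullet> x) + norm \<eta> * h)
        \<le> (c * k\<^sup>2 + (1 + k\<^sup>2) * exp k * c + k) + real (?d + 1) * (- (m / h) * (norm x - drift))"
        using e1 e2 e3 e4 by linarith
      then show ?thesis unfolding exp_add[symmetric] Ck_def Y_def exp_of_nat_mult[symmetric] by (simp only: exp_le_cancel_iff)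
    qed
    finally have key: "a / 2 * (\<omega> * (min (a / (2 * G)) h) ^ ?d) \<le> Ck * Y ^ (?d + 1)" .
    have "a * h ^ ?d \<le> C * Y"
    proof (cases "h \<le> a / (2 * G)")
      case True
      then have "min (a / (2 * G)) h = h" by simp
      then have "a * h ^ ?d \<le> 2 * Ck / \<omega> * Y ^ (?d + 1)" using key \<omega> by (simp add: field_simps)
      also have "\<dots> \<le> C * Y ^ 1" using Y C1 \<omega> Ck by (intro mult_mono power_decreasing) auto
      finally show ?thesis by simp
    next
      case False
      then have "a / 2 * (\<omega> * (a / (2 * G)) ^ ?d) \<le> Ck * Y ^ (?d + 1)" using key by (simp add: min_def)
      \<comment> \<open>Inserting \<open>G = g / h ^ (?d + 1)\<close> collects all powers of
        \<open>h\<close> into one power of \<open>a * h ^ ?d\<close>.\<close>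
      moreover have "a / 2 * (\<omega> * (a / (2 * G)) ^ ?d) = \<omega> / (2 * (2 * g) ^ ?d) * (a * h ^ ?d) ^ (?d + 1)"
        using g s(1) by (simp add: G_def power_divide power_mult_distrib power_mult[symmetric] power_add field_simps)
      ultimately have "\<omega> / (2 * (2 * g) ^ ?d) * (a * h ^ ?d) ^ (?d + 1) \<le> Ck * Y ^ (?d + 1)"
        by (simp only:)
      moreover have "\<omega> / D * Z \<le> Ck * q \<Longrightarrow> 0 < D \<Longrightarrow> Z \<le> D * Ck / \<omega> * q" for D Z q
        using \<omega> by (simp add: field_simps)
      ultimately have "(a * h ^ ?d) ^ (?d + 1) \<le> 2 * (2 * g) ^ ?d * Ck / \<omega> * Y ^ (?d + 1)"
        using g by auto
      also have "\<dots> \<le> C * Y ^ (?d + 1)" using Y C1 by (intro mult_right_mono) auto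
      also have "\<dots> \<le> C ^ (?d + 1) * Y ^ (?d + 1)"
        using Y C1(1) power_increasing[of 1 "?d + 1" C] by (intro mult_right_mono) auto
      also have "\<dots> = (C * Y) ^ (?d + 1)" by (simp only: power_mult_distrib)
      finally have "(a * h ^ ?d) ^ Suc ?d \<le> (C * Y) ^ Suc ?d" by (simp only: Suc_eq_plus1)
      then show ?thesis by (rule power_le_imp_le_base) (use C1 Y in auto)
    qed
    then show ?thesis by (simp add: a_def Y_def)
  qed
  then show ?thesis using C1 by (intro exI[of _ C]) auto
qed

text \<open>Decay in \<open>norm x / h\<close> leaves room for a power of
  \<open>exp (- (1 / h))\<close>, which is below the same power of \<open>h\<close>:
  \<open>h ^ ?d\<close> cancels the prefactor, and \<open>h\<^sup>2 \<le> c * t\<close> produces the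
  factor \<open>t\<close>.\<close>

lemma kern_h_tail:
  assumes m: "0 \<le> m"
  shows "\<exists>C>0. \<forall>t h x. good_scale t h \<longrightarrow> 2 * drift + 1 \<le> norm x \<longrightarrow> kern h t x \<le> C * t * exp (- m * norm x)"
proof -
  let ?d = "DIM('a)"
  \<comment> \<open>The factor 2 compensates for \<open>norm x - drift \<ge> norm x / 2\<close>; the
    summand \<open>?d + 2\<close> supplies the powers of \<open>h\<close>.\<close>
  define m' where "m' = 2 * (m + real (?d + 2))"
  have m': "0 \<le> m'" using m by (simp add: m'_def)
  obtain C where C: "0 < C" "\<And>t h x. good_scale t h \<Longrightarrow> x \<noteq> 0 \<Longrightarrow> drift \<le> norm x \<Longrightarrow>
    kern h t x * h ^ ?d \<le> C * exp (- (m' / h) * (norm x - drift))" using kern_h_bound[OF m'] by blast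
  have "kern h t x \<le> (C * c) * t * exp (- m * norm x)" if gs: "good_scale t h" and x: "2 * drift + 1 \<le> norm x" for t h x
  proof -
    note s = good_scaleD[OF gs]
    have nx: "1 \<le> norm x" "norm x / 2 \<le> norm x - drift" "x \<noteq> 0" "drift \<le> norm x" using x drift_nonneg by auto
    have "kern h t x * h ^ ?d \<le> C * exp (- (m' / h) * (norm x - drift))" by (rule C(2)[OF gs nx(3,4)])
    also have "\<dots> \<le> C * exp (- m * norm x + real (?d + 2) * (- (1 / h)))"
    proof (intro mult_left_mono)
      have "(m' / h) * (norm x / 2) \<le> (m' / h) * (norm x - drift)" using m' s(1) nx by (intro mult_left_mono) auto
      moreover have "(m' / h) * (norm x / 2) = m * (norm x / h) + real (?d + 2) * (norm x / h)"
        using s(1) by (simp add: m'_def field_simps)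
      moreover have "m * norm x \<le> m * (norm x / h)"
        using m s(1,2) mult_left_mono[of h 1 "norm x"] by (intro mult_left_mono) (auto simp: field_simps)
      moreover have "real (?d + 2) * (1 / h) \<le> real (?d + 2) * (norm x / h)"
        using s(1) nx by (intro mult_left_mono divide_right_mono) auto
      ultimately show "exp (- (m' / h) * (norm x - drift)) \<le> exp (- m * norm x + real (?d + 2) * (- (1 / h)))" by simp
    qed (use C in auto)
    also have "exp (- m * norm x + real (?d + 2) * (- (1 / h))) = exp (- m * norm x) * exp (- (1 / h)) ^ (?d + 2)"
      by (simp only: exp_add exp_of_nat_mult)
    also have "C * \<dots> \<le> C * (exp (- m * norm x) * h ^ (?d + 2))"
    proof (intro mult_left_mono power_mono)
      have "1 / h \<le> exp (1 / h)" using exp_ge_add_one_self[of "1 / h"] by linarith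
      then show "exp (- (1 / h)) \<le> h" using s(1) by (simp add: exp_minus field_simps)
    qed (use C in auto)
    finally have "kern h t x * h ^ ?d \<le> (C * exp (- m * norm x) * h\<^sup>2) * h ^ ?d" by (simp only: power_add mult_ac)
    then have "kern h t x \<le> C * exp (- m * norm x) * h\<^sup>2" using s(1) by (simp add: mult_le_cancel_right)
    also have "\<dots> \<le> C * exp (- m * norm x) * (c * t)" using C s(7) by (intro mult_left_mono) auto
    finally show ?thesis by (simp only: mult_ac)
  qed
  then show ?thesis using C c by (intro exI[of _ "C * c"]) auto
qed

end

lemma power_le_fact_exp: "0 \<le> x \<Longrightarrow> x ^ p \<le> fact p * exp x" for x :: real
proof -
  assume x: "0 \<le> x"
  have s: "summable (\<lambda>k. x ^ k / fact k)" "suminf (\<lambda>k. x ^ k / fact k) = exp x"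
    using exp_converges[of x] by (auto simp: sums_iff divide_inverse mult.commute)
  have "(\<Sum>k\<in>{p}. x ^ k / fact k) \<le> suminf (\<lambda>k. x ^ k / fact k)"
    using x s(1) by (intro sum_le_suminf) auto
  then show ?thesis using s(2) by (simp add: field_simps)
qed

section \<open>Restoring the jumps between the scale \<open>h\<close> and the cut radius
  \<open>R\<close>\<close>

context levy_heat
begin

definition mid :: "real \<Rightarrow> real \<Rightarrow> 'a \<Rightarrow> real" where
  "mid h R y = indicator (cball 0 R - cball 0 h) y * nu y"

lemma mid_measurable [measurable]: "mid h R \<in> borel_measurable borel"
  unfolding mid_def[abs_def] by measurable

lemma mid_nonneg: "0 \<le> mid h R y"
  using nu_nonneg by (simp add: mid_def indicator_def)

lemma mid_integrable: "0 < h \<Longrightarrow> integrable lborel (mid h R)"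
  by (rule Bochner_Integration.integrable_bound[OF integrable_nubar])
     (auto simp: mid_def nubar_def indicator_def)

lemma mid_mass_le: "0 < h \<Longrightarrow> (LINT y|lborel. mid h R y) \<le> mass h"
  unfolding mass_def using nu_nonneg
  by (intro integral_mono mid_integrable integrable_nubar) (auto simp: mid_def nubar_def indicator_def)

lemma cut_phi_split:
  assumes h: "0 < h" "h \<le> 1" and R: "1 \<le> R"
  shows "cut_phi R t \<xi> = complex_of_real (exp (- t * (LINT y|lborel. mid h R y))) *
    (cut_phi h t \<xi> * exp (complex_of_real t * char_fun (jump_measure (mid h R)) \<xi>))"
proof -
  have e1: "(\<lambda>y. indicator (- cball 0 h) y * nucut R y) = mid h R"
    by (auto simp: fun_eq_iff mid_def nucut_def indicator_def)
  have e2: "(\<lambda>y. indicator (cball 0 h) y * nucut R y) = nucut h"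
    using h R by (auto simp: fun_eq_iff nucut_def indicator_def)
  have z: "(\<lambda>y::'a. (indicator (- cball 0 R) y * nu y * indicator (ball 0 1) y) *\<^sub>R y) = (\<lambda>y. 0)"
    using R by (auto simp: fun_eq_iff indicator_def)
  \<comment> \<open>The compensator sees only jumps inside the unit ball, so a cut at
    \<open>R \<ge> 1\<close> does not change the drift.\<close>
  have bR: "bcut R = b" by (simp only: bcut_def z) simp
  have e3: "(\<lambda>y. (indicator (- cball 0 h) y * nucut R y * indicator (ball 0 1) y) *\<^sub>R y) =
    (\<lambda>y. (indicator (- cball 0 h) y * nu y * indicator (ball 0 1) y) *\<^sub>R y)"
    using R by (auto simp: fun_eq_iff nucut_def indicator_def)
  have "integrable lborel (\<lambda>y. indicator (- cball 0 h) y * nucut R y)"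
    unfolding e1 by (rule mid_integrable[OF h(1)])
  from levy_psi_split[OF nucut_levy _ this, of "bcut R" A \<xi>]
  have "levy_psi (bcut R) A (nucut R) \<xi> = levy_psi (bcut h) A (nucut h) \<xi> +
    (complex_of_real (LINT y|lborel. mid h R y) - char_fun (jump_measure (mid h R)) \<xi>)"
    unfolding e1 e2 e3 by (simp add: bR bcut_def[of h])
  then have "- complex_of_real t * levy_psi (bcut R) A (nucut R) \<xi> = complex_of_real (- t * (LINT y|lborel. mid h R y)) +
    (- complex_of_real t * levy_psi (bcut h) A (nucut h) \<xi> + complex_of_real t * char_fun (jump_measure (mid h R)) \<xi>)"
    by (simp only:) (simp add: algebra_simps)
  then show ?thesis unfolding cut_phi_def by (simp only: exp_add exp_of_real)
qed

text \<open>Since \<open>h \<le> 1\<close>, the bound of \<open>cut_mgf_bound\<close> at tilts of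
  fixed length \<open>q\<close> can be made independent of \<open>t\<close> and
  \<open>h\<close>.\<close>

lemma kern_h_moment:
  assumes m: "0 \<le> m"
  shows "\<exists>C>0. \<forall>t h. good_scale t h \<longrightarrow> (\<integral>\<^sup>+ z. ennreal (exp (m * norm z) * kern h t z) \<partial>lborel) \<le> ennreal C"
proof -
  define q where "q = m * real DIM('a)"
  have q: "0 \<le> q" using m by (simp add: q_def)
  define E where "E = exp (drift * q + c * q\<^sup>2 + (1 + q\<^sup>2) * exp q * c)"
  have E: "0 < E" by (simp add: E_def)
  have "(\<integral>\<^sup>+ z. ennreal (exp (m * norm z) * kern h t z) \<partial>lborel) \<le> ennreal (real DIM('a) * (2 * E))" if gs: "good_scale t h" for t h
  proof -
    note s = good_scaleD[OF gs]
    have le: "cut_mgf h t \<eta> \<le> E" if "norm \<eta> = q" for \<eta>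
    proof -
      have "h\<^sup>2 \<le> 1" using s by (intro power_le_one) auto
      then have "c * h\<^sup>2 * q\<^sup>2 \<le> c * 1 * q\<^sup>2" "c * h\<^sup>2 \<le> c * 1" using c by (intro mult_right_mono mult_left_mono; simp)+
      moreover have "q * h \<le> q * 1" using q s by (intro mult_left_mono) auto
      then have "exp (q * h) \<le> exp q" by simp
      then have "(1 + q\<^sup>2) * exp (q * h) * (c * h\<^sup>2) \<le> (1 + q\<^sup>2) * exp q * c"
        using \<open>c * h\<^sup>2 \<le> c * 1\<close> c by (intro mult_mono) auto
      ultimately show ?thesis using cut_mgf_bound[OF gs, of \<eta>] unfolding that E_def
        by (elim order_trans) simp
    qed
    have "(\<integral>\<^sup>+ z. ennreal (exp (m * norm z) * kern h t z) \<partial>lborel) \<le>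
      ennreal (\<Sum>b\<in>Basis. cut_mgf h t (0 + (m * DIM('a)) *\<^sub>R b) + cut_mgf h t (0 - (m * DIM('a)) *\<^sub>R b))"
      using nn_integral_exp_norm_le[OF cut_mgf_kernel[OF gs s(1)] m, of 0] by (simp add: kern_def)
    also have "\<dots> \<le> ennreal (\<Sum>b\<in>(Basis::'a set). 2 * E)"
    proof (intro ennreal_leI sum_mono)
      fix b :: 'a assume "b \<in> Basis"
      then have "cut_mgf h t (0 + (m * DIM('a)) *\<^sub>R b) \<le> E" "cut_mgf h t (0 - (m * DIM('a)) *\<^sub>R b) \<le> E"
        using m by (intro le; simp add: q_def)+
      then show "cut_mgf h t (0 + (m * DIM('a)) *\<^sub>R b) + cut_mgf h t (0 - (m * DIM('a)) *\<^sub>R b) \<le> 2 * E" by simp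
    qed
    finally show ?thesis by simp
  qed
  moreover have "0 < real DIM('a) * (2 * E)" using E by simp
  ultimately show ?thesis by blast
qed

text \<open>Let \<open>n' + 1\<close> intermediate jumps add up to \<open>z\<close>. If
  \<open>norm z < 1\<close>, the kernel at scale \<open>h\<close> still has to cover most of the
  distance and brings the factor \<open>t\<close>. Otherwise \<open>conv_pow_bound\<close> applies;
  it contains only \<open>n'\<close> powers of the jump mass, so one of the \<open>n' + 1\<close>
  factors \<open>t\<close> is left over. The threshold exceeds that of \<open>kern_h_tail\<close> by
  1 to leave room for the first case.\<close>

lemma kern_tail:
  assumes R: "1 \<le> R" and m: "0 \<le> m"
  shows "\<exists>C>0. \<forall>t h x. good_scale t h \<longrightarrow> 2 * drift + 2 \<le> norm x \<longrightarrow> kern R t x \<le> C * t * exp (- m * norm x)"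
proof -
  let ?d = "DIM('a)"
  obtain C1 where C1: "0 < C1" "\<And>t h x. good_scale t h \<Longrightarrow> 2 * drift + 1 \<le> norm x \<Longrightarrow> kern h t x \<le> C1 * t * exp (- m * norm x)"
    using kern_h_tail[OF m] by blast
  obtain Cf where Cf: "0 < Cf" "\<And>s. 0 < s \<Longrightarrow> s \<le> R \<Longrightarrow> f s * s ^ (?d + 2) \<le> Cf"
    using f_power_bound[of R] R by (auto simp del: power_add)
  obtain Cm where Cm: "0 < Cm" "\<And>t h. good_scale t h \<Longrightarrow> (\<integral>\<^sup>+ z. ennreal (exp (m * norm z) * kern h t z) \<partial>lborel) \<le> ennreal Cm"
    using kern_h_moment[OF m] by blast
  \<comment> \<open>The summands of \<open>H\<close> belong to the cases \<open>norm z < 1\<close>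
    and \<open>norm z \<ge> 1\<close>. Per jump, \<open>q\<close> collects \<open>c\<close> from
    \<open>t * lam\<close>, \<open>exp (m * R)\<close> from the support radius and
    \<open>exp 1\<close> from absorbing a power of the number of jumps.\<close>
  define H where "H = C1 * exp m + C0 * Cf * Cm * fact (?d + 3)"
  define q where "q = c * exp (m * R) * exp 1"
  have H: "0 < H" unfolding H_def using C1 Cf Cm C0_pos by (intro add_pos_nonneg) auto
  have eR: "1 \<le> exp (m * R)" "1 \<le> exp (1::real)" using m R by auto
  have q: "c \<le> q" "0 \<le> q"
    using c eR mult_mono[OF eR] by (auto simp: q_def mult.assoc intro: order_trans[of _ "c * 1"])
  have "kern R t x \<le> (H * exp q) * t * exp (- m * norm x)" if gs: "good_scale t h" and x: "2 * drift + 2 \<le> norm x" for t h x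
  proof -
    note s = good_scaleD[OF gs]
    define lam where "lam = (LINT y|lborel. mid h R y)"
    have lam0: "0 \<le> lam" unfolding lam_def using mid_nonneg by (intro integral_nonneg_AE) auto
    have tl: "t * lam \<le> c"
      unfolding lam_def by (rule order_trans[OF mult_left_mono[OF mid_mass_le[OF s(1)]] mass_bound[OF gs]]) (use s(3) in auto)
    note wctx = mid_measurable[of h R] mid_nonneg[of h R] mid_integrable[OF s(1), of R] lam_def
    note cphi = cut_phi_integrable(1)[OF gs s(1)]
    have u0: "0 \<le> ift (cut_phi h t) x" for x using kern_nonneg[OF gs s(1)] by (simp add: kern_def)
    have [measurable]: "kern h t \<in> borel_measurable borel" unfolding kern_def by (rule ift_borel_measurable[OF cphi])
    note [measurable] = conv_pow_measurable[OF wctx]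
    define a where "a n = ift (\<lambda>\<xi>. cut_phi h t \<xi> * char_fun (jump_measure (mid h R)) \<xi> ^ n) x" for n
    have a_sums: "(\<lambda>n. t ^ n / fact n * a n) sums (exp (t * lam) * kern R t x)"
    proof -
      have "(\<lambda>\<xi>. cut_phi h t \<xi> * exp (complex_of_real t * char_fun (jump_measure (mid h R)) \<xi>)) =
        (\<lambda>\<xi>. complex_of_real (exp (t * lam)) * cut_phi R t \<xi>)"
      proof
        fix \<xi>
        have "complex_of_real (exp (t * lam)) * cut_phi R t \<xi> = complex_of_real (exp (t * lam) * exp (- t * lam)) *
          (cut_phi h t \<xi> * exp (complex_of_real t * char_fun (jump_measure (mid h R)) \<xi>))"
          unfolding cut_phi_split[OF s(1,2) R] lam_def[symmetric] by (simp only: of_real_mult mult.assoc)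
        also have "exp (t * lam) * exp (- t * lam) = 1" by (simp add: exp_add[symmetric])
        finally show "cut_phi h t \<xi> * exp (complex_of_real t * char_fun (jump_measure (mid h R)) \<xi>) =
          complex_of_real (exp (t * lam)) * cut_phi R t \<xi>" by simp
      qed
      then show ?thesis
        using ift_exp_char_fun_sums[OF finite_measure_jump_measure[OF wctx(3,2)] _ cphi, of t x] s(3)
        by (simp only: a_def kern_def ift_cmult sets_jump_measure less_imp_le)
    qed
    define T where "T n = H * (t * exp (- m * norm x)) * (q ^ n / fact n)" for n
    have T_sums: "T sums (H * (t * exp (- m * norm x)) * exp q)"
      unfolding T_def using exp_converges[of q] by (intro sums_mult) (simp add: divide_inverse mult.commute)
    have "t ^ n / fact n * a n \<le> T n" for n
    proof (cases n)
      case 0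
      have "a 0 \<le> C1 * t * exp (- m * norm x)" using C1(2)[OF gs, of x] x by (simp add: a_def kern_def)
      also have "\<dots> \<le> H * (t * exp (- m * norm x))"
      proof -
        have "C1 * 1 \<le> C1 * exp m" using C1(1) m by (intro mult_left_mono) auto
        moreover have "0 \<le> C0 * Cf * Cm * fact (?d + 3)" using Cf(1) Cm(1) C0_pos by simp
        ultimately have "C1 \<le> H" unfolding H_def by linarith
        then have "C1 * (t * exp (- m * norm x)) \<le> H * (t * exp (- m * norm x))"
          by (rule mult_right_mono) (use s(3) in auto)
        then show ?thesis by (simp only: mult.assoc)
      qed
      finally show ?thesis by (simp add: 0 T_def)
    next
      case (Suc n')
      define N where "N = real (Suc n')"
      have N: "1 \<le> N" by (simp add: N_def)
      define P where "P = C1 * t * exp m * exp (- m * norm x)"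
      define Bn where "Bn = N ^ (?d + 3) * (C0 * Cf) * lam ^ n' * exp (m * R * N)"
      have P: "0 \<le> P" using C1(1) s(3) by (simp add: P_def)
      have Bn: "0 \<le> Bn" using C0_pos Cf(1) lam0 N by (simp add: Bn_def)
      have "ennreal (a (Suc n')) = (\<integral>\<^sup>+ z. ennreal (kern h t (x - z)) * conv_pow (mid h R) n' z \<partial>lborel)"
        using ift_char_fun_pow_conv(3)[OF wctx cphi u0, of n' x] by (simp only: a_def kern_def)
      also have "\<dots> \<le> (\<integral>\<^sup>+ z. ennreal P * conv_pow (mid h R) n' z +
          ennreal (Bn * exp (- m * norm x)) * ennreal (exp (m * norm (x - z)) * kern h t (x - z)) \<partial>lborel)"
      proof (rule nn_integral_mono)
        fix z
        have k0: "0 \<le> kern h t (x - z)" by (rule kern_nonneg[OF gs s(1)])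
        have tri: "norm x \<le> norm (x - z) + norm z" using norm_triangle_ineq[of "x - z" z] by simp
        show "ennreal (kern h t (x - z)) * conv_pow (mid h R) n' z \<le> ennreal P * conv_pow (mid h R) n' z +
          ennreal (Bn * exp (- m * norm x)) * ennreal (exp (m * norm (x - z)) * kern h t (x - z))"
        proof (cases "norm z < 1")
          case True
          have "kern h t (x - z) \<le> C1 * t * exp (- m * norm (x - z))" using True tri x by (intro C1(2)[OF gs]) auto
          also have "\<dots> \<le> C1 * t * exp (m + - m * norm x)"
          proof -
            have "m * norm x \<le> m * (norm (x - z) + 1)" using m tri True by (intro mult_left_mono) auto
            then show ?thesis using C1(1) s(3) by (intro mult_left_mono) (auto simp: algebra_simps)
          qed
          also have "\<dots> = P" by (simp only: P_def exp_add mult_ac)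
          finally have "ennreal (kern h t (x - z)) * conv_pow (mid h R) n' z \<le> ennreal P * conv_pow (mid h R) n' z"
            by (intro mult_right_mono ennreal_leI) auto
          then show ?thesis by (rule add_increasing2[rotated]) simp
        next
          case z1: False
          show ?thesis
          proof (cases "N * R < norm z")
            case True
            have "conv_pow (mid h R) n' z = 0"
              by (rule conv_pow_support[OF wctx]) (use True in \<open>auto simp: mid_def N_def simp del: of_nat_Suc\<close>)
            then show ?thesis by simp
          next
            case False
            define \<sigma> where "\<sigma> = norm z / N"
            have \<sigma>: "1 / N \<le> \<sigma>" "0 < \<sigma>" "\<sigma> \<le> R"
              using z1 N False by (auto simp: \<sigma>_def field_simps)
            have "conv_pow (mid h R) n' z \<le> ennreal (real (Suc n') * C0 * f (norm z / real (Suc n')) * lam ^ n')"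
            proof (rule conv_pow_bound[OF wctx])
              show "mid h R y \<le> C0 * f (norm y)" if "y \<noteq> 0" for y
                using nu_le_f[OF that] f_pos[of "norm y"] that C0_pos by (auto simp: mid_def indicator_def)
            qed (use f_noninc f_pos C0_pos z1 in auto)
            also have "\<dots> \<le> ennreal (Bn * exp (- m * norm z))"
            proof (rule ennreal_leI)
              \<comment> \<open>\<open>norm z \<ge> 1\<close> forces
                \<open>\<sigma> \<ge> 1 / N\<close>, so the singularity of \<open>f\<close> costs at
                most a multiple of \<open>N ^ (?d + 2)\<close>.\<close>
              have "f \<sigma> * (1 / N) ^ (?d + 2) \<le> f \<sigma> * \<sigma> ^ (?d + 2)"
                using \<sigma> N f_pos[OF \<sigma>(2)] by (intro mult_left_mono power_mono) auto
              also have "\<dots> \<le> Cf" by (rule Cf(2)[OF \<sigma>(2,3)])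
              finally have "f \<sigma> \<le> Cf * N ^ (?d + 2)" using N by (simp add: power_divide pos_divide_le_eq del: power_add)
              then have "N * C0 * f \<sigma> * lam ^ n' \<le> N * C0 * (Cf * N ^ (?d + 2)) * lam ^ n'"
                using N C0_pos lam0 by (intro mult_right_mono mult_left_mono) auto
              also have "\<dots> = N ^ (?d + 3) * (C0 * Cf) * lam ^ n' * 1"
              proof -
                have "N ^ (?d + 3) = N * N ^ (?d + 2)" by (simp add: numeral_3_eq_3 numeral_2_eq_2)
                then show ?thesis by (simp only: mult_ac mult_1_right mult_1_left)
              qed
              \<comment> \<open>On the support \<open>norm z \<le> N * R\<close>, so the inserted
                exponential is at least 1. It creates decay in \<open>norm z\<close>, which the
                exponential moment of the kernel turns into decay in \<open>norm x\<close>.\<close>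
              also have "\<dots> \<le> N ^ (?d + 3) * (C0 * Cf) * lam ^ n' * exp (m * R * N + - m * norm z)"
              proof (rule mult_left_mono)
                have "m * norm z \<le> m * (N * R)" using m False by (intro mult_left_mono) auto
                then show "1 \<le> exp (m * R * N + - m * norm z)" by (simp add: mult_ac)
                show "0 \<le> N ^ (?d + 3) * (C0 * Cf) * lam ^ n'" using N C0_pos Cf(1) lam0 by simp
              qed
              also have "\<dots> = Bn * exp (- m * norm z)" by (simp only: Bn_def exp_add mult.assoc)
              finally show "real (Suc n') * C0 * f (norm z / real (Suc n')) * lam ^ n' \<le> Bn * exp (- m * norm z)"
                by (simp only: N_def \<sigma>_def)
            qed
            finally have "ennreal (kern h t (x - z)) * conv_pow (mid h R) n' z \<le> ennreal (kern h t (x - z)) * ennreal (Bn * exp (- m * norm z))"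
              by (intro mult_left_mono) auto
            also have "\<dots> = ennreal (Bn * (exp (- m * norm z) * kern h t (x - z)))"
              using k0 Bn by (subst ennreal_mult[symmetric]) (auto simp: mult_ac)
            also have "\<dots> \<le> ennreal (Bn * (exp (- m * norm x + m * norm (x - z)) * kern h t (x - z)))"
            proof (intro ennreal_leI mult_left_mono mult_right_mono Bn k0)
              have "m * norm x \<le> m * (norm (x - z) + norm z)" using m tri by (intro mult_left_mono) auto
              then show "exp (- m * norm z) \<le> exp (- m * norm x + m * norm (x - z))" by (simp add: algebra_simps)
            qed
            also have "\<dots> = ennreal ((Bn * exp (- m * norm x)) * (exp (m * norm (x - z)) * kern h t (x - z)))"
              by (simp only: exp_add mult_ac)
            also have "\<dots> = ennreal (Bn * exp (- m * norm x)) * ennreal (exp (m * norm (x - z)) * kern h t (x - z))"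
              using k0 Bn by (intro ennreal_mult) auto
            finally show ?thesis by (rule add_increasing[rotated]) simp
          qed
        qed
      qed
      also have "\<dots> = ennreal P * (\<integral>\<^sup>+ z. conv_pow (mid h R) n' z \<partial>lborel) +
          ennreal (Bn * exp (- m * norm x)) * (\<integral>\<^sup>+ z. ennreal (exp (m * norm (x - z)) * kern h t (x - z)) \<partial>lborel)"
        by (simp add: nn_integral_add nn_integral_cmult)
      also have "\<dots> \<le> ennreal P * ennreal (lam ^ Suc n') + ennreal (Bn * exp (- m * norm x)) * ennreal Cm"
      proof (intro add_mono mult_left_mono)
        show "(\<integral>\<^sup>+ z. conv_pow (mid h R) n' z \<partial>lborel) \<le> ennreal (lam ^ Suc n')"
          by (simp only: nn_integral_conv_pow[OF wctx] order_refl)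
        show "(\<integral>\<^sup>+ z. ennreal (exp (m * norm (x - z)) * kern h t (x - z)) \<partial>lborel) \<le> ennreal Cm"
          using Cm(2)[OF gs] nn_integral_lborel_reflect[of "\<lambda>z. ennreal (exp (m * norm z) * kern h t z)" x] by simp
      qed auto
      also have "\<dots> = ennreal (P * lam ^ Suc n' + Bn * exp (- m * norm x) * Cm)"
        using P Bn lam0 Cm(1) by (simp add: ennreal_mult[symmetric] ennreal_plus[symmetric] del: ennreal_plus)
      finally have "a (Suc n') \<le> P * lam ^ Suc n' + Bn * exp (- m * norm x) * Cm"
        using P Bn lam0 Cm(1) by (subst (asm) ennreal_le_iff) auto
      then have "t ^ Suc n' / fact (Suc n') * a (Suc n') \<le> t ^ Suc n' / fact (Suc n') * (P * lam ^ Suc n' + Bn * exp (- m * norm x) * Cm)"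
        using s(3) by (intro mult_left_mono) auto
      also have "\<dots> = (t * exp (- m * norm x)) * ((C1 * exp m) * (t * lam) ^ Suc n' +
          (C0 * Cf * Cm) * (N ^ (?d + 3) * (t * lam) ^ n' * exp (m * R * N))) / fact (Suc n')"
        by (simp only: P_def Bn_def power_mult_distrib power_Suc) (simp add: field_simps)
      also have "\<dots> \<le> (t * exp (- m * norm x)) * ((C1 * exp m) * q ^ Suc n' +
          (C0 * Cf * Cm) * (fact (?d + 3) * q ^ Suc n')) / fact (Suc n')"
      proof -
        have "(t * lam) ^ Suc n' \<le> q ^ Suc n'" using tl q s(3) lam0 by (intro power_mono) auto
        moreover have "N ^ (?d + 3) * (t * lam) ^ n' * exp (m * R * N) \<le> fact (?d + 3) * q ^ Suc n'"
        proof -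
          have "N ^ (?d + 3) * (t * lam) ^ n' * exp (m * R * N) \<le> (fact (?d + 3) * exp N) * c ^ Suc n' * exp (m * R * N)"
          proof (intro mult_right_mono mult_mono)
            show "N ^ (?d + 3) \<le> fact (?d + 3) * exp N" using N by (intro power_le_fact_exp) auto
            have "(t * lam) ^ n' \<le> c ^ n'" using tl s(3) lam0 by (intro power_mono) auto
            also have "\<dots> \<le> c ^ Suc n'" using c by (intro power_increasing) auto
            finally show "(t * lam) ^ n' \<le> c ^ Suc n'" .
          qed (use s(3) lam0 in auto)
          also have "\<dots> = fact (?d + 3) * q ^ Suc n'"
          proof -
            have "exp N = exp 1 ^ Suc n'"
              unfolding N_def using exp_of_nat_mult[of "Suc n'" "1::real"] by (simp only: mult_1_right)
            moreover have "exp (m * R * N) = exp (m * R) ^ Suc n'"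
              unfolding N_def using exp_of_nat_mult[of "Suc n'" "m * R"] by (simp only: mult.commute)
            ultimately show ?thesis by (simp only: q_def power_mult_distrib mult_ac)
          qed
          finally show ?thesis .
        qed
        ultimately show ?thesis using C1(1) C0_pos Cf(1) Cm(1) s(3)
          by (intro divide_right_mono mult_left_mono add_mono) auto
      qed
      also have "\<dots> = T (Suc n')" unfolding T_def H_def by (simp add: field_simps del: fact_Suc power_Suc)
      finally show ?thesis by (simp only: Suc)
    qed
    then have "exp (t * lam) * kern R t x \<le> H * (t * exp (- m * norm x)) * exp q"
      by (intro sums_le[OF _ a_sums T_sums])
    moreover have "1 * kern R t x \<le> exp (t * lam) * kern R t x"
      using s(3) lam0 kern_nonneg[OF gs, of R x] R by (intro mult_right_mono) auto
    ultimately show ?thesis by (simp add: mult_ac)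
  qed
  then show ?thesis using H by (intro exI[of _ "H * exp q"]) auto
qed

text \<open>For fixed \<open>R\<close> the drift and the jump moment are fixed, while
  \<open>t \<le> c\<close> and \<open>h \<le> 1\<close>; tilts of fixed length then give a uniform
  bound.\<close>

lemma kern_moment:
  assumes R: "1 \<le> R"  and m: "0 \<le> m"
  shows "\<exists>C>0. \<forall>t h. good_scale t h \<longrightarrow> (\<integral>\<^sup>+ z. ennreal (exp (m * norm z) * kern R t z) \<partial>lborel) \<le> ennreal C"
proof -
  define q where "q = m * real DIM('a)"
  have q: "0 \<le> q" using m by (simp add: q_def)
  define I where "I = (LINT y|lborel. min 1 ((norm y)\<^sup>2) * nucut R y)"
  have I: "0 \<le> I" unfolding I_def using levy_densityD(2)[OF nucut_levy] by (intro integral_nonneg_AE) auto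
  define E where "E = exp (c * norm (bcut R) * q + c * q\<^sup>2 + c * ((1 + q\<^sup>2) * exp (q * R) * I))"
  have E: "0 < E" by (simp add: E_def)
  have "(\<integral>\<^sup>+ z. ennreal (exp (m * norm z) * kern R t z) \<partial>lborel) \<le> ennreal (real DIM('a) * (2 * E))" if gs: "good_scale t h" for t h
  proof -
    note s = good_scaleD[OF gs]
    have R0: "0 < R" using R by simp
    have le: "cut_mgf R t \<eta> \<le> E" if n\<eta>: "norm \<eta> = q" for \<eta>
    proof -
      let ?I = "LINT y|lborel. nucut R y * (1 - exp (\<eta> \<bullet> y) + (\<eta> \<bullet> y) * indicator (ball 0 1) y)"
      let ?K = "(1 + q\<^sup>2) * exp (q * R) * I"
      have K: "0 \<le> ?K" using I by simp
      have "t * (\<eta> \<bullet> bcut R) \<le> t * (norm \<eta> * norm (bcut R))" using s(3) by (intro mult_left_mono norm_cauchy_schwarz) auto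
      also have "\<dots> \<le> c * (norm \<eta> * norm (bcut R))" using s(4) by (intro mult_right_mono) auto
      finally have 1: "t * (\<eta> \<bullet> bcut R) \<le> c * norm (bcut R) * q" by (simp add: n\<eta> mult_ac)
      have "c * h\<^sup>2 * q\<^sup>2 \<le> c * 1 * q\<^sup>2" using c s(1,2) by (intro mult_right_mono mult_left_mono power_le_one) auto
      then have 2: "t * (\<eta> \<bullet> A \<eta>) \<le> c * q\<^sup>2" using s(8)[of \<eta>] by (simp add: n\<eta>)
      have "\<bar>?I\<bar> \<le> (1 + (norm \<eta>)\<^sup>2) * exp (norm \<eta> * R) * I"
        unfolding I_def by (rule psi_tilde_integral_bound[OF nucut_levy nucut_supp])
      then have "\<bar>?I\<bar> \<le> ?K" by (simp only: n\<eta>)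
      then have "- ?I \<le> ?K" by linarith
      then have "t * (- ?I) \<le> t * ?K" using s(3) by (intro mult_left_mono) auto
      also have "\<dots> \<le> c * ?K" using s(4) K by (intro mult_right_mono) auto
      finally have 3: "- (t * ?I) \<le> c * ?K" by simp
      have "- t * psi_tilde (bcut R) A (nucut R) \<eta> = t * (\<eta> \<bullet> bcut R) + t * (\<eta> \<bullet> A \<eta>) - t * ?I"
        by (simp add: psi_tilde_def algebra_simps)
      then show ?thesis unfolding cut_mgf_def E_def using 1 2 3 by (simp only: exp_le_cancel_iff)
    qed
    have "(\<integral>\<^sup>+ z. ennreal (exp (m * norm z) * kern R t z) \<partial>lborel) \<le>
      ennreal (\<Sum>b\<in>Basis. cut_mgf R t (0 + (m * DIM('a)) *\<^sub>R b) + cut_mgf R t (0 - (m * DIM('a)) *\<^sub>R b))"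
      using nn_integral_exp_norm_le[OF cut_mgf_kernel[OF gs R0] m, of 0] by (simp add: kern_def)
    also have "\<dots> \<le> ennreal (\<Sum>b\<in>(Basis::'a set). 2 * E)"
    proof (intro ennreal_leI sum_mono)
      fix b :: 'a assume "b \<in> Basis"
      then have "cut_mgf R t (0 + (m * DIM('a)) *\<^sub>R b) \<le> E" "cut_mgf R t (0 - (m * DIM('a)) *\<^sub>R b) \<le> E"
        using m by (intro le; simp add: q_def)+
      then show "cut_mgf R t (0 + (m * DIM('a)) *\<^sub>R b) + cut_mgf R t (0 - (m * DIM('a)) *\<^sub>R b) \<le> 2 * E" by simp
    qed
    finally show ?thesis by simp
  qed
  moreover have "0 < real DIM('a) * (2 * E)" using E by simp
  ultimately show ?thesis by blast
qed

end

section \<open>Expansion of the heat kernel in the number of large jumps\<close>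

context levy_heat
begin

definition heat :: "real \<Rightarrow> 'a \<Rightarrow> real" where
  "heat t = ift (full_phi t)"

text \<open>The truncated kernel convolved with the \<open>n\<close>-th convolution power of
  \<open>nubar R\<close>, without the Poisson weights.\<close>

definition jumps :: "real \<Rightarrow> real \<Rightarrow> nat \<Rightarrow> 'a \<Rightarrow> real" where
  "jumps R t n = ift (\<lambda>\<xi>. cut_phi R t \<xi> * char_fun (jump_measure (nubar R)) \<xi> ^ n)"

context
  fixes R t h :: real assumes R: "0 < R" and gs: "good_scale t h"
begin

lemmas nubar_facts = nubar_measurable[of R] nubar_nonneg[of R] integrable_nubar[OF R] mass_def[of R]

lemma jumps_measurable [measurable]: "jumps R t n \<in> borel_measurable borel"
  unfolding jumps_def
  by (rule ift_borel_measurable[OF integrable_mult_char_fun[OF finite_measure_jump_measure[OF nubar_facts(3,2)] _ cut_phi_integrable(1)[OF gs R]]]) simp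

lemma kern_measurable [measurable]: "kern R t \<in> borel_measurable borel"
  unfolding kern_def by (rule ift_borel_measurable[OF cut_phi_integrable(1)[OF gs R]])

lemma jumps_0: "jumps R t 0 = kern R t"
  by (simp add: jumps_def kern_def)

lemma jumps_nonneg: "0 \<le> jumps R t n x"
  unfolding jumps_def
  by (rule ift_char_fun_pow_conv(1)[OF nubar_facts cut_phi_integrable(1)[OF gs R]])
     (use kern_nonneg[OF gs R] in \<open>simp add: kern_def\<close>)

lemma jumps_Suc: "ennreal (jumps R t (Suc n) x) = (\<integral>\<^sup>+ y. ennreal (jumps R t n (x - y)) * ennreal (nubar R y) \<partial>lborel)"
  unfolding jumps_def
  by (rule ift_char_fun_pow_conv(2)[OF nubar_facts cut_phi_integrable(1)[OF gs R]])
     (use kern_nonneg[OF gs R] in \<open>simp add: kern_def\<close>)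

lemma full_phi_eq: "complex_of_real (exp (t * mass R)) * full_phi t \<xi> =
    cut_phi R t \<xi> * exp (complex_of_real t * char_fun (jump_measure (nubar R)) \<xi>)"
proof -
  have "exp (t * mass R) * exp (- t * mass R) = 1" by (simp add: exp_add[symmetric])
  then have "complex_of_real (exp (t * mass R)) * complex_of_real (exp (- t * mass R)) = 1"
    by (simp only: of_real_mult[symmetric] of_real_1)
  then show ?thesis unfolding full_phi_split[OF R, of t \<xi>] by (simp only: mult.assoc[symmetric] mult_1)
qed

lemma heat_sums: "(\<lambda>n. t ^ n / fact n * jumps R t n x) sums (exp (t * mass R) * heat t x)"
  using ift_exp_char_fun_sums[OF finite_measure_jump_measure[OF nubar_facts(3,2)] _ cut_phi_integrable(1)[OF gs R], of t x]
    good_scaleD(3)[OF gs]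
  by (simp only: full_phi_eq[symmetric] ift_cmult heat_def jumps_def sets_jump_measure less_imp_le)

lemma heat_nonneg: "0 \<le> heat t x"
proof -
  have "0 \<le> exp (t * mass R) * heat t x"
    using jumps_nonneg good_scaleD(3)[OF gs] by (intro sums_le[OF _ sums_zero heat_sums]) auto
  then show ?thesis by (simp add: zero_le_mult_iff)
qed

lemma heat_measurable [measurable]: "heat t \<in> borel_measurable borel"
  unfolding heat_def by (rule ift_borel_measurable[OF full_phi_integrable(2)[OF gs]])

text \<open>The full heat kernel convolved with the convolution square of \<open>nubar R\<close>;
  the exponent is written \<open>Suc 1\<close> to match
  \<open>ift_char_fun_pow_conv\<close>.\<close>

definition two_jumps :: "'a \<Rightarrow> real" where
  "two_jumps = ift (\<lambda>\<xi>. full_phi t \<xi> * char_fun (jump_measure (nubar R)) \<xi> ^ Suc 1)"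

lemma two_jumps_sums: "(\<lambda>n. t ^ n / fact n * jumps R t (n + 2) x) sums (exp (t * mass R) * two_jumps x)"
proof -
  note fin = finite_measure_jump_measure[OF nubar_facts(3,2)]
  let ?j = "char_fun (jump_measure (nubar R))"
  have i: "integrable lborel (\<lambda>\<xi>. cut_phi R t \<xi> * ?j \<xi> ^ 2)"
    by (rule integrable_mult_char_fun[OF fin _ cut_phi_integrable(1)[OF gs R]]) simp
  have "(\<lambda>n. t ^ n / fact n * ift (\<lambda>\<xi>. (cut_phi R t \<xi> * ?j \<xi> ^ 2) * ?j \<xi> ^ n) x) sums
     ift (\<lambda>\<xi>. (cut_phi R t \<xi> * ?j \<xi> ^ 2) * exp (complex_of_real t * ?j \<xi>)) x"
    by (rule ift_exp_char_fun_sums[OF fin _ i]) (use good_scaleD(3)[OF gs] in auto)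
  moreover have "(\<lambda>\<xi>. (cut_phi R t \<xi> * ?j \<xi> ^ 2) * exp (complex_of_real t * ?j \<xi>)) =
     (\<lambda>\<xi>. complex_of_real (exp (t * mass R)) * (full_phi t \<xi> * ?j \<xi> ^ Suc 1))"
  proof
    fix \<xi>
    have "complex_of_real (exp (t * mass R)) * (full_phi t \<xi> * ?j \<xi> ^ Suc 1) =
      (cut_phi R t \<xi> * exp (complex_of_real t * ?j \<xi>)) * ?j \<xi> ^ Suc 1"
      by (simp only: mult.assoc[symmetric] full_phi_eq)
    also have "\<dots> = (cut_phi R t \<xi> * ?j \<xi> ^ 2) * exp (complex_of_real t * ?j \<xi>)"
      by (simp add: power2_eq_square)
    finally show "(cut_phi R t \<xi> * ?j \<xi> ^ 2) * exp (complex_of_real t * ?j \<xi>) =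
       complex_of_real (exp (t * mass R)) * (full_phi t \<xi> * ?j \<xi> ^ Suc 1)" by (rule sym)
  qed
  moreover have "(\<lambda>\<xi>. (cut_phi R t \<xi> * ?j \<xi> ^ 2) * ?j \<xi> ^ n) = (\<lambda>\<xi>. cut_phi R t \<xi> * ?j \<xi> ^ (n + 2))" for n
    by (simp add: power_add power2_eq_square mult_ac)
  ultimately show ?thesis by (simp only: jumps_def two_jumps_def ift_cmult)
qed

lemma two_jumps_eq: "ennreal (two_jumps x) = (\<integral>\<^sup>+ z. ennreal (heat t (x - z)) * conv_pow (nubar R) 1 z \<partial>lborel)"
  unfolding two_jumps_def heat_def
  by (rule ift_char_fun_pow_conv(3)[OF nubar_facts full_phi_integrable(2)[OF gs]])
     (use heat_nonneg in \<open>simp add: heat_def\<close>)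

text \<open>In the terms with at least two jumps, replacing \<open>fact (n + 2)\<close> by
  \<open>fact n\<close> lets the series sum back to the whole heat kernel convolved with two large
  jumps, which leaves the factor \<open>t\<^sup>2\<close> and no series.\<close>

lemma heat_expansion:
  "\<bar>heat t x - exp (- t * mass R) * (kern R t x + t * jumps R t 1 x)\<bar> \<le> t\<^sup>2 * two_jumps x"
proof -
  note t = good_scaleD(3)[OF gs]
  let ?S = "exp (t * mass R) * heat t x"
  let ?g = "\<lambda>n. t ^ n / fact n * jumps R t n x"
  have "(\<lambda>n. ?g (n + 2)) sums (?S - (\<Sum>n<2. ?g n))"
    using heat_sums by (rule sums_split_initial_segment)
  moreover have "(\<Sum>n<2. ?g n) = kern R t x + t * jumps R t 1 x"
    by (simp add: numeral_2_eq_2 jumps_0)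
  ultimately have s1: "(\<lambda>n. ?g (n + 2)) sums (?S - (kern R t x + t * jumps R t 1 x))" by simp
  have s2: "(\<lambda>n. t\<^sup>2 * (t ^ n / fact n * jumps R t (n + 2) x)) sums (t\<^sup>2 * (exp (t * mass R) * two_jumps x))"
    by (intro sums_mult two_jumps_sums)
  have "?g (n + 2) \<le> t\<^sup>2 * (t ^ n / fact n * jumps R t (n + 2) x)" for n
  proof -
    have "?g (n + 2) = t\<^sup>2 * (t ^ n / fact (n + 2) * jumps R t (n + 2) x)"
      by (simp add: power_add power2_eq_square)
    also have "\<dots> \<le> t\<^sup>2 * (t ^ n / fact n * jumps R t (n + 2) x)"
      using t jumps_nonneg by (intro mult_left_mono mult_right_mono divide_left_mono fact_mono) auto
    finally show ?thesis .
  qed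
  then have up: "?S - (kern R t x + t * jumps R t 1 x) \<le> t\<^sup>2 * (exp (t * mass R) * two_jumps x)"
    by (intro sums_le[OF _ s1 s2])
  have lo: "0 \<le> ?S - (kern R t x + t * jumps R t 1 x)"
    using t jumps_nonneg by (intro sums_le[OF _ sums_zero s1]) auto
  have e: "exp (- t * mass R) * exp (t * mass R) = 1" by (simp add: exp_add[symmetric])
  have e1: "heat t x - exp (- t * mass R) * (kern R t x + t * jumps R t 1 x) =
    exp (- t * mass R) * (?S - (kern R t x + t * jumps R t 1 x))"
    using e by (simp only: right_diff_distrib mult.assoc[symmetric] mult_1)
  have e2: "exp (- t * mass R) * (t\<^sup>2 * (exp (t * mass R) * two_jumps x)) = t\<^sup>2 * two_jumps x"
  proof -
    have "exp (- t * mass R) * (t\<^sup>2 * (exp (t * mass R) * two_jumps x)) =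
      (exp (- t * mass R) * exp (t * mass R)) * (t\<^sup>2 * two_jumps x)" by (simp only: mult_ac)
    then show ?thesis by (simp only: e mult_1)
  qed
  have "exp (- t * mass R) * (?S - (kern R t x + t * jumps R t 1 x)) \<le> exp (- t * mass R) * (t\<^sup>2 * (exp (t * mass R) * two_jumps x))"
    by (rule mult_left_mono[OF up]) simp
  moreover have "0 \<le> exp (- t * mass R) * (?S - (kern R t x + t * jumps R t 1 x))"
    by (rule mult_nonneg_nonneg[OF _ lo]) simp
  ultimately show ?thesis unfolding e1 e2 by (simp only: abs_of_nonneg)
qed

end

text \<open>The expansion is used with cut radius 1, so that the constant does not depend on the
  radius \<open>R\<close> chosen elsewhere. The kernel without jumps is handled by translation and
  an exponential moment. Each jump costs a factor \<open>B\<close>, since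
  \<open>nubar 1 \<le> C0 * F\<close> and \<open>F\<close> convolved with itself is at most
  \<open>CF * F\<close>; the series sums to \<open>exp (t * B)\<close>.\<close>

lemma heat_conv_F: "\<exists>C\<ge>0. \<forall>t h x. good_scale t h \<longrightarrow>
  (\<integral>\<^sup>+ z. ennreal (heat t (x - z)) * ennreal (F z) \<partial>lborel) \<le> ennreal (C * F x)"
proof -
  obtain C m where C: "1 \<le> C" "0 \<le> m" "\<And>x z. F (x - z) \<le> C * exp (m * norm z) * F x" using F_shift by blast
  obtain Cm where Cm: "0 < Cm" "\<And>t h. good_scale t h \<Longrightarrow> (\<integral>\<^sup>+ z. ennreal (exp (m * norm z) * kern 1 t z) \<partial>lborel) \<le> ennreal Cm"
    using kern_moment[OF order_refl C(2)] by blast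
  obtain CF where CF: "0 \<le> CF" "\<And>x. (\<integral>\<^sup>+ y. ennreal (F (x - y) * F y) \<partial>lborel) \<le> ennreal (CF * F x)" using F_conv_F by blast
  define B where "B = C0 * CF"
  have B: "0 \<le> B" using C0_pos CF by (simp add: B_def)
  define D where "D = C * Cm"
  have D: "0 \<le> D" using C Cm by (simp add: D_def)
  have "(\<integral>\<^sup>+ z. ennreal (heat t (x - z)) * ennreal (F z) \<partial>lborel) \<le> ennreal ((D * exp (c * B)) * F x)"
    if gs: "good_scale t h" for t h x
  proof -
    note t = good_scaleD(3,4)[OF gs]
    note j0 = jumps_nonneg[OF zero_less_one gs]
    note [measurable] = jumps_measurable[OF zero_less_one gs] kern_measurable[OF zero_less_one gs] heat_measurable[OF zero_less_one gs]
    have I: "(\<integral>\<^sup>+ z. ennreal (jumps 1 t n (x - z)) * ennreal (F z) \<partial>lborel) \<le> ennreal (D * B ^ n * F x)" for n x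
    proof (induction n arbitrary: x)
      case 0
      have "(\<integral>\<^sup>+ z. ennreal (kern 1 t (x - z)) * ennreal (F z) \<partial>lborel) = (\<integral>\<^sup>+ z. ennreal (kern 1 t z) * ennreal (F (x - z)) \<partial>lborel)"
        using nn_integral_lborel_reflect[of "\<lambda>z. ennreal (kern 1 t z) * ennreal (F (x - z))" x] by simp
      also have "\<dots> \<le> (\<integral>\<^sup>+ z. ennreal (C * F x) * ennreal (exp (m * norm z) * kern 1 t z) \<partial>lborel)"
      proof (rule nn_integral_mono)
        fix z
        have k0: "0 \<le> kern 1 t z" using j0[of 0 z] by (simp add: jumps_0[OF zero_less_one gs])
        have "kern 1 t z * F (x - z) \<le> kern 1 t z * (C * exp (m * norm z) * F x)" by (intro mult_left_mono C(3) k0)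
        also have "\<dots> = (C * F x) * (exp (m * norm z) * kern 1 t z)" by (simp only: mult_ac)
        finally show "ennreal (kern 1 t z) * ennreal (F (x - z)) \<le> ennreal (C * F x) * ennreal (exp (m * norm z) * kern 1 t z)"
          using k0 F_nonneg C by (subst (1 2) ennreal_mult[symmetric]) (auto intro!: ennreal_leI)
      qed
      also have "\<dots> = ennreal (C * F x) * (\<integral>\<^sup>+ z. ennreal (exp (m * norm z) * kern 1 t z) \<partial>lborel)"
        by (rule nn_integral_cmult) measurable
      also have "\<dots> \<le> ennreal (C * F x) * ennreal Cm" by (intro mult_left_mono Cm(2)[OF gs]) auto
      also have "\<dots> = ennreal (D * F x)" using C F_nonneg Cm by (subst ennreal_mult[symmetric]) (auto simp: D_def mult_ac)
      finally show ?case by (simp add: jumps_0[OF zero_less_one gs])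
    next
      case (Suc n)
      have "(\<integral>\<^sup>+ z. ennreal (jumps 1 t (Suc n) (x - z)) * ennreal (F z) \<partial>lborel) =
        (\<integral>\<^sup>+ z. \<integral>\<^sup>+ v. ennreal (nubar 1 v) * (ennreal (jumps 1 t n (x - v - z)) * ennreal (F z)) \<partial>lborel \<partial>lborel)"
      proof (rule nn_integral_cong)
        fix z
        show "ennreal (jumps 1 t (Suc n) (x - z)) * ennreal (F z) =
          (\<integral>\<^sup>+ v. ennreal (nubar 1 v) * (ennreal (jumps 1 t n (x - v - z)) * ennreal (F z)) \<partial>lborel)"
          unfolding jumps_Suc[OF zero_less_one gs]
          by (subst nn_integral_multc[symmetric]) (auto simp: algebra_simps intro!: nn_integral_cong)
      qed
      also have "\<dots> = (\<integral>\<^sup>+ v. \<integral>\<^sup>+ z. ennreal (nubar 1 v) * (ennreal (jumps 1 t n (x - v - z)) * ennreal (F z)) \<partial>lborel \<partial>lborel)"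
        by (rule lborel_pair.Fubini') measurable
      also have "\<dots> = (\<integral>\<^sup>+ v. ennreal (nubar 1 v) * (\<integral>\<^sup>+ z. ennreal (jumps 1 t n (x - v - z)) * ennreal (F z) \<partial>lborel) \<partial>lborel)"
        by (intro nn_integral_cong nn_integral_cmult) measurable
      also have "\<dots> \<le> (\<integral>\<^sup>+ v. ennreal (C0 * F v) * ennreal (D * B ^ n * F (x - v)) \<partial>lborel)"
        by (intro nn_integral_mono mult_mono Suc ennreal_leI nubar_le_F) auto
      also have "\<dots> = (\<integral>\<^sup>+ v. ennreal (C0 * D * B ^ n) * ennreal (F (x - v) * F v) \<partial>lborel)"
        using C0_pos D B F_nonneg
        by (intro nn_integral_cong, subst (1 2) ennreal_mult[symmetric]) (auto simp: mult_ac)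
      also have "\<dots> = ennreal (C0 * D * B ^ n) * (\<integral>\<^sup>+ v. ennreal (F (x - v) * F v) \<partial>lborel)"
        by (rule nn_integral_cmult) measurable
      also have "\<dots> \<le> ennreal (C0 * D * B ^ n) * ennreal (CF * F x)" by (intro mult_left_mono CF) auto
      also have "\<dots> = ennreal (D * B ^ Suc n * F x)"
        using C0_pos D B F_nonneg CF(1) by (subst ennreal_mult[symmetric]) (auto simp: B_def mult_ac)
      finally show ?case .
    qed
    have heat_le: "ennreal (heat t y) \<le> (\<Sum>n. ennreal (t ^ n / fact n) * ennreal (jumps 1 t n y))" for y
    proof -
      note hs = heat_sums[OF zero_less_one gs, of y]
      have "1 * heat t y \<le> exp (t * mass 1) * heat t y"
        using t mass_nonneg[of 1] heat_nonneg[OF zero_less_one gs] by (intro mult_right_mono) auto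
      also have "\<dots> = (\<Sum>n. t ^ n / fact n * jumps 1 t n y)" using hs by (simp add: sums_iff)
      finally have "ennreal (heat t y) \<le> ennreal (\<Sum>n. t ^ n / fact n * jumps 1 t n y)" by (simp add: ennreal_leI)
      also have "\<dots> = (\<Sum>n. ennreal (t ^ n / fact n * jumps 1 t n y))"
        using hs t j0 by (intro suminf_ennreal2[symmetric]) (auto simp: sums_iff)
      also have "\<dots> = (\<Sum>n. ennreal (t ^ n / fact n) * ennreal (jumps 1 t n y))"
        using t j0 by (intro suminf_cong ennreal_mult) auto
      finally show ?thesis .
    qed
    have "(\<integral>\<^sup>+ z. ennreal (heat t (x - z)) * ennreal (F z) \<partial>lborel) \<le>
      (\<integral>\<^sup>+ z. (\<Sum>n. ennreal (t ^ n / fact n) * (ennreal (jumps 1 t n (x - z)) * ennreal (F z))) \<partial>lborel)"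
    proof (rule nn_integral_mono)
      fix z
      have "ennreal (heat t (x - z)) * ennreal (F z) \<le> (\<Sum>n. ennreal (t ^ n / fact n) * ennreal (jumps 1 t n (x - z))) * ennreal (F z)"
        by (intro mult_right_mono heat_le) auto
      also have "\<dots> = (\<Sum>n. ennreal (t ^ n / fact n) * (ennreal (jumps 1 t n (x - z)) * ennreal (F z)))"
        by (simp add: ennreal_suminf_multc[symmetric] mult.assoc)
      finally show "ennreal (heat t (x - z)) * ennreal (F z) \<le> \<dots>" .
    qed
    also have "\<dots> = (\<Sum>n. \<integral>\<^sup>+ z. ennreal (t ^ n / fact n) * (ennreal (jumps 1 t n (x - z)) * ennreal (F z)) \<partial>lborel)"
      by (rule nn_integral_suminf) measurable
    also have "\<dots> = (\<Sum>n. ennreal (t ^ n / fact n) * (\<integral>\<^sup>+ z. ennreal (jumps 1 t n (x - z)) * ennreal (F z) \<partial>lborel))"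
      by (intro suminf_cong nn_integral_cmult) measurable
    also have "\<dots> \<le> (\<Sum>n. ennreal (t ^ n / fact n) * ennreal (D * B ^ n * F x))"
      by (intro suminf_le mult_left_mono I) auto
    also have "\<dots> = (\<Sum>n. ennreal (D * F x * ((t * B) ^ n / fact n)))"
      using t D B F_nonneg by (intro suminf_cong, subst ennreal_mult[symmetric]) (auto simp: power_mult_distrib mult_ac)
    also have "\<dots> = ennreal (D * F x * exp (t * B))"
    proof (rule suminf_ennreal_eq)
      show "(\<lambda>n. D * F x * ((t * B) ^ n / fact n)) sums (D * F x * exp (t * B))"
        using exp_converges[of "t * B"] by (intro sums_mult) (simp add: divide_inverse mult.commute)
    qed (use D B F_nonneg t in auto)
    also have "\<dots> \<le> ennreal ((D * exp (c * B)) * F x)"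
    proof (rule ennreal_leI)
      have "t * B \<le> c * B" using t B by (intro mult_right_mono) auto
      then have "(D * F x) * exp (t * B) \<le> (D * F x) * exp (c * B)" using D F_nonneg by (intro mult_left_mono) auto
      then show "D * F x * exp (t * B) \<le> (D * exp (c * B)) * F x" by (simp only: mult_ac)
    qed
    finally show ?thesis .
  qed
  moreover have "0 \<le> D * exp (c * B)" using D by simp
  ultimately show ?thesis by blast
qed

text \<open>\<open>C\<close> is chosen before \<open>R\<close>, so the error relative to
  \<open>F\<close> depends on \<open>R\<close> only through \<open>double_jump R\<close> and
  vanishes as \<open>R\<close> grows.\<close>

lemma heat_main_term: "\<exists>C\<ge>0. \<forall>R t h x. 1 \<le> R \<longrightarrow> levy_K TYPE('a) f R < \<infinity> \<longrightarrow> good_scale t h \<longrightarrow>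
  \<bar>heat t x - exp (- t * mass R) * (kern R t x + t * jumps R t 1 x)\<bar> \<le> t\<^sup>2 * (C * double_jump R * F x)"
proof -
  obtain C where C: "0 \<le> C" "\<And>t h x. good_scale t h \<Longrightarrow>
    (\<integral>\<^sup>+ z. ennreal (heat t (x - z)) * ennreal (F z) \<partial>lborel) \<le> ennreal (C * F x)" using heat_conv_F by blast
  have "\<bar>heat t x - exp (- t * mass R) * (kern R t x + t * jumps R t 1 x)\<bar> \<le> t\<^sup>2 * (C * double_jump R * F x)"
    if R: "1 \<le> R" and K: "levy_K TYPE('a) f R < \<infinity>" and gs: "good_scale t h" for R t h x
  proof -
    have R0: "0 < R" using R by simp
    note [measurable] = heat_measurable[OF R0 gs]
    have cp: "conv_pow (nubar R) 1 z \<le> ennreal (double_jump R) * ennreal (F z)" for z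
      using nubar_conv_nubar[OF R K, of z] nubar_nonneg double_jump_nonneg[of R] F_nonneg[of z]
      by (simp add: ennreal_mult)
    have "ennreal (two_jumps R t x) \<le> (\<integral>\<^sup>+ z. ennreal (double_jump R) * (ennreal (heat t (x - z)) * ennreal (F z)) \<partial>lborel)"
      unfolding two_jumps_eq[OF R0 gs]
    proof (rule nn_integral_mono)
      fix z show "ennreal (heat t (x - z)) * conv_pow (nubar R) 1 z \<le> ennreal (double_jump R) * (ennreal (heat t (x - z)) * ennreal (F z))"
        using mult_left_mono[OF cp[of z], of "ennreal (heat t (x - z))"] by (simp add: mult_ac)
    qed
    also have "\<dots> = ennreal (double_jump R) * (\<integral>\<^sup>+ z. ennreal (heat t (x - z)) * ennreal (F z) \<partial>lborel)"
      by (rule nn_integral_cmult) measurable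
    also have "\<dots> \<le> ennreal (double_jump R) * ennreal (C * F x)" by (intro mult_left_mono C(2)[OF gs]) auto
    also have "\<dots> = ennreal (C * double_jump R * F x)"
      using double_jump_nonneg C(1) F_nonneg by (subst ennreal_mult[symmetric]) (auto simp: mult_ac)
    finally have "two_jumps R t x \<le> C * double_jump R * F x"
      using double_jump_nonneg C(1) F_nonneg by (subst (asm) ennreal_le_iff) auto
    then have "t\<^sup>2 * two_jumps R t x \<le> t\<^sup>2 * (C * double_jump R * F x)" by (intro mult_left_mono) auto
    then show ?thesis using heat_expansion[OF R0 gs, of x] by linarith
  qed
  then show ?thesis using C(1) by blast
qed

end

section \<open>Asymptotics along rays\<close>

lemma abs_mult_diff: "0 \<le> k \<Longrightarrow> \<bar>k * p - k * q\<bar> = k * \<bar>p - q\<bar>" for k p q :: real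
  using abs_mult[of k "p - q"] by (simp add: right_diff_distrib)

locale levy_limit = levy_heat nu f C0 b A c
  for nu :: "'a::euclidean_space \<Rightarrow> real" and f :: "real \<Rightarrow> real" and C0 :: real
    and b :: 'a and A :: "'a \<Rightarrow> 'a" and c :: real +
  fixes E :: "'a set" and \<kappa> C1 :: real
  assumes E_norm: "\<And>\<theta>. \<theta> \<in> E \<Longrightarrow> norm \<theta> = 1" and kappa: "0 \<le> \<kappa>" and C1: "0 < C1"
    and low: "\<And>\<theta> r. \<theta> \<in> E \<Longrightarrow> 0 < r \<Longrightarrow> C1 * f r \<le> nu (r *\<^sub>R \<theta>)"
    and ratio: "\<And>\<theta> y. \<theta> \<in> E \<Longrightarrow>
      ((\<lambda>r. nu (r *\<^sub>R \<theta> - y) / nu (r *\<^sub>R \<theta>)) \<longlongrightarrow> exp (\<kappa> * (\<theta> \<bullet> y))) at_top"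
begin

text \<open>Agrees with \<open>limit_value\<close> also for \<open>\<kappa> = 0\<close>, because
  \<open>psi_tilde\<close> vanishes at 0; both cases are treated together.\<close>

definition lim_val :: "real \<Rightarrow> 'a \<Rightarrow> 'a \<Rightarrow> real" where
  "lim_val t \<theta> y = exp (- t * psi_tilde b A nu (\<kappa> *\<^sub>R \<theta>) + \<kappa> * (\<theta> \<bullet> y))"

text \<open>Here \<open>z\<close> is the displacement by the truncated kernel and
  \<open>r *\<^sub>R \<theta> - y - z\<close> the single large jump; the subtracted exponential is
  the limit given by (C).\<close>

definition ratio_err :: "real \<Rightarrow> 'a \<Rightarrow> 'a \<Rightarrow> real \<Rightarrow> 'a \<Rightarrow> real" where
  "ratio_err R \<theta> y r z = \<bar>nubar R (r *\<^sub>R \<theta> - y - z) / nu (r *\<^sub>R \<theta>) - exp (\<kappa> * (\<theta> \<bullet> (y + z)))\<bar>"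

definition main_err :: "real \<Rightarrow> real \<Rightarrow> 'a \<Rightarrow> 'a \<Rightarrow> real \<Rightarrow> real" where
  "main_err R t \<theta> y r = (LINT z|lborel. kern R t z * ratio_err R \<theta> y r z)"

lemma ratio_err_measurable [measurable]: "ratio_err R \<theta> y r \<in> borel_measurable borel"
  unfolding ratio_err_def[abs_def] by measurable

lemma F_ray: "\<theta> \<in> E \<Longrightarrow> 1 \<le> r \<Longrightarrow> F (r *\<^sub>R \<theta>) = f r"
  using E_norm by (simp add: F_def max_def)

lemma nu_ray: "\<theta> \<in> E \<Longrightarrow> 1 \<le> r \<Longrightarrow> C1 * F (r *\<^sub>R \<theta>) \<le> nu (r *\<^sub>R \<theta>)"
  using low[of \<theta> r] by (simp add: F_ray)

lemma nu_ray_pos: "\<theta> \<in> E \<Longrightarrow> 1 \<le> r \<Longrightarrow> 0 < nu (r *\<^sub>R \<theta>)"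
  using nu_ray[of \<theta> r] C1 F_pos[of "r *\<^sub>R \<theta>"] by (meson less_le_trans mult_pos_pos)

lemma exp_inner_le:
  assumes "\<theta> \<in> E"
  shows "exp (\<kappa> * (\<theta> \<bullet> z)) \<le> exp (\<kappa> * norm z)"
proof -
  have "\<theta> \<bullet> z \<le> norm z" using norm_cauchy_schwarz[of \<theta> z] E_norm[OF assms] by simp
  then show ?thesis using kappa by (simp add: mult_left_mono)
qed

lemma tail_mass:
  assumes R: "1 \<le> R" and K: "levy_K TYPE('a) f R < \<infinity>" and \<theta>: "\<theta> \<in> E"
  shows "integrable lborel (\<lambda>y. nubar R y * exp ((\<kappa> *\<^sub>R \<theta>) \<bullet> y))"
    "(LINT y|lborel. nubar R y * exp ((\<kappa> *\<^sub>R \<theta>) \<bullet> y)) \<le> C0\<^sup>2 / C1 * kk R"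
proof -
  have le: "(\<integral>\<^sup>+ y. ennreal (nubar R y * exp ((\<kappa> *\<^sub>R \<theta>) \<bullet> y)) \<partial>lborel) \<le> ennreal (C0\<^sup>2 / C1 * kk R)"
    using nubar_exp_tail[OF R K E_norm[OF \<theta>] C1 low[OF \<theta>] ratio[OF \<theta>]] by simp
  show i: "integrable lborel (\<lambda>y. nubar R y * exp ((\<kappa> *\<^sub>R \<theta>) \<bullet> y))"
    by (rule integrableI_nonneg) (use le nubar_nonneg in \<open>auto intro: le_less_trans\<close>)
  show "(LINT y|lborel. nubar R y * exp ((\<kappa> *\<^sub>R \<theta>) \<bullet> y)) \<le> C0\<^sup>2 / C1 * kk R"
    using le C1 kk_nonneg nubar_nonneg
    by (subst (asm) nn_integral_eq_integral[OF i]) (auto simp: ennreal_le_iff)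
qed

text \<open>Up to some radius \<open>R\<close> with finite \<open>levy_K\<close> the exponential
  weight is bounded; beyond it \<open>tail_mass\<close> applies.\<close>

lemma nubar_1_exp_integrable:
  assumes \<theta>: "\<theta> \<in> E"
  shows "integrable lborel (\<lambda>y. nubar 1 y * exp ((\<kappa> *\<^sub>R \<theta>) \<bullet> y))"
proof -
  obtain R where R: "1 \<le> R" "levy_K TYPE('a) f R < \<infinity>" using levy_K_finite by auto
  have i: "integrable lborel (\<lambda>y. exp (\<kappa> * R) * nubar 1 y + nubar R y * exp ((\<kappa> *\<^sub>R \<theta>) \<bullet> y))"
    using integrable_nubar[of 1] tail_mass(1)[OF R \<theta>] by simp
  show ?thesis
  proof (rule Bochner_Integration.integrable_bound[OF i])
    show "AE y in lborel. norm (nubar 1 y * exp ((\<kappa> *\<^sub>R \<theta>) \<bullet> y)) \<le> norm (exp (\<kappa> * R) * nubar 1 y + nubar R y * exp ((\<kappa> *\<^sub>R \<theta>) \<bullet> y))"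
    proof (rule AE_I2)
      fix y
      have "nubar 1 y * exp (\<kappa> * (\<theta> \<bullet> y)) \<le> exp (\<kappa> * R) * nubar 1 y + nubar R y * exp (\<kappa> * (\<theta> \<bullet> y))"
      proof (cases "norm y \<le> R")
        case True
        have "exp (\<kappa> * (\<theta> \<bullet> y)) \<le> exp (\<kappa> * norm y)" by (rule exp_inner_le[OF \<theta>])
        also have "\<dots> \<le> exp (\<kappa> * R)" using True kappa by (simp add: mult_left_mono)
        finally have "nubar 1 y * exp (\<kappa> * (\<theta> \<bullet> y)) \<le> nubar 1 y * exp (\<kappa> * R)" by (intro mult_left_mono nubar_nonneg)
        then show ?thesis using nubar_nonneg[of R y] by (simp add: mult.commute add_increasing2)
      next
        case False
        then have "nubar 1 y = nubar R y" using R by (simp add: nubar_def)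
        then show ?thesis using nubar_nonneg[of 1 y] by simp
      qed
      then show "norm (nubar 1 y * exp ((\<kappa> *\<^sub>R \<theta>) \<bullet> y)) \<le> norm (exp (\<kappa> * R) * nubar 1 y + nubar R y * exp ((\<kappa> *\<^sub>R \<theta>) \<bullet> y))"
        using nubar_nonneg by (simp add: abs_of_nonneg add_nonneg_nonneg)
    qed
  qed measurable
qed

text \<open>Truncation changes the limit exactly by \<open>exp (- t * J)\<close>, where
  \<open>J\<close> is the exponential moment of the jumps beyond \<open>R\<close>; by
  \<open>tail_mass\<close> this factor tends to 1 uniformly over bounded times and
  \<open>E\<close>.\<close>

lemma cut_mgf_lim_val:
  assumes R: "1 \<le> R" and K: "levy_K TYPE('a) f R < \<infinity>" and \<theta>: "\<theta> \<in> E"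
  shows "exp (- t * mass R) * cut_mgf R t (\<kappa> *\<^sub>R \<theta>) = exp (- t * psi_tilde b A nu (\<kappa> *\<^sub>R \<theta>)) *
     exp (- t * (LINT y|lborel. nubar R y * exp ((\<kappa> *\<^sub>R \<theta>) \<bullet> y)))"
proof -
  have R0: "0 < R" using R by simp
  have e: "(\<lambda>y. indicator (- cball 0 R) y * nu y) = nubar R" "(\<lambda>y. indicator (cball 0 R) y * nu y) = nucut R"
    by (auto simp: nubar_def nucut_def)
  have e2: "(\<lambda>y. indicator (- cball 0 R) y * nu y * exp ((\<kappa> *\<^sub>R \<theta>) \<bullet> y)) = (\<lambda>y. nubar R y * exp ((\<kappa> *\<^sub>R \<theta>) \<bullet> y))"
    by (auto simp: nubar_def)
  have i: "integrable lborel (\<lambda>y. indicator (- cball 0 R) y * nu y)" "integrable lborel (\<lambda>y. indicator (- cball 0 R) y * nu y * exp ((\<kappa> *\<^sub>R \<theta>) \<bullet> y))"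
    unfolding e e2 by (rule integrable_nubar[OF R0], rule tail_mass(1)[OF R K \<theta>])
  have i3: "integrable lborel (\<lambda>y. indicator (cball 0 R) y * nu y * (1 - exp ((\<kappa> *\<^sub>R \<theta>) \<bullet> y) + ((\<kappa> *\<^sub>R \<theta>) \<bullet> y) * indicator (ball 0 1) y))"
  proof -
    have "integrable lborel (\<lambda>y. nucut R y * (1 - exp ((\<kappa> *\<^sub>R \<theta>) \<bullet> y) + ((\<kappa> *\<^sub>R \<theta>) \<bullet> y) * indicator (ball 0 1) y))"
      by (rule psi_tilde_integrable[OF nucut_levy nucut_supp])
    then show ?thesis by (simp only: nucut_def)
  qed
  have "psi_tilde b A nu (\<kappa> *\<^sub>R \<theta>) = psi_tilde (bcut R) A (nucut R) (\<kappa> *\<^sub>R \<theta>) +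
     (mass R - (LINT y|lborel. nubar R y * exp ((\<kappa> *\<^sub>R \<theta>) \<bullet> y)))"
    using psi_tilde_split[OF nu _ i i3, of b A] unfolding e e2 bcut_def mass_def by simp
  then have "- t * mass R + - t * psi_tilde (bcut R) A (nucut R) (\<kappa> *\<^sub>R \<theta>) =
    - t * psi_tilde b A nu (\<kappa> *\<^sub>R \<theta>) + - t * (LINT y|lborel. nubar R y * exp ((\<kappa> *\<^sub>R \<theta>) \<bullet> y))"
    by (simp only:) (simp add: algebra_simps)
  then show ?thesis unfolding cut_mgf_def exp_add[symmetric] by (simp only:)
qed

lemma cut_mgf_eq_integral:
  assumes R: "1 \<le> R" and gs: "good_scale t h"
  shows "integrable lborel (\<lambda>z. kern R t z * exp (\<eta> \<bullet> z))" "(LINT z|lborel. kern R t z * exp (\<eta> \<bullet> z)) = cut_mgf R t \<eta>"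
proof -
  have R0: "0 < R" using R by simp
  note mk = mgf_kernelD[OF cut_mgf_kernel[OF gs R0]]
  note [measurable] = kern_measurable[OF R0 gs]
  have e: "(\<integral>\<^sup>+ z. ennreal (kern R t z * exp (\<eta> \<bullet> z)) \<partial>lborel) = ennreal (cut_mgf R t \<eta>)"
    using mk(4)[of \<eta>] by (simp add: kern_def mult.commute)
  have "0 \<le> kern R t z * exp (\<eta> \<bullet> z)" for z using kern_nonneg[OF gs R0] by simp
  then have "has_bochner_integral lborel (\<lambda>z. kern R t z * exp (\<eta> \<bullet> z)) (cut_mgf R t \<eta>)"
    using e mk(3) by (intro has_bochner_integral_nn_integral) auto
  then show "integrable lborel (\<lambda>z. kern R t z * exp (\<eta> \<bullet> z))" "(LINT z|lborel. kern R t z * exp (\<eta> \<bullet> z)) = cut_mgf R t \<eta>"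
    by (auto simp: has_bochner_integral_iff)
qed

lemma kern_moment_integrable:
  assumes R: "1 \<le> R" and m: "0 \<le> m"
  shows "\<exists>C>0. \<forall>t h. good_scale t h \<longrightarrow> integrable lborel (\<lambda>z. exp (m * norm z) * kern R t z) \<and>
     (LINT z|lborel. exp (m * norm z) * kern R t z) \<le> C"
proof -
  have R0: "0 < R" using R by simp
  obtain C where C: "0 < C" "\<And>t h. good_scale t h \<Longrightarrow> (\<integral>\<^sup>+ z. ennreal (exp (m * norm z) * kern R t z) \<partial>lborel) \<le> ennreal C"
    using kern_moment[OF R m] by blast
  have "integrable lborel (\<lambda>z. exp (m * norm z) * kern R t z) \<and> (LINT z|lborel. exp (m * norm z) * kern R t z) \<le> C"
    if gs: "good_scale t h" for t h
  proof
    note [measurable] = kern_measurable[OF R0 gs]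
    have nn: "0 \<le> exp (m * norm z) * kern R t z" for z using kern_nonneg[OF gs R0] by simp
    show i: "integrable lborel (\<lambda>z. exp (m * norm z) * kern R t z)"
      by (rule integrableI_nonneg) (use C(2)[OF gs] nn in \<open>auto intro: le_less_trans\<close>)
    show "(LINT z|lborel. exp (m * norm z) * kern R t z) \<le> C"
      using C(2)[OF gs] C(1) nn by (subst (asm) nn_integral_eq_integral[OF i]) (auto simp: ennreal_le_iff)
  qed
  then show ?thesis using C(1) by blast
qed

text \<open>\<open>F\<close> is translated by \<open>y + z\<close>, and \<open>nu\<close> is at
  least \<open>C1 * F\<close> on the ray; \<open>F (r *\<^sub>R \<theta>)\<close> cancels. The
  resulting majorant is independent of \<open>R\<close>, \<open>\<theta>\<close> and
  \<open>r\<close>, and the truncated kernel integrates it.\<close>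

lemma ratio_err_bound:
  assumes \<rho>: "0 \<le> \<rho>"
  shows "\<exists>D m. 0 < D \<and> 0 \<le> m \<and> (\<forall>R \<theta> y r z. 1 \<le> R \<longrightarrow> \<theta> \<in> E \<longrightarrow> norm y \<le> \<rho> \<longrightarrow> 1 \<le> r \<longrightarrow>
     ratio_err R \<theta> y r z \<le> D * exp (m * norm z) \<and> nubar R (r *\<^sub>R \<theta> - y - z) / nu (r *\<^sub>R \<theta>) \<le> D * exp (m * norm z))"
proof -
  obtain C m where C: "1 \<le> C" "0 \<le> m" "\<And>x z. F (x - z) \<le> C * exp (m * norm z) * F x" using F_shift by blast
  define D where "D = (C0 * C / C1 + 1) * exp ((m + \<kappa>) * \<rho>)"
  have D: "0 < D" unfolding D_def using C0_pos C C1 by (intro mult_pos_pos add_nonneg_pos) auto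
  have "ratio_err R \<theta> y r z \<le> D * exp ((m + \<kappa>) * norm z) \<and> nubar R (r *\<^sub>R \<theta> - y - z) / nu (r *\<^sub>R \<theta>) \<le> D * exp ((m + \<kappa>) * norm z)"
    if R: "1 \<le> R" and \<theta>: "\<theta> \<in> E" and y: "norm y \<le> \<rho>" and r: "1 \<le> r" for R \<theta> y r z
  proof -
    let ?e = "exp ((m + \<kappa>) * (\<rho> + norm z))"
    have yz: "norm (y + z) \<le> \<rho> + norm z" using norm_triangle_ineq[of y z] y by linarith
    have "m * norm (y + z) \<le> (m + \<kappa>) * (\<rho> + norm z)" "\<kappa> * norm (y + z) \<le> (m + \<kappa>) * (\<rho> + norm z)"
      using yz C(2) kappa by (intro mult_mono; simp)+
    then have me: "exp (m * norm (y + z)) \<le> ?e" "exp (\<kappa> * norm (y + z)) \<le> ?e" by simp_all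
    have "nubar R (r *\<^sub>R \<theta> - y - z) / nu (r *\<^sub>R \<theta>) \<le> (C0 * (C * ?e * F (r *\<^sub>R \<theta>))) / (C1 * F (r *\<^sub>R \<theta>))"
    proof (rule frac_le)
      have "nubar R (r *\<^sub>R \<theta> - y - z) \<le> C0 * F (r *\<^sub>R \<theta> - (y + z))"
        using nubar_le_F[OF R, of "r *\<^sub>R \<theta> - y - z"] by (simp add: algebra_simps)
      also have "\<dots> \<le> C0 * (C * exp (m * norm (y + z)) * F (r *\<^sub>R \<theta>))" using C0_pos by (intro mult_left_mono C(3)) auto
      also have "\<dots> \<le> C0 * (C * ?e * F (r *\<^sub>R \<theta>))"
        using C0_pos C(1) F_nonneg me by (intro mult_left_mono mult_right_mono) auto
      finally show "nubar R (r *\<^sub>R \<theta> - y - z) \<le> C0 * (C * ?e * F (r *\<^sub>R \<theta>))" .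
      show "0 \<le> C0 * (C * ?e * F (r *\<^sub>R \<theta>))" using C0_pos C(1) F_nonneg by simp
      show "0 < C1 * F (r *\<^sub>R \<theta>)" using C1 F_pos by simp
      show "C1 * F (r *\<^sub>R \<theta>) \<le> nu (r *\<^sub>R \<theta>)" by (rule nu_ray[OF \<theta> r])
    qed
    also have "\<dots> = C0 * C / C1 * ?e" using F_pos[of "r *\<^sub>R \<theta>"] C1 by simp
    finally have 1: "nubar R (r *\<^sub>R \<theta> - y - z) / nu (r *\<^sub>R \<theta>) \<le> C0 * C / C1 * ?e" .
    have 2: "exp (\<kappa> * (\<theta> \<bullet> (y + z))) \<le> ?e" using exp_inner_le[OF \<theta>, of "y + z"] me by linarith
    have 0: "0 \<le> nubar R (r *\<^sub>R \<theta> - y - z) / nu (r *\<^sub>R \<theta>)" using nubar_nonneg nu_nonneg by simp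
    have eq: "D * exp ((m + \<kappa>) * norm z) = C0 * C / C1 * ?e + ?e"
      by (simp add: D_def exp_add[symmetric] mult.assoc distrib_left distrib_right)
    have "0 < ?e" by simp
    have "\<bar>p - q\<bar> \<le> p + q" if "0 \<le> p" "0 \<le> q" for p q :: real using that by linarith
    from this[OF 0, of "exp (\<kappa> * (\<theta> \<bullet> (y + z)))"]
    have "ratio_err R \<theta> y r z \<le> nubar R (r *\<^sub>R \<theta> - y - z) / nu (r *\<^sub>R \<theta>) + exp (\<kappa> * (\<theta> \<bullet> (y + z)))"
      unfolding ratio_err_def by simp
    then show ?thesis unfolding eq using 1 2 \<open>0 < ?e\<close> by linarith
  qed
  then show ?thesis using D C(2) kappa by (intro exI[of _ D] exI[of _ "m + \<kappa>"]) auto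
qed

text \<open>After a reflection the integration variable is the displacement by the kernel. Both
  quantities are then integrals against \<open>kern R t\<close>, and their difference is at most the
  integral of \<open>ratio_err\<close>.\<close>

lemma jumps_1_ratio:
  assumes R: "1 \<le> R" and gs: "good_scale t h" and \<theta>: "\<theta> \<in> E" and r: "1 \<le> r"
  shows "\<bar>jumps R t 1 (r *\<^sub>R \<theta> - y) / nu (r *\<^sub>R \<theta>) - exp (\<kappa> * (\<theta> \<bullet> y)) * cut_mgf R t (\<kappa> *\<^sub>R \<theta>)\<bar> \<le> main_err R t \<theta> y r"
proof -
  have R0: "0 < R" using R by simp
  let ?x = "r *\<^sub>R \<theta> - y" and ?N = "nu (r *\<^sub>R \<theta>)"
  have N: "0 < ?N" by (rule nu_ray_pos[OF \<theta> r])
  note [measurable] = kern_measurable[OF R0 gs]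
  note k0 = kern_nonneg[OF gs R0]
  obtain D m where Dm: "0 < D" "0 \<le> m" and Db: "\<And>z. ratio_err R \<theta> y r z \<le> D * exp (m * norm z)"
     "\<And>z. nubar R (r *\<^sub>R \<theta> - y - z) / ?N \<le> D * exp (m * norm z)"
    using ratio_err_bound[of "norm y"] R \<theta> r by auto
  have mi: "integrable lborel (\<lambda>z. D * (exp (m * norm z) * kern R t z))"
    using kern_moment_integrable[OF R Dm(2)] gs by auto
  have i1: "integrable lborel (\<lambda>z. kern R t z * (nubar R (?x - z) / ?N))"
  proof (rule Bochner_Integration.integrable_bound[OF mi])
    show "AE z in lborel. norm (kern R t z * (nubar R (?x - z) / ?N)) \<le> norm (D * (exp (m * norm z) * kern R t z))"
    proof (rule AE_I2)
      fix z
      have "kern R t z * (nubar R (?x - z) / ?N) \<le> kern R t z * (D * exp (m * norm z))" by (intro mult_left_mono Db k0)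
      then show "norm (kern R t z * (nubar R (?x - z) / ?N)) \<le> norm (D * (exp (m * norm z) * kern R t z))"
        using k0[of z] nubar_nonneg[of R "?x - z"] N Dm(1) by (simp add: abs_mult abs_of_nonneg mult_ac)
    qed
  qed measurable
  have i2: "integrable lborel (\<lambda>z. kern R t z * exp (\<kappa> * (\<theta> \<bullet> (y + z))))"
  proof -
    have "integrable lborel (\<lambda>z. exp (\<kappa> * (\<theta> \<bullet> y)) * (kern R t z * exp ((\<kappa> *\<^sub>R \<theta>) \<bullet> z)))"
      using cut_mgf_eq_integral(1)[OF R gs, of "\<kappa> *\<^sub>R \<theta>"] by (intro integrable_mult_right)
    then show ?thesis by (simp add: inner_add_right distrib_left exp_add mult_ac)
  qed
  have e2: "(LINT z|lborel. kern R t z * exp (\<kappa> * (\<theta> \<bullet> (y + z)))) = exp (\<kappa> * (\<theta> \<bullet> y)) * cut_mgf R t (\<kappa> *\<^sub>R \<theta>)"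
  proof -
    have "(LINT z|lborel. kern R t z * exp (\<kappa> * (\<theta> \<bullet> (y + z)))) = (LINT z|lborel. exp (\<kappa> * (\<theta> \<bullet> y)) * (kern R t z * exp ((\<kappa> *\<^sub>R \<theta>) \<bullet> z)))"
      by (simp add: inner_add_right distrib_left exp_add mult_ac)
    then show ?thesis using cut_mgf_eq_integral(2)[OF R gs, of "\<kappa> *\<^sub>R \<theta>"] by simp
  qed
  have e1: "jumps R t 1 ?x / ?N = (LINT z|lborel. kern R t z * (nubar R (?x - z) / ?N))"
  proof -
    have i1': "integrable lborel (\<lambda>z. kern R t z * nubar R (?x - z))"
      using integrable_mult_left[OF i1, of ?N] N by simp
    have "ennreal (jumps R t 1 ?x) = (\<integral>\<^sup>+ z. ennreal (kern R t (?x - z)) * ennreal (nubar R z) \<partial>lborel)"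
      using jumps_Suc[OF R0 gs, of 0 ?x] by (simp add: jumps_0[OF R0 gs])
    also have "\<dots> = (\<integral>\<^sup>+ z. ennreal (kern R t z) * ennreal (nubar R (?x - z)) \<partial>lborel)"
      using nn_integral_lborel_reflect[of "\<lambda>z. ennreal (kern R t z) * ennreal (nubar R (?x - z))" ?x] by simp
    also have "\<dots> = (\<integral>\<^sup>+ z. ennreal (kern R t z * nubar R (?x - z)) \<partial>lborel)"
      using k0 nubar_nonneg by (intro nn_integral_cong ennreal_mult[symmetric]) auto
    also have "\<dots> = ennreal (LINT z|lborel. kern R t z * nubar R (?x - z))"
      using i1' k0 nubar_nonneg by (intro nn_integral_eq_integral) auto
    finally have "jumps R t 1 ?x = (LINT z|lborel. kern R t z * nubar R (?x - z))"
      using jumps_nonneg[OF R0 gs] k0 nubar_nonneg by (subst (asm) ennreal_inj) (auto intro!: integral_nonneg_AE)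
    then show ?thesis by simp
  qed
  have d: "jumps R t 1 ?x / ?N - exp (\<kappa> * (\<theta> \<bullet> y)) * cut_mgf R t (\<kappa> *\<^sub>R \<theta>) =
    (LINT z|lborel. kern R t z * (nubar R (?x - z) / ?N) - kern R t z * exp (\<kappa> * (\<theta> \<bullet> (y + z))))"
    unfolding e1 e2[symmetric] by (rule Bochner_Integration.integral_diff[OF i1 i2, symmetric])
  have "\<bar>jumps R t 1 ?x / ?N - exp (\<kappa> * (\<theta> \<bullet> y)) * cut_mgf R t (\<kappa> *\<^sub>R \<theta>)\<bar> \<le>
    (LINT z|lborel. \<bar>kern R t z * (nubar R (?x - z) / ?N) - kern R t z * exp (\<kappa> * (\<theta> \<bullet> (y + z)))\<bar>)"
    unfolding d by (rule integral_abs_bound)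
  also have "\<dots> = main_err R t \<theta> y r"
    unfolding main_err_def ratio_err_def
  proof (rule Bochner_Integration.integral_cong[OF refl])
    fix z
    show "\<bar>kern R t z * (nubar R (?x - z) / ?N) - kern R t z * exp (\<kappa> * (\<theta> \<bullet> (y + z)))\<bar> =
      kern R t z * \<bar>nubar R (?x - z) / ?N - exp (\<kappa> * (\<theta> \<bullet> (y + z)))\<bar>"
      by (rule abs_mult_diff[OF k0])
  qed
  finally show ?thesis .
qed

text \<open>At one fixed radius, \<open>cut_mgf_lim_val\<close> expresses the value through a moment
  of the truncated kernel that is uniform over \<open>good_scale\<close>.\<close>

lemma lim_val_bound: "\<exists>C>0. \<forall>t h \<theta>. good_scale t h \<longrightarrow> \<theta> \<in> E \<longrightarrow> exp (- t * psi_tilde b A nu (\<kappa> *\<^sub>R \<theta>)) \<le> C"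
proof -
  obtain R where R: "1 \<le> R" "levy_K TYPE('a) f R < \<infinity>" using levy_K_finite by auto
  have R0: "0 < R" using R by simp
  obtain C where C: "0 < C" "\<And>t h. good_scale t h \<Longrightarrow> integrable lborel (\<lambda>z. exp (\<kappa> * norm z) * kern R t z) \<and>
     (LINT z|lborel. exp (\<kappa> * norm z) * kern R t z) \<le> C"
    using kern_moment_integrable[OF R(1) kappa] by blast
  define I where "I = C0\<^sup>2 / C1 * kk R"
  have I: "0 \<le> I" using C1 kk_nonneg by (simp add: I_def)
  have "exp (- t * psi_tilde b A nu (\<kappa> *\<^sub>R \<theta>)) \<le> C * exp (c * I)" if gs: "good_scale t h" and \<theta>: "\<theta> \<in> E" for t h \<theta>
  proof -
    note t = good_scaleD(3,4)[OF gs]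
    note k0 = kern_nonneg[OF gs R0]
    let ?J = "LINT y|lborel. nubar R y * exp ((\<kappa> *\<^sub>R \<theta>) \<bullet> y)"
    have J: "0 \<le> ?J" "?J \<le> I" using nubar_nonneg tail_mass(2)[OF R \<theta>] by (auto simp: I_def intro!: integral_nonneg_AE)
    have M: "cut_mgf R t (\<kappa> *\<^sub>R \<theta>) \<le> C"
    proof -
      have "cut_mgf R t (\<kappa> *\<^sub>R \<theta>) = (LINT z|lborel. kern R t z * exp ((\<kappa> *\<^sub>R \<theta>) \<bullet> z))"
        by (rule cut_mgf_eq_integral(2)[OF R(1) gs, symmetric])
      also have "\<dots> \<le> (LINT z|lborel. exp (\<kappa> * norm z) * kern R t z)"
      proof (rule integral_mono)
        fix z
        have "kern R t z * exp (\<kappa> * (\<theta> \<bullet> z)) \<le> kern R t z * exp (\<kappa> * norm z)" by (intro mult_left_mono exp_inner_le[OF \<theta>] k0)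
        then show "kern R t z * exp ((\<kappa> *\<^sub>R \<theta>) \<bullet> z) \<le> exp (\<kappa> * norm z) * kern R t z" by (simp add: mult.commute)
      qed (use cut_mgf_eq_integral(1)[OF R(1) gs, of "\<kappa> *\<^sub>R \<theta>"] C(2)[OF gs] in auto)
      also have "\<dots> \<le> C" using C(2)[OF gs] by simp
      finally show ?thesis .
    qed
    have "exp (- t * psi_tilde b A nu (\<kappa> *\<^sub>R \<theta>)) = (exp (- t * psi_tilde b A nu (\<kappa> *\<^sub>R \<theta>)) * exp (- t * ?J)) * exp (t * ?J)"
    proof -
      have "exp (- t * ?J) * exp (t * ?J) = 1" by (simp add: exp_add[symmetric])
      then show ?thesis by (simp only: mult.assoc mult_1_right)
    qed
    also have "\<dots> = (exp (- t * mass R) * cut_mgf R t (\<kappa> *\<^sub>R \<theta>)) * exp (t * ?J)" by (simp only: cut_mgf_lim_val[OF R \<theta>])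
    also have "\<dots> \<le> (1 * C) * exp (c * I)"
    proof (intro mult_mono M)
      show "exp (- t * mass R) \<le> 1" using t mass_nonneg[of R] by simp
      have "t * ?J \<le> c * I" using J t c by (intro mult_mono) auto
      then show "exp (t * ?J) \<le> exp (c * I)" by simp
    qed (use C in \<open>auto simp: cut_mgf_def\<close>)
    finally show ?thesis by simp
  qed
  then show ?thesis using C(1) by (intro exI[of _ "C * exp (c * I)"]) auto
qed

lemma small_part_tendsto:
  assumes R: "1 \<le> R" and \<rho>: "0 \<le> \<rho>" and \<epsilon>: "0 < \<epsilon>"
  shows "\<exists>r1\<ge>1. \<forall>r t h \<theta> y. r1 \<le> r \<longrightarrow> good_scale t h \<longrightarrow> \<theta> \<in> E \<longrightarrow> norm y \<le> \<rho> \<longrightarrow>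
     kern R t (r *\<^sub>R \<theta> - y) / (t * nu (r *\<^sub>R \<theta>)) \<le> \<epsilon>"
proof -
  obtain c0 m0 where m0: "0 < c0" "0 \<le> m0" "\<And>x. c0 * exp (- m0 * norm x) \<le> F x" using F_lower by blast
  \<comment> \<open>Decay at rate \<open>m0 + 1\<close> leaves a factor \<open>exp (- r)\<close>
    after division by the lower bound of order \<open>exp (- m0 * r)\<close> for \<open>nu\<close>
    on the ray.\<close>
  obtain C where C: "0 < C" "\<And>t h x. good_scale t h \<Longrightarrow> 2 * drift + 2 \<le> norm x \<Longrightarrow> kern R t x \<le> C * t * exp (- (m0 + 1) * norm x)"
    using kern_tail[OF R, of "m0 + 1"] m0(2) by auto
  define Q where "Q = C * exp ((m0 + 1) * \<rho>) / (C1 * c0)"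
  have Q: "0 < Q" using C C1 m0 by (simp add: Q_def)
  have "((\<lambda>r::real. Q * exp (- r)) \<longlongrightarrow> Q * 0) at_top" by (intro tendsto_mult tendsto_const) real_asymp
  then have lim: "((\<lambda>r::real. Q * exp (- r)) \<longlongrightarrow> 0) at_top" by simp
  have "\<forall>\<^sub>F r::real in at_top. Q * exp (- r) < \<epsilon>" by (rule order_tendstoD(2)[OF lim \<epsilon>])
  then obtain r0 where r0: "\<And>r::real. r0 \<le> r \<Longrightarrow> Q * exp (- r) < \<epsilon>" by (auto simp: eventually_at_top_linorder)
  have "kern R t (r *\<^sub>R \<theta> - y) / (t * nu (r *\<^sub>R \<theta>)) \<le> \<epsilon>"
    if r: "max (max 1 r0) (2 * drift + 2 + \<rho>) \<le> r" and gs: "good_scale t h" and \<theta>: "\<theta> \<in> E" and y: "norm y \<le> \<rho>" for r t h \<theta> y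
  proof -
    have r': "1 \<le> r" "r0 \<le> r" "2 * drift + 2 + \<rho> \<le> r" using r by auto
    note t = good_scaleD(3)[OF gs]
    have nr: "norm (r *\<^sub>R \<theta>) = r" using E_norm[OF \<theta>] r'(1) by simp
    have nx: "r - \<rho> \<le> norm (r *\<^sub>R \<theta> - y)" using norm_triangle_ineq2[of "r *\<^sub>R \<theta>" y] y nr by linarith
    have low: "C1 * (c0 * exp (- m0 * r)) \<le> nu (r *\<^sub>R \<theta>)"
      using order_trans[OF mult_left_mono[OF m0(3)[of "r *\<^sub>R \<theta>"], of C1] nu_ray[OF \<theta> r'(1)]] C1 nr by simp
    have "kern R t (r *\<^sub>R \<theta> - y) \<le> C * t * exp (- (m0 + 1) * norm (r *\<^sub>R \<theta> - y))" using nx r'(3) by (intro C(2)[OF gs]) linarith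
    also have "\<dots> \<le> C * t * exp (- (m0 + 1) * (r - \<rho>))"
    proof -
      have "(m0 + 1) * (r - \<rho>) \<le> (m0 + 1) * norm (r *\<^sub>R \<theta> - y)" using nx m0(2) by (intro mult_left_mono) auto
      then have "exp (- (m0 + 1) * norm (r *\<^sub>R \<theta> - y)) \<le> exp (- (m0 + 1) * (r - \<rho>))"
        by (simp only: exp_le_cancel_iff mult_minus_left neg_le_iff_le)
      then show ?thesis using C(1) t by (intro mult_left_mono) auto
    qed
    finally have "kern R t (r *\<^sub>R \<theta> - y) / (t * nu (r *\<^sub>R \<theta>)) \<le> (C * t * exp (- (m0 + 1) * (r - \<rho>))) / (t * (C1 * (c0 * exp (- m0 * r))))"
      using low t C1 m0 C by (intro frac_le mult_left_mono) auto
    also have "\<dots> = Q * exp (- r)"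
    proof -
      have "- (m0 + 1) * (r - \<rho>) = (m0 + 1) * \<rho> + - r + - m0 * r" by (simp add: algebra_simps)
      then have "exp (- (m0 + 1) * (r - \<rho>)) = exp ((m0 + 1) * \<rho>) * exp (- r) * exp (- m0 * r)" by (simp only: exp_add)
      then show ?thesis using t C1 m0(1) by (simp only: Q_def) (simp add: field_simps)
    qed
    also have "\<dots> \<le> \<epsilon>" using r0[OF r'(2)] by simp
    finally show ?thesis .
  qed
  then show ?thesis by (intro exI[of _ "max (max 1 r0) (2 * drift + 2 + \<rho>)"]) auto
qed

text \<open>The error has four parts: no large jump (\<open>q1\<close>), one large jump against its
  limit (\<open>q2\<close>), truncation of the limit (\<open>q3\<close>), at least two large jumps
  (\<open>q4\<close>). \<open>q3\<close> and \<open>q4\<close> determine \<open>R\<close>, then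
  \<open>q1\<close> determines \<open>r1\<close>. The part \<open>main_err\<close> stays open,
  because the pointwise and the uniform statement treat it differently.\<close>

lemma heat_ratio_bound:
  assumes \<rho>: "0 < \<rho>" and \<epsilon>: "0 < \<epsilon>"
  shows "\<exists>R r1. 1 \<le> R \<and> 1 \<le> r1 \<and> (\<forall>r t h \<theta> y. r1 \<le> r \<longrightarrow> good_scale t h \<longrightarrow> \<theta> \<in> E \<longrightarrow> norm y \<le> \<rho> \<longrightarrow>
     \<bar>heat t (r *\<^sub>R \<theta> - y) / (t * nu (r *\<^sub>R \<theta>)) - lim_val t \<theta> y\<bar> \<le> \<epsilon> + main_err R t \<theta> y r)"
proof -
  obtain CL where CL: "0 < CL" "\<And>t h \<theta>. good_scale t h \<Longrightarrow> \<theta> \<in> E \<Longrightarrow> exp (- t * psi_tilde b A nu (\<kappa> *\<^sub>R \<theta>)) \<le> CL"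
    using lim_val_bound by blast
  obtain CH where CH: "0 \<le> CH" "\<And>R t h x. 1 \<le> R \<Longrightarrow> levy_K TYPE('a) f R < \<infinity> \<Longrightarrow> good_scale t h \<Longrightarrow>
     \<bar>heat t x - exp (- t * mass R) * (kern R t x + t * jumps R t 1 x)\<bar> \<le> t\<^sup>2 * (CH * double_jump R * F x)"
    using heat_main_term by blast
  obtain C m where C: "1 \<le> C" "0 \<le> m" "\<And>x z. F (x - z) \<le> C * exp (m * norm z) * F x" using F_shift by blast
  define a1 where "a1 = exp (\<kappa> * \<rho>) * CL * c * (C0\<^sup>2 / C1)"
  define a2 where "a2 = c * CH * C * exp (m * \<rho>) / C1"
  have "((\<lambda>R. a1 * kk R + a2 * double_jump R) \<longlongrightarrow> a1 * 0 + a2 * 0) at_top"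
    by (intro tendsto_intros kk_tendsto_0 double_jump_tendsto_0)
  then have lim: "((\<lambda>R. a1 * kk R + a2 * double_jump R) \<longlongrightarrow> 0) at_top" by simp
  have "\<forall>\<^sub>F R in at_top. a1 * kk R + a2 * double_jump R < \<epsilon> / 2"
    by (rule order_tendstoD(2)[OF lim]) (use \<epsilon> in simp)
  then obtain R1 where R1: "\<And>R. R1 \<le> R \<Longrightarrow> a1 * kk R + a2 * double_jump R < \<epsilon> / 2" by (auto simp: eventually_at_top_linorder)
  obtain R0 where R0: "1 \<le> R0" "\<And>R. R0 \<le> R \<Longrightarrow> levy_K TYPE('a) f R < \<infinity>" using levy_K_finite by auto
  define R where "R = max R0 R1"
  have R: "1 \<le> R" "levy_K TYPE('a) f R < \<infinity>" and Re: "a1 * kk R + a2 * double_jump R < \<epsilon> / 2"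
    using R0 R1 by (auto simp: R_def intro!: R0(2))
  obtain r1 where r1: "1 \<le> r1" "\<And>r t h \<theta> y. r1 \<le> r \<Longrightarrow> good_scale t h \<Longrightarrow> \<theta> \<in> E \<Longrightarrow> norm y \<le> \<rho> \<Longrightarrow>
     kern R t (r *\<^sub>R \<theta> - y) / (t * nu (r *\<^sub>R \<theta>)) \<le> \<epsilon> / 2"
    using small_part_tendsto[OF R(1) less_imp_le[OF \<rho>] half_gt_zero[OF \<epsilon>]] by blast
  have "\<bar>heat t (r *\<^sub>R \<theta> - y) / (t * nu (r *\<^sub>R \<theta>)) - lim_val t \<theta> y\<bar> \<le> \<epsilon> + main_err R t \<theta> y r"
    if r: "r1 \<le> r" and gs: "good_scale t h" and \<theta>: "\<theta> \<in> E" and y: "norm y \<le> \<rho>" for r t h \<theta> y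
  proof -
    note t = good_scaleD(3,4)[OF gs]
    have R0: "0 < R" using R(1) by simp
    have r': "1 \<le> r" using r r1(1) by simp
    let ?N = "nu (r *\<^sub>R \<theta>)" and ?x = "r *\<^sub>R \<theta> - y"
    let ?e = "exp (- t * mass R)" and ?k = "kern R t ?x" and ?j = "jumps R t 1 ?x"
    let ?M = "cut_mgf R t (\<kappa> *\<^sub>R \<theta>)" and ?ey = "exp (\<kappa> * (\<theta> \<bullet> y))"
    let ?J = "LINT y|lborel. nubar R y * exp ((\<kappa> *\<^sub>R \<theta>) \<bullet> y)"
    let ?L = "exp (- t * psi_tilde b A nu (\<kappa> *\<^sub>R \<theta>))"
    have N: "0 < ?N" by (rule nu_ray_pos[OF \<theta> r'])
    have e1: "?e \<le> 1" "0 < ?e" using t mass_nonneg[of R] by auto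
    have q1: "\<bar>?e * (?k / (t * ?N))\<bar> \<le> \<epsilon> / 2"
    proof -
      have k0: "0 \<le> ?k / (t * ?N)" using kern_nonneg[OF gs R0] t N by simp
      have "\<bar>?e * (?k / (t * ?N))\<bar> = ?e * (?k / (t * ?N))"
        by (rule abs_of_nonneg[OF mult_nonneg_nonneg[OF less_imp_le[OF e1(2)] k0]])
      also have "\<dots> \<le> 1 * (?k / (t * ?N))" by (rule mult_right_mono[OF e1(1) k0])
      also have "\<dots> = ?k / (t * ?N)" by (rule mult_1)
      also have "\<dots> \<le> \<epsilon> / 2" by (rule r1(2)[OF r gs \<theta> y])
      finally show ?thesis .
    qed
    have q2: "\<bar>?e * (?j / ?N) - ?e * (?ey * ?M)\<bar> \<le> main_err R t \<theta> y r"
    proof -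
      have J: "\<bar>?j / ?N - ?ey * ?M\<bar> \<le> main_err R t \<theta> y r" by (rule jumps_1_ratio[OF R(1) gs \<theta> r'])
      have "\<bar>?e * (?j / ?N) - ?e * (?ey * ?M)\<bar> = ?e * \<bar>?j / ?N - ?ey * ?M\<bar>"
        by (rule abs_mult_diff) simp
      also have "\<dots> \<le> 1 * \<bar>?j / ?N - ?ey * ?M\<bar>" using e1 by (intro mult_right_mono) auto
      finally show ?thesis using J by simp
    qed
    have q3: "\<bar>?e * (?ey * ?M) - lim_val t \<theta> y\<bar> \<le> a1 * kk R"
    proof -
      have J: "0 \<le> ?J" "?J \<le> C0\<^sup>2 / C1 * kk R" using nubar_nonneg tail_mass(2)[OF R \<theta>] by (auto intro!: integral_nonneg_AE)
      have "?e * (?ey * ?M) = ?ey * ?L * exp (- t * ?J)" using cut_mgf_lim_val[OF R \<theta>, of t] by (simp add: mult_ac)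
      moreover have "lim_val t \<theta> y = ?ey * ?L" unfolding lim_val_def exp_add by (simp only: mult.commute)
      ultimately have "lim_val t \<theta> y - ?e * (?ey * ?M) = ?ey * ?L * (1 - exp (- t * ?J))"
        by (simp only: right_diff_distrib mult_1_right)
      moreover have "0 \<le> 1 - exp (- t * ?J)" using J t by simp
      moreover have "1 - exp (- t * ?J) \<le> t * ?J" using exp_ge_add_one_self[of "- t * ?J"] by simp
      ultimately have "\<bar>?e * (?ey * ?M) - lim_val t \<theta> y\<bar> \<le> ?ey * ?L * (t * ?J)"
        by (subst abs_minus_commute) (simp only: abs_mult abs_exp_cancel abs_of_nonneg mult_left_mono mult_nonneg_nonneg exp_ge_zero)
      also have "\<dots> \<le> exp (\<kappa> * \<rho>) * CL * (c * (C0\<^sup>2 / C1 * kk R))"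
      proof (intro mult_mono CL(2)[OF gs \<theta>] J t)
        have "\<kappa> * norm y \<le> \<kappa> * \<rho>" using kappa y by (intro mult_left_mono)
        then show "?ey \<le> exp (\<kappa> * \<rho>)" using exp_inner_le[OF \<theta>, of y] by (meson exp_le_cancel_iff order_trans)
      qed (use CL(1) J t c in auto)
      finally show ?thesis by (simp only: a1_def mult_ac)
    qed
    have q4: "\<bar>heat t ?x / (t * ?N) - (?e * (?k / (t * ?N)) + ?e * (?j / ?N))\<bar> \<le> a2 * double_jump R"
    proof -
      have d: "heat t ?x / (t * ?N) - (?e * (?k / (t * ?N)) + ?e * (?j / ?N)) = (heat t ?x - ?e * (?k + t * ?j)) / (t * ?N)"
        using t N by (simp add: field_simps)
      have "\<bar>heat t ?x / (t * ?N) - (?e * (?k / (t * ?N)) + ?e * (?j / ?N))\<bar> = \<bar>heat t ?x - ?e * (?k + t * ?j)\<bar> / (t * ?N)"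
        unfolding d using t N by (simp add: abs_divide abs_mult)
      also have "\<dots> \<le> (t\<^sup>2 * (CH * double_jump R * F ?x)) / (t * ?N)"
        using t N by (intro divide_right_mono CH(2)[OF R gs]) auto
      also have "\<dots> \<le> (t\<^sup>2 * (CH * double_jump R * (C * exp (m * \<rho>) * F (r *\<^sub>R \<theta>)))) / (t * (C1 * F (r *\<^sub>R \<theta>)))"
      proof (rule frac_le)
        have "F ?x \<le> C * exp (m * norm y) * F (r *\<^sub>R \<theta>)" by (rule C(3))
        also have "\<dots> \<le> C * exp (m * \<rho>) * F (r *\<^sub>R \<theta>)"
        proof (intro mult_right_mono mult_left_mono)
          show "exp (m * norm y) \<le> exp (m * \<rho>)" using y C(2) by (simp add: mult_left_mono)
        qed (use C(1) F_nonneg in auto)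
        finally show "t\<^sup>2 * (CH * double_jump R * F ?x) \<le> t\<^sup>2 * (CH * double_jump R * (C * exp (m * \<rho>) * F (r *\<^sub>R \<theta>)))"
          using CH(1) double_jump_nonneg[of R] by (intro mult_left_mono) auto
        show "0 \<le> t\<^sup>2 * (CH * double_jump R * (C * exp (m * \<rho>) * F (r *\<^sub>R \<theta>)))"
          using CH(1) double_jump_nonneg[of R] C(1) F_nonneg by simp
        show "0 < t * (C1 * F (r *\<^sub>R \<theta>))" using t C1 F_pos by simp
        show "t * (C1 * F (r *\<^sub>R \<theta>)) \<le> t * ?N" using t nu_ray[OF \<theta> r'] by (intro mult_left_mono) auto
      qed
      also have "\<dots> = t * (CH * C * exp (m * \<rho>) / C1 * double_jump R)"
        using t C1 F_pos[of "r *\<^sub>R \<theta>"] by (simp add: field_simps power2_eq_square)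
      also have "\<dots> \<le> c * (CH * C * exp (m * \<rho>) / C1 * double_jump R)"
        using t CH(1) C(1) C1 double_jump_nonneg[of R] by (intro mult_right_mono) auto
      finally show ?thesis by (simp add: a2_def mult_ac)
    qed
    have "\<bar>heat t ?x / (t * ?N) - lim_val t \<theta> y\<bar> \<le> a2 * double_jump R + \<epsilon> / 2 + main_err R t \<theta> y r + a1 * kk R"
    proof -
      have "\<bar>H - L\<bar> \<le> d4 + d1 + d2 + d3" if "\<bar>u\<bar> \<le> d1" "\<bar>v - w\<bar> \<le> d2" "\<bar>w - L\<bar> \<le> d3" "\<bar>H - (u + v)\<bar> \<le> d4"
        for H L u v w d1 d2 d3 d4 :: real using that by linarith
      from this[OF q1 q2 q3 q4] show ?thesis .
    qed
    then show ?thesis using Re by linarith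
  qed
  then show ?thesis using R(1) r1(1) by blast
qed

lemma main_err_tendsto:
  assumes R: "1 \<le> R" and gs: "good_scale t h" and \<theta>: "\<theta> \<in> E"
  shows "(main_err R t \<theta> y \<longlongrightarrow> 0) at_top"
proof -
  have R0: "0 < R" using R by simp
  note [measurable] = kern_measurable[OF R0 gs]
  note k0 = kern_nonneg[OF gs R0]
  obtain D m where Dm: "0 < D" "0 \<le> m" and Db: "\<And>r z. 1 \<le> r \<Longrightarrow> ratio_err R \<theta> y r z \<le> D * exp (m * norm z)"
    using ratio_err_bound[of "norm y"] R \<theta> by auto
  have mi: "integrable lborel (\<lambda>z. D * (exp (m * norm z) * kern R t z))"
    using kern_moment_integrable[OF R Dm(2)] gs by auto
  have "((\<lambda>r. LINT z|lborel. kern R t z * ratio_err R \<theta> y r z) \<longlongrightarrow> (LINT z|(lborel::'a measure). 0::real)) at_top"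
  proof (rule integral_dominated_convergence_at_top[OF _ _ mi])
    show "\<forall>\<^sub>F r in at_top. AE z in lborel. norm (kern R t z * ratio_err R \<theta> y r z) \<le> D * (exp (m * norm z) * kern R t z)"
      using eventually_ge_at_top[of 1]
    proof eventually_elim
      case (elim r)
      show ?case
      proof (rule AE_I2)
        fix z
        have "kern R t z * ratio_err R \<theta> y r z \<le> kern R t z * (D * exp (m * norm z))" by (intro mult_left_mono Db elim k0)
        then show "norm (kern R t z * ratio_err R \<theta> y r z) \<le> D * (exp (m * norm z) * kern R t z)"
          using k0[of z] by (simp add: abs_mult ratio_err_def mult_ac)
      qed
    qed
    show "AE z in lborel. ((\<lambda>r. kern R t z * ratio_err R \<theta> y r z) \<longlongrightarrow> 0) at_top"
    proof (rule AE_I2)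
      fix z
      have "((\<lambda>r. nu (r *\<^sub>R \<theta> - (y + z)) / nu (r *\<^sub>R \<theta>)) \<longlongrightarrow> exp (\<kappa> * (\<theta> \<bullet> (y + z)))) at_top" by (rule ratio[OF \<theta>])
      moreover have "\<forall>\<^sub>F r in at_top. nu (r *\<^sub>R \<theta> - (y + z)) / nu (r *\<^sub>R \<theta>) = nubar R (r *\<^sub>R \<theta> - y - z) / nu (r *\<^sub>R \<theta>)"
        using eventually_gt_at_top[of "R + norm (y + z)"]
      proof eventually_elim
        case (elim r)
        have "0 < r" using elim R norm_ge_zero[of "y + z"] by linarith
        then have "norm (r *\<^sub>R \<theta>) = r" using E_norm[OF \<theta>] by simp
        then have "R < norm (r *\<^sub>R \<theta> - (y + z))" using norm_triangle_ineq2[of "r *\<^sub>R \<theta>" "y + z"] elim by linarith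
        then show ?case by (simp add: nubar_def diff_diff_eq)
      qed
      ultimately have "((\<lambda>r. nubar R (r *\<^sub>R \<theta> - y - z) / nu (r *\<^sub>R \<theta>)) \<longlongrightarrow> exp (\<kappa> * (\<theta> \<bullet> (y + z)))) at_top"
        by (rule Lim_transform_eventually)
      then have "((\<lambda>r. kern R t z * \<bar>nubar R (r *\<^sub>R \<theta> - y - z) / nu (r *\<^sub>R \<theta>) - exp (\<kappa> * (\<theta> \<bullet> (y + z)))\<bar>) \<longlongrightarrow>
          kern R t z * \<bar>exp (\<kappa> * (\<theta> \<bullet> (y + z))) - exp (\<kappa> * (\<theta> \<bullet> (y + z)))\<bar>) at_top"
        by (intro tendsto_intros)
      then show "((\<lambda>r. kern R t z * ratio_err R \<theta> y r z) \<longlongrightarrow> 0) at_top" by (simp add: ratio_err_def)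
    qed
  qed measurable
  then show ?thesis by (simp add: main_err_def[abs_def])
qed

text \<open>For \<open>norm z \<le> s\<close> the point \<open>y + z\<close> stays in a compact
  ball, on which the ratio converges uniformly. Beyond, a moment of order \<open>m + 1\<close>
  instead of \<open>m\<close> gains \<open>exp (- s)\<close>. Both moments are uniform over
  \<open>good_scale\<close>.\<close>

lemma main_err_uniform:
  assumes R: "1 \<le> R" and \<rho>: "0 < \<rho>" and \<epsilon>: "0 < \<epsilon>"
    and unif: "\<And>D. compact D \<Longrightarrow> uniform_limit (E \<times> D) (\<lambda>r (\<theta>, y). nu (r *\<^sub>R \<theta> - y) / nu (r *\<^sub>R \<theta>))
       (\<lambda>(\<theta>, y). exp (\<kappa> * (\<theta> \<bullet> y))) at_top"
  shows "\<exists>r2. \<forall>r t h \<theta> y. r2 \<le> r \<longrightarrow> good_scale t h \<longrightarrow> \<theta> \<in> E \<longrightarrow> norm y \<le> \<rho> \<longrightarrow> main_err R t \<theta> y r \<le> \<epsilon>"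
proof -
  have R0: "0 < R" using R by simp
  obtain D m where Dm: "0 < D" "0 \<le> m" and Db: "\<And>\<theta> y r z. \<theta> \<in> E \<Longrightarrow> norm y \<le> \<rho> \<Longrightarrow> 1 \<le> r \<Longrightarrow> ratio_err R \<theta> y r z \<le> D * exp (m * norm z)"
    using ratio_err_bound[of \<rho>] R \<rho> by auto
  have m1: "0 \<le> m + 1" using Dm by simp
  obtain C0' where C0': "0 < C0'" "\<And>t h. good_scale t h \<Longrightarrow> integrable lborel (\<lambda>z. exp (0 * norm z) * kern R t z) \<and>
     (LINT z|lborel. exp (0 * norm z) * kern R t z) \<le> C0'"
    using kern_moment_integrable[OF R order_refl] by blast
  obtain Cm where Cm: "0 < Cm" "\<And>t h. good_scale t h \<Longrightarrow> integrable lborel (\<lambda>z. exp ((m + 1) * norm z) * kern R t z) \<and>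
     (LINT z|lborel. exp ((m + 1) * norm z) * kern R t z) \<le> Cm"
    using kern_moment_integrable[OF R m1] by blast
  have "((\<lambda>s::real. D * Cm * exp (- s)) \<longlongrightarrow> D * Cm * 0) at_top" by (intro tendsto_mult tendsto_const) real_asymp
  then have lim: "((\<lambda>s::real. D * Cm * exp (- s)) \<longlongrightarrow> 0) at_top" by simp
  have "\<forall>\<^sub>F s::real in at_top. D * Cm * exp (- s) < \<epsilon> / 2"
    by (rule order_tendstoD(2)[OF lim]) (use \<epsilon> in simp)
  then obtain s0 where s0: "\<And>s::real. s0 \<le> s \<Longrightarrow> D * Cm * exp (- s) < \<epsilon> / 2" unfolding eventually_at_top_linorder by blast
  define s where "s = max 0 s0"
  have s: "0 \<le> s" "D * Cm * exp (- s) < \<epsilon> / 2" using s0[of s] by (simp_all add: s_def)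
  define \<epsilon>1 where "\<epsilon>1 = \<epsilon> / (2 * C0')"
  have \<epsilon>1: "0 < \<epsilon>1" using \<epsilon> C0'(1) by (simp add: \<epsilon>1_def)
  have "\<forall>\<^sub>F r in at_top. \<forall>p\<in>E \<times> cball 0 (\<rho> + s). dist (case p of (\<theta>, y) \<Rightarrow> nu (r *\<^sub>R \<theta> - y) / nu (r *\<^sub>R \<theta>)) (case p of (\<theta>, y) \<Rightarrow> exp (\<kappa> * (\<theta> \<bullet> y))) < \<epsilon>1"
    using uniform_limitD[OF unif[OF compact_cball] \<epsilon>1, of 0 "\<rho> + s"] by simp
  then obtain r0 where r0': "\<forall>r\<ge>r0. \<forall>p\<in>E \<times> cball 0 (\<rho> + s). dist (case p of (\<theta>, y) \<Rightarrow> nu (r *\<^sub>R \<theta> - y) / nu (r *\<^sub>R \<theta>)) (case p of (\<theta>, y) \<Rightarrow> exp (\<kappa> * (\<theta> \<bullet> y))) < \<epsilon>1"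
    unfolding eventually_at_top_linorder by blast
  have r0: "\<bar>nu (r *\<^sub>R \<theta> - y) / nu (r *\<^sub>R \<theta>) - exp (\<kappa> * (\<theta> \<bullet> y))\<bar> < \<epsilon>1"
    if "r0 \<le> r" "\<theta> \<in> E" "norm y \<le> \<rho> + s" for r \<theta> y
    using r0'[rule_format, OF that(1), of "(\<theta>, y)"] that(2,3) by (simp add: dist_real_def)
  have "main_err R t \<theta> y r \<le> \<epsilon>"
    if r: "max (max 1 r0) (R + \<rho> + s + 1) \<le> r" and gs: "good_scale t h" and \<theta>: "\<theta> \<in> E" and y: "norm y \<le> \<rho>" for r t h \<theta> y
  proof -
    have r': "1 \<le> r" "r0 \<le> r" "R + \<rho> + s + 1 \<le> r" using r by auto
    note [measurable] = kern_measurable[OF R0 gs]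
    note k0 = kern_nonneg[OF gs R0]
    have c0: "integrable lborel (\<lambda>z. kern R t z)" "(LINT z|lborel. kern R t z) \<le> C0'" using C0'(2)[OF gs] by auto
    have cm: "integrable lborel (\<lambda>z. exp ((m + 1) * norm z) * kern R t z)" "(LINT z|lborel. exp ((m + 1) * norm z) * kern R t z) \<le> Cm"
      using Cm(2)[OF gs] by auto
    have "main_err R t \<theta> y r \<le> (LINT z|lborel. \<epsilon>1 * kern R t z + D * exp (- s) * (exp ((m + 1) * norm z) * kern R t z))"
      unfolding main_err_def
    proof (rule integral_mono')
      show "integrable lborel (\<lambda>z. \<epsilon>1 * kern R t z + D * exp (- s) * (exp ((m + 1) * norm z) * kern R t z))"
        using c0(1) cm(1) by simp
      fix z
      show "kern R t z * ratio_err R \<theta> y r z \<le> \<epsilon>1 * kern R t z + D * exp (- s) * (exp ((m + 1) * norm z) * kern R t z)"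
      proof (cases "norm z \<le> s")
        case True
        have yz: "norm (y + z) \<le> \<rho> + s" using norm_triangle_ineq[of y z] y True by linarith
        have "norm (r *\<^sub>R \<theta>) = r" using E_norm[OF \<theta>] r' by simp
        then have "R < norm (r *\<^sub>R \<theta> - (y + z))" using norm_triangle_ineq2[of "r *\<^sub>R \<theta>" "y + z"] yz r'(3) by linarith
        then have "nubar R (r *\<^sub>R \<theta> - y - z) = nu (r *\<^sub>R \<theta> - (y + z))" by (simp add: nubar_def diff_diff_eq)
        then have "ratio_err R \<theta> y r z \<le> \<epsilon>1" unfolding ratio_err_def using r0[OF r'(2) \<theta> yz] by simp
        then have "kern R t z * ratio_err R \<theta> y r z \<le> kern R t z * \<epsilon>1" by (intro mult_left_mono k0)
        moreover have "0 \<le> D * exp (- s) * (exp ((m + 1) * norm z) * kern R t z)" using Dm k0[of z] by simp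
        ultimately show ?thesis by (simp add: mult.commute)
      next
        case False
        have "ratio_err R \<theta> y r z \<le> D * exp (m * norm z)" by (rule Db[OF \<theta> y r'(1)])
        also have "\<dots> \<le> D * exp (- s + (m + 1) * norm z)" using Dm False by (intro mult_left_mono) (auto simp: algebra_simps)
        also have "\<dots> = D * exp (- s) * exp ((m + 1) * norm z)" by (simp only: exp_add mult.assoc)
        finally have "kern R t z * ratio_err R \<theta> y r z \<le> kern R t z * (D * exp (- s) * exp ((m + 1) * norm z))"
          by (intro mult_left_mono k0)
        moreover have "0 \<le> \<epsilon>1 * kern R t z" using \<epsilon>1 k0[of z] by simp
        moreover have "kern R t z * (D * exp (- s) * exp ((m + 1) * norm z)) = D * exp (- s) * (exp ((m + 1) * norm z) * kern R t z)"
          by (simp only: mult_ac)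
        ultimately show ?thesis by linarith
      qed
      show "0 \<le> \<epsilon>1 * kern R t z + D * exp (- s) * (exp ((m + 1) * norm z) * kern R t z)" using Dm k0[of z] \<epsilon>1 by simp
    qed
    also have "\<dots> = \<epsilon>1 * (LINT z|lborel. kern R t z) + D * exp (- s) * (LINT z|lborel. exp ((m + 1) * norm z) * kern R t z)"
      using c0(1) cm(1) by simp
    also have "\<dots> \<le> \<epsilon>1 * C0' + D * exp (- s) * Cm"
      using c0(2) cm(2) \<epsilon>1 Dm by (intro add_mono mult_left_mono) auto
    also have "\<dots> \<le> \<epsilon> / 2 + \<epsilon> / 2"
    proof (rule add_mono)
      show "\<epsilon>1 * C0' \<le> \<epsilon> / 2" using C0'(1) by (simp add: \<epsilon>1_def)
      show "D * exp (- s) * Cm \<le> \<epsilon> / 2" using s(2) by (simp add: mult_ac)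
    qed
    finally show ?thesis by simp
  qed
  then show ?thesis by blast
qed

lemma heat_ratio_tendsto:
  assumes gs: "good_scale t h" and \<theta>: "\<theta> \<in> E"
  shows "((\<lambda>r. heat t (r *\<^sub>R \<theta> - y) / (t * nu (r *\<^sub>R \<theta>))) \<longlongrightarrow> lim_val t \<theta> y) at_top"
proof (rule tendstoI)
  fix \<epsilon> :: real assume \<epsilon>: "0 < \<epsilon>"
  have pos: "0 < norm y + 1" "0 < \<epsilon> / 2" using \<epsilon> by (auto simp: add_nonneg_pos)
  obtain R r1 where R: "1 \<le> R" "1 \<le> r1" and b': "\<forall>r t h \<theta> y'. r1 \<le> r \<longrightarrow> good_scale t h \<longrightarrow> \<theta> \<in> E \<longrightarrow> norm y' \<le> norm y + 1 \<longrightarrow>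
     \<bar>heat t (r *\<^sub>R \<theta> - y') / (t * nu (r *\<^sub>R \<theta>)) - lim_val t \<theta> y'\<bar> \<le> \<epsilon> / 2 + main_err R t \<theta> y' r"
    using heat_ratio_bound[OF pos] by blast
  have b: "\<bar>heat t (r *\<^sub>R \<theta> - y) / (t * nu (r *\<^sub>R \<theta>)) - lim_val t \<theta> y\<bar> \<le> \<epsilon> / 2 + main_err R t \<theta> y r" if "r1 \<le> r" for r
    using b'[rule_format, OF that gs \<theta>] by simp
  have "\<forall>\<^sub>F r in at_top. main_err R t \<theta> y r < \<epsilon> / 2"
    using order_tendstoD(2)[OF main_err_tendsto[OF R(1) gs \<theta>], of "\<epsilon> / 2"] \<epsilon> by simp
  then show "\<forall>\<^sub>F r in at_top. dist (heat t (r *\<^sub>R \<theta> - y) / (t * nu (r *\<^sub>R \<theta>))) (lim_val t \<theta> y) < \<epsilon>"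
    using eventually_ge_at_top[of r1]
  proof eventually_elim
    case (elim r)
    then show ?case using b[of r] by (simp add: dist_real_def)
  qed
qed

lemma heat_ratio_uniform_limit:
  assumes gs: "\<And>t. t \<in> T \<Longrightarrow> \<exists>h. good_scale t h" and \<rho>: "0 < \<rho>"
    and unif: "\<And>D. compact D \<Longrightarrow> uniform_limit (E \<times> D) (\<lambda>r (\<theta>, y). nu (r *\<^sub>R \<theta> - y) / nu (r *\<^sub>R \<theta>))
       (\<lambda>(\<theta>, y). exp (\<kappa> * (\<theta> \<bullet> y))) at_top"
  shows "uniform_limit (T \<times> E \<times> ball 0 \<rho>) (\<lambda>r (t, \<theta>, y). heat t (r *\<^sub>R \<theta> - y) / (t * nu (r *\<^sub>R \<theta>)))
     (\<lambda>(t, \<theta>, y). lim_val t \<theta> y) at_top"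
proof (rule uniform_limitI)
  fix \<epsilon> :: real assume \<epsilon>: "0 < \<epsilon>"
  obtain R r1 where R: "1 \<le> R" "1 \<le> r1" and b: "\<And>r t h \<theta> y. r1 \<le> r \<Longrightarrow> good_scale t h \<Longrightarrow> \<theta> \<in> E \<Longrightarrow> norm y \<le> \<rho> \<Longrightarrow>
     \<bar>heat t (r *\<^sub>R \<theta> - y) / (t * nu (r *\<^sub>R \<theta>)) - lim_val t \<theta> y\<bar> \<le> \<epsilon> / 2 + main_err R t \<theta> y r"
    using heat_ratio_bound[OF \<rho> half_gt_zero[OF \<epsilon>]] by blast
  have \<epsilon>4: "0 < \<epsilon> / 4" using \<epsilon> by simp
  obtain r2 where r2: "\<And>r t h \<theta> y. r2 \<le> r \<Longrightarrow> good_scale t h \<Longrightarrow> \<theta> \<in> E \<Longrightarrow> norm y \<le> \<rho> \<Longrightarrow> main_err R t \<theta> y r \<le> \<epsilon> / 4"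
    using main_err_uniform[OF R(1) \<rho> \<epsilon>4 unif] by blast
  show "\<forall>\<^sub>F r in at_top. \<forall>p\<in>T \<times> E \<times> ball 0 \<rho>.
     dist (case p of (t, \<theta>, y) \<Rightarrow> heat t (r *\<^sub>R \<theta> - y) / (t * nu (r *\<^sub>R \<theta>))) (case p of (t, \<theta>, y) \<Rightarrow> lim_val t \<theta> y) < \<epsilon>"
    using eventually_ge_at_top[of "max r1 r2"]
  proof eventually_elim
    case (elim r)
    show ?case
    proof
      fix p assume "p \<in> T \<times> E \<times> ball (0::'a) \<rho>"
      then obtain t \<theta> y where p: "p = (t, \<theta>, y)" "t \<in> T" "\<theta> \<in> E" "norm y \<le> \<rho>" by (auto simp: less_imp_le)
      obtain h where h: "good_scale t h" using gs[OF p(2)] by blast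
      have "\<bar>heat t (r *\<^sub>R \<theta> - y) / (t * nu (r *\<^sub>R \<theta>)) - lim_val t \<theta> y\<bar> \<le> \<epsilon> / 2 + \<epsilon> / 4"
        using b[OF _ h p(3,4), of r] r2[OF _ h p(3,4), of r] elim by simp
      then show "dist (case p of (t, \<theta>, y) \<Rightarrow> heat t (r *\<^sub>R \<theta> - y) / (t * nu (r *\<^sub>R \<theta>))) (case p of (t, \<theta>, y) \<Rightarrow> lim_val t \<theta> y) < \<epsilon>"
        using \<epsilon> by (simp add: p(1) dist_real_def)
    qed
  qed
qed

end

section \<open>The spatial scale of the process\<close>

text \<open>\<open>1 - sin a / a\<close> is the mean of \<open>1 - cos (s * a)\<close> over
  \<open>s\<close> in [0,1]. For \<open>0 < x < 2\<close> the Taylor polynomial with remainder of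
  order 5 gives \<open>2 / 15\<close> times the square; for larger \<open>x\<close> the value is at
  least 1/2.\<close>

lemma one_minus_sinc_ge:
  fixes a :: real
  assumes "a \<noteq> 0"
  shows "min 1 (a\<^sup>2) / 12 \<le> 1 - sin a / a"
proof -
  have pos: "min 1 (x\<^sup>2) / 12 \<le> 1 - sin x / x" if x: "0 < x" for x :: real
  proof (cases "2 \<le> x")
    case True
    have "sin x / x \<le> 1 / 2" using True by (intro frac_le) auto
    moreover have "min 1 (x\<^sup>2) \<le> 1" by simp
    ultimately show ?thesis by linarith
  next
    case False
    have "\<bar>sin x - (\<Sum>m<5. sin_coeff m * x ^ m)\<bar> \<le> inverse (fact 5) * \<bar>x\<bar> ^ 5" by (rule Maclaurin_sin_bound)
    moreover have "(\<Sum>m<5. sin_coeff m * x ^ m) = x - x ^ 3 / 6"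
      by (simp add: eval_nat_numeral sin_coeff_Suc cos_coeff_Suc)
    moreover have "inverse (fact 5) * \<bar>x\<bar> ^ 5 = x ^ 5 / 120" using x by (simp add: fact_numeral)
    ultimately have "sin x \<le> x - x ^ 3 / 6 + x ^ 5 / 120" by linarith
    then have "sin x / x \<le> (x - x ^ 3 / 6 + x ^ 5 / 120) / x" using x by (intro divide_right_mono) auto
    also have "\<dots> = 1 - x\<^sup>2 / 6 + x\<^sup>2 * x\<^sup>2 / 120" using x by (simp add: field_simps eval_nat_numeral)
    also have "\<dots> \<le> 1 - x\<^sup>2 / 6 + x\<^sup>2 * 4 / 120"
    proof -
      have "x\<^sup>2 \<le> 2\<^sup>2" using x False by (intro power_mono) auto
      then have "x\<^sup>2 * x\<^sup>2 \<le> x\<^sup>2 * 4" by (intro mult_left_mono) auto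
      then show ?thesis by simp
    qed
    finally have "x\<^sup>2 * (2 / 15) \<le> 1 - sin x / x" by simp
    moreover have "min 1 (x\<^sup>2) / 12 \<le> x\<^sup>2 * (2 / 15)" using zero_le_power2[of x] by (simp add: min_def) 
    ultimately show ?thesis by linarith
  qed
  show ?thesis
  proof (cases "0 < a")
    case False
    then show ?thesis using pos[of "- a"] assms by simp
  qed (use pos in auto)
qed

lemma average_one_minus_cos:
  fixes a :: real
  shows "ennreal (min 1 (a\<^sup>2) / 12) \<le> (\<integral>\<^sup>+ s. ennreal (1 - cos (s * a)) * indicator {0..1} s \<partial>lborel)"
proof (cases "a = 0")
  case False
  have "(\<integral>\<^sup>+ s. ennreal (1 - cos (s * a)) * indicator {0..1} s \<partial>lborel) = ennreal ((1 - sin (1 * a) / a) - (0 - sin (0 * a) / a))"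
  proof (rule nn_integral_FTC_Icc[where F="\<lambda>s. s - sin (s * a) / a"])
    fix s :: real
    show "((\<lambda>s. s - sin (s * a) / a) has_real_derivative 1 - cos (s * a)) (at s)"
      using False by (auto intro!: derivative_eq_intros)
  qed auto
  also have "\<dots> = ennreal (1 - sin a / a)" by simp
  finally show ?thesis using one_minus_sinc_ge[OF False] by (simp add: ennreal_leI)
qed simp

text \<open>If one coordinate term reaches 1, it alone suffices; otherwise no minimum on the right
  is active and the sum is the squared norm.\<close>

lemma min_1_norm_sq_le_sum:
  fixes y :: "'a::euclidean_space"
  shows "min 1 ((r * norm y)\<^sup>2) \<le> (\<Sum>b\<in>Basis. min 1 ((r * (y \<bullet> b))\<^sup>2))"
proof (cases "\<exists>b\<in>Basis. 1 \<le> (r * (y \<bullet> b))\<^sup>2")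
  case True
  then obtain b where b: "b \<in> Basis" "1 \<le> (r * (y \<bullet> b))\<^sup>2" by auto
  have "min 1 ((r * norm y)\<^sup>2) \<le> 1" by simp
  also have "1 = min 1 ((r * (y \<bullet> b))\<^sup>2)" using b by simp
  also have "\<dots> \<le> (\<Sum>b\<in>Basis. min 1 ((r * (y \<bullet> b))\<^sup>2))" using b(1) by (intro member_le_sum) auto
  finally show ?thesis .
next
  case False
  have n: "(norm y)\<^sup>2 = (\<Sum>b\<in>Basis. (y \<bullet> b)\<^sup>2)"
    by (subst euclidean_inner[of y y, folded power2_norm_eq_inner]) (simp add: power2_eq_square)
  have "min 1 ((r * norm y)\<^sup>2) \<le> (r * norm y)\<^sup>2" by simp
  also have "\<dots> = (\<Sum>b\<in>Basis. (r * (y \<bullet> b))\<^sup>2)" by (simp add: power_mult_distrib n sum_distrib_left)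
  also have "\<dots> = (\<Sum>b\<in>Basis. min 1 ((r * (y \<bullet> b))\<^sup>2))" using False by (intro sum.cong) auto
  finally show ?thesis .
qed

section \<open>The function \<open>Psi\<close>, its level sets and the choice of the scale\<close>

context jump_kernel
begin

definition I0 :: real where
  "I0 = (LINT y|lborel. min 1 ((norm y)\<^sup>2) * nu y)"

lemma I0_nonneg: "0 \<le> I0"
  unfolding I0_def using nu_nonneg by (intro integral_nonneg_AE) auto

lemma Re_levy_Phi_le: "Re (levy_Phi nu \<xi>) \<le> (2 + (norm \<xi>)\<^sup>2) * I0"
proof -
  have "Re (levy_Phi nu \<xi>) \<le> (LINT y|lborel. (2 + (norm \<xi>)\<^sup>2) * (min 1 ((norm y)\<^sup>2) * nu y))"
    unfolding Re_levy_Phi[OF nu]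
  proof (rule integral_mono)
    show "integrable lborel (\<lambda>y. nu y * (1 - cos (\<xi> \<bullet> y)))" by (rule integrable_one_minus_cos[OF nu])
    show "integrable lborel (\<lambda>y. (2 + (norm \<xi>)\<^sup>2) * (min 1 ((norm y)\<^sup>2) * nu y))"
      using levy_densityD(3)[OF nu] by simp
    fix y
    have "1 - cos (\<xi> \<bullet> y) \<le> (2 + (norm \<xi>)\<^sup>2) * min 1 ((norm y)\<^sup>2)" using one_minus_cos_bound[of \<xi> y] by simp
    then have "nu y * (1 - cos (\<xi> \<bullet> y)) \<le> nu y * ((2 + (norm \<xi>)\<^sup>2) * min 1 ((norm y)\<^sup>2))"
      by (intro mult_left_mono nu_nonneg)
    then show "nu y * (1 - cos (\<xi> \<bullet> y)) \<le> (2 + (norm \<xi>)\<^sup>2) * (min 1 ((norm y)\<^sup>2) * nu y)" by (simp only: mult_ac)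
  qed
  then show ?thesis by (simp add: I0_def)
qed

lemma isCont_Re_levy_Phi: "isCont (\<lambda>\<xi>. Re (levy_Phi nu \<xi>)) \<xi>"
  unfolding continuous_at_sequentially comp_def
proof (intro allI impI)
  fix X :: "nat \<Rightarrow> 'a" assume X: "X \<longlonglongrightarrow> \<xi>"
  obtain M where M: "\<And>n. norm (X n) \<le> M" using convergent_imp_Bseq[OF convergentI[OF X]] by (auto simp: Bseq_def)
  show "(\<lambda>n. Re (levy_Phi nu (X n))) \<longlonglongrightarrow> Re (levy_Phi nu \<xi>)"
    unfolding Re_levy_Phi[OF nu]
  proof (rule integral_dominated_convergence[where w="\<lambda>y. (2 + M\<^sup>2) * (min 1 ((norm y)\<^sup>2) * nu y)"])
    show "integrable lborel (\<lambda>y. (2 + M\<^sup>2) * (min 1 ((norm y)\<^sup>2) * nu y))" using levy_densityD(3)[OF nu] by simp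
    show "AE y in lborel. (\<lambda>n. nu y * (1 - cos (X n \<bullet> y))) \<longlonglongrightarrow> nu y * (1 - cos (\<xi> \<bullet> y))"
      by (intro AE_I2 tendsto_intros X)
    show "AE y in lborel. norm (nu y * (1 - cos (X n \<bullet> y))) \<le> (2 + M\<^sup>2) * (min 1 ((norm y)\<^sup>2) * nu y)" for n
    proof (rule AE_I2)
      fix y
      have "norm (1 - cos (X n \<bullet> y)) \<le> (2 + (norm (X n))\<^sup>2) * min 1 ((norm y)\<^sup>2)" by (rule one_minus_cos_bound)
      also have "\<dots> \<le> (2 + M\<^sup>2) * min 1 ((norm y)\<^sup>2)"
        using M[of n] by (intro mult_right_mono add_left_mono power_mono) auto
      finally have "nu y * norm (1 - cos (X n \<bullet> y)) \<le> nu y * ((2 + M\<^sup>2) * min 1 ((norm y)\<^sup>2))"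
        by (intro mult_left_mono nu_nonneg)
      then show "norm (nu y * (1 - cos (X n \<bullet> y))) \<le> (2 + M\<^sup>2) * (min 1 ((norm y)\<^sup>2) * nu y)"
        unfolding norm_mult using nu_nonneg[of y] by (simp add: mult_ac)
    qed
  qed measurable
qed

lemma Psi_bdd: "bdd_above ((\<lambda>\<xi>. Re (levy_Phi nu \<xi>)) ` cball 0 r)"
proof (rule bdd_aboveI2)
  fix \<xi> :: 'a assume "\<xi> \<in> cball 0 r"
  then have "norm \<xi> \<le> r" by simp
  then have "(2 + (norm \<xi>)\<^sup>2) * I0 \<le> (2 + r\<^sup>2) * I0"
    by (intro mult_right_mono add_left_mono power_mono I0_nonneg) auto
  then show "Re (levy_Phi nu \<xi>) \<le> (2 + r\<^sup>2) * I0" using Re_levy_Phi_le[of \<xi>] by linarith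
qed

lemma Re_levy_Phi_le_Psi: "norm \<xi> \<le> r \<Longrightarrow> Re (levy_Phi nu \<xi>) \<le> Psi nu r"
  unfolding Psi_def by (rule cSUP_upper[OF _ Psi_bdd]) simp

lemma Psi_le:
  assumes "0 \<le> r" "\<And>\<xi>. norm \<xi> \<le> r \<Longrightarrow> Re (levy_Phi nu \<xi>) \<le> B"
  shows "Psi nu r \<le> B"
  unfolding Psi_def by (rule cSUP_least) (use assms in auto)

lemma Psi_mono: "0 \<le> r \<Longrightarrow> r \<le> s \<Longrightarrow> Psi nu r \<le> Psi nu s"
  by (rule Psi_le) (auto intro: Re_levy_Phi_le_Psi)

lemma Psi_upper: "0 \<le> r \<Longrightarrow> Psi nu r \<le> (2 + r\<^sup>2) * I0"
proof (rule Psi_le)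
  fix \<xi> :: 'a assume "norm \<xi> \<le> r" 
  then have "(2 + (norm \<xi>)\<^sup>2) * I0 \<le> (2 + r\<^sup>2) * I0"
    by (intro mult_right_mono add_left_mono power_mono I0_nonneg) auto
  then show "Re (levy_Phi nu \<xi>) \<le> (2 + r\<^sup>2) * I0" using Re_levy_Phi_le[of \<xi>] by linarith
qed

lemma Psi_0: "Psi nu 0 = 0"
  by (simp add: Psi_def Re_levy_Phi[OF nu])

text \<open>A frequency of norm above \<open>s\<close> is moved radially to the sphere of radius
  \<open>s\<close>, a shift by less than \<open>d\<close>. With the modulus of continuity
  \<open>d\<close> given in advance, the step serves both directions of continuity.\<close>

lemma Psi_uniform_step:
  assumes e: "0 < e" and d: "\<And>\<xi> \<zeta>. norm \<xi> \<le> r1 \<Longrightarrow> norm \<zeta> \<le> r1 \<Longrightarrow> dist \<zeta> \<xi> < d \<Longrightarrow> dist (Re (levy_Phi nu \<zeta>)) (Re (levy_Phi nu \<xi>)) < e"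
    and rs: "0 \<le> s" "s \<le> r" "r \<le> r1" "r - s < d"
  shows "Psi nu r \<le> Psi nu s + e"
proof (rule Psi_le)
  show "0 \<le> r" using rs by simp
  fix \<xi> :: 'a assume \<xi>: "norm \<xi> \<le> r"
  show "Re (levy_Phi nu \<xi>) \<le> Psi nu s + e"
  proof (cases "norm \<xi> \<le> s")
    case True
    then show ?thesis using Re_levy_Phi_le_Psi[OF True] e by linarith
  next
    case False
    then have n0: "0 < norm \<xi>" using rs by linarith
    define \<zeta> where "\<zeta> = (s / norm \<xi>) *\<^sub>R \<xi>"
    have n\<zeta>: "norm \<zeta> = s" using n0 rs by (simp add: \<zeta>_def)
    have "\<xi> - \<zeta> = (1 - s / norm \<xi>) *\<^sub>R \<xi>" by (simp add: \<zeta>_def scaleR_diff_left)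
    then have "norm (\<xi> - \<zeta>) = \<bar>1 - s / norm \<xi>\<bar> * norm \<xi>" by simp
    also have "\<dots> = norm \<xi> - s" using n0 False by (simp add: abs_of_nonneg field_simps)
    finally have "dist \<xi> \<zeta> < d" using \<xi> rs by (simp add: dist_norm)
    then have "dist (Re (levy_Phi nu \<xi>)) (Re (levy_Phi nu \<zeta>)) < e" using \<xi> rs n\<zeta> by (intro d) auto
    then show ?thesis using Re_levy_Phi_le_Psi[of \<zeta> s] n\<zeta> by (simp add: dist_real_def)
  qed
qed

lemma continuous_on_Psi: "continuous_on {0..r1} (Psi nu)"
  unfolding continuous_on_iff
proof (intro ballI allI impI)
  fix r e :: real assume r: "r \<in> {0..r1}" and e: "0 < e"
  have "uniformly_continuous_on (cball 0 r1) (\<lambda>\<xi>. Re (levy_Phi nu \<xi>))"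
    by (intro compact_uniformly_continuous continuous_at_imp_continuous_on ballI isCont_Re_levy_Phi) auto
  then obtain d where d0: "0 < d" and dd: "\<forall>\<xi>\<in>cball 0 r1. \<forall>\<zeta>\<in>cball 0 r1. dist \<zeta> \<xi> < d \<longrightarrow> dist (Re (levy_Phi nu \<zeta>)) (Re (levy_Phi nu \<xi>)) < e / 2"
    unfolding uniformly_continuous_on_def using half_gt_zero[OF e] by blast
  have d: "0 < d" "\<And>\<xi> \<zeta>. norm \<xi> \<le> r1 \<Longrightarrow> norm \<zeta> \<le> r1 \<Longrightarrow> dist \<zeta> \<xi> < d \<Longrightarrow> dist (Re (levy_Phi nu \<zeta>)) (Re (levy_Phi nu \<xi>)) < e / 2"
    using d0 dd by (simp_all add: mem_cball_0)
  show "\<exists>d>0. \<forall>s\<in>{0..r1}. dist s r < d \<longrightarrow> dist (Psi nu s) (Psi nu r) < e"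
  proof (intro exI[of _ d] conjI ballI impI)
    fix s assume s: "s \<in> {0..r1}" "dist s r < d"
    show "dist (Psi nu s) (Psi nu r) < e"
    proof (cases "s \<le> r")
      case True
      have "Psi nu r \<le> Psi nu s + e / 2" using e r s True by (intro Psi_uniform_step[OF _ d(2)]) (auto simp: dist_real_def)
      then show ?thesis using Psi_mono[of s r] s True e by (simp add: dist_real_def)
    next
      case False
      have "Psi nu s \<le> Psi nu r + e / 2" using e r s False by (intro Psi_uniform_step[OF _ d(2)]) (auto simp: dist_real_def)
      then show ?thesis using Psi_mono[of r s] r False e by (simp add: dist_real_def)
    qed
  qed (use d in auto)
qed

lemma Psi_infty_eq: "Psi_infty nu = (SUP r\<in>{0..}. ereal (Psi nu r))"
  unfolding Psi_infty_def
proof (rule tendsto_Lim)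
  let ?l = "SUP r\<in>{0..}. ereal (Psi nu r)"
  show "((\<lambda>r. ereal (Psi nu r)) \<longlongrightarrow> ?l) at_top"
  proof (rule order_tendstoI)
    fix a assume "a < ?l"
    then obtain r0 where r0: "0 \<le> r0" "a < ereal (Psi nu r0)" by (auto simp: less_SUP_iff)
    show "\<forall>\<^sub>F r in at_top. a < ereal (Psi nu r)" using eventually_ge_at_top[of r0]
    proof eventually_elim
      case (elim r)
      then have "ereal (Psi nu r0) \<le> ereal (Psi nu r)" using Psi_mono[OF r0(1)] by simp
      then show ?case by (rule less_le_trans[OF r0(2)])
    qed
  next
    fix a assume a: "?l < a"
    show "\<forall>\<^sub>F r in at_top. ereal (Psi nu r) < a" using eventually_ge_at_top[of 0]
    proof eventually_elim
      case (elim r)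
      have "ereal (Psi nu r) \<le> ?l" using elim by (intro SUP_upper) auto
      then show ?case using a by (rule le_less_trans)
    qed
  qed
qed simp

text \<open>The level set is nonempty by the intermediate value theorem and bounded because the
  monotone \<open>Psi\<close> exceeds \<open>1 / t\<close> somewhere. A level point within a factor
  2 of the supremum is enough for the scale, whether or not the supremum is attained.\<close>

lemma Psi_minus_facts:
  assumes t: "0 < t" and inf: "ereal (1 / t) < Psi_infty nu"
  defines "S \<equiv> Psi_minus nu (1 / t)"
  shows "\<exists>r. 0 < r \<and> r \<le> S \<and> S \<le> 2 * r \<and> Psi nu r = 1 / t"
proof -
  let ?X = "{r. 0 < r \<and> Psi nu r = 1 / t}"
  obtain r1 where r1: "0 \<le> r1" "1 / t < Psi nu r1" using inf by (auto simp: Psi_infty_eq less_SUP_iff)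
  have "\<exists>r\<ge>0. r \<le> r1 \<and> Psi nu r = 1 / t"
    by (rule IVT'[OF _ _ r1(1) continuous_on_Psi]) (use r1(2) t Psi_0 in auto)
  then obtain r where "0 \<le> r" "Psi nu r = 1 / t" by auto
  moreover have "r \<noteq> 0" using Psi_0 t calculation(2) by auto
  ultimately have ne: "r \<in> ?X" by auto
  have bdd: "bdd_above ?X"
  proof (rule bdd_aboveI)
    fix s assume "s \<in> ?X"
    then show "s \<le> r1" using Psi_mono[OF r1(1), of s] r1(2) by (cases "r1 \<le> s") auto
  qed
  have S: "S = Sup ?X" by (simp add: S_def Psi_minus_def)
  have up: "s \<le> S" if "s \<in> ?X" for s unfolding S by (rule cSup_upper[OF that bdd])
  have "0 < S" using up[OF ne] ne by auto
  then have "S / 2 < Sup ?X" unfolding S[symmetric] by simp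
  then obtain s where "s \<in> ?X" "S / 2 < s" using less_cSupD[of ?X "S / 2"] ne by blast
  then show ?thesis using up by (intro exI[of _ s]) auto
qed

text \<open>Averaging \<open>1 - cos (s * (r * (y \<bullet> b)))\<close> over \<open>s\<close> in
  [0,1] and exchanging the integrals bounds the moment in direction \<open>b\<close> by values of
  \<open>Re (levy_Phi nu)\<close> at frequencies of norm at most \<open>r\<close>; summing over the
  basis gives the factor \<open>DIM('a)\<close>.\<close>

lemma scaled_moment_le_Psi:
  assumes r: "0 < r"
  shows "(\<integral>\<^sup>+ y. ennreal (min 1 ((r * norm y)\<^sup>2) * nu y) \<partial>lborel) \<le> ennreal (12 * DIM('a) * Psi nu r)"
proof -
  have P0: "0 \<le> Psi nu r" using Psi_mono[of 0 r] r Psi_0 by simp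
  have one: "(\<integral>\<^sup>+ y. ennreal (min 1 ((r * (y \<bullet> b))\<^sup>2) * nu y) \<partial>lborel) \<le> ennreal (12 * Psi nu r)" if b: "b \<in> Basis" for b
  proof -
    have "(\<integral>\<^sup>+ y. ennreal (min 1 ((r * (y \<bullet> b))\<^sup>2) * nu y) \<partial>lborel) \<le>
      (\<integral>\<^sup>+ y. \<integral>\<^sup>+ s. ennreal (12 * nu y * (1 - cos (s * (r * (y \<bullet> b))))) * indicator {0..1} s \<partial>lborel \<partial>lborel)"
    proof (rule nn_integral_mono)
      fix y :: 'a
      let ?a = "r * (y \<bullet> b)"
      have "ennreal (min 1 (?a\<^sup>2) * nu y) = ennreal (12 * nu y) * ennreal (min 1 (?a\<^sup>2) / 12)"
        using nu_nonneg[of y] by (subst ennreal_mult[symmetric]) auto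
      also have "\<dots> \<le> ennreal (12 * nu y) * (\<integral>\<^sup>+ s. ennreal (1 - cos (s * ?a)) * indicator {0..1} s \<partial>lborel)"
        by (intro mult_left_mono average_one_minus_cos) auto
      also have "\<dots> = (\<integral>\<^sup>+ s. ennreal (12 * nu y) * (ennreal (1 - cos (s * ?a)) * indicator {0..1} s) \<partial>lborel)"
        by (rule nn_integral_cmult[symmetric]) measurable
      also have "\<dots> = (\<integral>\<^sup>+ s. ennreal (12 * nu y * (1 - cos (s * ?a))) * indicator {0..1} s \<partial>lborel)"
        using nu_nonneg[of y] by (intro nn_integral_cong) (simp add: ennreal_mult mult.assoc)
      finally show "ennreal (min 1 (?a\<^sup>2) * nu y) \<le> \<dots>" .
    qed
    also have "\<dots> = (\<integral>\<^sup>+ s. \<integral>\<^sup>+ y. ennreal (12 * nu y * (1 - cos (s * (r * (y \<bullet> b))))) * indicator {0..1} s \<partial>lborel \<partial>lborel)"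
      by (rule lborel_pair.Fubini') measurable
    also have "\<dots> \<le> (\<integral>\<^sup>+ s. ennreal (12 * Psi nu r) * indicator {0..1::real} s \<partial>lborel)"
    proof (rule nn_integral_mono)
      fix s :: real
      show "(\<integral>\<^sup>+ y. ennreal (12 * nu y * (1 - cos (s * (r * (y \<bullet> b))))) * indicator {0..1} s \<partial>lborel) \<le> ennreal (12 * Psi nu r) * indicator {0..1} s"
      proof (cases "s \<in> {0..1}")
        case True
        let ?\<xi> = "(s * r) *\<^sub>R b"
        have i: "integrable lborel (\<lambda>y. 12 * (nu y * (1 - cos (?\<xi> \<bullet> y))))"
          by (intro integrable_mult_right integrable_one_minus_cos[OF nu])
        have "(\<integral>\<^sup>+ y. ennreal (12 * nu y * (1 - cos (s * (r * (y \<bullet> b))))) * indicator {0..1} s \<partial>lborel) =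
          (\<integral>\<^sup>+ y. ennreal (12 * (nu y * (1 - cos (?\<xi> \<bullet> y)))) \<partial>lborel)"
          using True by (intro nn_integral_cong) (simp add: inner_commute mult_ac)
        also have "\<dots> = ennreal (LINT y|lborel. 12 * (nu y * (1 - cos (?\<xi> \<bullet> y))))"
          using nu_nonneg by (intro nn_integral_eq_integral i) auto
        also have "\<dots> = ennreal (12 * Re (levy_Phi nu ?\<xi>))" by (simp add: Re_levy_Phi[OF nu])
        also have "\<dots> \<le> ennreal (12 * Psi nu r)"
        proof -
          have "norm ?\<xi> \<le> r" using True r b by (simp add: mult_left_le_one_le)
          then show ?thesis using Re_levy_Phi_le_Psi by (intro ennreal_leI) simp
        qed
        finally show ?thesis using True by simp
      qed simp
    qed
    also have "\<dots> = ennreal (12 * Psi nu r)" by (simp add: nn_integral_cmult_indicator)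
    finally show ?thesis .
  qed
  have "(\<integral>\<^sup>+ y. ennreal (min 1 ((r * norm y)\<^sup>2) * nu y) \<partial>lborel) \<le> (\<integral>\<^sup>+ y. (\<Sum>b\<in>Basis. ennreal (min 1 ((r * (y \<bullet> b))\<^sup>2) * nu y)) \<partial>lborel)"
  proof (rule nn_integral_mono)
    fix y :: 'a
    have "min 1 ((r * norm y)\<^sup>2) * nu y \<le> (\<Sum>b\<in>Basis. min 1 ((r * (y \<bullet> b))\<^sup>2)) * nu y"
      by (intro mult_right_mono min_1_norm_sq_le_sum nu_nonneg)
    then show "ennreal (min 1 ((r * norm y)\<^sup>2) * nu y) \<le> (\<Sum>b\<in>Basis. ennreal (min 1 ((r * (y \<bullet> b))\<^sup>2) * nu y))"
      using nu_nonneg[of y] by (subst sum_ennreal) (auto simp: sum_distrib_right intro!: ennreal_leI)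
  qed
  also have "\<dots> = (\<Sum>b\<in>Basis. \<integral>\<^sup>+ y. ennreal (min 1 ((r * (y \<bullet> b))\<^sup>2) * nu y) \<partial>lborel)"
    by (rule nn_integral_sum) measurable
  also have "\<dots> \<le> (\<Sum>b\<in>(Basis::'a set). ennreal (12 * Psi nu r))" by (intro sum_mono one)
  also have "\<dots> = ennreal (12 * DIM('a) * Psi nu r)"
    using P0 by (subst sum_ennreal) (auto simp: mult_ac)
  finally show ?thesis .
qed

lemma integrable_min_scaled: "integrable lborel (\<lambda>y. min 1 ((r * norm y)\<^sup>2) * nu y)"
proof -
  have "integrable lborel (\<lambda>y. nu y *\<^sub>R min 1 ((r * norm y)\<^sup>2))"
  proof (rule levy_density_bounded_integrable[OF nu, where C="1 + r\<^sup>2"])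
    fix y :: 'a
    show "norm (min 1 ((r * norm y)\<^sup>2)) \<le> (1 + r\<^sup>2) * min 1 ((norm y)\<^sup>2)"
    proof (cases "1 \<le> (norm y)\<^sup>2")
      case True
      then show ?thesis by (auto simp: min_def add_increasing2)
    next
      case False
      have "min 1 ((r * norm y)\<^sup>2) \<le> r\<^sup>2 * (norm y)\<^sup>2" by (simp add: power_mult_distrib)
      also have "\<dots> \<le> (1 + r\<^sup>2) * (norm y)\<^sup>2" by (intro mult_right_mono) auto
      finally show ?thesis using False by (simp add: min_def)
    qed
  qed measurable
  then show ?thesis by (simp add: mult.commute)
qed

text \<open>\<open>h\<close> is the reciprocal of \<open>Psi_minus nu (1 / t)\<close>, capped at 1.
  Then (D) is the frequency bound and \<open>scaled_moment_le_Psi\<close> the jump moment. The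
  constant 48 is 12 times 4, and the 4 comes from \<open>S \<le> 2 * r\<close>.\<close>

lemma scale_degenerate:
  assumes t: "0 < t" "t \<le> t0" and inf: "ereal (1 / t) < Psi_infty nu" and C2: "0 < C2"
    and D: "(\<integral>\<^sup>+ \<xi>. ennreal (exp (- t * Re (levy_Phi nu \<xi>)) * norm \<xi>) \<partial>lborel) \<le> ennreal (C2 * Psi_minus nu (1 / t) ^ (DIM('a) + 1))"
    and c: "C2 \<le> c" "t0 * I0 + 48 * DIM('a) \<le> c" "3 * I0 \<le> c"
  shows "\<exists>h. 0 < h \<and> h \<le> 1 \<and>
     (\<integral>\<^sup>+ \<xi>. ennreal (norm \<xi> * exp (- t * Re (levy_Phi nu \<xi>))) \<partial>lborel) \<le> ennreal (c / h ^ (DIM('a) + 1)) \<and>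
     t * (LINT y|lborel. min 1 ((norm y / h)\<^sup>2) * nu y) \<le> c \<and> h\<^sup>2 \<le> c * t"
proof -
  define S where "S = Psi_minus nu (1 / t)"
  obtain r where r: "0 < r" "r \<le> S" "S \<le> 2 * r" "Psi nu r = 1 / t"
    using Psi_minus_facts[OF t(1) inf] by (auto simp: S_def)
  have S: "0 < S" using r by simp
  define h where "h = min 1 (1 / S)"
  have h: "0 < h" "h \<le> 1" "h \<le> 1 / S" using S by (auto simp: h_def)
  have Sh: "S \<le> 1 / h" using h S by (simp add: field_simps)
  have h1: "1 \<le> 1 / h" using h by simp
  have "(\<integral>\<^sup>+ \<xi>. ennreal (norm \<xi> * exp (- t * Re (levy_Phi nu \<xi>))) \<partial>lborel) \<le> ennreal (C2 * S ^ (DIM('a) + 1))"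
    using D by (simp add: S_def mult.commute)
  also have "\<dots> \<le> ennreal (c * (1 / h) ^ (DIM('a) + 1))"
    using C2 c(1) S Sh by (intro ennreal_leI mult_mono power_mono) auto
  also have "c * (1 / h) ^ (DIM('a) + 1) = c / h ^ (DIM('a) + 1)" by (simp only: power_one_over) simp
  finally have 1: "(\<integral>\<^sup>+ \<xi>. ennreal (norm \<xi> * exp (- t * Re (levy_Phi nu \<xi>))) \<partial>lborel) \<le> ennreal (c / h ^ (DIM('a) + 1))" .
  have rbd: "(LINT y|lborel. min 1 ((r * norm y)\<^sup>2) * nu y) \<le> 12 * DIM('a) * (1 / t)"
  proof -
    have "ennreal (LINT y|lborel. min 1 ((r * norm y)\<^sup>2) * nu y) = (\<integral>\<^sup>+ y. ennreal (min 1 ((r * norm y)\<^sup>2) * nu y) \<partial>lborel)"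
      using nu_nonneg by (intro nn_integral_eq_integral[symmetric] integrable_min_scaled) auto
    also have "\<dots> \<le> ennreal (12 * DIM('a) * (1 / t))" using scaled_moment_le_Psi[OF r(1)] by (simp only: r(4))
    finally show ?thesis using t by (subst (asm) ennreal_le_iff) auto
  qed
  have "(LINT y|lborel. min 1 ((norm y / h)\<^sup>2) * nu y) \<le> (LINT y|lborel. min 1 ((norm y)\<^sup>2) * nu y + 4 * (min 1 ((r * norm y)\<^sup>2) * nu y))"
  proof (rule integral_mono)
    show "integrable lborel (\<lambda>y. min 1 ((norm y / h)\<^sup>2) * nu y)"
      using integrable_min_scaled[of "1 / h"] by simp
    show "integrable lborel (\<lambda>y. min 1 ((norm y)\<^sup>2) * nu y + 4 * (min 1 ((r * norm y)\<^sup>2) * nu y))"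
      using levy_densityD(3)[OF nu] integrable_min_scaled[of r] by simp
    fix y :: 'a
    have "min 1 ((norm y / h)\<^sup>2) \<le> min 1 ((norm y)\<^sup>2) + 4 * min 1 ((r * norm y)\<^sup>2)"
    proof (cases "1 \<le> 1 / S")
      case True
      then have "h = 1" by (simp add: h_def)
      then show ?thesis by (simp add: add_increasing2)
    next
      case False
      then have "h = 1 / S" by (simp add: h_def)
      then have "(norm y / h)\<^sup>2 = (S * norm y)\<^sup>2" by (simp add: mult.commute)
      also have "\<dots> \<le> (2 * r * norm y)\<^sup>2" using S r(3) by (intro power_mono mult_right_mono) auto
      also have "\<dots> = 4 * (r * norm y)\<^sup>2" by (simp add: power_mult_distrib)
      finally have "min 1 ((norm y / h)\<^sup>2) \<le> 4 * min 1 ((r * norm y)\<^sup>2)" by (auto simp: min_def)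
      then show ?thesis by (intro add_increasing) auto
    qed
    then have "min 1 ((norm y / h)\<^sup>2) * nu y \<le> (min 1 ((norm y)\<^sup>2) + 4 * min 1 ((r * norm y)\<^sup>2)) * nu y"
      by (intro mult_right_mono nu_nonneg)
    then show "min 1 ((norm y / h)\<^sup>2) * nu y \<le> min 1 ((norm y)\<^sup>2) * nu y + 4 * (min 1 ((r * norm y)\<^sup>2) * nu y)"
      by (simp only: distrib_right mult.assoc)
  qed
  also have "\<dots> = I0 + 4 * (LINT y|lborel. min 1 ((r * norm y)\<^sup>2) * nu y)"
    using levy_densityD(3)[OF nu] integrable_min_scaled[of r] by (simp add: I0_def)
  also have "\<dots> \<le> I0 + 4 * (12 * DIM('a) * (1 / t))" using rbd by simp
  finally have "t * (LINT y|lborel. min 1 ((norm y / h)\<^sup>2) * nu y) \<le> t * (I0 + 4 * (12 * DIM('a) * (1 / t)))"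
    using t by (intro mult_left_mono) auto
  also have "\<dots> = t * I0 + 48 * DIM('a)" using t by (simp add: field_simps)
  also have "\<dots> \<le> t0 * I0 + 48 * DIM('a)" using t I0_nonneg by (intro add_right_mono mult_right_mono) auto
  finally have 2: "t * (LINT y|lborel. min 1 ((norm y / h)\<^sup>2) * nu y) \<le> c" using c(2) by linarith
  \<comment> \<open>\<open>1 / t = Psi nu r\<close> is at most quadratic in \<open>1 / h\<close>,
    which turns into an upper bound on \<open>h\<^sup>2\<close>.\<close>
  have 3: "h\<^sup>2 \<le> c * t"
  proof -
    have "r\<^sup>2 \<le> (1 / h)\<^sup>2" using r Sh by (intro power_mono) auto
    moreover have "1 \<le> (1 / h)\<^sup>2" using h1 by (intro one_le_power) auto
    ultimately have "2 + r\<^sup>2 \<le> 3 * (1 / h)\<^sup>2" by linarith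
    then have "(2 + r\<^sup>2) * I0 \<le> 3 * (1 / h)\<^sup>2 * I0" by (intro mult_right_mono I0_nonneg)
    then have "1 / t \<le> 3 * (1 / h)\<^sup>2 * I0" using Psi_upper[of r] r by simp
    then have "h\<^sup>2 \<le> 3 * I0 * t" using t h by (simp add: field_simps power_divide)
    also have "\<dots> \<le> c * t" using t c(3) by (intro mult_right_mono) auto
    finally show ?thesis .
  qed
  show ?thesis using h(1,2) 1 2 3 by blast
qed

text \<open>The substitution \<open>\<xi> = s *\<^sub>R u\<close> with \<open>s = 1 / sqrt t\<close>
  scales \<open>t\<close> out; the Jacobian and the weight \<open>norm \<xi>\<close> together
  contribute \<open>DIM('a) + 1\<close> powers of \<open>s\<close>.\<close>

lemma scale_nondegenerate:
  assumes a: "0 < a"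
  shows "\<exists>C>0. \<forall>t>0. (\<integral>\<^sup>+ \<xi>. ennreal (norm (\<xi>::'a) * exp (- t * (a * (norm \<xi>)\<^sup>2))) \<partial>lborel) \<le> ennreal (C / sqrt t ^ (DIM('a) + 1))"
proof -
  let ?g = "\<lambda>u::'a. norm u * exp (- (a * (norm u)\<^sup>2))"
  have fin: "(\<integral>\<^sup>+ u. ennreal (?g u) \<partial>lborel) < \<infinity>"
  proof -
    let ?e = "\<lambda>u::'a. exp (- (sqrt a * norm u)\<^sup>2 / 2)"
    have i: "integrable lborel ?e"
      using mgf_kernelD(1)[OF mgf_kernel_gaussian[of "sqrt a", where 'a='a]] a by (simp only: complex_of_real_integrable_eq real_sqrt_gt_0_iff)
    have "?g u \<le> 1 / a * ?e u + ?e u" for u :: 'a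
    proof -
      let ?y = "a * (norm u)\<^sup>2 / 2"
      have "norm u \<le> (1 + (norm u)\<^sup>2) / 2" using sum_squares_bound[of "norm u" 1] by simp
      also have "\<dots> \<le> (1 / a + 1) * (1 + ?y)" using a by (simp add: field_simps)
      also have "\<dots> \<le> (1 / a + 1) * exp ?y" using a exp_ge_add_one_self[of ?y] by (intro mult_left_mono) auto
      finally have "norm u * exp (- (a * (norm u)\<^sup>2)) \<le> (1 / a + 1) * exp ?y * exp (- (a * (norm u)\<^sup>2))"
        by (intro mult_right_mono) auto
      also have "\<dots> = (1 / a + 1) * exp (?y + - (a * (norm u)\<^sup>2))" by (simp only: exp_add mult.assoc)
      also have "?y + - (a * (norm u)\<^sup>2) = - (sqrt a * norm u)\<^sup>2 / 2" using a by (simp add: power_mult_distrib)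
      finally show ?thesis by (simp add: distrib_right)
    qed
    then have "(\<integral>\<^sup>+ u. ennreal (?g u) \<partial>lborel) \<le> (\<integral>\<^sup>+ u. ennreal (1 / a * ?e u + ?e u) \<partial>lborel)"
      by (intro nn_integral_mono ennreal_leI)
    also have "\<dots> = ennreal (LINT u|lborel. 1 / a * ?e u + ?e u)"
    proof (rule nn_integral_eq_integral)
      show "integrable lborel (\<lambda>u. 1 / a * ?e u + ?e u)" using i by (intro Bochner_Integration.integrable_add integrable_mult_right)
      show "AE u in lborel. 0 \<le> 1 / a * ?e u + ?e u" using a by auto
    qed
    finally show ?thesis by (simp add: le_less_trans)
  qed
  define C where "C = enn2real (\<integral>\<^sup>+ u. ennreal (?g u) \<partial>lborel) + 1"
  have C: "0 < C" "(\<integral>\<^sup>+ u. ennreal (?g u) \<partial>lborel) \<le> ennreal C"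
  proof -
    show "0 < C" by (simp add: C_def add_nonneg_pos)
    have "(\<integral>\<^sup>+ u. ennreal (?g u) \<partial>lborel) = ennreal (enn2real (\<integral>\<^sup>+ u. ennreal (?g u) \<partial>lborel))" using fin by simp
    also have "\<dots> \<le> ennreal C" by (intro ennreal_leI) (simp add: C_def)
    finally show "(\<integral>\<^sup>+ u. ennreal (?g u) \<partial>lborel) \<le> ennreal C" .
  qed
  have "(\<integral>\<^sup>+ \<xi>. ennreal (norm (\<xi>::'a) * exp (- t * (a * (norm \<xi>)\<^sup>2))) \<partial>lborel) \<le> ennreal (C / sqrt t ^ (DIM('a) + 1))" if t: "0 < t" for t
  proof -
    define s where "s = 1 / sqrt t"
    have s: "0 < s" "s\<^sup>2 * t = 1" using t by (auto simp: s_def power_divide)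
    have "(\<integral>\<^sup>+ \<xi>. ennreal (norm (\<xi>::'a) * exp (- t * (a * (norm \<xi>)\<^sup>2))) \<partial>lborel) =
      (\<integral>\<^sup>+ u. ennreal (\<bar>s\<bar> ^ DIM('a)) * ennreal (norm (0 + s *\<^sub>R (u::'a)) * exp (- t * (a * (norm (0 + s *\<^sub>R u))\<^sup>2))) \<partial>lborel)"
      using s by (subst lborel_affine[of s 0]) (simp_all add: nn_integral_density nn_integral_distr)
    also have "\<dots> = (\<integral>\<^sup>+ u. ennreal (s ^ (DIM('a) + 1)) * ennreal (?g u) \<partial>lborel)"
    proof (rule nn_integral_cong)
      fix u :: 'a
      have "t * (a * (norm (0 + s *\<^sub>R u))\<^sup>2) = (s\<^sup>2 * t) * (a * (norm u)\<^sup>2)" using s by (simp add: power_mult_distrib mult_ac)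
      then have e: "- t * (a * (norm (0 + s *\<^sub>R u))\<^sup>2) = - (a * (norm u)\<^sup>2)" by (simp only: s(2) mult_1 mult_minus_left)
      show "ennreal (\<bar>s\<bar> ^ DIM('a)) * ennreal (norm (0 + s *\<^sub>R u) * exp (- t * (a * (norm (0 + s *\<^sub>R u))\<^sup>2))) = ennreal (s ^ (DIM('a) + 1)) * ennreal (?g u)"
        unfolding e using s by (subst (1 2) ennreal_mult[symmetric]) (auto simp: mult_ac)
    qed
    also have "\<dots> = ennreal (s ^ (DIM('a) + 1)) * (\<integral>\<^sup>+ u. ennreal (?g u) \<partial>lborel)" by (rule nn_integral_cmult) measurable
    also have "\<dots> \<le> ennreal (s ^ (DIM('a) + 1)) * ennreal C" by (intro mult_left_mono C) auto
    also have "\<dots> = ennreal (C / sqrt t ^ (DIM('a) + 1))"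
      using s C(1) t by (subst ennreal_mult[symmetric]) (auto simp: s_def power_divide)
    finally show ?thesis .
  qed
  then show ?thesis using C(1) by blast
qed

end

text \<open>If \<open>A = 0\<close>, the jumps determine the scale through
  \<open>scale_degenerate\<close>; if the form is positive on the sphere, the Gaussian part does,
  with \<open>h = min 1 (sqrt t)\<close>. Boundedness of \<open>T\<close> makes \<open>c\<close>
  common to all times.\<close>

lemma (in jump_kernel) heat_scale_exists:
  fixes A :: "'a \<Rightarrow> 'a" and T :: "real set"
  assumes A: "linear A" "\<And>x. 0 \<le> x \<bullet> A x"
    and condA: "(\<forall>x. A x = 0) \<or> (INF \<xi>\<in>sphere 0 1. \<xi> \<bullet> A \<xi>) > 0"
    and T: "T \<subseteq> {0<..}" "bounded T" and C2: "C2 > 0"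
    and T_Psi: "\<And>t. t \<in> T \<Longrightarrow> ereal (1 / t) < Psi_infty nu"
    and condD: "\<And>t. t \<in> T \<Longrightarrow>
          (\<integral>\<^sup>+ \<xi>. ennreal (exp (- t * Re (levy_Phi nu \<xi>)) * norm \<xi>) \<partial>lborel)
            \<le> ennreal (C2 * Psi_minus nu (1 / t) ^ (DIM('a) + 1))"
  shows "\<exists>c\<ge>1. \<forall>t\<in>T. \<exists>h. 0 < h \<and> h \<le> 1 \<and> 0 < t \<and> t \<le> c \<and>
     (\<integral>\<^sup>+ \<xi>. ennreal (norm \<xi> * exp (- t * (\<xi> \<bullet> A \<xi> + Re (levy_Phi nu \<xi>)))) \<partial>lborel) \<le> ennreal (c / h ^ (DIM('a) + 1)) \<and>
     t * (LINT y|lborel. min 1 ((norm y / h)\<^sup>2) * nu y) \<le> c \<and> h\<^sup>2 \<le> c * t \<and>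
     (\<forall>\<eta>. t * (\<eta> \<bullet> A \<eta>) \<le> c * h\<^sup>2 * (norm \<eta>)\<^sup>2)" (is "\<exists>c\<ge>1. \<forall>t\<in>T. \<exists>h. ?Q c t h")
proof -
  obtain t1 where t1: "\<And>t. t \<in> T \<Longrightarrow> norm t \<le> t1" using T(2) by (auto simp: bounded_iff)
  define t0 where "t0 = max 1 t1"
  have t0: "1 \<le> t0" "\<And>t. t \<in> T \<Longrightarrow> 0 < t \<and> t \<le> t0" using t1 T(1) by (force simp: t0_def)+
  note I0 = I0_nonneg
  show ?thesis
  proof (cases "\<forall>x. A x = 0")
    case True
    define c where "c = 1 + t0 + C2 + t0 * I0 + 48 * DIM('a) + 3 * I0"
    have tI: "0 \<le> t0 * I0" using t0 I0 by simp
    have c: "1 \<le> c" "t0 \<le> c" "C2 \<le> c" "t0 * I0 + 48 * DIM('a) \<le> c" "3 * I0 \<le> c"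
      using t0 I0 C2 tI by (auto simp: c_def)
    show ?thesis
    proof (rule exI[of _ c], rule conjI[OF c(1)], rule ballI)
      fix t assume t: "t \<in> T"
      have tt: "0 < t" "t \<le> t0" using t0(2)[OF t] by auto
      obtain h where h: "0 < h" "h \<le> 1"
        "(\<integral>\<^sup>+ \<xi>. ennreal (norm \<xi> * exp (- t * Re (levy_Phi nu \<xi>))) \<partial>lborel) \<le> ennreal (c / h ^ (DIM('a) + 1))"
        "t * (LINT y|lborel. min 1 ((norm y / h)\<^sup>2) * nu y) \<le> c" "h\<^sup>2 \<le> c * t"
        using scale_degenerate[OF tt T_Psi[OF t] C2 condD[OF t] c(3-5)] by blast
      have "\<forall>\<eta>. t * (\<eta> \<bullet> A \<eta>) \<le> c * h\<^sup>2 * (norm \<eta>)\<^sup>2" using True c by simp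
      moreover have "(\<integral>\<^sup>+ \<xi>. ennreal (norm \<xi> * exp (- t * (\<xi> \<bullet> A \<xi> + Re (levy_Phi nu \<xi>)))) \<partial>lborel) \<le> ennreal (c / h ^ (DIM('a) + 1))"
        using h(3) True by simp
      moreover have "t \<le> c" using tt c(2) by simp
      ultimately show "\<exists>h. ?Q c t h"
        using h tt(1) by blast
    qed
  next
    case False
    define a where "a = (INF \<xi>\<in>sphere 0 1. \<xi> \<bullet> A \<xi>)"
    have a: "0 < a" using condA False by (auto simp: a_def)
    interpret A: linear A by fact
    have low: "a * (norm \<xi>)\<^sup>2 \<le> \<xi> \<bullet> A \<xi>" for \<xi>
    proof (cases "\<xi> = 0")
      case False
      let ?e = "(1 / norm \<xi>) *\<^sub>R \<xi>"
      have "a \<le> ?e \<bullet> A ?e" unfolding a_def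
        by (rule cINF_lower) (use False A(2) in \<open>auto intro!: bdd_belowI2[where m=0]\<close>)
      also have "\<dots> = (\<xi> \<bullet> A \<xi>) / (norm \<xi>)\<^sup>2" by (simp add: A.scale power2_eq_square)
      finally show ?thesis using False by (simp add: field_simps)
    qed simp
    obtain B where B: "0 < B" "\<And>x. norm (A x) \<le> B * norm x" using linear_bounded_pos[OF A(1)] by blast
    have up: "\<eta> \<bullet> A \<eta> \<le> B * (norm \<eta>)\<^sup>2" for \<eta>
    proof -
      have "\<eta> \<bullet> A \<eta> \<le> norm \<eta> * norm (A \<eta>)" by (rule norm_cauchy_schwarz)
      also have "\<dots> \<le> norm \<eta> * (B * norm \<eta>)" by (intro mult_left_mono B) auto
      finally show ?thesis by (simp add: power2_eq_square mult_ac)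
    qed
    obtain C where C: "0 < C" "\<And>t. 0 < t \<Longrightarrow> (\<integral>\<^sup>+ \<xi>. ennreal (norm (\<xi>::'a) * exp (- t * (a * (norm \<xi>)\<^sup>2))) \<partial>lborel) \<le> ennreal (C / sqrt t ^ (DIM('a) + 1))"
      using scale_nondegenerate[OF a] by blast
    define c where "c = 1 + t0 + C + t0 * I0 + t0 * B"
    have tI: "0 \<le> t0 * I0" "0 \<le> t0 * B" using t0 I0 B by auto
    have c: "1 \<le> c" "t0 \<le> c" "C \<le> c" "t0 * I0 \<le> c" "t0 * B \<le> c"
      using t0 I0 C tI by (auto simp: c_def)
    show ?thesis
    proof (rule exI[of _ c], rule conjI[OF c(1)], rule ballI)
      fix t assume t: "t \<in> T"
      have tt: "0 < t" "t \<le> t0" using t0(2)[OF t] by auto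
      define h where "h = min 1 (sqrt t)"
      have h: "0 < h" "h \<le> 1" "h \<le> sqrt t" using tt by (auto simp: h_def)
      have th: "t \<le> t0 * h\<^sup>2"
      proof (cases "t \<le> 1")
        case True
        then have "h = sqrt t" by (simp add: h_def)
        then have "h\<^sup>2 = t" using tt by simp
        then show ?thesis using t0(1) tt mult_right_mono[of 1 t0 t] by simp
      next
        case False
        then have "h = 1" by (simp add: h_def)
        then show ?thesis using tt by simp
      qed
      have 1: "(\<integral>\<^sup>+ \<xi>. ennreal (norm \<xi> * exp (- t * (\<xi> \<bullet> A \<xi> + Re (levy_Phi nu \<xi>)))) \<partial>lborel) \<le> ennreal (c / h ^ (DIM('a) + 1))"
      proof -
        have "(\<integral>\<^sup>+ \<xi>. ennreal (norm \<xi> * exp (- t * (\<xi> \<bullet> A \<xi> + Re (levy_Phi nu \<xi>)))) \<partial>lborel) \<le>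
          (\<integral>\<^sup>+ \<xi>. ennreal (norm (\<xi>::'a) * exp (- t * (a * (norm \<xi>)\<^sup>2))) \<partial>lborel)"
        proof (intro nn_integral_mono ennreal_leI mult_left_mono)
          fix \<xi> :: 'a
          have "a * (norm \<xi>)\<^sup>2 \<le> \<xi> \<bullet> A \<xi> + Re (levy_Phi nu \<xi>)" using low[of \<xi>] Re_levy_Phi_nonneg[OF nu, of \<xi>] by linarith
          then show "exp (- t * (\<xi> \<bullet> A \<xi> + Re (levy_Phi nu \<xi>))) \<le> exp (- t * (a * (norm \<xi>)\<^sup>2))" using tt by simp
        qed simp
        also have "\<dots> \<le> ennreal (C / sqrt t ^ (DIM('a) + 1))" by (rule C(2)[OF tt(1)])
        also have "\<dots> \<le> ennreal (c / h ^ (DIM('a) + 1))"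
          using C(1) c(3) h by (intro ennreal_leI frac_le power_mono) auto
        finally show ?thesis .
      qed
      have 2: "t * (LINT y|lborel. min 1 ((norm y / h)\<^sup>2) * nu y) \<le> c"
      proof -
        have "(LINT y|lborel. min 1 ((norm y / h)\<^sup>2) * nu y) \<le> (LINT y|lborel. 1 / h\<^sup>2 * (min 1 ((norm y)\<^sup>2) * nu y))"
        proof (rule integral_mono)
          show "integrable lborel (\<lambda>y. min 1 ((norm y / h)\<^sup>2) * nu y)" using integrable_min_scaled[of "1 / h"] by simp
          show "integrable lborel (\<lambda>y. 1 / h\<^sup>2 * (min 1 ((norm y)\<^sup>2) * nu y))" by (intro integrable_mult_right levy_densityD(3)[OF nu])
          fix y :: 'a
          have "min 1 ((norm y / h)\<^sup>2) \<le> min (1 / h\<^sup>2) ((norm y)\<^sup>2 / h\<^sup>2)"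
            using h power_le_one[of h 2] by (intro min.mono) (auto simp: power_divide)
          also have "\<dots> = 1 / h\<^sup>2 * min 1 ((norm y)\<^sup>2)" using h by (simp add: min_mult_distrib_left)
          finally have "min 1 ((norm y / h)\<^sup>2) * nu y \<le> 1 / h\<^sup>2 * min 1 ((norm y)\<^sup>2) * nu y" by (intro mult_right_mono nu_nonneg)
          then show "min 1 ((norm y / h)\<^sup>2) * nu y \<le> 1 / h\<^sup>2 * (min 1 ((norm y)\<^sup>2) * nu y)" by (simp only: mult.assoc)
        qed
        also have "\<dots> = 1 / h\<^sup>2 * I0" by (simp add: I0_def)
        finally have "t * (LINT y|lborel. min 1 ((norm y / h)\<^sup>2) * nu y) \<le> t * (1 / h\<^sup>2 * I0)" using tt by (intro mult_left_mono) auto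
        also have "\<dots> = t / h\<^sup>2 * I0" by simp
        also have "\<dots> \<le> t0 * I0" using th h I0 by (intro mult_right_mono) (auto simp: field_simps)
        finally show ?thesis using c(4) by linarith
      qed
      have 3: "h\<^sup>2 \<le> c * t"
      proof -
        have "h\<^sup>2 \<le> (sqrt t)\<^sup>2" using h by (intro power_mono) auto
        also have "\<dots> = 1 * t" using tt by simp
        also have "\<dots> \<le> c * t" using c(1) tt by (intro mult_right_mono) auto
        finally show ?thesis .
      qed
      have 4: "t * (\<eta> \<bullet> A \<eta>) \<le> c * h\<^sup>2 * (norm \<eta>)\<^sup>2" for \<eta>
      proof -
        have "t * (\<eta> \<bullet> A \<eta>) \<le> (t0 * h\<^sup>2) * (B * (norm \<eta>)\<^sup>2)" using th tt up A(2) t0(1) by (intro mult_mono) auto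
        also have "\<dots> = (t0 * B) * (h\<^sup>2 * (norm \<eta>)\<^sup>2)" by (simp only: mult_ac)
        also have "\<dots> \<le> c * (h\<^sup>2 * (norm \<eta>)\<^sup>2)" by (intro mult_right_mono c) auto
        finally show ?thesis by (simp only: mult.assoc)
      qed
      have "t \<le> c" using tt c(2) by simp
      then show "\<exists>h. ?Q c t h"
        using h(1,2) tt(1) 1 2 3 4 by blast
    qed
  qed
qed

text \<open>Two densities differing only at the origin have the same limits along rays: for bounded
  \<open>y\<close> the origin is eventually avoided, uniformly in \<open>\<theta>\<close> and
  \<open>y\<close>.\<close>

lemma eventually_ray_off_origin:
  fixes E :: "'a::euclidean_space set"
  assumes E: "E \<subseteq> sphere 0 1"
  shows "\<forall>\<^sub>F r in at_top. \<forall>\<theta>\<in>E. \<forall>y. norm y \<le> \<rho> \<longrightarrow> r *\<^sub>R \<theta> - y \<noteq> 0 \<and> r *\<^sub>R \<theta> \<noteq> 0"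
  using eventually_gt_at_top[of "max 0 \<rho>"]
proof eventually_elim
  case (elim r)
  show ?case
  proof (intro ballI allI impI)
    fix \<theta> y :: 'a assume \<theta>: "\<theta> \<in> E" and y: "norm y \<le> \<rho>"
    have n: "norm (r *\<^sub>R \<theta>) = r" using \<theta> E elim by auto
    then have "r *\<^sub>R \<theta> \<noteq> y" "r *\<^sub>R \<theta> \<noteq> 0" using y elim by auto
    then show "r *\<^sub>R \<theta> - y \<noteq> 0 \<and> r *\<^sub>R \<theta> \<noteq> 0" by simp
  qed
qed

text \<open>The limit depends on pointwise values, so the density is required to be the continuous
  version. The set-integrability clause is the condition under which \<open>psi_tilde\<close> at
  \<open>\<kappa> *\<^sub>R \<theta>\<close> is defined, and \<open>T_Psi\<close> keeps
  \<open>1 / t\<close> in the domain of \<open>Psi_minus\<close>.\<close>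

theorem theorem1:
  fixes b :: "'a::euclidean_space"
    and A :: "'a \<Rightarrow> 'a"
    and nu :: "'a \<Rightarrow> real"
    and P :: "real \<Rightarrow> 'a measure"
    and f :: "real \<Rightarrow> real"
    and C0 C2 \<kappa> :: real
    and E :: "'a set"
    and T :: "real set"
  assumes A_lin: "linear A"
    and A_sym: "\<And>x y. A x \<bullet> y = x \<bullet> A y"
    and A_nonneg: "\<And>x. 0 \<le> x \<bullet> A x"
    and nu_meas: "nu \<in> borel_measurable borel"
    and nu_nonneg: "\<And>x. x \<noteq> 0 \<Longrightarrow> 0 \<le> nu x"
    and nu_levy: "(\<integral>\<^sup>+ y. ennreal (min 1 (norm y ^ 2) * nu y) \<partial>lborel) < \<infinity>"
    and P_prob: "\<And>t. 0 \<le> t \<Longrightarrow> prob_space (P t)"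
    and P_sets: "\<And>t. 0 \<le> t \<Longrightarrow> sets (P t) = sets borel"
    and P_char: "\<And>t \<xi>. 0 \<le> t \<Longrightarrow> char_fun (P t) \<xi> = exp (- complex_of_real t * levy_psi b A nu \<xi>)"
    \<comment> \<open>(A)\<close>
    and condA: "(\<forall>x. A x = 0) \<or> (INF \<xi>\<in>sphere 0 1. \<xi> \<bullet> A \<xi>) > 0"
    \<comment> \<open>(B)\<close>
    and f_pos: "\<And>r. 0 < r \<Longrightarrow> 0 < f r"
    and f_noninc: "\<And>r s. 0 < r \<Longrightarrow> r \<le> s \<Longrightarrow> f s \<le> f r"
    and C0_pos: "C0 > 0"
    and nu_le_f: "\<And>x. x \<noteq> 0 \<Longrightarrow> nu x \<le> C0 * f (norm x)"
    and nu_small: "Liminf (at_right 0)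
          (\<lambda>r. ereal (measure (density lborel (\<lambda>x. ennreal (nu x))) {x. r < norm x}
                       / (f r * r ^ DIM('a)))) > 0"
    and K_decr: "\<And>r s. 0 < r \<Longrightarrow> r \<le> s \<Longrightarrow> levy_K TYPE('a) f s \<le> levy_K TYPE('a) f r"
    and K_lim: "(levy_K TYPE('a) f \<longlongrightarrow> 0) at_top"
    \<comment> \<open>(C)\<close>
    and E_sphere: "E \<subseteq> sphere 0 1"
    and kappa_nonneg: "0 \<le> \<kappa>"
    and nu_ratio: "\<And>\<theta> y. \<theta> \<in> E \<Longrightarrow>
          ((\<lambda>r. nu (r *\<^sub>R \<theta> - y) / nu (r *\<^sub>R \<theta>)) \<longlongrightarrow> exp (\<kappa> * (\<theta> \<bullet> y))) at_top"
    and C1_pos: "(INF x\<in>Gamma_cone E. nu x / f (norm x)) > 0"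
    \<comment> \<open>(D)\<close>
    and T_pos: "T \<subseteq> {0<..}"
    and T_ne: "T \<noteq> {}"
    and T_bdd: "bounded T"
    and C2_pos: "C2 > 0"
    and T_Psi: "\<And>t. t \<in> T \<Longrightarrow> ereal (1 / t) < Psi_infty nu"
    and condD: "\<And>t. t \<in> T \<Longrightarrow>
          (\<integral>\<^sup>+ \<xi>. ennreal (exp (- t * Re (levy_Phi nu \<xi>)) * norm \<xi>) \<partial>lborel)
            \<le> ennreal (C2 * Psi_minus nu (1 / t) ^ (DIM('a) + 1))"
  shows "\<exists>p :: real \<Rightarrow> 'a \<Rightarrow> real.
           (\<forall>t\<in>T. continuous_on UNIV (p t) \<and> (\<forall>x. 0 \<le> p t x)
                   \<and> P t = density lborel (\<lambda>x. ennreal (p t x)))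
         \<and> (\<forall>t\<in>T. \<forall>\<theta>\<in>E. \<forall>y.
               (0 < \<kappa> \<longrightarrow> set_integrable lborel {y. 1 < norm y}
                              (\<lambda>y. exp ((\<kappa> *\<^sub>R \<theta>) \<bullet> y) * nu y))
             \<and> ((\<lambda>r. p t (r *\<^sub>R \<theta> - y) / (t * nu (r *\<^sub>R \<theta>)))
                   \<longlongrightarrow> limit_value b A nu \<kappa> t \<theta> y) at_top)
         \<and> ((\<forall>D. compact D \<longrightarrow>
                uniform_limit (E \<times> D)
                  (\<lambda>r (\<theta>, y). nu (r *\<^sub>R \<theta> - y) / nu (r *\<^sub>R \<theta>))
                  (\<lambda>(\<theta>, y). exp (\<kappa> * (\<theta> \<bullet> y))) at_top)
             \<longrightarrow> (\<forall>\<rho>>0. uniform_limit (T \<times> E \<times> ball 0 \<rho>)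
                  (\<lambda>r (t, \<theta>, y). p t (r *\<^sub>R \<theta> - y) / (t * nu (r *\<^sub>R \<theta>)))
                  (\<lambda>(t, \<theta>, y). limit_value b A nu \<kappa> t \<theta> y) at_top))"
proof -
  note nu_meas [measurable]
  \<comment> \<open>The value of \<open>nu\<close> at the origin is unconstrained, in particular possibly negative.\<close>
  define n where "n y = (if y = 0 then 0 else nu y)" for y
  have n_meas [measurable]: "n \<in> borel_measurable borel" unfolding n_def[abs_def] by measurable
  have n_eq: "y \<noteq> 0 \<Longrightarrow> n y = nu y" for y by (simp add: n_def)
  have n0: "0 \<le> n y" for y using nu_nonneg by (simp add: n_def)
  have Phi_eq: "levy_Phi n = levy_Phi nu"
    unfolding levy_Phi_def by (intro ext Bochner_Integration.integral_cong[OF refl]) (simp add: n_def)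
  have psi_eq: "levy_psi b A n = levy_psi b A nu" by (simp add: levy_psi_def fun_eq_iff Phi_eq)
  have pt_eq: "psi_tilde b A n = psi_tilde b A nu"
  proof
    fix \<xi>
    have "(LINT y|lborel. n y * (1 - exp (\<xi> \<bullet> y) + (\<xi> \<bullet> y) * indicator (ball 0 1) y)) =
      (LINT y|lborel. nu y * (1 - exp (\<xi> \<bullet> y) + (\<xi> \<bullet> y) * indicator (ball 0 1) y))"
      by (intro Bochner_Integration.integral_cong[OF refl]) (simp add: n_def)
    then show "psi_tilde b A n \<xi> = psi_tilde b A nu \<xi>" by (simp add: psi_tilde_def)
  qed
  have Psi_eq: "Psi n = Psi nu" "Psi_infty n = Psi_infty nu" "Psi_minus n = Psi_minus nu"
    by (simp_all add: Psi_def fun_eq_iff Psi_infty_def Psi_minus_def Phi_eq)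
  have levy: "levy_density n"
  proof -
    have "(\<integral>\<^sup>+ y. ennreal (min 1 ((norm y)\<^sup>2) * n y) \<partial>lborel) = (\<integral>\<^sup>+ y. ennreal (min 1 (norm y ^ 2) * nu y) \<partial>lborel)"
      by (intro nn_integral_cong) (simp add: n_def)
    then have "integrable lborel (\<lambda>y. min 1 ((norm y)\<^sup>2) * n y)"
      using nu_levy n0 by (intro integrableI_nonneg) auto
    then show ?thesis using n0 by (simp add: levy_density_def)
  qed
  interpret J: jump_kernel n f C0
  proof
    \<comment> \<open>For \<open>r > 0\<close> the set \<open>{x. r < norm x}\<close> omits the
      origin, the only point where the two densities can differ.\<close>
    show "Liminf (at_right 0) (\<lambda>r. ereal (measure (density lborel (\<lambda>x. ennreal (n x))) {x::'a. r < norm x} / (f r * r ^ DIM('a)))) > 0"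
    proof -
      have "\<forall>\<^sub>F r in at_right 0. ereal (measure (density lborel (\<lambda>x. ennreal (n x))) {x::'a. r < norm x} / (f r * r ^ DIM('a))) =
        ereal (measure (density lborel (\<lambda>x. ennreal (nu x))) {x. r < norm x} / (f r * r ^ DIM('a)))"
        using eventually_at_right_less[of 0]
      proof eventually_elim
        case (elim r)
        have "emeasure (density lborel (\<lambda>x. ennreal (n x))) {x::'a. r < norm x} =
          emeasure (density lborel (\<lambda>x. ennreal (nu x))) {x. r < norm x}"
          using elim by (subst (1 2) emeasure_density) (auto simp: n_def indicator_def intro!: nn_integral_cong)
        then show ?case by (simp add: measure_def)
      qed
      from Liminf_eq[OF this] show ?thesis using nu_small by simp
    qed
    show "n x \<le> C0 * f (norm x)" if "x \<noteq> 0" for x using nu_le_f[OF that] n_eq[OF that] by simp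
  qed (use levy f_pos f_noninc C0_pos K_lim in auto)
  obtain c where c: "1 \<le> c" and sc: "\<forall>t\<in>T. \<exists>h. 0 < h \<and> h \<le> 1 \<and> 0 < t \<and> t \<le> c \<and>
     (\<integral>\<^sup>+ \<xi>. ennreal (norm \<xi> * exp (- t * (\<xi> \<bullet> A \<xi> + Re (levy_Phi n \<xi>)))) \<partial>lborel) \<le> ennreal (c / h ^ (DIM('a) + 1)) \<and>
     t * (LINT y|lborel. min 1 ((norm y / h)\<^sup>2) * n y) \<le> c \<and> h\<^sup>2 \<le> c * t \<and>
     (\<forall>\<eta>. t * (\<eta> \<bullet> A \<eta>) \<le> c * h\<^sup>2 * (norm \<eta>)\<^sup>2)"
    using J.heat_scale_exists[OF A_lin A_nonneg condA T_pos T_bdd C2_pos] T_Psi condD by (auto simp: Psi_eq Phi_eq)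
  define C1 where "C1 = (INF x\<in>Gamma_cone E. nu x / f (norm x))"
  have C1: "0 < C1" using C1_pos by (simp add: C1_def)
  have En: "norm \<theta> = 1" if "\<theta> \<in> E" for \<theta> using that E_sphere by auto
  interpret L: levy_limit n f C0 b A c E \<kappa> C1
  proof
    show "C1 * f r \<le> n (r *\<^sub>R \<theta>)" if \<theta>: "\<theta> \<in> E" and r: "0 < r" for \<theta> r
    proof -
      have nr: "norm (r *\<^sub>R \<theta>) = r" using En[OF \<theta>] r by simp
      then have r0: "r *\<^sub>R \<theta> \<noteq> 0" using r by auto
      have "r *\<^sub>R \<theta> \<in> Gamma_cone E" using \<theta> r r0 nr by (simp add: Gamma_cone_def)
      then have "C1 \<le> nu (r *\<^sub>R \<theta>) / f (norm (r *\<^sub>R \<theta>))" unfolding C1_def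
        using nu_nonneg f_pos
        by (intro cINF_lower bdd_belowI2[where m=0]) (auto simp: Gamma_cone_def less_imp_le)
      then show ?thesis using nr f_pos[OF r] n_eq[OF r0] by (simp add: field_simps)
    qed
    show "((\<lambda>r. n (r *\<^sub>R \<theta> - y) / n (r *\<^sub>R \<theta>)) \<longlongrightarrow> exp (\<kappa> * (\<theta> \<bullet> y))) at_top" if \<theta>: "\<theta> \<in> E" for \<theta> y
      using nu_ratio[OF \<theta>]
    proof (rule Lim_transform_eventually)
      show "\<forall>\<^sub>F r in at_top. nu (r *\<^sub>R \<theta> - y) / nu (r *\<^sub>R \<theta>) = n (r *\<^sub>R \<theta> - y) / n (r *\<^sub>R \<theta>)"
        using eventually_ray_off_origin[OF E_sphere, of "norm y"]
      proof eventually_elim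
        case (elim r)
        then have "n (r *\<^sub>R \<theta> - y) = nu (r *\<^sub>R \<theta> - y)" "n (r *\<^sub>R \<theta>) = nu (r *\<^sub>R \<theta>)"
          using elim[rule_format, OF \<theta> order_refl] by (intro n_eq; simp)+
        then show ?case by simp
      qed
    qed
  qed (use linear_add[OF A_lin] linear_scale[OF A_lin] A_sym A_nonneg c En kappa_nonneg C1 in auto)
  have full: "L.full_phi t \<xi> = exp (- complex_of_real t * levy_psi b A nu \<xi>)" for t \<xi>
    by (simp add: L.full_phi_def psi_eq)
  have gs: "\<exists>h. L.good_scale t h" if t: "t \<in> T" for t
    using sc[rule_format, OF t] unfolding L.good_scale_def L.full_phi_def norm_exp_levy_psi by blast
  have lv: "L.lim_val t \<theta> y = limit_value b A nu \<kappa> t \<theta> y" for t \<theta> y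
    by (auto simp: L.lim_val_def limit_value_def pt_eq psi_tilde_def)
  have dens: "continuous_on UNIV (L.heat t) \<and> (\<forall>x. 0 \<le> L.heat t x) \<and> P t = density lborel (\<lambda>x. ennreal (L.heat t x))" if t: "t \<in> T" for t
  proof -
    have t0: "0 \<le> t" using t T_pos by auto
    obtain h where h: "L.good_scale t h" using gs[OF t] by blast
    have ch: "char_fun (P t) = L.full_phi t" using P_char[OF t0] full by (simp add: fun_eq_iff)
    have int: "integrable lborel (char_fun (P t))" unfolding ch by (rule L.full_phi_integrable(2)[OF h])
    \<comment> \<open>Inversion identifies \<open>L.heat t\<close> as the density of
      \<open>P t\<close>; integrability of the characteristic function comes from the frequency
      bound in \<open>good_scale\<close>.\<close>
    note d = density_ift_char_fun[OF P_prob[OF t0] P_sets[OF t0] int, unfolded ch, folded L.heat_def]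
    have "continuous_on UNIV (L.heat t)" unfolding L.heat_def ch[symmetric] by (rule continuous_on_ift[OF int])
    with d show ?thesis by blast
  qed
  have tails: "set_integrable lborel {y. 1 < norm y} (\<lambda>y. exp ((\<kappa> *\<^sub>R \<theta>) \<bullet> y) * nu y)" if \<theta>: "\<theta> \<in> E" for \<theta>
  proof -
    have "(\<lambda>y. indicator {y. 1 < norm y} y *\<^sub>R (exp ((\<kappa> *\<^sub>R \<theta>) \<bullet> y) * nu y)) = (\<lambda>y. J.nubar 1 y * exp ((\<kappa> *\<^sub>R \<theta>) \<bullet> y))"
      by (auto simp: J.nubar_def indicator_def n_def fun_eq_iff)
    then show ?thesis unfolding set_integrable_def using L.nubar_1_exp_integrable[OF \<theta>] by simp
  qed
  have limit: "((\<lambda>r. L.heat t (r *\<^sub>R \<theta> - y) / (t * nu (r *\<^sub>R \<theta>))) \<longlongrightarrow> limit_value b A nu \<kappa> t \<theta> y) at_top"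
    if t: "t \<in> T" and \<theta>: "\<theta> \<in> E" for t \<theta> y
  proof -
    obtain h where h: "L.good_scale t h" using gs[OF t] by blast
    have "((\<lambda>r. L.heat t (r *\<^sub>R \<theta> - y) / (t * n (r *\<^sub>R \<theta>))) \<longlongrightarrow> limit_value b A nu \<kappa> t \<theta> y) at_top"
      using L.heat_ratio_tendsto[OF h \<theta>, of y] by (simp only: lv)
    moreover have "\<forall>\<^sub>F r in at_top. L.heat t (r *\<^sub>R \<theta> - y) / (t * n (r *\<^sub>R \<theta>)) = L.heat t (r *\<^sub>R \<theta> - y) / (t * nu (r *\<^sub>R \<theta>))"
      using eventually_ray_off_origin[OF E_sphere, of "norm y"]
    proof eventually_elim
      case (elim r)
      then have "n (r *\<^sub>R \<theta>) = nu (r *\<^sub>R \<theta>)" using elim[rule_format, OF \<theta> order_refl] by (intro n_eq) simp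
      then show ?case by simp
    qed
    ultimately show ?thesis by (rule Lim_transform_eventually)
  qed
  have unif: "uniform_limit (T \<times> E \<times> ball 0 \<rho>) (\<lambda>r (t, \<theta>, y). L.heat t (r *\<^sub>R \<theta> - y) / (t * nu (r *\<^sub>R \<theta>)))
      (\<lambda>(t, \<theta>, y). limit_value b A nu \<kappa> t \<theta> y) at_top"
    if u: "\<forall>D. compact D \<longrightarrow> uniform_limit (E \<times> D) (\<lambda>r (\<theta>, y). nu (r *\<^sub>R \<theta> - y) / nu (r *\<^sub>R \<theta>))
        (\<lambda>(\<theta>, y). exp (\<kappa> * (\<theta> \<bullet> y))) at_top" and \<rho>: "0 < \<rho>" for \<rho>
  proof -
    have u': "uniform_limit (E \<times> D) (\<lambda>r (\<theta>, y). n (r *\<^sub>R \<theta> - y) / n (r *\<^sub>R \<theta>)) (\<lambda>(\<theta>, y). exp (\<kappa> * (\<theta> \<bullet> y))) at_top"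
      if D: "compact D" for D
    proof -
      obtain B where B: "\<And>y. y \<in> D \<Longrightarrow> norm y \<le> B" using compact_imp_bounded[OF D] by (auto simp: bounded_iff)
      have ev: "\<forall>\<^sub>F r in at_top. \<forall>p\<in>E \<times> D. (case p of (\<theta>, y) \<Rightarrow> n (r *\<^sub>R \<theta> - y) / n (r *\<^sub>R \<theta>)) = (case p of (\<theta>, y) \<Rightarrow> nu (r *\<^sub>R \<theta> - y) / nu (r *\<^sub>R \<theta>))"
        using eventually_ray_off_origin[OF E_sphere, of B]
      proof eventually_elim
        case (elim r)
        show ?case
        proof
          fix p assume "p \<in> E \<times> D"
          then obtain \<theta> y where p: "p = (\<theta>, y)" "\<theta> \<in> E" "y \<in> D" by auto
          have "n (r *\<^sub>R \<theta> - y) = nu (r *\<^sub>R \<theta> - y)" "n (r *\<^sub>R \<theta>) = nu (r *\<^sub>R \<theta>)"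
            using elim[rule_format, OF p(2) B[OF p(3)]] by (intro n_eq; simp)+
          then show "(case p of (\<theta>, y) \<Rightarrow> n (r *\<^sub>R \<theta> - y) / n (r *\<^sub>R \<theta>)) = (case p of (\<theta>, y) \<Rightarrow> nu (r *\<^sub>R \<theta> - y) / nu (r *\<^sub>R \<theta>))"
            by (simp add: p(1))
        qed
      qed
      show ?thesis using u[rule_format, OF D] uniform_limit_cong[OF ev refl] by simp
    qed
    have ev: "\<forall>\<^sub>F r in at_top. \<forall>p\<in>T \<times> E \<times> ball 0 \<rho>. (case p of (t, \<theta>, y) \<Rightarrow> L.heat t (r *\<^sub>R \<theta> - y) / (t * n (r *\<^sub>R \<theta>))) =
       (case p of (t, \<theta>, y) \<Rightarrow> L.heat t (r *\<^sub>R \<theta> - y) / (t * nu (r *\<^sub>R \<theta>)))"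
      using eventually_ray_off_origin[OF E_sphere, of 0]
    proof eventually_elim
      case (elim r)
      then have "r *\<^sub>R \<theta> \<noteq> 0" if "\<theta> \<in> E" for \<theta> using that by (metis norm_zero order_refl)
      then show ?case using n_eq by auto
    qed
    have "uniform_limit (T \<times> E \<times> ball 0 \<rho>) (\<lambda>r (t, \<theta>, y). L.heat t (r *\<^sub>R \<theta> - y) / (t * n (r *\<^sub>R \<theta>)))
      (\<lambda>(t, \<theta>, y). limit_value b A nu \<kappa> t \<theta> y) at_top"
      unfolding lv[symmetric] by (rule L.heat_ratio_uniform_limit[OF gs \<rho> u'])
    then show ?thesis by (rule iffD1[OF uniform_limit_cong[OF ev refl]])
  qed
  show ?thesis
    using dens tails limit unif by (intro exI[of _ L.heat] conjI ballI allI impI) blast+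
qed

end
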